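(* Let $A \in \mathrm M_n(k)$ and $B \in \mathrm M_m(k)$ be nilpotent. The following are equivalent: (i) $n = m$ and $A$ and $B$ are similar (over $k$). (ii) For almost all $v \in \mathcal V_k$, $\zeta_{A,\mathfrak o_v}(s) = \zeta_{B,\mathfrak o_v}(s)$. (iii) There exists a finite $S \subset \mathcal V_k$ such that $A$ and $B$ both have entries in $\mathfrak o_S$ and such that $\zeta_{A,\mathfrak o_S}(s) = \zeta_{B,\mathfrak o_S}(s)$.
   Context: $k$ is a number field, $\mathcal V_k$ its set of non-Archimedean places; for $v\in\mathcal V_k$, $\mathfrak o_v$ is the valuation ring of the completion $k_v$; for $S\subset\mathcal V_k$, $\mathfrak o_S=\bigcap_{v\in\mathcal V_k\setminus S}\mathfrak o_v\cap k$ is the ring of $S$-integers. "Almost all" means all but finitely many. Matrix sizes are positive. For $R=\mathfrak o_v$ or $R=\mathfrak o_S$ (with $S$ finite) and $A\in\mathrm M_n(R)$, acting on row vectors in $R^n$ by right multiplication, $\zeta_{A,R}(s)=\sum_{m\ge1}a_m(A,R)m^{-s}$, where $a_m(A,R)$ is the number of $A$-invariant $R$-submodules of $R^n$ of index $m$. If $A\in\mathrm M_n(k)$, then $A\in\mathrm M_n(\mathfrak o_v)$ for almost all $v$. *)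

theory Defs
  imports "HOL-Analysis.Analysis" "HOL-Algebra.QuotRing" "Jordan_Normal_Form.Matrix"
begin

(* keeps $ for the matrix library only *)
unbundle no vec_syntax

section \<open>Number fields and their non-Archimedean places\<close>

definition number_field :: "'k::field_char_0 itself \<Rightarrow> bool" where
  "number_field _ \<longleftrightarrow>
     (\<exists>Basis. finite_dimensional_vector_space (\<lambda>(q::rat) (x::'k). of_rat q * x) Basis)"

definition nonarch_abs :: "('k::field \<Rightarrow> real) \<Rightarrow> bool" where
  "nonarch_abs f \<longleftrightarrow>
     (\<forall>x. 0 \<le> f x) \<and> (\<forall>x. f x = 0 \<longleftrightarrow> x = 0) \<and>
     (\<forall>x y. f (x * y) = f x * f y) \<and> (\<forall>x y. f (x + y) \<le> max (f x) (f y)) \<and>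
     (\<exists>x. x \<noteq> 0 \<and> f x \<noteq> 1)"

definition abs_equivalence :: "(('k::field \<Rightarrow> real) \<times> ('k \<Rightarrow> real)) set" where
  "abs_equivalence =
     {(f, g). nonarch_abs f \<and> nonarch_abs g \<and> (\<exists>c>0. \<forall>x. g x = f x powr c)}"

definition places :: "('k::field \<Rightarrow> real) set set" where
  "places = {f. nonarch_abs f} // abs_equivalence"

text \<open>The completion and its valuation ring depend only on the place, since equivalent absolute
  values have the same Cauchy sequences, null sequences and closed unit balls.\<close>

definition place_abs :: "('k::field \<Rightarrow> real) set \<Rightarrow> 'k \<Rightarrow> real" where
  "place_abs v = (SOME f. f \<in> v)"

section \<open>Completions and valuation rings\<close>

definition cauchy_ring :: "('k::field \<Rightarrow> real) set \<Rightarrow> (nat \<Rightarrow> 'k) ring" where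
  "cauchy_ring v =
     \<lparr>carrier = {X. \<forall>e>0. \<exists>M. \<forall>i\<ge>M. \<forall>j\<ge>M. place_abs v (X i - X j) < e},
      mult = (\<lambda>X Y i. X i * Y i), one = (\<lambda>_. 1), zero = (\<lambda>_. 0), add = (\<lambda>X Y i. X i + Y i)\<rparr>"

definition null_seqs :: "('k::field \<Rightarrow> real) set \<Rightarrow> (nat \<Rightarrow> 'k) set" where
  "null_seqs v = {X. (\<lambda>i. place_abs v (X i)) \<longlonglongrightarrow> 0}"

definition completion :: "('k::field \<Rightarrow> real) set \<Rightarrow> (nat \<Rightarrow> 'k) set ring" where
  "completion v = cauchy_ring v Quot null_seqs v"

definition to_completion :: "('k::field \<Rightarrow> real) set \<Rightarrow> 'k \<Rightarrow> (nat \<Rightarrow> 'k) set" where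
  "to_completion v x = null_seqs v +>\<^bsub>cauchy_ring v\<^esub> (\<lambda>_. x)"

text \<open>The extension of the absolute value to the completion; the limit does not depend on the
  representing Cauchy sequence.\<close>

definition completion_abs :: "('k::field \<Rightarrow> real) set \<Rightarrow> (nat \<Rightarrow> 'k) set \<Rightarrow> real" where
  "completion_abs v a = lim (\<lambda>i. place_abs v ((SOME X. X \<in> a) i))"

definition valuation_ring :: "('k::field \<Rightarrow> real) set \<Rightarrow> (nat \<Rightarrow> 'k) set ring" where
  "valuation_ring v =
     (completion v)\<lparr>carrier := {a \<in> carrier (completion v). completion_abs v a \<le> 1}\<rparr>"

definition S_integers :: "('k::field \<Rightarrow> real) set set \<Rightarrow> 'k ring" where
  "S_integers S =
     \<lparr>carrier = {x. \<forall>v \<in> places - S. to_completion v x \<in> carrier (valuation_ring v)},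
      mult = (*), one = 1, zero = 0, add = (+)\<rparr>"

section \<open>Zeta functions of invariant submodules\<close>

text \<open>The fields \<open>mult\<close> and \<open>one\<close> of a module record are irrelevant, cf. \<open>module_vec\<close>.\<close>

definition free_module :: "('r, 'b) ring_scheme \<Rightarrow> nat \<Rightarrow> ('r, 'r vec) module" where
  "free_module R n =
     \<lparr>carrier = {x \<in> carrier_vec n. \<forall>i<n. x $ i \<in> carrier R},
      mult = undefined, one = undefined,
      zero = vec n (\<lambda>_. \<zero>\<^bsub>R\<^esub>),
      add = (\<lambda>x y. vec n (\<lambda>i. x $ i \<oplus>\<^bsub>R\<^esub> y $ i)),
      smult = (\<lambda>a x. vec n (\<lambda>i. a \<otimes>\<^bsub>R\<^esub> x $ i))\<rparr>"

definition row_mult :: "('r, 'b) ring_scheme \<Rightarrow> 'r vec \<Rightarrow> 'r mat \<Rightarrow> 'r vec" where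
  "row_mult R x A = vec (dim_col A) (\<lambda>j. \<Oplus>\<^bsub>R\<^esub>i\<in>{..<dim_row A}. x $ i \<otimes>\<^bsub>R\<^esub> A $$ (i, j))"

definition num_invariant_submodules :: "('r, 'b) ring_scheme \<Rightarrow> 'r mat \<Rightarrow> nat \<Rightarrow> nat" where
  "num_invariant_submodules R A m =
     card {N. submodule N R (free_module R (dim_row A)) \<and> (\<forall>x\<in>N. row_mult R x A \<in> N) \<and>
              card (a_rcosets\<^bsub>free_module R (dim_row A)\<^esub> N) = m}"

definition submodule_zeta :: "('r, 'b) ring_scheme \<Rightarrow> 'r mat \<Rightarrow> complex \<Rightarrow> complex" where
  "submodule_zeta R A s =
     (\<Sum>m. of_nat (num_invariant_submodules R A (Suc m)) * of_nat (Suc m) powr (- s))"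

definition matrix_over :: "('r, 'b) ring_scheme \<Rightarrow> 'r mat \<Rightarrow> bool" where
  "matrix_over R A \<longleftrightarrow> elements_mat A \<subseteq> carrier R"

text \<open>For the rings above the coefficients grow at most polynomially, so the series converge
  absolutely on some right half-plane; an identity of zeta functions is an identity of
  functions on such a half-plane.\<close>

definition zeta_eq :: "('r, 'b) ring_scheme \<Rightarrow> 'r mat \<Rightarrow> 'r mat \<Rightarrow> bool" where
  "zeta_eq R A B \<longleftrightarrow>
     (\<exists>\<sigma>::real. \<forall>s. Re s > \<sigma> \<longrightarrow> submodule_zeta R A s = submodule_zeta R B s)"

definition nilpotent_mat :: "'a::semiring_1 mat \<Rightarrow> bool" where
  "nilpotent_mat A \<longleftrightarrow> (\<exists>j. A ^\<^sub>m j = 0\<^sub>m (dim_row A) (dim_col A))"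

end

theory Submission
  imports Defs "HOL-Library.Function_Algebras" "HOL-Algebra.Multiplicative_Group" "Jordan_Normal_Form.Determinant"
begin

text \<open>Over \<open>k\<close>, a nilpotent matrix is conjugate to a shift along chains of basis vectors, and at almost all
  places the conjugating matrix and its inverse are integral, so \<open>A\<close> may be replaced by the shift. By
  uniqueness of Dirichlet series the zeta function determines the number of invariant submodules of
  every index. Fix a rational prime \<open>p\<close> avoiding the exceptional places. The counts for index \<open>p ^ e\<close>
  depend on the ring only modulo \<open>p ^ e\<close>; hence they are the same over a completion and over the
  corresponding localisation of \<open>k\<close>, and over the ring of integers away from \<open>S\<close> and over the semilocal
  ring of elements integral at the places over \<open>p\<close>. The latter is a principal ideal domain \<open>R\<close>.

  Over \<open>R\<close>, let \<open>c h\<close> be the number of basis vectors at height \<open>h\<close> in their chains. Projecting an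
  invariant submodule to height \<open>0\<close> and intersecting it with the span of the other heights, and
  iterating, shows that the zeta function is a product over \<open>h\<close> of the zeta functions of the modules
  \<open>R ^ c h\<close> at \<open>(h + 1) * s - (c 0 + \<dots> + c (h - 1))\<close>. If \<open>m\<close> is the least index of a proper ideal
  of \<open>R\<close>, then cancelling the first \<open>h\<close> factors exhibits the number of submodules of \<open>R ^ c h\<close> of index \<open>m\<close>
  as a coefficient, and this number determines \<open>c h\<close>. The numbers \<open>c h\<close> are a complete similarity
  invariant.\<close>

section \<open>Subgroups and indices\<close>

text \<open>All counting takes place in rings that are subsets of \<open>k\<close>, with lattices as
  sets of functions from \<open>nat\<close> to \<open>k\<close>; a completion enters only through
  its residues modulo \<open>p ^ e\<close>. The places over one prime are kept together. The ring is
  then semilocal with several residue fields, no Euler product over the places above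
  \<open>p\<close> is required, and the least index of a proper ideal replaces the cardinality of a
  residue field. At indices that are not powers of \<open>p\<close> the semilocal counts are 0.

  The product formula rests on a coincidence of sizes. Let \<open>L\<close> be the projection of an
  invariant submodule to height 0 and \<open>N'\<close> its intersection with the other heights.
  Invariance confines \<open>L\<close> to a submodule, again free, whose index depends on
  \<open>N'\<close> alone, and the submodules with given \<open>L\<close> and \<open>N'\<close>
  number a power of this same index. So one exponent and one weight carry the whole recursion.

  A proper invariant submodule has a proper projection to its lowest height, so the factor at height
  \<open>h\<close> shows its first nontrivial coefficient at \<open>m ^ (h + 1)\<close>, before any
  later factor interferes.

  That every prime has a place above it is not visible from absolute values; a maximal subring
  without \<open>1 / p\<close> supplies one.\<close>

definition subgrp :: "'v::ab_group_add set \<Rightarrow> bool" where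
  "subgrp N \<longleftrightarrow> 0 \<in> N \<and> (\<forall>x\<in>N. \<forall>y\<in>N. x - y \<in> N)"

text \<open>An infinite index is recorded as 0, so \<open>0 < idx M N\<close> asserts that the index
  is finite.\<close>

definition idx :: "'v::ab_group_add set \<Rightarrow> 'v set \<Rightarrow> nat" where
  "idx M N = card ((\<lambda>a. (+) a ` N) ` M)"

lemma subgrp_zero: "subgrp N \<Longrightarrow> 0 \<in> N"
  by (simp add: subgrp_def)

lemma subgrp_diff: "subgrp N \<Longrightarrow> x \<in> N \<Longrightarrow> y \<in> N \<Longrightarrow> x - y \<in> N"
  by (simp add: subgrp_def)

lemma subgrp_minus: "subgrp N \<Longrightarrow> x \<in> N \<Longrightarrow> - x \<in> N"
  using subgrp_diff[of N 0 x] subgrp_zero[of N] by simp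

lemma subgrp_add: "subgrp N \<Longrightarrow> x \<in> N \<Longrightarrow> y \<in> N \<Longrightarrow> x + y \<in> N"
  using subgrp_diff[of N x "- y"] subgrp_minus[of N y] by simp

lemma subgrp_sum: "subgrp N \<Longrightarrow> (\<And>i. i \<in> I \<Longrightarrow> f i \<in> N) \<Longrightarrow> sum f I \<in> N"
  by (induction I rule: infinite_finite_induct) (auto simp: subgrp_zero subgrp_add)

lemma subgrp_Int: "subgrp M \<Longrightarrow> subgrp N \<Longrightarrow> subgrp (M \<inter> N)"
  by (simp add: subgrp_def)

lemma subgrp_diff_trans:
  assumes "subgrp N" "a - b \<in> N" "b - c \<in> N" shows "a - c \<in> N"
  using subgrp_add[OF assms] by simp

lemma subgrp_diff_swap: "subgrp N \<Longrightarrow> a - b \<in> N \<Longrightarrow> b - a \<in> N"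
  using subgrp_minus[of N "a - b"] by simp

lemma coset_eq_iff:
  assumes "subgrp N" shows "(+) a ` N = (+) b ` N \<longleftrightarrow> a - b \<in> N"
proof
  assume e: "(+) a ` N = (+) b ` N"
  have "a \<in> (+) a ` N" using subgrp_zero[OF assms] by force
  then obtain n where "n \<in> N" "a = b + n" unfolding e by auto
  then show "a - b \<in> N" by simp
next
  assume d: "a - b \<in> N"
  have *: "(+) a ` N \<subseteq> (+) b ` N" if "a - b \<in> N" for a b
  proof
    fix x assume "x \<in> (+) a ` N"
    then obtain n where n: "n \<in> N" "x = a + n" by auto
    then have "x = b + ((a - b) + n)" by simp
    then show "x \<in> (+) b ` N" using subgrp_add[OF assms that n(1)] by blast
  qed
  show "(+) a ` N = (+) b ` N"
    using *[OF d] *[OF subgrp_diff_swap[OF assms d]] by blast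
qed

text \<open>Both images are copies of the partition of \<open>M\<close> into common fibres; a
  representative is picked in each fibre of \<open>f\<close>.\<close>

lemma bij_betw_image_kernel:
  assumes "\<And>a b. a \<in> M \<Longrightarrow> b \<in> M \<Longrightarrow> f a = f b \<longleftrightarrow> g a = g b"
  shows "bij_betw (\<lambda>y. g (inv_into M f y)) (f ` M) (g ` M)"
proof (rule bij_betwI')
  fix x y assume "x \<in> f ` M" "y \<in> f ` M"
  then show "(g (inv_into M f x) = g (inv_into M f y)) = (x = y)"
    by (metis assms f_inv_into_f inv_into_into)
next
  fix x assume "x \<in> f ` M" then show "g (inv_into M f x) \<in> g ` M" by (simp add: inv_into_into)
next
  fix y assume "y \<in> g ` M"
  then obtain a where a: "a \<in> M" "y = g a" by auto
  then have "g (inv_into M f (f a)) = g a"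
    by (metis assms f_inv_into_f image_eqI inv_into_into)
  then show "\<exists>x\<in>f ` M. y = g (inv_into M f x)" using a by (intro bexI[of _ "f a"]) auto
qed

lemma card_image_kernel:
  assumes "\<And>a b. a \<in> M \<Longrightarrow> b \<in> M \<Longrightarrow> f a = f b \<longleftrightarrow> g a = g b"
  shows "card (f ` M) = card (g ` M)"
  using bij_betw_same_card[OF bij_betw_image_kernel[OF assms]] .

lemma idx_eq_card_image:
  assumes "subgrp N" "\<And>a b. a \<in> M \<Longrightarrow> b \<in> M \<Longrightarrow> h a = h b \<longleftrightarrow> a - b \<in> N"
  shows "idx M N = card (h ` M)"
  unfolding idx_def by (rule card_image_kernel) (simp add: coset_eq_iff assms)

lemma finite_cosets: "idx M N > 0 \<Longrightarrow> finite ((\<lambda>a. (+) a ` N) ` M)"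
  unfolding idx_def by (meson card_gt_0_iff)

text \<open>Equal values of \<open>h\<close> force equal cosets, so the set of cosets is a quotient
  of the finite image of \<open>h\<close>. This gives finiteness and a bound without computing the
  index.\<close>

lemma idx_pos_if_finite_image:
  assumes "subgrp N" "\<And>a b. a \<in> M \<Longrightarrow> b \<in> M \<Longrightarrow> h a = h b \<Longrightarrow> a - b \<in> N"
    "finite (h ` M)" "M \<noteq> {}"
  shows "idx M N > 0" and "idx M N \<le> card (h ` M)"
proof -
  let ?c = "\<lambda>a. (+) a ` N"
  have sub: "?c ` M \<subseteq> (\<lambda>y. ?c (inv_into M h y)) ` (h ` M)"
  proof
    fix C assume "C \<in> ?c ` M"
    then obtain a where a: "a \<in> M" "C = ?c a" by auto
    have "a - inv_into M h (h a) \<in> N"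
      by (rule assms(2)) (use a in \<open>auto simp: f_inv_into_f inv_into_into\<close>)
    then have "?c a = ?c (inv_into M h (h a))" by (simp add: coset_eq_iff assms(1))
    then show "C \<in> (\<lambda>y. ?c (inv_into M h y)) ` (h ` M)" using a by blast
  qed
  have fin: "finite (?c ` M)" using finite_subset[OF sub] assms(3) by blast
  then show "idx M N > 0" unfolding idx_def using assms(4) by (simp add: card_gt_0_iff)
  show "idx M N \<le> card (h ` M)" unfolding idx_def
    using card_mono[OF _ sub] card_image_le[OF assms(3)] assms(3) order_trans by blast
qed

text \<open>The last three assumptions say that \<open>h\<close> induces a bijection from
  \<open>M\<close> modulo \<open>N\<close> to \<open>M'\<close> modulo \<open>N'\<close>. Stated
  modulo the subgroups, they cover inclusions, projections and the shift alike, and so contain the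
  isomorphism theorems for indices.\<close>

lemma idx_hom:
  assumes N: "subgrp N" and N': "subgrp N'"
    and diff: "\<And>a b. a \<in> M \<Longrightarrow> b \<in> M \<Longrightarrow> h a - h b \<in> N' \<longleftrightarrow> a - b \<in> N"
    and into: "\<And>a. a \<in> M \<Longrightarrow> h a \<in> M'"
    and onto: "\<And>y. y \<in> M' \<Longrightarrow> \<exists>a\<in>M. y - h a \<in> N'"
  shows "idx M' N' = idx M N"
proof -
  have "idx M N = card ((\<lambda>a. (+) (h a) ` N') ` M)"
    by (rule idx_eq_card_image[OF N]) (simp add: coset_eq_iff N' diff)
  also have "(\<lambda>a. (+) (h a) ` N') ` M = (\<lambda>a. (+) a ` N') ` M'"
  proof
    show "(\<lambda>a. (+) (h a) ` N') ` M \<subseteq> (\<lambda>a. (+) a ` N') ` M'" using into by blast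
    show "(\<lambda>a. (+) a ` N') ` M' \<subseteq> (\<lambda>a. (+) (h a) ` N') ` M"
    proof
      fix C assume "C \<in> (\<lambda>a. (+) a ` N') ` M'"
      then obtain y where y: "y \<in> M'" "C = (+) y ` N'" by auto
      obtain a where "a \<in> M" "y - h a \<in> N'" using onto[OF y(1)] by blast
      then show "C \<in> (\<lambda>a. (+) (h a) ` N') ` M" using y coset_eq_iff[OF N'] by blast
    qed
  qed
  finally show ?thesis by (simp add: idx_def)
qed

text \<open>With \<open>s a\<close> a chosen representative of the \<open>L\<close>-coset of
  \<open>a\<close>, the map sending \<open>a\<close> to its \<open>L\<close>-coset and the
  \<open>N\<close>-coset of \<open>a - s a\<close> identifies \<open>M\<close> modulo
  \<open>N\<close> with a product. The identity includes infinite indices, which count as 0.\<close>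

lemma idx_mult:
  assumes M: "subgrp M" and L: "subgrp L" and N: "subgrp N" and "N \<subseteq> L" "L \<subseteq> M"
  shows "idx M N = idx M L * idx L N"
proof -
  let ?c = "\<lambda>a. (+) a ` L"
  define s where "s a = inv_into M ?c (?c a)" for a
  have s: "s a \<in> M" "a - s a \<in> L" if "a \<in> M" for a
  proof -
    show "s a \<in> M" unfolding s_def using that by (simp add: inv_into_into)
    have "?c (s a) = ?c a" unfolding s_def using that f_inv_into_f[of "?c a" ?c M] by blast
    then show "a - s a \<in> L" using coset_eq_iff[OF L] by metis
  qed
  have s_eq: "s a = s b" if "?c a = ?c b" for a b using that by (simp add: s_def)
  define h where "h a = (?c a, (+) (a - s a) ` N)" for a
  have "idx M N = card (h ` M)"
  proof (rule idx_eq_card_image[OF N])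
    fix a b assume ab: "a \<in> M" "b \<in> M"
    show "h a = h b \<longleftrightarrow> a - b \<in> N"
    proof
      assume "h a = h b"
      then have "?c a = ?c b" "(a - s a) - (b - s b) \<in> N"
        unfolding h_def by (auto simp: coset_eq_iff N)
      moreover from this(1) have "s a = s b" by (rule s_eq)
      ultimately show "a - b \<in> N" by simp
    next
      assume d: "a - b \<in> N"
      then have c: "?c a = ?c b" using assms coset_eq_iff[OF L] by blast
      then show "h a = h b" unfolding h_def using d s_eq[OF c] by (simp add: coset_eq_iff N)
    qed
  qed
  also have "h ` M = ?c ` M \<times> (\<lambda>a. (+) a ` N) ` L"
  proof
    show "h ` M \<subseteq> ?c ` M \<times> (\<lambda>a. (+) a ` N) ` L" unfolding h_def using s by auto
    show "?c ` M \<times> (\<lambda>a. (+) a ` N) ` L \<subseteq> h ` M"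
    proof
      fix p assume "p \<in> ?c ` M \<times> (\<lambda>a. (+) a ` N) ` L"
      then obtain a l where al: "a \<in> M" "l \<in> L" "p = (?c a, (+) l ` N)" by auto
      define b where "b = s a + l"
      have b: "b \<in> M" unfolding b_def using s al assms by (meson M subgrp_add subsetD)
      have "?c b = ?c a"
      proof -
        have "a - b = (a - s a) - l" by (simp add: b_def)
        then have "a - b \<in> L" using s(2)[OF al(1)] al(2) subgrp_diff[OF L] by metis
        then show ?thesis using coset_eq_iff[OF L] by metis
      qed
      then have "h b = p" unfolding h_def al using s_eq[of b a] by (simp add: b_def)
      then show "p \<in> h ` M" using b by blast
    qed
  qed
  finally show ?thesis by (simp add: card_cartesian_product idx_def)
qed

lemma idx_self: "subgrp M \<Longrightarrow> idx M M = 1"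
proof -
  assume M: "subgrp M"
  have "(\<lambda>a. (+) a ` M) ` M = {M}"
  proof -
    have "(+) a ` M = M" if "a \<in> M" for a
      using coset_eq_iff[OF M, of a 0] that by simp
    then show ?thesis using subgrp_zero[OF M] by auto
  qed
  then show ?thesis by (simp add: idx_def)
qed

lemma idx_eq_1_iff:
  assumes "subgrp M" "subgrp N" "N \<subseteq> M"
  shows "idx M N = 1 \<longleftrightarrow> N = M"
proof
  assume "idx M N = 1"
  then obtain C where C: "(\<lambda>a. (+) a ` N) ` M = {C}" unfolding idx_def by (meson card_1_singletonE)
  have "a \<in> N" if "a \<in> M" for a
  proof -
    have "(+) a ` N \<in> {C}" "(+) 0 ` N \<in> {C}"
      unfolding C[symmetric] using that subgrp_zero[OF assms(1)] by (intro imageI; simp)+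
    then have "(+) a ` N = (+) 0 ` N" by simp
    then show ?thesis using coset_eq_iff[OF assms(2), of a 0] by simp
  qed
  then show "N = M" using assms by blast
qed (use assms idx_self in auto)

text \<open>Lagrange's theorem for an abelian quotient: translation by \<open>a\<close> permutes the
  finite set \<open>Q\<close> of cosets, so the sum of all representatives is unchanged modulo
  \<open>N\<close> when each of them is increased by \<open>a\<close>.\<close>

lemma sum_const_idx_mem:
  assumes M: "subgrp M" and N: "subgrp N" and NM: "N \<subseteq> M" and pos: "idx M N > 0" and a: "a \<in> M"
  shows "(\<Sum>i<idx M N. a) \<in> N"
proof -
  let ?c = "\<lambda>a. (+) a ` N"
  define Q where "Q = ?c ` M"
  have fin: "finite Q" unfolding Q_def by (rule finite_cosets[OF pos])
  define r where "r C = inv_into M ?c C" for C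
  have r: "r C \<in> M" "?c (r C) = C" if "C \<in> Q" for C
    using that f_inv_into_f[of C ?c M] inv_into_into[of C ?c M] unfolding Q_def r_def by blast+
  define t where "t C = ?c (r C + a)" for C
  have tQ: "t C \<in> Q" if "C \<in> Q" for C
    unfolding Q_def t_def using r[OF that] subgrp_add[OF M _ a] by blast
  have inj: "inj_on t Q"
  proof (rule inj_onI)
    fix C D assume CD: "C \<in> Q" "D \<in> Q" "t C = t D"
    then have "(r C + a) - (r D + a) \<in> N" unfolding t_def by (simp only: coset_eq_iff[OF N])
    then have "r C - r D \<in> N" by simp
    then have "?c (r C) = ?c (r D)" by (simp only: coset_eq_iff[OF N])
    then show "C = D" using r(2) CD by simp
  qed
  have tim: "t ` Q = Q" using inj tQ fin by (simp add: endo_inj_surj image_subsetI)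
  have "(\<Sum>C\<in>Q. r (t C)) = (\<Sum>C\<in>Q. r C)"
    using sum.reindex[OF inj, of r] tim by simp
  moreover have "(\<Sum>C\<in>Q. (r C + a) - r (t C)) \<in> N"
  proof (rule subgrp_sum[OF N])
    fix C assume "C \<in> Q"
    have "?c (r (t C)) = ?c (r C + a)" using r(2)[OF tQ[OF \<open>C \<in> Q\<close>]] by (simp only: t_def)
    then show "(r C + a) - r (t C) \<in> N" using coset_eq_iff[OF N] by metis
  qed
  ultimately have "(\<Sum>C\<in>Q. a) \<in> N" by (simp only: sum.distrib sum_subtractf) simp
  moreover have "(\<Sum>C\<in>Q. a) = (\<Sum>i<idx M N. a)"
  proof -
    obtain g where g: "bij_betw g {..<card Q} Q"
      using ex_bij_betw_nat_finite[OF fin] by (auto simp: atLeast0LessThan)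
    have "(\<Sum>i<card Q. a) = (\<Sum>C\<in>Q. a)" using sum.reindex_bij_betw[OF g, of "\<lambda>_. a"] by simp
    then show ?thesis by (simp add: Q_def idx_def)
  qed
  ultimately show ?thesis by simp
qed

section \<open>Submodules of free modules, with vectors as functions on \<open>nat\<close>\<close>

definition smul :: "'k::field \<Rightarrow> (nat \<Rightarrow> 'k) \<Rightarrow> (nat \<Rightarrow> 'k)" where
  "smul r f = (\<lambda>q. r * f q)"

definition submod :: "'k::field set \<Rightarrow> (nat \<Rightarrow> 'k) set \<Rightarrow> bool" where
  "submod R N \<longleftrightarrow> subgrp N \<and> (\<forall>r\<in>R. \<forall>f\<in>N. smul r f \<in> N)"

text \<open>The free module on the index set \<open>S\<close>, extended by zero. Free modules on
  different index sets share one type, and the module on fewer coordinates is literally a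
  subset.\<close>

definition vecs :: "'k::field set \<Rightarrow> nat set \<Rightarrow> (nat \<Rightarrow> 'k) set" where
  "vecs R S = {f. \<forall>q. f q \<in> R \<and> (q \<notin> S \<longrightarrow> f q = 0)}"

text \<open>\<open>X\<close> is an operator on all functions; with the identity for \<open>X\<close>
  all submodules of index \<open>m\<close> are counted.\<close>

definition cnt :: "'k::field set \<Rightarrow> (nat \<Rightarrow> 'k) set \<Rightarrow> ((nat \<Rightarrow> 'k) \<Rightarrow> (nat \<Rightarrow> 'k)) \<Rightarrow> nat \<Rightarrow> nat" where
  "cnt R M X m = card {N. submod R N \<and> N \<subseteq> M \<and> X ` N \<subseteq> N \<and> idx M N = m}"

definition subring :: "'k::field set \<Rightarrow> bool" where
  "subring R \<longleftrightarrow> subgrp R \<and> 1 \<in> R \<and> (\<forall>x\<in>R. \<forall>y\<in>R. x * y \<in> R)"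

lemma smul_apply [simp]: "smul r f q = r * f q"
  by (simp add: smul_def)

lemma fun_diff_apply [simp]: "(f - g) x = f x - g x"
  by (simp add: fun_diff_def)

lemma fun_uminus_apply [simp]: "(- f) x = - f x"
  by (simp add: fun_Compl_def)

lemma sum_fun_apply [simp]: "(\<Sum>i\<in>I. f i) x = (\<Sum>i\<in>I. f i x)"
  by (induction I rule: infinite_finite_induct) auto

lemma smul_diff: "smul r (f - g) = smul r f - smul r g"
  and smul_add_left: "smul (r + s) f = smul r f + smul s f"
  and smul_diff_left: "smul (r - s) f = smul r f - smul s f"
  and smul_smul: "smul r (smul s f) = smul (r * s) f"
  and smul_one: "smul 1 f = f"
  and smul_zero_left: "smul 0 f = 0"
  and smul_zero: "smul r 0 = 0"
  by (auto simp: fun_eq_iff algebra_simps)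

lemma smul_sum: "smul r (\<Sum>i\<in>I. f i) = (\<Sum>i\<in>I. smul r (f i))"
  by (auto simp: fun_eq_iff sum_distrib_left)

lemma sum_const_smul: "(\<Sum>i<m. f) = smul (of_nat m) f"
  by (auto simp: fun_eq_iff)

lemma submod_subgrp: "submod R N \<Longrightarrow> subgrp N"
  by (simp add: submod_def)

lemma submod_smul: "submod R N \<Longrightarrow> r \<in> R \<Longrightarrow> f \<in> N \<Longrightarrow> smul r f \<in> N"
  by (simp add: submod_def)

lemma submod_Int: "submod R M \<Longrightarrow> submod R N \<Longrightarrow> submod R (M \<inter> N)"
  by (simp add: submod_def subgrp_Int)

lemma subring_subgrp: "subring R \<Longrightarrow> subgrp R"
  and subring_one: "subring R \<Longrightarrow> 1 \<in> R"
  and subring_mult: "subring R \<Longrightarrow> x \<in> R \<Longrightarrow> y \<in> R \<Longrightarrow> x * y \<in> R"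
  by (auto simp: subring_def)

lemma subring_zero: "subring R \<Longrightarrow> 0 \<in> R"
  by (simp add: subring_subgrp subgrp_zero)

lemma subring_of_nat: "subring R \<Longrightarrow> of_nat m \<in> R"
  by (induction m) (auto simp: subring_zero subring_one subgrp_add subring_subgrp)

lemma subring_of_int: "subring R \<Longrightarrow> of_int a \<in> R"
  by (cases a) (auto simp: subring_of_nat subgrp_minus subring_subgrp
      simp del: of_nat_Suc intro: subgrp_minus)

lemma submod_vecs: "subring R \<Longrightarrow> submod R (vecs R S)"
  by (auto simp: submod_def subgrp_def vecs_def subring_def)

lemma subgrp_vecs: "subring R \<Longrightarrow> subgrp (vecs R S)"
  by (rule submod_subgrp, rule submod_vecs)

lemma submod_idx_mem:
  assumes "subgrp M" "subgrp N" "N \<subseteq> M" "idx M N > 0" "f \<in> M"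
  shows "smul (of_nat (idx M N)) f \<in> N"
  using sum_const_idx_mem[OF assms] unfolding sum_const_smul .

lemma subgrp_smul_of_nat: "subgrp N \<Longrightarrow> f \<in> N \<Longrightarrow> smul (of_nat m) f \<in> N"
  using subgrp_sum[of N "{..<m}" "\<lambda>_. f"] unfolding sum_const_smul by blast

lemma subgrp_smul_of_int:
  assumes "subgrp N" "f \<in> N" shows "smul (of_int a) f \<in> N"
proof (cases "a \<ge> 0")
  case True
  then obtain m where "a = int m" using nonneg_int_cases by blast
  then show ?thesis using subgrp_smul_of_nat[OF assms] by simp
next
  case False
  then obtain m where "a = - int m" using nonpos_int_cases by (metis linorder_not_le less_imp_le)
  then have "smul (of_int a) f = - smul (of_nat m) f" by (auto simp: fun_eq_iff)
  then show ?thesis using subgrp_minus[OF assms(1) subgrp_smul_of_nat[OF assms]] by simp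
qed

lemma subgrp_smul_image: "subgrp N \<Longrightarrow> subgrp (smul r ` N)"
  unfolding subgrp_def by (auto simp: image_iff) (metis smul_zero, metis smul_diff)

section \<open>Subgroups of finite-dimensional rational spaces\<close>

lemma rat_common_denominator:
  fixes s t :: rat
  obtains c u v :: int where "c > 0" "s = of_int u / of_int c" "t = of_int v / of_int c"
proof -
  obtain a b where ab: "quotient_of s = (a, b)" by (cases "quotient_of s")
  obtain a' b' where ab': "quotient_of t = (a', b')" by (cases "quotient_of t")
  have b: "b > 0" "b' > 0" using quotient_of_denom_pos[OF ab] quotient_of_denom_pos[OF ab'] .
  have "s = of_int (a * b') / of_int (b * b')" "t = of_int (a' * b) / of_int (b * b')"
    using b quotient_of_div[OF ab] quotient_of_div[OF ab'] by auto
  moreover have "b * b' > 0" using b by simp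
  ultimately show ?thesis using that by blast
qed

text \<open>Finitely many rationals generate a cyclic group. In the induction step Bezout, applied
  to the numerators over a common denominator, gives an element of \<open>H\<close> whose value
  divides both values.\<close>

lemma cyclic_values:
  fixes l :: "(nat \<Rightarrow> 'k::field_char_0) \<Rightarrow> rat"
  assumes H: "subgrp H" and l_add: "\<And>x y. l (x + y) = l x + l y"
    and l_int: "\<And>a x. l (smul (of_int a) x) = of_int a * l x"
    and "finite F" "F \<subseteq> H"
  shows "\<exists>y\<in>H. \<forall>f\<in>F. \<exists>a::int. l f = of_int a * l y"
  using assms(4,5)
proof (induction F rule: finite_induct)
  case empty
  show ?case using subgrp_zero[OF H] by blast
next
  case (insert f F)
  obtain y where y: "y \<in> H" "\<forall>f\<in>F. \<exists>a::int. l f = of_int a * l y" using insert by auto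
  obtain c u v where c: "c > 0" "l y = of_int u / of_int c" "l f = of_int v / of_int c"
    by (rule rat_common_denominator)
  obtain p q where pq: "p * u + q * v = gcd u v" by (metis bezout_int)
  define z where "z = smul (of_int p) y + smul (of_int q) f"
  have z: "z \<in> H" unfolding z_def using insert.prems y
    by (intro subgrp_add[OF H] subgrp_smul_of_int[OF H]) auto
  have "l z = of_int (p * u + q * v) / of_int c"
    unfolding z_def by (simp add: l_add l_int c add_divide_distrib)
  then have lz: "l z = of_int (gcd u v) / of_int c" by (simp add: pq)
  have ly: "l y = of_int (u div gcd u v) * l z" "l f = of_int (v div gcd u v) * l z"
    unfolding lz c by (simp_all flip: of_int_mult)
  have "\<exists>a::int. l g = of_int a * l z" if "g \<in> insert f F" for g
  proof (cases "g = f")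
    case False
    then have "g \<in> F" using that by simp
    then obtain a :: int where "l g = of_int a * l y" using y by blast
    then have "l g = of_int (a * (u div gcd u v)) * l z" using ly by simp
    then show ?thesis by blast
  qed (use ly in blast)
  then show ?case using z by blast
qed

text \<open>Induction on the number of coordinates: an element \<open>y\<close> generating the
  values of the last coordinate on \<open>F\<close> is split off, and the remainders lie in the
  subgroup where that coordinate vanishes. So any finite part of \<open>H\<close> lies in a subgroup
  with \<open>D\<close> generators, even if \<open>H\<close> is not finitely generated.\<close>

lemma finite_subset_generated:
  fixes l :: "nat \<Rightarrow> (nat \<Rightarrow> 'k::field_char_0) \<Rightarrow> rat"
  assumes l_add: "\<And>i x y. l i (x + y) = l i x + l i y"
    and l_int: "\<And>i a x. l i (smul (of_int a) x) = of_int a * l i x"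
    and "subgrp H" "\<And>x. x \<in> H \<Longrightarrow> (\<forall>i<D. l i x = 0) \<Longrightarrow> x = 0" "finite F" "F \<subseteq> H"
  shows "\<exists>x. (\<forall>i. x i \<in> H) \<and> (\<forall>f\<in>F. \<exists>a::nat \<Rightarrow> int. f = (\<Sum>i<D. smul (of_int (a i)) (x i)))"
  using assms(3-)
proof (induction D arbitrary: H F)
  case 0
  have "0 \<in> H" using 0 by (simp add: subgrp_zero)
  moreover have "f = 0" if "f \<in> F" for f using 0(2)[of f] 0(4) that by blast
  ultimately show ?case
    by (intro exI[of _ "\<lambda>_::nat. 0::nat \<Rightarrow> 'k"] conjI allI ballI exI[of _ "\<lambda>_. 0"])
      (simp_all only: lessThan_0 sum.empty)
next
  case (Suc D)
  note H = \<open>subgrp H\<close>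
  have l_diff: "l i (x - y) = l i x - l i y" for i x y
    using l_add[of i "x - y" y] by simp
  have l_0: "l i 0 = 0" for i using l_add[of i 0 0] by simp
  obtain y where y: "y \<in> H" "\<forall>f\<in>F. \<exists>a::int. l D f = of_int a * l D y"
    using cyclic_values[of H "l D" F] l_add l_int Suc.prems by blast
  then obtain a :: "_ \<Rightarrow> int" where a: "\<And>f. f \<in> F \<Longrightarrow> l D f = of_int (a f) * l D y" by metis
  define H' where "H' = {x \<in> H. l D x = 0}"
  define F' where "F' = (\<lambda>f. f - smul (of_int (a f)) y) ` F"
  have H': "subgrp H'" using H unfolding H'_def subgrp_def by (auto simp: l_diff l_0)
  have F': "F' \<subseteq> H'"
    unfolding F'_def H'_def using Suc.prems a y
    by (auto simp: l_diff l_int intro!: subgrp_diff[OF H] subgrp_smul_of_int[OF H])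
  have "\<exists>x. (\<forall>i. x i \<in> H') \<and> (\<forall>f\<in>F'. \<exists>a::nat \<Rightarrow> int. f = (\<Sum>i<D. smul (of_int (a i)) (x i)))"
  proof (rule Suc.IH[OF H' _ _ F'])
    show "finite F'" unfolding F'_def using Suc.prems by simp
    fix x assume "x \<in> H'" "\<forall>i<D. l i x = 0"
    then show "x = 0" using Suc.prems(2)[of x] unfolding H'_def less_Suc_eq by auto
  qed
  then obtain x where x: "\<And>i. x i \<in> H'"
    "\<And>f. f \<in> F' \<Longrightarrow> \<exists>a::nat \<Rightarrow> int. f = (\<Sum>i<D. smul (of_int (a i)) (x i))" by blast
  have "\<exists>b::nat \<Rightarrow> int. f = (\<Sum>i<Suc D. smul (of_int (b i)) ((x(D := y)) i))" if f: "f \<in> F" for f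
  proof -
    have "f - smul (of_int (a f)) y \<in> F'" using f unfolding F'_def by blast
    then obtain b :: "nat \<Rightarrow> int" where b: "f - smul (of_int (a f)) y = (\<Sum>i<D. smul (of_int (b i)) (x i))"
      using x by blast
    have "(\<Sum>i<Suc D. smul (of_int ((b(D := a f)) i)) ((x(D := y)) i)) =
        (\<Sum>i<D. smul (of_int (b i)) (x i)) + smul (of_int (a f)) y"
      by (simp add: sum.lessThan_Suc)
    also have "\<dots> = f" unfolding b[symmetric] by simp
    finally show ?thesis by metis
  qed
  moreover have "\<forall>i. (x(D := y)) i \<in> H" using x(1) y(1) unfolding H'_def by auto
  ultimately show ?case by blast
qed

text \<open>A subgroup of a rational vector space of dimension \<open>D\<close> has finitely many subgroups of each
  index \<open>m\<close>, since each of them is generated modulo \<open>m\<close> by \<open>D\<close> elements.\<close>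

locale rational_coords =
  fixes l :: "nat \<Rightarrow> (nat \<Rightarrow> 'k::field_char_0) \<Rightarrow> rat" and D :: nat and H :: "(nat \<Rightarrow> 'k) set"
  assumes l_add: "\<And>i x y. l i (x + y) = l i x + l i y"
    and l_int: "\<And>i a x. l i (smul (of_int a) x) = of_int a * l i x"
    and H: "subgrp H"
    and l_inj: "\<And>x. x \<in> H \<Longrightarrow> (\<forall>i<D. l i x = 0) \<Longrightarrow> x = 0"
begin

abbreviation "mul m \<equiv> smul (of_nat m) ` H"

lemma generated:
  assumes "subgrp N" "N \<subseteq> H" "finite F" "F \<subseteq> N"
  shows "\<exists>x. (\<forall>i. x i \<in> N) \<and> (\<forall>f\<in>F. \<exists>a::nat \<Rightarrow> int. f = (\<Sum>i<D. smul (of_int (a i)) (x i)))"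
  using finite_subset_generated[of l N D F] l_add l_int l_inj assms by blast

lemma comb_diff_mem:
  fixes a b :: "nat \<Rightarrow> int"
  assumes "\<And>i. i < D \<Longrightarrow> x i \<in> H" "\<And>i. i < D \<Longrightarrow> a i mod int m = b i mod int m"
  shows "(\<Sum>i<D. smul (of_int (a i)) (x i)) - (\<Sum>i<D. smul (of_int (b i)) (x i)) \<in> mul m"
proof -
  have "smul (of_int (a i)) (x i) - smul (of_int (b i)) (x i) \<in> mul m" if "i < D" for i
  proof -
    have "int m dvd a i - b i" using assms(2)[OF that] by (simp add: mod_eq_dvd_iff)
    then obtain c where "a i - b i = int m * c" by (elim dvdE)
    then have "smul (of_int (a i)) (x i) - smul (of_int (b i)) (x i) = smul (of_nat m) (smul (of_int c) (x i))"
      by (simp add: smul_smul flip: smul_diff_left of_int_diff)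
    then show ?thesis using subgrp_smul_of_int[OF H assms(1)[OF that]] by blast
  qed
  then show ?thesis
    unfolding sum_subtractf[symmetric] by (intro subgrp_sum subgrp_smul_image H) auto
qed

text \<open>\<open>H\<close> may be infinitely generated, as a localisation is over the integers, so
  the bound is proved for finite sets of cosets: representatives of such a set are combinations of
  \<open>D\<close> elements of \<open>H\<close>, and only the coefficients modulo \<open>m\<close>
  matter.\<close>

lemma quotient_bound:
  assumes "m > 0"
  shows "0 < idx H (mul m)" and "idx H (mul m) \<le> m ^ D"
proof -
  let ?c = "\<lambda>a. (+) a ` mul m"
  have bd: "card T \<le> m ^ D" if T: "T \<subseteq> ?c ` H" "finite T" for T
  proof -
    obtain F where F: "F \<subseteq> H" "finite F" "T = ?c ` F" using finite_subset_image[OF T(2,1)] by blast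
    obtain x where x: "\<And>i. x i \<in> H" "\<And>f. f \<in> F \<Longrightarrow> \<exists>a::nat \<Rightarrow> int. f = (\<Sum>i<D. smul (of_int (a i)) (x i))"
      using generated[OF H subset_refl F(2,1)] by blast
    then obtain a :: "_ \<Rightarrow> nat \<Rightarrow> int" where a: "\<And>f. f \<in> F \<Longrightarrow> f = (\<Sum>i<D. smul (of_int (a f i)) (x i))" by metis
    let ?P = "{..<D} \<rightarrow>\<^sub>E {0..<int m}"
    define h where "h f = (\<lambda>i\<in>{..<D}. a f i mod int m)" for f
    have "card T \<le> card (h ` F)"
    proof -
      have "?c f = ?c g" if "f \<in> F" "g \<in> F" "h f = h g" for f g
      proof -
        have "a f i mod int m = a g i mod int m" if "i < D" for i
          using that \<open>h f = h g\<close> unfolding h_def by (metis lessThan_iff restrict_apply')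
        then have "f - g \<in> mul m"
          using comb_diff_mem[of x "a f" m "a g"] x(1) a[OF that(1)] a[OF that(2)] by metis
        then show ?thesis using coset_eq_iff[OF subgrp_smul_image[OF H]] by blast
      qed
      then have "?c f = ?c (inv_into F h (h f))" if "f \<in> F" for f
        using that by (metis f_inv_into_f image_eqI inv_into_into)
      then have "T \<subseteq> (\<lambda>y. ?c (inv_into F h y)) ` (h ` F)"
        unfolding F(3) by blast
      then show ?thesis using F(2) by (meson card_image_le card_mono finite_imageI order_trans)
    qed
    also have "\<dots> \<le> card ?P"
    proof (rule card_mono)
      show "finite ?P" by (intro finite_PiE) auto
      show "h ` F \<subseteq> ?P" unfolding h_def using assms by (intro image_subsetI restrict_PiE_iff[THEN iffD2]) simp
    qed
    also have "\<dots> = m ^ D" by (simp add: card_PiE)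
    finally show ?thesis .
  qed
  have fin: "finite (?c ` H) \<and> card (?c ` H) \<le> m ^ D"
    by (rule finite_if_finite_subsets_card_bdd) (use bd in blast)
  moreover have "?c ` H \<noteq> {}" using subgrp_zero[OF H] by blast
  ultimately show "0 < idx H (mul m)" "idx H (mul m) \<le> m ^ D"
    unfolding idx_def by (simp_all add: card_gt_0_iff)
qed

lemma subgroups_bound:
  assumes "m > 0"
  shows "finite {N. subgrp N \<and> N \<subseteq> H \<and> idx H N = m}" (is "finite ?A")
    and "card {N. subgrp N \<and> N \<subseteq> H \<and> idx H N = m} \<le> m ^ (D * D)"
proof -
  let ?c = "\<lambda>a. (+) a ` mul m"
  have fin: "finite (?c ` H)" by (rule finite_cosets[OF quotient_bound(1)[OF assms]])
  have cmul: "subgrp (mul m)" by (rule subgrp_smul_image[OF H])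
  have ex: "\<exists>x. (\<forall>i. x i \<in> N) \<and> (\<forall>f\<in>N. \<exists>a::nat \<Rightarrow> int. f - (\<Sum>i<D. smul (of_int (a i)) (x i)) \<in> mul m)"
    if N: "N \<in> ?A" for N
  proof -
    have "finite (?c ` N)" using N by (intro finite_subset[OF _ fin]) auto
    then obtain F where F: "F \<subseteq> N" "finite F" "?c ` N = ?c ` F"
      using finite_subset_image[of "?c ` N" ?c N] by blast
    obtain x where x: "\<forall>i. x i \<in> N" "\<And>f. f \<in> F \<Longrightarrow> \<exists>a::nat \<Rightarrow> int. f = (\<Sum>i<D. smul (of_int (a i)) (x i))"
      using generated[OF _ _ F(2,1)] N by blast
    have "\<exists>a::nat \<Rightarrow> int. f - (\<Sum>i<D. smul (of_int (a i)) (x i)) \<in> mul m" if "f \<in> N" for f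
    proof -
      have "?c f \<in> ?c ` F" using F(3) that by blast
      then obtain g where g: "g \<in> F" "?c f = ?c g" by blast
      then have "f - g \<in> mul m" using coset_eq_iff[OF cmul] by blast
      then show ?thesis using x(2)[OF g(1)] by metis
    qed
    then show ?thesis using x(1) by blast
  qed
  then have "\<forall>N\<in>?A. \<exists>x. (\<forall>i. x i \<in> N) \<and> (\<forall>f\<in>N. \<exists>a::nat \<Rightarrow> int. f - (\<Sum>i<D. smul (of_int (a i)) (x i)) \<in> mul m)"
    by blast
  from bchoice[OF this] obtain x where x: "\<And>N i. N \<in> ?A \<Longrightarrow> x N i \<in> N"
    "\<And>N f. N \<in> ?A \<Longrightarrow> f \<in> N \<Longrightarrow> \<exists>a::nat \<Rightarrow> int. f - (\<Sum>i<D. smul (of_int (a i)) (x N i)) \<in> mul m"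
    by blast
  let ?P = "{..<D} \<rightarrow>\<^sub>E ?c ` H"
  define h where "h N = (\<lambda>i\<in>{..<D}. ?c (x N i))" for N
  have sub: "N \<subseteq> N'" if N: "N \<in> ?A" "N' \<in> ?A" "h N = h N'" for N N'
  proof
    fix f assume f: "f \<in> N"
    obtain a :: "nat \<Rightarrow> int" where a: "f - (\<Sum>i<D. smul (of_int (a i)) (x N i)) \<in> mul m" using x(2)[OF N(1) f] by blast
    have N': "subgrp N'" using N by simp
    \<comment> \<open>Multiplication by the index kills the quotient, so \<open>N'\<close> contains
      all of \<open>mul m\<close> and can be recovered from cosets of \<open>mul m\<close>.\<close>
    have mN': "mul m \<subseteq> N'" using submod_idx_mem[OF H N', of ] N(2) assms by blast
    have "x N i \<in> N'" if "i < D" for i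
    proof -
      have "?c (x N i) = ?c (x N' i)" using fun_cong[OF N(3), of i] that by (simp add: h_def)
      then have "x N i - x N' i \<in> mul m" by (simp only: coset_eq_iff[OF cmul])
      then have d: "x N i - x N' i \<in> N'" using mN' by (rule rev_subsetD)
      show ?thesis using subgrp_add[OF N' d x(1)[OF N(2), of i]] by simp
    qed
    then have d: "(\<Sum>i<D. smul (of_int (a i)) (x N i)) \<in> N'"
      by (intro subgrp_sum[OF N'] subgrp_smul_of_int[OF N']) auto
    show "f \<in> N'" using subgrp_add[OF N' rev_subsetD[OF a mN'] d] by simp
  qed
  have inj: "inj_on h ?A"
  proof (rule inj_onI, rule equalityI)
    fix N N' assume *: "N \<in> ?A" "N' \<in> ?A" "h N = h N'"
    show "N \<subseteq> N'" by (rule sub[OF *])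
    show "N' \<subseteq> N" by (rule sub[OF *(2,1) *(3)[symmetric]])
  qed
  have im: "h ` ?A \<subseteq> ?P"
  proof (rule image_subsetI)
    fix N assume N: "N \<in> ?A"
    then have "x N i \<in> H" for i using x(1)[OF N, of i] by blast
    then show "h N \<in> ?P" unfolding h_def by (simp add: restrict_PiE_iff)
  qed
  have finP: "finite ?P" using fin by (intro finite_PiE) auto
  show "finite ?A" using inj im finP by (meson finite_imageD finite_subset)
  have "card ?A \<le> card ?P" using inj im finP by (rule card_inj_on_le)
  also have "\<dots> = idx H (mul m) ^ D" by (simp add: card_PiE idx_def)
  also have "\<dots> \<le> (m ^ D) ^ D" using quotient_bound(2)[OF assms] by (rule power_mono) simp
  finally show "card ?A \<le> m ^ (D * D)" by (simp add: power_mult)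
qed

end

section \<open>Transport of counts, and families of vectors\<close>

lemma cnt_iso:
  assumes bij: "bij_betw \<phi> M M'" and M: "submod R M"
    and diff: "\<And>f g. f \<in> M \<Longrightarrow> g \<in> M \<Longrightarrow> \<phi> (f - g) = \<phi> f - \<phi> g"
    and smul: "\<And>r f. r \<in> R \<Longrightarrow> f \<in> M \<Longrightarrow> \<phi> (smul r f) = smul r (\<phi> f)"
    and XM: "\<And>f. f \<in> M \<Longrightarrow> X f \<in> M" and XY: "\<And>f. f \<in> M \<Longrightarrow> \<phi> (X f) = Y (\<phi> f)"
  shows "cnt R M X m = cnt R M' Y m"
proof -
  let ?A = "{N. submod R N \<and> N \<subseteq> M \<and> X ` N \<subseteq> N \<and> idx M N = m}"
  let ?B = "{N. submod R N \<and> N \<subseteq> M' \<and> Y ` N \<subseteq> N \<and> idx M' N = m}"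
  have inj: "inj_on \<phi> M" and im: "\<phi> ` M = M'" using bij by (auto simp: bij_betw_def)
  have sM: "subgrp M" by (rule submod_subgrp[OF M])
  have z: "\<phi> 0 = 0" using diff[of 0 0] subgrp_zero[OF sM] by simp
  have submod_image: "submod R (\<phi> ` N)" if N: "submod R N" "N \<subseteq> M" for N
    unfolding submod_def subgrp_def
  proof (intro conjI ballI)
    show "0 \<in> \<phi> ` N" using z subgrp_zero[OF submod_subgrp[OF N(1)]] by (metis imageI)
    fix x y assume "x \<in> \<phi> ` N" "y \<in> \<phi> ` N"
    then obtain f g where fg: "f \<in> N" "g \<in> N" "x = \<phi> f" "y = \<phi> g" by blast
    then have "x - y = \<phi> (f - g)" using diff N(2) by (metis subsetD)
    then show "x - y \<in> \<phi> ` N" using subgrp_diff[OF submod_subgrp[OF N(1)] fg(1,2)] by blast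
  next
    fix r x assume "r \<in> R" "x \<in> \<phi> ` N"
    then obtain f where f: "f \<in> N" "x = \<phi> f" by blast
    then have "smul r x = \<phi> (smul r f)" using smul[OF \<open>r \<in> R\<close>] N(2) by (metis subsetD)
    then show "smul r x \<in> \<phi> ` N" using submod_smul[OF N(1) \<open>r \<in> R\<close> f(1)] by blast
  qed
  have idx_image: "idx M' (\<phi> ` N) = idx M N" if N: "submod R N" "N \<subseteq> M" for N
  proof (rule idx_hom)
    show "subgrp N" "subgrp (\<phi> ` N)" using N submod_image submod_subgrp by blast+
    fix a b assume ab: "a \<in> M" "b \<in> M"
    then have m: "a - b \<in> M" by (rule subgrp_diff[OF sM])
    have "\<phi> (a - b) \<in> \<phi> ` N \<longleftrightarrow> a - b \<in> N" by (rule inj_on_image_mem_iff[OF inj m N(2)])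
    then show "\<phi> a - \<phi> b \<in> \<phi> ` N \<longleftrightarrow> a - b \<in> N" using diff[OF ab] by simp
    show "\<phi> a \<in> M'" using ab im by blast
  next
    fix y assume "y \<in> M'"
    then obtain a where "a \<in> M" "y = \<phi> a" using im by blast
    moreover have "0 \<in> \<phi> ` N" using z subgrp_zero[OF submod_subgrp[OF N(1)]] by (metis imageI)
    ultimately show "\<exists>a\<in>M. y - \<phi> a \<in> \<phi> ` N" by (intro bexI[of _ a]) (simp_all only: diff_self)
  qed
  have image_eq: "(\<lambda>N. \<phi> ` N) ` ?A = ?B"
  proof
    show "(\<lambda>N. \<phi> ` N) ` ?A \<subseteq> ?B"
    proof (rule image_subsetI, rule CollectI, intro conjI)
      fix N assume "N \<in> ?A"
      then have N: "submod R N" "N \<subseteq> M" "X ` N \<subseteq> N" "idx M N = m" by auto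
      show "submod R (\<phi> ` N)" "idx M' (\<phi> ` N) = m" using submod_image[OF N(1,2)] idx_image[OF N(1,2)] N(4) by auto
      show "\<phi> ` N \<subseteq> M'" using N im by blast
      show "Y ` \<phi> ` N \<subseteq> \<phi> ` N"
      proof (rule image_subsetI)
        fix x assume "x \<in> \<phi> ` N"
        then obtain f where f: "f \<in> N" "x = \<phi> f" by blast
        then have "Y x = \<phi> (X f)" using XY N(2) by (metis subsetD)
        then show "Y x \<in> \<phi> ` N" using N(3) f by auto
      qed
    qed
    show "?B \<subseteq> (\<lambda>N. \<phi> ` N) ` ?A"
    proof
      fix L assume "L \<in> ?B"
      then have L: "submod R L" "L \<subseteq> M'" "Y ` L \<subseteq> L" "idx M' L = m" by auto
      define N where "N = {f \<in> M. \<phi> f \<in> L}"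
      have L_eq: "\<phi> ` N = L" unfolding N_def using L(2) im by auto
      have NM: "N \<subseteq> M" unfolding N_def by blast
      have N: "submod R N"
        unfolding submod_def subgrp_def N_def
        using subgrp_zero[OF sM] z subgrp_zero[OF submod_subgrp[OF L(1)]] diff subgrp_diff[OF sM]
          subgrp_diff[OF submod_subgrp[OF L(1)]] smul submod_smul[OF L(1)] submod_smul[OF M]
        by auto
      have "X ` N \<subseteq> N" unfolding N_def using XM XY L(3) by auto
      then have "N \<in> ?A" using N NM idx_image[OF N NM] L_eq L(4) by auto
      then show "L \<in> (\<lambda>N. \<phi> ` N) ` ?A" using L_eq by blast
    qed
  qed
  have "inj_on (\<lambda>N. \<phi> ` N) ?A"
    using inj by (intro inj_onI) (auto simp: inj_on_image_eq_iff)
  from card_image[OF this] show ?thesis unfolding cnt_def image_eq by (rule sym)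
qed

text \<open>The map from coefficients to linear combinations. That \<open>b\<close> is a basis of
  \<open>L\<close> over \<open>R\<close> is always expressed as bijectivity of
  \<open>lin S b\<close> from \<open>vecs R S\<close> to \<open>L\<close>.\<close>

definition lin :: "nat set \<Rightarrow> (nat \<Rightarrow> nat \<Rightarrow> 'k::field) \<Rightarrow> (nat \<Rightarrow> 'k) \<Rightarrow> (nat \<Rightarrow> 'k)" where
  "lin S b f = (\<Sum>q\<in>S. smul (f q) (b q))"

lemma lin_diff: "lin S b (f - g) = lin S b f - lin S b g"
  by (simp add: lin_def smul_diff_left sum_subtractf)

lemma lin_smul: "lin S b (smul r f) = smul r (lin S b f)"
  by (simp add: lin_def smul_smul smul_sum)

lemma lin_mem:
  assumes "submod R N" "\<And>q. q \<in> S \<Longrightarrow> b q \<in> N" "\<And>q. q \<in> S \<Longrightarrow> f q \<in> R"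
  shows "lin S b f \<in> N"
  unfolding lin_def using assms by (intro subgrp_sum submod_smul[OF assms(1)]) (auto intro: submod_subgrp)

definition restr :: "nat set \<Rightarrow> (nat \<Rightarrow> 'k::zero) \<Rightarrow> (nat \<Rightarrow> 'k)" where
  "restr T f = (\<lambda>q. if q \<in> T then f q else 0)"

lemma restr_apply [simp]: "restr T f q = (if q \<in> T then f q else 0)"
  by (simp add: restr_def)

lemma restr_diff: "restr T (f - g) = restr T f - (restr T g :: nat \<Rightarrow> 'k::field)"
  and restr_add: "restr T (f + g) = restr T f + (restr T g :: nat \<Rightarrow> 'k::field)"
  and restr_smul: "restr T (smul r f) = smul r (restr T f)"
  by (auto simp: fun_eq_iff)

definition delta :: "nat \<Rightarrow> nat \<Rightarrow> 'k::field" where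
  "delta q = (\<lambda>j. if j = q then 1 else 0)"

lemma delta_apply [simp]: "delta q j = (if j = q then 1 else 0)"
  by (simp add: delta_def)

lemma lin_delta:
  assumes "finite S" "q \<in> S" shows "lin S b (delta q) = b q"
proof -
  have "lin S b (delta q) = (\<Sum>j\<in>S. if j = q then b q else 0)"
    unfolding lin_def by (intro sum.cong) (auto simp: smul_one smul_zero_left)
  then show ?thesis using assms by (simp add: sum.delta)
qed

lemma lin_deltas:
  assumes "finite S" "\<And>q. q \<notin> S \<Longrightarrow> f q = 0" shows "lin S delta f = f"
proof
  fix q
  have "lin S delta f q = (\<Sum>j\<in>S. if j = q then f q else 0)"
    unfolding lin_def sum_fun_apply by (intro sum.cong) auto
  then show "lin S delta f q = f q" using assms by (auto simp: sum.delta)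
qed

text \<open>\<open>co\<close> stands for the coordinates of \<open>k\<close> with respect to a
  rational basis with \<open>d\<close> elements. They bound indices uniformly over all subrings
  \<open>R\<close>.\<close>

locale nf_ring =
  fixes R :: "'k::field_char_0 set" and co :: "nat \<Rightarrow> 'k \<Rightarrow> rat" and d :: nat
  assumes ring: "subring R"
    and co_add: "\<And>i x y. co i (x + y) = co i x + co i y"
    and co_int: "\<And>i a x. co i (of_int a * x) = of_int a * co i x"
    and co_inj: "\<And>x. (\<forall>i<d. co i x = 0) \<Longrightarrow> x = 0"
begin

text \<open>Coordinate \<open>j\<close> of a vector is coordinate \<open>j mod d\<close> of entry
  \<open>j div d\<close>, so \<open>n\<close> entries in \<open>k\<close> make \<open>n * d\<close>
  rational coordinates.\<close>

lemma vecs_coords: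
  "rational_coords (\<lambda>j f. co (j mod d) (f (j div d))) (n * d) (vecs R {..<n})"
proof
  show "subgrp (vecs R {..<n})" by (rule subgrp_vecs[OF ring])
  fix x :: "nat \<Rightarrow> 'k" assume x: "x \<in> vecs R {..<n}" "\<forall>i<n * d. co (i mod d) (x (i div d)) = 0"
  show "x = 0"
  proof
    fix q
    show "x q = 0 q"
    proof (cases "q < n")
      case True
      have "co i (x q) = 0" if "i < d" for i
      proof -
        have "q * d + i < Suc q * d" using that by simp
        also have "\<dots> \<le> n * d" using True by (intro mult_le_mono1) simp
        finally have "q * d + i < n * d" .
        then have "co ((q * d + i) mod d) (x ((q * d + i) div d)) = 0" using x(2) by blast
        then show ?thesis using that by simp
      qed
      then show ?thesis using co_inj by simp
    qed (use x(1) in \<open>auto simp: vecs_def\<close>)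
  qed
qed (simp_all add: co_add co_int)

text \<open>For index sets of the form \<open>{..<n}\<close> the bound is known. The module on
  \<open>S\<close> embeds in such a module, and a multiple of \<open>m\<close> there that is
  supported on \<open>S\<close> is a multiple of \<open>m\<close> in the smaller module.\<close>

lemma vecs_mult_idx_pos:
  assumes "finite S" "m > 0"
  shows "idx (vecs R S) (smul (of_nat m) ` vecs R S) > 0"
proof -
  obtain n where n: "S \<subseteq> {..<n}" using assms(1) finite_nat_bounded by blast
  interpret rational_coords "\<lambda>j f. co (j mod d) (f (j div d))" "n * d" "vecs R {..<n}" by (rule vecs_coords)
  have fin: "finite ((\<lambda>a. (+) a ` mul m) ` vecs R {..<n})" by (rule finite_cosets[OF quotient_bound(1)[OF assms(2)]])
  have sub: "vecs R S \<subseteq> vecs R {..<n}" using n by (auto simp: vecs_def)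
  show ?thesis
  proof (rule idx_pos_if_finite_image)
    show "subgrp (smul (of_nat m) ` vecs R S)" by (rule subgrp_smul_image[OF subgrp_vecs[OF ring]])
    show "finite ((\<lambda>a. (+) a ` mul m) ` vecs R S)" using fin sub by (meson finite_subset image_mono)
    show "vecs R S \<noteq> {}" using subgrp_zero[OF subgrp_vecs[OF ring]] by blast
    fix a b assume ab: "a \<in> vecs R S" "b \<in> vecs R S" "(+) a ` mul m = (+) b ` mul m"
    then have "a - b \<in> mul m" using coset_eq_iff[OF subgrp_smul_image[OF H]] by blast
    then obtain g where g: "g \<in> vecs R {..<n}" "a - b = smul (of_nat m) g" by blast
    have "g q = 0" if "q \<notin> S" for q
    proof -
      have "(a - b) q = 0" using ab that by (simp add: vecs_def)
      then show ?thesis unfolding g(2) using assms(2) by simp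
    qed
    then have "g \<in> vecs R S" using g(1) by (simp add: vecs_def)
    then show "a - b \<in> smul (of_nat m) ` vecs R S" using g(2) by blast
  qed
qed

text \<open>A submodule of index \<open>m\<close> contains all multiples of \<open>m\<close>, hence
  is determined by its image in a finite quotient.\<close>

lemma finite_submods:
  assumes "finite S" "m > 0"
  shows "finite {N. submod R N \<and> N \<subseteq> vecs R S \<and> idx (vecs R S) N = m}"
proof -
  define c where "c = idx (vecs R S) (smul (of_nat m) ` vecs R S)"
  have c: "c > 0" unfolding c_def by (rule vecs_mult_idx_pos[OF assms])
  obtain n where n: "S \<subseteq> {..<n}" using assms(1) finite_nat_bounded by blast
  let ?V = "vecs R S" let ?mV = "smul (of_nat m) ` ?V"
  have sV: "subgrp ?V" "subgrp ?mV" by (intro subgrp_smul_image subgrp_vecs ring)+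
  let ?c = "\<lambda>a. (+) a ` ?mV"
  have fin: "finite (Pow (?c ` ?V))" using finite_cosets[of ?V ?mV] c by (simp add: c_def)
  show ?thesis
  proof (rule inj_on_finite[OF _ _ fin])
    show "(\<lambda>N. ?c ` N) ` {N. submod R N \<and> N \<subseteq> ?V \<and> idx ?V N = m} \<subseteq> Pow (?c ` ?V)" by blast
    have sub: "N \<subseteq> N'" if N: "N \<subseteq> ?V" and N': "submod R N'" "N' \<subseteq> ?V" "idx ?V N' = m"
      and eq: "?c ` N = ?c ` N'" for N N'
    proof
      fix f assume "f \<in> N"
      then have "?c f \<in> ?c ` N'" unfolding eq[symmetric] by (rule imageI)
      then obtain g where g: "g \<in> N'" "?c f = ?c g" by (rule imageE)
      have "f - g \<in> ?mV" using g(2) by (simp only: coset_eq_iff[OF sV(2)])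
      then obtain h where h: "h \<in> ?V" "f - g = smul (of_nat m) h" by (rule imageE)
      have "f - g \<in> N'" unfolding h(2) N'(3)[symmetric]
        by (rule submod_idx_mem[OF sV(1) submod_subgrp[OF N'(1)] N'(2) _ h(1)]) (simp add: N'(3) assms)
      then show "f \<in> N'" using subgrp_add[OF submod_subgrp[OF N'(1)] _ g(1)] by fastforce
    qed
    show "inj_on (\<lambda>N. ?c ` N) {N. submod R N \<and> N \<subseteq> ?V \<and> idx ?V N = m}"
    proof (rule inj_onI, rule equalityI)
      fix N N' assume *: "N \<in> {N. submod R N \<and> N \<subseteq> ?V \<and> idx ?V N = m}"
        "N' \<in> {N. submod R N \<and> N \<subseteq> ?V \<and> idx ?V N = m}" "?c ` N = ?c ` N'"
      have n: "N \<subseteq> ?V" "submod R N" "idx ?V N = m" and n': "N' \<subseteq> ?V" "submod R N'" "idx ?V N' = m"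
        using *(1,2) by simp_all
      show "N \<subseteq> N'" by (rule sub[OF n(1) n'(2,1,3) *(3)])
      show "N' \<subseteq> N" by (rule sub[OF n'(1) n(2,1,3) *(3)[symmetric]])
    qed
  qed
qed

text \<open>Submodules are among the subgroups of a group with \<open>n * d\<close> rational
  coordinates. This polynomial growth gives absolute convergence of the Dirichlet series on a
  half-plane.\<close>

lemma cnt_bound:
  "cnt R (vecs R {..<n}) X (Suc m) \<le> Suc m ^ ((n * d) * (n * d))"
proof -
  interpret rational_coords "\<lambda>j f. co (j mod d) (f (j div d))" "n * d" "vecs R {..<n}" by (rule vecs_coords)
  show ?thesis
    unfolding cnt_def
  proof (rule order_trans[OF card_mono])
    show "finite {N. subgrp N \<and> N \<subseteq> vecs R {..<n} \<and> idx (vecs R {..<n}) N = Suc m}"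
      by (rule subgroups_bound) simp
    show "card {N. subgrp N \<and> N \<subseteq> vecs R {..<n} \<and> idx (vecs R {..<n}) N = Suc m} \<le> Suc m ^ ((n * d) * (n * d))"
      by (rule subgroups_bound) simp
  qed (auto simp: submod_def)
qed

end

section \<open>Submodules over principal ideal domains\<close>

text \<open>The last assumption excludes rings in which every positive integer is invertible. Over
  such a ring no proper submodule has finite index and the counts carry no information.\<close>

locale pid_ring = nf_ring +
  assumes principal: "\<And>I. \<lbrakk>I \<subseteq> R; subgrp I; \<And>r a. r \<in> R \<Longrightarrow> a \<in> I \<Longrightarrow> r * a \<in> I\<rbrakk>
      \<Longrightarrow> \<exists>a\<in>I. \<forall>b\<in>I. \<exists>r\<in>R. b = r * a"
    and not_divisible: "\<exists>c::nat. c > 0 \<and> inverse (of_nat c) \<notin> R"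
begin

lemma R0: "0 \<in> R" and R1: "1 \<in> R"
  by (auto simp: subring_zero subring_one ring)

lemma vecsD: "f \<in> vecs R S \<Longrightarrow> f q \<in> R" "f \<in> vecs R S \<Longrightarrow> q \<notin> S \<Longrightarrow> f q = 0"
  by (auto simp: vecs_def)

lemma vecsI: "(\<And>q. q \<in> S \<Longrightarrow> f q \<in> R) \<Longrightarrow> (\<And>q. q \<notin> S \<Longrightarrow> f q = 0) \<Longrightarrow> f \<in> vecs R S"
  using R0 by (fastforce simp: vecs_def)

lemma subgrp_V: "subgrp (vecs R S)" and submod_V: "submod R (vecs R S)"
  using subgrp_vecs submod_vecs ring by blast+

lemma delta_mem: "q \<in> S \<Longrightarrow> delta q \<in> vecs R S"
  by (rule vecsI) (auto simp: R0 R1)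

text \<open>A submodule of full rank over a principal ideal domain is free of the same rank. The
  coordinates are removed one at a time: the values at \<open>q\<close> form an ideal with generator
  \<open>a = w q\<close>, and \<open>w\<close> complements the part of \<open>L\<close> that
  vanishes at \<open>q\<close>.\<close>

lemma basis_exists:
  assumes "finite S" "submod R L" "L \<subseteq> vecs R S" "c > 0" "smul (of_nat c) ` vecs R S \<subseteq> L"
  shows "\<exists>b. (\<forall>q\<in>S. b q \<in> L) \<and> bij_betw (lin S b) (vecs R S) L"
  using assms(1-3,5)
proof (induction S arbitrary: L rule: finite_induct)
  case empty
  have V: "vecs R {} = {0}" using R0 by (auto simp: vecs_def fun_eq_iff)
  have "L = {0}" using empty.prems subgrp_zero[OF submod_subgrp] unfolding V by blast
  then have "bij_betw (lin {} b) (vecs R {}) L" for b unfolding V by (simp add: bij_betw_def lin_def)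
  then show ?case by blast
next
  case (insert q S)
  note L = \<open>submod R L\<close> and sL = submod_subgrp[OF \<open>submod R L\<close>]
  define I where "I = (\<lambda>f. f q) ` L"
  have IR: "I \<subseteq> R" unfolding I_def using insert.prems vecsD by blast
  have sI: "subgrp I" unfolding I_def subgrp_def
  proof (intro conjI ballI)
    show "0 \<in> (\<lambda>f. f q) ` L" by (rule image_eqI[OF _ subgrp_zero[OF sL]]) simp
    fix x y assume "x \<in> (\<lambda>f. f q) ` L" "y \<in> (\<lambda>f. f q) ` L"
    then obtain f g where "f \<in> L" "g \<in> L" "x = f q" "y = g q" by blast
    then show "x - y \<in> (\<lambda>f. f q) ` L" by (intro image_eqI[of _ _ "f - g"] subgrp_diff[OF sL]) auto
  qed
  have mI: "r * a \<in> I" if r: "r \<in> R" and a: "a \<in> I" for r a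
  proof -
    obtain f where "f \<in> L" "a = f q" using a unfolding I_def by blast
    then show ?thesis unfolding I_def by (intro image_eqI[of _ _ "smul r f"] submod_smul[OF L r]) auto
  qed
  from principal[OF IR sI mI] obtain a where a: "a \<in> I" "\<And>b. b \<in> I \<Longrightarrow> \<exists>r\<in>R. b = r * a" by blast
  obtain w where w: "w \<in> L" "w q = a" using a(1) unfolding I_def by blast
  have "smul (of_nat c) (delta q) \<in> L" using insert.prems(3) delta_mem[of q "insert q S"] by blast
  then have "of_nat c \<in> I" unfolding I_def by (rule image_eqI[rotated]) simp
  \<comment> \<open>\<open>L\<close> contains \<open>c\<close> times the unit vector at
    \<open>q\<close>, so the ideal is nonzero and no rank is lost at this coordinate.\<close>
  then have a0: "a \<noteq> 0" using a(2)[of "of_nat c"] \<open>c > 0\<close> by auto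
  define L' where "L' = L \<inter> vecs R S"
  have L': "submod R L'" unfolding L'_def by (rule submod_Int[OF L submod_V])
  have "smul (of_nat c) ` vecs R S \<subseteq> L'"
  proof (rule image_subsetI)
    fix f assume f: "f \<in> vecs R S"
    then have "f \<in> vecs R (insert q S)" by (auto simp: vecs_def)
    then have "smul (of_nat c) f \<in> L" using insert.prems(3) by blast
    moreover have "smul (of_nat c) f \<in> vecs R S" by (rule submod_smul[OF submod_V subring_of_nat[OF ring] f])
    ultimately show "smul (of_nat c) f \<in> L'" by (simp add: L'_def)
  qed
  with insert.IH[OF L'] obtain b' where b': "\<forall>j\<in>S. b' j \<in> L'" "bij_betw (lin S b') (vecs R S) L'"
    unfolding L'_def by blast
  define b where "b = b'(q := w)"
  have lin_b: "lin (insert q S) b f = smul (f q) w + lin S b' (f(q := 0))" for f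
  proof -
    have "lin S b f = lin S b' (f(q := 0))"
      unfolding lin_def b_def using insert.hyps by (intro sum.cong) auto
    then show ?thesis using insert.hyps by (simp add: lin_def b_def)
  qed
  have upd: "f(q := 0) \<in> vecs R S" if "f \<in> vecs R (insert q S)" for f
    using that R0 by (auto simp: vecs_def)
  have b'_mem: "lin S b' f \<in> L'" if "f \<in> vecs R S" for f using b'(2) that by (auto simp: bij_betw_def)
  have L'q: "h q = 0" if "h \<in> L'" for h using that insert.hyps by (auto simp: L'_def vecs_def)
  have "bij_betw (lin (insert q S) b) (vecs R (insert q S)) L"
  proof (rule bij_betw_imageI)
    show "inj_on (lin (insert q S) b) (vecs R (insert q S))"
    proof (rule inj_onI)
      fix f g assume f: "f \<in> vecs R (insert q S)" and g: "g \<in> vecs R (insert q S)"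
        and eq: "lin (insert q S) b f = lin (insert q S) b g"
      have "lin S b' (f(q := 0)) q = 0" "lin S b' (g(q := 0)) q = 0"
        using L'q b'_mem upd f g by blast+
      then have "f q * a = g q * a" using fun_cong[OF eq, of q] w(2) by (simp add: lin_b)
      then have fg: "f q = g q" using a0 by simp
      then have "lin S b' (f(q := 0)) = lin S b' (g(q := 0))" using eq by (simp add: lin_b)
      then have "f(q := 0) = g(q := 0)"
        using b'(2) upd[OF f] upd[OF g] by (auto simp: bij_betw_def dest: inj_onD)
      then show "f = g" using fg by (metis fun_upd_triv fun_upd_upd)
    qed
    show "lin (insert q S) b ` vecs R (insert q S) = L"
    proof
      show "lin (insert q S) b ` vecs R (insert q S) \<subseteq> L"
      proof (rule image_subsetI)
        fix f assume f: "f \<in> vecs R (insert q S)"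
        have "lin S b' (f(q := 0)) \<in> L" using b'_mem[OF upd[OF f]] by (simp add: L'_def)
        then show "lin (insert q S) b f \<in> L"
          unfolding lin_b using submod_smul[OF L vecsD(1)[OF f] w(1)] by (intro subgrp_add[OF sL])
      qed
      show "L \<subseteq> lin (insert q S) b ` vecs R (insert q S)"
      proof
        fix h assume h: "h \<in> L"
        then have "h q \<in> I" unfolding I_def by blast
        then obtain r where r: "r \<in> R" "h q = r * a" using a(2) by blast
        have hL: "h - smul r w \<in> L" using submod_smul[OF L r(1) w(1)] h by (intro subgrp_diff[OF sL])
        then have "h - smul r w \<in> vecs R (insert q S)" using insert.prems by blast
        moreover have "(h - smul r w) q = 0" using r w by simp
        ultimately have "h - smul r w \<in> L'" using hL by (auto simp: L'_def vecs_def)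
        then obtain f where f: "f \<in> vecs R S" "h - smul r w = lin S b' f"
          using b'(2) by (auto simp: bij_betw_def)
        have fq: "f q = 0" using f(1) insert.hyps by (auto simp: vecs_def)
        have "lin (insert q S) b (f(q := r)) = h"
        proof -
          have "lin (insert q S) b (f(q := r)) = smul r w + lin S b' (f(q := 0))" by (simp add: lin_b)
          also have "f(q := 0) = f" using fq by (simp add: fun_upd_idem)
          also have "smul r w + lin S b' f = h" unfolding f(2)[symmetric] by simp
          finally show ?thesis .
        qed
        moreover have "f(q := r) \<in> vecs R (insert q S)" using f(1) r(1) by (auto simp: vecs_def)
        ultimately show "h \<in> lin (insert q S) b ` vecs R (insert q S)" by blast
      qed
    qed
  qed
  moreover have "\<forall>j\<in>insert q S. b j \<in> L" using b' w unfolding b_def L'_def by auto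
  ultimately show ?case by blast
qed

definition nsub :: "nat set \<Rightarrow> nat \<Rightarrow> nat" where
  "nsub S m = cnt R (vecs R S) (\<lambda>f. f) m"

lemma nsub_eq: "nsub S m = card {L. submod R L \<and> L \<subseteq> vecs R S \<and> idx (vecs R S) L = m}"
  by (simp add: nsub_def cnt_def)

text \<open>Finite index makes \<open>L\<close> free of rank \<open>card S\<close>, so counting
  inside \<open>L\<close> is the same as counting inside the whole module. This is what turns a sum
  over nested submodules into a product.\<close>

lemma nsub_submodule:
  assumes "finite S" "submod R L" "L \<subseteq> vecs R S" "idx (vecs R S) L > 0"
  shows "card {K. submod R K \<and> K \<subseteq> L \<and> idx L K = m} = nsub S m"
proof -
  have "smul (of_nat (idx (vecs R S) L)) ` vecs R S \<subseteq> L"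
    using submod_idx_mem[OF subgrp_V submod_subgrp[OF assms(2)] assms(3,4)] by blast
  then obtain b where b: "bij_betw (lin S b) (vecs R S) L"
    using basis_exists[OF assms(1-4)] by blast
  have "cnt R (vecs R S) (\<lambda>f. f) m = cnt R L (\<lambda>f. f) m"
    by (rule cnt_iso[OF b submod_V]) (auto simp: lin_diff lin_smul)
  then show ?thesis by (simp add: nsub_def cnt_def)
qed

lemma nsub_card_cong:
  assumes "finite S" "finite S'" "card S = card S'"
  shows "nsub S m = nsub S' m"
proof -
  obtain \<sigma> where \<sigma>: "bij_betw \<sigma> S' S" using assms finite_same_card_bij by metis
  define \<phi> where "\<phi> f = (\<lambda>q. if q \<in> S' then f (\<sigma> q) else 0)" for f :: "nat \<Rightarrow> 'a"
  have \<sigma>S: "\<sigma> q \<in> S" if "q \<in> S'" for q using \<sigma> that by (auto simp: bij_betw_def)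
  have bij: "bij_betw \<phi> (vecs R S) (vecs R S')"
  proof (rule bij_betw_imageI)
    show "inj_on \<phi> (vecs R S)"
    proof (rule inj_onI, rule ext)
      fix f g q assume *: "f \<in> vecs R S" "g \<in> vecs R S" "\<phi> f = \<phi> g"
      show "f q = g q"
      proof (cases "q \<in> S")
        case True
        then obtain p where "p \<in> S'" "q = \<sigma> p" using \<sigma> by (auto simp: bij_betw_def)
        then show ?thesis using fun_cong[OF *(3), of p] by (simp add: \<phi>_def)
      next
        case False
        then show ?thesis using vecsD(2)[OF *(1)] vecsD(2)[OF *(2)] by simp
      qed
    qed
    show "\<phi> ` vecs R S = vecs R S'"
    proof
      show "\<phi> ` vecs R S \<subseteq> vecs R S'" by (intro image_subsetI vecsI) (auto simp: \<phi>_def vecsD)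
      show "vecs R S' \<subseteq> \<phi> ` vecs R S"
      proof
        fix g assume g: "g \<in> vecs R S'"
        define f where "f q = (if q \<in> S then g (inv_into S' \<sigma> q) else 0)" for q
        have "f \<in> vecs R S" by (rule vecsI) (auto simp: f_def vecsD[OF g])
        moreover have "\<phi> f = g"
        proof
          fix q show "\<phi> f q = g q"
            using \<sigma> \<sigma>S vecsD(2)[OF g] by (auto simp: \<phi>_def f_def bij_betw_def inv_into_f_f)
        qed
        ultimately show "g \<in> \<phi> ` vecs R S" by blast
      qed
    qed
  qed
  show ?thesis unfolding nsub_def
    by (rule cnt_iso[OF bij submod_V]) (auto simp: \<phi>_def fun_eq_iff)
qed

text \<open>Since \<open>vecs R {0}\<close> is a copy of \<open>R\<close>, this is the least finite
  index of a proper ideal.\<close>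

definition m0 :: nat where "m0 = (LEAST m. m > 1 \<and> nsub {0} m > 0)"

lemma nsub_posI:
  assumes "finite S" "submod R L" "L \<subseteq> vecs R S" "idx (vecs R S) L = m" "m > 0"
  shows "nsub S m > 0"
  unfolding nsub_eq using finite_submods[OF assms(1,5)] assms by (auto simp: card_gt_0_iff)

lemma nsub_posD:
  "nsub S m > 0 \<Longrightarrow> \<exists>L. submod R L \<and> L \<subseteq> vecs R S \<and> idx (vecs R S) L = m"
  unfolding nsub_eq by (auto simp: card_gt_0_iff)

text \<open>The multiples of an integer \<open>c\<close> that is not invertible in \<open>R\<close>
  form a proper ideal, of finite index by \<open>vecs_mult_idx_pos\<close>.\<close>

lemma m0: "m0 > 1" "nsub {0} m0 > 0"
proof -
  obtain c :: nat where c: "c > 0" "inverse (of_nat c) \<notin> R" using not_divisible by blast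
  let ?L = "smul (of_nat c) ` vecs R {0}"
  have L: "submod R ?L" unfolding submod_def
  proof (intro conjI ballI)
    show "subgrp ?L" by (rule subgrp_smul_image[OF subgrp_V])
    fix r f assume r: "r \<in> R" "f \<in> ?L"
    then obtain g where g: "g \<in> vecs R {0}" "f = smul (of_nat c) g" by blast
    have "smul r f = smul (of_nat c) (smul r g)" using g by (simp add: smul_smul mult.commute)
    then show "smul r f \<in> ?L" using submod_smul[OF submod_V r(1) g(1)] by blast
  qed
  have sub: "?L \<subseteq> vecs R {0}" using submod_smul[OF submod_V subring_of_nat[OF ring]] by blast
  have pos: "idx (vecs R {0}) ?L > 0" by (rule vecs_mult_idx_pos[OF _ c(1)]) simp
  have "?L \<noteq> vecs R {0}"
  proof
    assume "?L = vecs R {0}"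
    then have "delta 0 \<in> ?L" using delta_mem[of 0 "{0}"] by blast
    then obtain g where g: "g \<in> vecs R {0}" "delta 0 = smul (of_nat c) g" by blast
    have "of_nat c * g 0 = 1" using fun_cong[OF g(2), of 0] by simp
    then have "g 0 = inverse (of_nat c)" by (metis inverse_unique)
    then show False using c(2) vecsD(1)[OF g(1)] by metis
  qed
  then have "idx (vecs R {0}) ?L \<noteq> 1" using idx_eq_1_iff[OF subgrp_V submod_subgrp[OF L] sub] by blast
  then have "idx (vecs R {0}) ?L > 1" using pos by linarith
  moreover have "nsub {0} (idx (vecs R {0}) ?L) > 0" by (rule nsub_posI[OF _ L sub refl pos]) simp
  ultimately have "\<exists>m. m > 1 \<and> nsub {0} m > 0" by blast
  from LeastI_ex[OF this] show "m0 > 1" "nsub {0} m0 > 0" unfolding m0_def by blast+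
qed

text \<open>A proper submodule misses some unit vector \<open>delta q\<close>. Pulling
  \<open>L\<close> back along the multiples of \<open>delta q\<close> gives a proper ideal
  \<open>K\<close> whose quotient embeds in the quotient by \<open>L\<close>.\<close>

lemma m0_le:
  assumes S: "finite S" and L: "submod R L" "L \<subseteq> vecs R S" "L \<noteq> vecs R S" and pos: "idx (vecs R S) L > 0"
  shows "m0 \<le> idx (vecs R S) L"
proof -
  have "\<exists>q\<in>S. delta q \<notin> L"
  proof (rule ccontr)
    assume "\<not> (\<exists>q\<in>S. delta q \<notin> L)"
    then have e: "delta q \<in> L" if "q \<in> S" for q using that by blast
    have "f \<in> L" if "f \<in> vecs R S" for f
      using lin_mem[of R L S delta f] e L(1) lin_deltas[OF S, of f] vecsD[OF that] by simp
    then show False using L by blast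
  qed
  then obtain q where q: "q \<in> S" "delta q \<notin> L" by blast
  define K where "K = {f \<in> vecs R {0}. smul (f 0) (delta q) \<in> L}"
  have KL: "smul (f 0) (delta q) - smul (g 0) (delta q) \<in> L \<longleftrightarrow> f - g \<in> K" if "f \<in> vecs R {0}" "g \<in> vecs R {0}" for f g
    using subgrp_diff[OF subgrp_V that] by (simp add: K_def smul_diff_left)
  have K: "submod R K" unfolding submod_def
  proof (intro conjI ballI)
    show "subgrp K" unfolding subgrp_def K_def
      using subgrp_zero[OF subgrp_V] subgrp_zero[OF submod_subgrp[OF L(1)]]
        subgrp_diff[OF submod_subgrp[OF L(1)]] subgrp_diff[OF subgrp_V]
      by (auto simp: smul_zero_left smul_diff_left)
    fix r f assume "r \<in> R" "f \<in> K"
    then show "smul r f \<in> K" using submod_smul[OF L(1), of r "smul (f 0) (delta q)"] submod_smul[OF submod_V]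
      by (auto simp: K_def smul_smul)
  qed
  have KV: "K \<subseteq> vecs R {0}" unfolding K_def by blast
  let ?h = "\<lambda>f. (+) (smul (f 0) (delta q)) ` L"
  have sub: "?h ` vecs R {0} \<subseteq> (\<lambda>a. (+) a ` L) ` vecs R S"
  proof (rule image_subsetI)
    fix f assume "f \<in> vecs R {0}"
    then have "smul (f 0) (delta q) \<in> vecs R S" by (intro submod_smul[OF submod_V] delta_mem q vecsD)
    then show "?h f \<in> (\<lambda>a. (+) a ` L) ` vecs R S" by (rule imageI)
  qed
  have fin: "finite (?h ` vecs R {0})" by (rule finite_subset[OF sub finite_cosets[OF pos]])
  have ker: "a - b \<in> K" if ab: "a \<in> vecs R {0}" "b \<in> vecs R {0}" "?h a = ?h b" for a b
    using ab(3) KL[OF ab(1,2)] by (simp only: coset_eq_iff[OF submod_subgrp[OF L(1)]])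
  have ne: "vecs R {0} \<noteq> {}" using subgrp_zero[OF subgrp_V] by blast
  have Kpos: "idx (vecs R {0}) K > 0"
    by (rule idx_pos_if_finite_image(1)[OF submod_subgrp[OF K] ker fin ne])
  have "idx (vecs R {0}) K \<le> card (?h ` vecs R {0})"
    by (rule idx_pos_if_finite_image(2)[OF submod_subgrp[OF K] ker fin ne])
  also have "\<dots> \<le> idx (vecs R S) L"
    unfolding idx_def by (rule card_mono[OF finite_cosets[OF pos] sub])
  finally have le: "idx (vecs R {0}) K \<le> idx (vecs R S) L" .
  have "delta 0 \<notin> K" using q(2) by (simp add: K_def smul_one)
  then have "K \<noteq> vecs R {0}" using delta_mem[of 0 "{0}"] by blast
  then have "idx (vecs R {0}) K \<noteq> 1" using idx_eq_1_iff[OF subgrp_V submod_subgrp[OF K] KV] by blast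
  then have "idx (vecs R {0}) K > 1" using Kpos by linarith
  moreover have "nsub {0} (idx (vecs R {0}) K) > 0" by (rule nsub_posI[OF _ K KV refl Kpos]) simp
  ultimately have "m0 \<le> idx (vecs R {0}) K" unfolding m0_def by (intro Least_le) blast
  then show ?thesis using le by linarith
qed

lemma nsub_less_m0:
  assumes "finite S" "1 < m" "m < m0" shows "nsub S m = 0"
proof (rule ccontr)
  assume "nsub S m \<noteq> 0"
  then obtain L where L: "submod R L" "L \<subseteq> vecs R S" "idx (vecs R S) L = m" using nsub_posD by blast
  have "L \<noteq> vecs R S" using L assms idx_self[OF subgrp_V, of S] by auto
  then have "m0 \<le> m" using m0_le[OF assms(1) L(1,2)] L(3) assms by simp
  then show False using assms by simp
qed

lemma nsub_1: "nsub S 1 = 1"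
proof -
  have "{L. submod R L \<and> L \<subseteq> vecs R S \<and> idx (vecs R S) L = 1} = {vecs R S}"
    using idx_eq_1_iff[OF subgrp_V submod_subgrp] submod_V idx_self[OF subgrp_V] by auto
  then show ?thesis by (simp add: nsub_eq)
qed

text \<open>Pulling back along the restriction to \<open>S\<close> embeds the submodules for
  \<open>S\<close> into those for \<open>S'\<close> and preserves the index. One more submodule of
  index \<open>m0\<close> comes from a coordinate \<open>q\<close> outside \<open>S\<close>.\<close>

lemma nsub_strict_subset:
  assumes S': "finite S'" and "S \<subset> S'"
  shows "nsub S m0 < nsub S' m0"
proof -
  obtain q where q: "q \<in> S'" "q \<notin> S" using assms by blast
  let ?A = "{L. submod R L \<and> L \<subseteq> vecs R S \<and> idx (vecs R S) L = m0}"
  let ?B = "{L. submod R L \<and> L \<subseteq> vecs R S' \<and> idx (vecs R S') L = m0}"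
  define E where "E h L = {f \<in> vecs R S'. h f \<in> L}" for h :: "(nat \<Rightarrow> 'a) \<Rightarrow> (nat \<Rightarrow> 'a)" and L
  have E: "E h L \<in> ?B"
    if L: "submod R L" "L \<subseteq> vecs R T" "idx (vecs R T) L = m0"
      and h: "\<And>f g. h (f - g) = h f - h g" "\<And>r f. h (smul r f) = smul r (h f)"
        "\<And>f. f \<in> vecs R S' \<Longrightarrow> h f \<in> vecs R T"
        "\<And>y. y \<in> vecs R T \<Longrightarrow> \<exists>f\<in>vecs R S'. h f = y" for h L T
  proof -
    have h0: "h 0 = 0" using h(1)[of 0 0] by simp
    have sL: "subgrp L" by (rule submod_subgrp[OF L(1)])
    have EL: "submod R (E h L)" unfolding submod_def subgrp_def E_def
      using subgrp_zero[OF subgrp_V] subgrp_zero[OF sL] subgrp_diff[OF subgrp_V] subgrp_diff[OF sL]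
        submod_smul[OF L(1)] submod_smul[OF submod_V] h h0 by auto
    moreover have "idx (vecs R T) L = idx (vecs R S') (E h L)"
    proof (rule idx_hom[OF submod_subgrp[OF EL] sL])
      fix a b assume ab: "a \<in> vecs R S'" "b \<in> vecs R S'"
      show "h a - h b \<in> L \<longleftrightarrow> a - b \<in> E h L" using subgrp_diff[OF subgrp_V ab] by (simp add: E_def h)
      show "h a \<in> vecs R T" using h ab by blast
    next
      fix y assume "y \<in> vecs R T"
      then obtain f where f: "f \<in> vecs R S'" "h f = y" using h by blast
      then have "y - h f \<in> L" using subgrp_zero[OF sL] by simp
      then show "\<exists>a\<in>vecs R S'. y - h a \<in> L" using f(1) by blast
    qed
    ultimately show ?thesis using L(3) by (simp add: E_def)
  qed
  have restr_in: "restr S f \<in> vecs R S" if "f \<in> vecs R S'" for f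
    by (rule vecsI) (auto simp: vecsD[OF that])
  have restr_onto: "\<exists>f\<in>vecs R S'. restr S f = y" if "y \<in> vecs R S" for y
    using that assms by (intro bexI[of _ y]) (auto simp: vecs_def fun_eq_iff)
  have AB: "E (restr S) ` ?A \<subseteq> ?B"
    using E[where h = "restr S" and T = S] restr_diff restr_smul restr_in restr_onto by blast
  have inj: "inj_on (E (restr S)) ?A"
  proof (rule inj_onI)
    have *: "L = restr S ` E (restr S) L" if LS: "L \<subseteq> vecs R S" for L
    proof
      show "L \<subseteq> restr S ` E (restr S) L"
      proof
        fix y assume y: "y \<in> L"
        obtain f where "f \<in> vecs R S'" "restr S f = y" using restr_onto[OF subsetD[OF LS y]] by blast
        then show "y \<in> restr S ` E (restr S) L" using y by (intro image_eqI[of _ _ f]) (auto simp: E_def)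
      qed
    qed (auto simp: E_def)
    fix L L' assume "L \<in> ?A" "L' \<in> ?A" "E (restr S) L = E (restr S) L'"
    then show "L = L'" using *[of L] *[of L'] by simp
  qed
  \<comment> \<open>Imposing the ideal \<open>I\<close> on the coordinate \<open>q\<close> alone
    excludes the unit vector at \<open>q\<close>, whereas every submodule pulled back from
    \<open>S\<close> contains it.\<close>
  obtain I where I: "submod R I" "I \<subseteq> vecs R {0}" "idx (vecs R {0}) I = m0" using nsub_posD m0 by blast
  define h where "h f = (\<lambda>j. if j = (0::nat) then f q else 0)" for f :: "nat \<Rightarrow> 'a"
  have "E h I \<in> ?B"
  proof (rule E[OF I])
    fix y assume "y \<in> vecs R {0}"
    then show "\<exists>f\<in>vecs R S'. h f = y"
      using q(1) R0 by (intro bexI[of _ "\<lambda>j. if j = q then y 0 else 0"]) (auto simp: h_def vecs_def fun_eq_iff)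
  qed (auto simp: h_def vecs_def fun_eq_iff R0)
  moreover have "E h I \<notin> E (restr S) ` ?A"
  proof
    assume "E h I \<in> E (restr S) ` ?A"
    then obtain L where L: "E h I = E (restr S) L" "submod R L" by blast
    have "restr S (delta q) = (0 :: nat \<Rightarrow> 'a)" using q by (auto simp: fun_eq_iff)
    then have "delta q \<in> E (restr S) L"
      using delta_mem[OF q(1)] subgrp_zero[OF submod_subgrp[OF L(2)]] by (simp add: E_def)
    then have "h (delta q) \<in> I" unfolding L(1)[symmetric] by (simp add: E_def)
    moreover have "h (delta q) = delta 0" by (auto simp: h_def fun_eq_iff)
    ultimately have I0: "delta 0 \<in> I" by simp
    have "f \<in> I" if "f \<in> vecs R {0}" for f
    proof -
      have "f = smul (f 0) (delta 0)" using vecsD(2)[OF that] by (auto simp: fun_eq_iff)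
      then show ?thesis using submod_smul[OF I(1) vecsD(1)[OF that] I0] by metis
    qed
    then have "I = vecs R {0}" using I(2) by blast
    then show False using I(3) idx_self[OF subgrp_V] m0(1) by simp
  qed
  ultimately have "E (restr S) ` ?A \<subset> ?B" using AB by blast
  moreover have "finite ?B" using m0(1) by (intro finite_submods[OF S']) simp
  ultimately have "card (E (restr S) ` ?A) < card ?B" by (intro psubset_card_mono)
  then show ?thesis using card_image[OF inj] by (simp add: nsub_eq)
qed

lemma nsub_m0_inj:
  assumes S: "finite S" "finite S'" "nsub S m0 = nsub S' m0"
  shows "card S = card S'"
proof -
  have "\<not> card S < card S'" if S: "finite S" "finite S'" "nsub S m0 = nsub S' m0" for S S'
  proof
    assume less: "card S < card S'"
    then obtain T where T: "T \<subseteq> S'" "card T = card S" using obtain_subset_with_card_n less_imp_le by metis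
    then have "T \<subset> S'" using less by auto
    then have "nsub T m0 < nsub S' m0" by (rule nsub_strict_subset[OF S(2)])
    moreover have "nsub T m0 = nsub S m0" using T S by (intro nsub_card_cong) (auto intro: finite_subset)
    ultimately show False using S(3) by simp
  qed
  from this[OF S] this[OF S(2,1) S(3)[symmetric]] show ?thesis by linarith
qed

end

section \<open>Invariant submodules of a shift\<close>

text \<open>\<open>lev q\<close> is the height of the index \<open>q\<close> in its chain. Chains
  occupy consecutive indices, and a new one starts wherever \<open>lev\<close> is 0. The entry at
  the last index of a chain is dropped.\<close>

definition shift :: "nat \<Rightarrow> (nat \<Rightarrow> nat) \<Rightarrow> (nat \<Rightarrow> 'k::zero) \<Rightarrow> (nat \<Rightarrow> 'k)" where
  "shift n lev f = (\<lambda>q. if q < n \<and> 0 < lev q then f (q - 1) else 0)"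

lemma shift_apply: "shift n lev f q = (if q < n \<and> 0 < lev q then f (q - 1) else 0)"
  by (simp add: shift_def)

lemma shift_diff: "shift n lev (f - g) = shift n lev f - (shift n lev g :: nat \<Rightarrow> 'k::field)"
  and shift_add: "shift n lev (f + g) = shift n lev f + (shift n lev g :: nat \<Rightarrow> 'k::field)"
  and shift_smul: "shift n lev (smul r f) = smul r (shift n lev f)"
  by (auto simp: fun_eq_iff shift_apply)

lemma shift_sum: "shift n lev (\<Sum>i\<in>A. f i :: nat \<Rightarrow> 'k::field) = (\<Sum>i\<in>A. shift n lev (f i))"
  by (auto simp: fun_eq_iff shift_apply)

definition good_lev :: "(nat \<Rightarrow> nat) \<Rightarrow> bool" where
  "good_lev lev \<longleftrightarrow> lev 0 = 0 \<and> (\<forall>q. lev (Suc q) = 0 \<or> lev (Suc q) = Suc (lev q))"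

definition level_set :: "nat \<Rightarrow> (nat \<Rightarrow> nat) \<Rightarrow> nat \<Rightarrow> nat set" where
  "level_set n lev h = {q. q < n \<and> lev q = h}"

definition tail_set :: "nat \<Rightarrow> (nat \<Rightarrow> nat) \<Rightarrow> nat \<Rightarrow> nat set" where
  "tail_set n lev h = {q. q < n \<and> h \<le> lev q}"

lemma finite_level_set: "finite (level_set n lev h)" and finite_tail_set: "finite (tail_set n lev h)"
  by (auto simp: level_set_def tail_set_def)

text \<open>The filtration of the free module by height: \<open>U h\<close> is a complement of
  \<open>M (Suc h)\<close> in \<open>M h\<close>, and the shift maps \<open>M h\<close> onto
  \<open>M (Suc h)\<close> and \<open>U h\<close> onto \<open>U (Suc h)\<close>.\<close>

locale chain = pid_ring +
  fixes n :: nat and lev :: "nat \<Rightarrow> nat"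
  assumes good_lev: "good_lev lev"
begin

abbreviation "X \<equiv> (shift n lev :: (nat \<Rightarrow> 'a) \<Rightarrow> nat \<Rightarrow> 'a)"
abbreviation "I h \<equiv> level_set n lev h"
abbreviation "M h \<equiv> vecs R (tail_set n lev h)"
abbreviation "U h \<equiv> vecs R (level_set n lev h)"

lemma levD: "0 < lev q \<Longrightarrow> 0 < q \<and> lev q = Suc (lev (q - 1))"
proof (cases q)
  case (Suc p)
  have "lev (Suc p) = 0 \<or> lev (Suc p) = Suc (lev p)" using good_lev unfolding good_lev_def by blast
  then show "0 < lev q \<Longrightarrow> ?thesis" unfolding Suc by simp
qed (use good_lev in \<open>simp add: good_lev_def\<close>)

lemma M_Suc: "M (Suc h) \<subseteq> M h" and U_M: "U h \<subseteq> M h"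
  by (auto simp: vecs_def tail_set_def level_set_def)

lemma X_M: "f \<in> M h \<Longrightarrow> X f \<in> M (Suc h)"
proof (rule vecsI)
  fix q assume f: "f \<in> M h" and q: "q \<notin> tail_set n lev (Suc h)"
  show "X f q = 0"
  proof (cases "q < n \<and> 0 < lev q")
    case True
    then have "q - 1 \<notin> tail_set n lev h" using q levD[of q] by (auto simp: tail_set_def)
    then show ?thesis using vecsD(2)[OF f] by (simp add: shift_apply)
  qed (auto simp: shift_apply)
qed (auto simp: shift_apply vecsD R0)

lemma X_U: "f \<in> U h \<Longrightarrow> X f \<in> U (Suc h)"
proof (rule vecsI)
  fix q assume f: "f \<in> U h" and q: "q \<notin> I (Suc h)"
  show "X f q = 0"
  proof (cases "q < n \<and> 0 < lev q")
    case True
    then have "q - 1 \<notin> I h" using q levD[of q] by (auto simp: level_set_def)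
    then show ?thesis using vecsD(2)[OF f] by (simp add: shift_apply)
  qed (auto simp: shift_apply)
qed (auto simp: shift_apply vecsD R0)

text \<open>A section of \<open>X\<close> over the indices of positive height. It makes
  \<open>X\<close> surjective from each height to the next; \<open>X\<close> itself kills the ends
  of the chains.\<close>

definition unshift :: "(nat \<Rightarrow> 'a) \<Rightarrow> nat \<Rightarrow> 'a" where
  "unshift g = (\<lambda>q. if Suc q < n \<and> 0 < lev (Suc q) then g (Suc q) else 0)"

lemma X_unshift: assumes "g \<in> M (Suc h)" shows "X (unshift g) = g"
proof
  fix q
  show "X (unshift g) q = g q"
  proof (cases "q < n \<and> 0 < lev q")
    case True then show ?thesis using levD[of q] by (auto simp: shift_apply unshift_def)
  next
    case False
    then have "q \<notin> tail_set n lev (Suc h)" by (auto simp: tail_set_def)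
    then show ?thesis using False vecsD(2)[OF assms] by (auto simp: shift_apply)
  qed
qed

lemma unshift_M: assumes g: "g \<in> M (Suc h)" shows "unshift g \<in> M h"
proof (rule vecsI)
  fix q assume "q \<notin> tail_set n lev h"
  then have "Suc q < n \<Longrightarrow> 0 < lev (Suc q) \<Longrightarrow> Suc q \<notin> tail_set n lev (Suc h)"
    using levD[of "Suc q"] by (auto simp: tail_set_def)
  then show "unshift g q = 0" using vecsD(2)[OF g] by (auto simp: unshift_def)
qed (auto simp: unshift_def vecsD[OF g] R0)

lemma unshift_U: assumes g: "g \<in> U (Suc h)" shows "unshift g \<in> U h"
proof (rule vecsI)
  fix q assume "q \<notin> I h"
  then have "Suc q < n \<Longrightarrow> 0 < lev (Suc q) \<Longrightarrow> Suc q \<notin> I (Suc h)"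
    using levD[of "Suc q"] by (auto simp: level_set_def)
  then show "unshift g q = 0" using vecsD(2)[OF g] by (auto simp: unshift_def)
qed (auto simp: unshift_def vecsD[OF g] R0)

abbreviation "pr h \<equiv> restr (level_set n lev h)"

lemma pr_M: "f \<in> M h \<Longrightarrow> pr h f \<in> U h"
  by (rule vecsI) (auto simp: vecsD)

lemma pr_U: "f \<in> U h \<Longrightarrow> pr h f = f"
  using vecsD(2)[of f "I h"] by (auto simp: fun_eq_iff)

lemma pr_eq_0: "f \<in> M h \<Longrightarrow> pr h f = 0 \<longleftrightarrow> f \<in> M (Suc h)"
proof
  assume f: "f \<in> M h" and z: "pr h f = 0"
  show "f \<in> M (Suc h)"
  proof (rule vecsI)
    fix q assume "q \<notin> tail_set n lev (Suc h)"
    then have "q \<notin> tail_set n lev h \<or> q \<in> I h" by (auto simp: tail_set_def level_set_def)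
    then show "f q = 0" using vecsD(2)[OF f] fun_cong[OF z, of q] by auto
  qed (rule vecsD(1)[OF f])
next
  assume "f \<in> M h" "f \<in> M (Suc h)"
  then have "f q = 0" if "q \<in> I h" for q
    using that vecsD(2)[of f "tail_set n lev (Suc h)" q] by (auto simp: level_set_def tail_set_def)
  then show "pr h f = 0" by (auto simp: fun_eq_iff)
qed

lemma pr_X: "pr (Suc h) (X f) = X (pr h f)"
proof
  fix q
  show "pr (Suc h) (X f) q = X (pr h f) q"
    using levD[of q] by (auto simp: shift_apply level_set_def)
qed

text \<open>By \<open>idx_split\<close> the index of \<open>N\<close> is this number times the index
  of the intersection with the next step of the filtration. Apart from the index, the recursion
  retains nothing else about \<open>N\<close>.\<close>

definition b :: "nat \<Rightarrow> (nat \<Rightarrow> 'a) set \<Rightarrow> nat" where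
  "b h N = idx (U h) (pr h ` N)"

definition Inv :: "nat \<Rightarrow> (nat \<Rightarrow> 'a) set set" where
  "Inv h = {N. submod R N \<and> N \<subseteq> M h \<and> X ` N \<subseteq> N \<and> 0 < idx (M h) N}"

lemma submod_pr: assumes N: "submod R N" shows "submod R (pr h ` N)"
  unfolding submod_def subgrp_def
proof (intro conjI ballI)
  show "0 \<in> pr h ` N" by (rule image_eqI[OF _ subgrp_zero[OF submod_subgrp[OF N]]]) (auto simp: fun_eq_iff)
  fix x y assume "x \<in> pr h ` N" "y \<in> pr h ` N"
  then obtain f g where "f \<in> N" "g \<in> N" "x = pr h f" "y = pr h g" by blast
  then show "x - y \<in> pr h ` N"
    by (intro image_eqI[of _ _ "f - g"] subgrp_diff[OF submod_subgrp[OF N]]) (auto simp: restr_diff)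
next
  fix r x assume r: "r \<in> R" and "x \<in> pr h ` N"
  then obtain f where "f \<in> N" "x = pr h f" by blast
  then show "smul r x \<in> pr h ` N"
    by (intro image_eqI[of _ _ "smul r f"] submod_smul[OF N r]) (auto simp: restr_smul)
qed

lemma pr_N_U: "N \<subseteq> M h \<Longrightarrow> pr h ` N \<subseteq> U h"
  using pr_M by blast

text \<open>\<open>K\<close> is the sum of \<open>N\<close> and \<open>M (Suc h)\<close>. The
  isomorphism theorems identify \<open>M h\<close> modulo \<open>K\<close> with \<open>U h\<close>
  modulo the projection of \<open>N\<close>, and \<open>K\<close> modulo \<open>N\<close> with
  \<open>M (Suc h)\<close> modulo the intersection.\<close>

lemma idx_split_aux:
  assumes N: "submod R N" "N \<subseteq> M h"
  defines "K \<equiv> {f \<in> M h. pr h f \<in> pr h ` N}"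
  shows "subgrp K" "N \<subseteq> K" "idx (M h) K = b h N" "idx K N = idx (M (Suc h)) (N \<inter> M (Suc h))"
    "idx (M h) N = b h N * idx K N"
proof -
  note sN = submod_subgrp[OF N(1)]
  have sP: "subgrp (pr h ` N)" by (rule submod_subgrp[OF submod_pr[OF N(1)]])
  have pr0: "pr h 0 = 0" by (auto simp: fun_eq_iff)
  show sK: "subgrp K" unfolding subgrp_def
  proof (intro conjI ballI)
    show "0 \<in> K" using subgrp_zero[OF subgrp_V] subgrp_zero[OF sP] by (simp add: K_def pr0)
    fix x y assume "x \<in> K" "y \<in> K"
    then show "x - y \<in> K"
      using subgrp_diff[OF subgrp_V] subgrp_diff[OF sP] by (simp add: K_def restr_diff)
  qed
  show NK: "N \<subseteq> K" using N by (auto simp: K_def)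
  show K: "idx (M h) K = b h N" unfolding b_def
  proof (rule idx_hom[OF sK sP, symmetric])
    fix f g assume fg: "f \<in> M h" "g \<in> M h"
    show "pr h f - pr h g \<in> pr h ` N \<longleftrightarrow> f - g \<in> K"
      unfolding restr_diff[symmetric] K_def using subgrp_diff[OF subgrp_V fg] by simp
    show "pr h f \<in> U h" by (rule pr_M[OF fg(1)])
  next
    fix y assume y: "y \<in> U h"
    then have "y - pr h y = 0" by (simp add: pr_U)
    then show "\<exists>a\<in>M h. y - pr h a \<in> pr h ` N" using y U_M subgrp_zero[OF sP] by (metis subsetD)
  qed
  show "idx K N = idx (M (Suc h)) (N \<inter> M (Suc h))"
  proof (rule idx_hom)
    show "subgrp (N \<inter> M (Suc h))" by (rule subgrp_Int[OF sN subgrp_V])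
    show "subgrp N" by (rule sN)
    fix f g assume "f \<in> M (Suc h)" "g \<in> M (Suc h)"
    then show "f - g \<in> N \<longleftrightarrow> f - g \<in> N \<inter> M (Suc h)" using subgrp_diff[OF subgrp_V] by auto
  next
    fix f assume f: "f \<in> M (Suc h)"
    then have "f \<in> M h" using M_Suc by blast
    moreover from this f have "pr h f = 0" by (simp add: pr_eq_0)
    ultimately show "f \<in> K" using subgrp_zero[OF sP] by (simp add: K_def)
  next
    fix y assume "y \<in> K"
    then obtain g where y: "y \<in> M h" and g: "g \<in> N" "pr h y = pr h g" by (auto simp: K_def)
    have "y - g \<in> M h" using y g N subgrp_diff[OF subgrp_V] by blast
    moreover have "pr h (y - g) = 0" using g by (simp add: restr_diff)
    ultimately have "y - g \<in> M (Suc h)" by (simp add: pr_eq_0)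
    then show "\<exists>a\<in>M (Suc h). y - a \<in> N" using g(1) by (intro bexI[of _ "y - g"]) simp_all
  qed
  have "K \<subseteq> M h" by (auto simp: K_def)
  then show "idx (M h) N = b h N * idx K N" using idx_mult[OF subgrp_V sK sN NK] K by simp
qed

lemma idx_split:
  assumes "submod R N" "N \<subseteq> M h"
  shows "idx (M h) N = b h N * idx (M (Suc h)) (N \<inter> M (Suc h))"
  using idx_split_aux(4,5)[OF assms] by simp

lemma InvD:
  assumes "N \<in> Inv h"
  shows "submod R N" "N \<subseteq> M h" "X ` N \<subseteq> N" "0 < idx (M h) N"
  using assms by (auto simp: Inv_def)

lemma Inv_Int: assumes N: "N \<in> Inv h" shows "N \<inter> M (Suc h) \<in> Inv (Suc h)"
proof -
  have "0 < idx (M (Suc h)) (N \<inter> M (Suc h))" using idx_split[OF InvD(1,2)[OF N]] InvD(4)[OF N] by simp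
  moreover have "X ` (N \<inter> M (Suc h)) \<subseteq> N \<inter> M (Suc h)"
    using InvD(3)[OF N] X_M[of _ "Suc h"] M_Suc[of "Suc h"] by blast
  ultimately show ?thesis using submod_Int[OF InvD(1)[OF N] submod_V] by (auto simp: Inv_def)
qed

lemma b_pos: "N \<in> Inv h \<Longrightarrow> 0 < b h N"
  using idx_split[OF InvD(1,2)] InvD(4) by fastforce

lemma b_le: "N \<in> Inv h \<Longrightarrow> b h N \<le> idx (M h) N"
  using idx_split[OF InvD(1,2)] InvD(4) by fastforce

text \<open>If \<open>N\<close> is invariant and meets \<open>M (Suc h)\<close> in
  \<open>N'\<close>, then shifts of elements of \<open>N\<close> lie in \<open>N'\<close>; at height
  \<open>h\<close> this confines the projection of \<open>N\<close> to \<open>allowed h N'\<close>.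
  Its index equals that of the projection of \<open>N'\<close>, because \<open>X\<close> maps
  \<open>U h\<close> onto \<open>U (Suc h)\<close>.\<close>

definition allowed :: "nat \<Rightarrow> (nat \<Rightarrow> 'a) set \<Rightarrow> (nat \<Rightarrow> 'a) set" where
  "allowed h N' = {u \<in> U h. X u \<in> pr (Suc h) ` N'}"

lemma allowed:
  assumes N': "N' \<in> Inv (Suc h)"
  shows "submod R (allowed h N')" "allowed h N' \<subseteq> U h" "idx (U h) (allowed h N') = b (Suc h) N'"
proof -
  have P: "submod R (pr (Suc h) ` N')" by (rule submod_pr[OF InvD(1)[OF N']])
  note sP = submod_subgrp[OF P]
  show L: "submod R (allowed h N')" unfolding submod_def subgrp_def allowed_def
  proof (intro conjI ballI CollectI)
    have "X 0 = 0" by (auto simp: shift_apply fun_eq_iff)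
    then show "X 0 \<in> pr (Suc h) ` N'" using subgrp_zero[OF sP] by simp
    show "0 \<in> U h" by (rule subgrp_zero[OF subgrp_V])
    fix x y assume "x \<in> {u \<in> U h. X u \<in> pr (Suc h) ` N'}" "y \<in> {u \<in> U h. X u \<in> pr (Suc h) ` N'}"
    then have xy: "x \<in> U h" "y \<in> U h" "X x \<in> pr (Suc h) ` N'" "X y \<in> pr (Suc h) ` N'" by simp_all
    show "x - y \<in> U h" by (rule subgrp_diff[OF subgrp_V xy(1,2)])
    show "X (x - y) \<in> pr (Suc h) ` N'" unfolding shift_diff by (rule subgrp_diff[OF sP xy(3,4)])
  next
    fix r x assume r: "r \<in> R" and "x \<in> {u \<in> U h. X u \<in> pr (Suc h) ` N'}"
    then have x: "x \<in> U h" "X x \<in> pr (Suc h) ` N'" by simp_all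
    show "smul r x \<in> U h" by (rule submod_smul[OF submod_V r x(1)])
    show "X (smul r x) \<in> pr (Suc h) ` N'" unfolding shift_smul by (rule submod_smul[OF P r x(2)])
  qed
  show "allowed h N' \<subseteq> U h" by (auto simp: allowed_def)
  show "idx (U h) (allowed h N') = b (Suc h) N'" unfolding b_def
  proof (rule idx_hom[OF submod_subgrp[OF L] sP, symmetric])
    fix f g assume fg: "f \<in> U h" "g \<in> U h"
    show "X f - X g \<in> pr (Suc h) ` N' \<longleftrightarrow> f - g \<in> allowed h N'"
      unfolding shift_diff[symmetric] allowed_def using subgrp_diff[OF subgrp_V fg] by simp
    show "X f \<in> U (Suc h)" by (rule X_U[OF fg(1)])
  next
    fix y assume y: "y \<in> U (Suc h)"
    then have "X (unshift y) = y" using X_unshift U_M by blast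
    then have "y - X (unshift y) \<in> pr (Suc h) ` N'" using subgrp_zero[OF sP] by simp
    then show "\<exists>a\<in>U h. y - X a \<in> pr (Suc h) ` N'" using unshift_U[OF y] by blast
  qed
qed

lemma pr_Inv_allowed:
  assumes N: "N \<in> Inv h" shows "pr h ` N \<subseteq> allowed h (N \<inter> M (Suc h))"
proof (rule image_subsetI)
  fix f assume f: "f \<in> N"
  then have fM: "f \<in> M h" using InvD(2)[OF N] by blast
  have "X f \<in> N \<inter> M (Suc h)" using f InvD(3)[OF N] X_M[OF fM] by blast
  then have "X (pr h f) \<in> pr (Suc h) ` (N \<inter> M (Suc h))" unfolding pr_X[symmetric] by (rule imageI)
  then show "pr h f \<in> allowed h (N \<inter> M (Suc h))" using pr_M[OF fM] by (simp add: allowed_def)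
qed

text \<open>The kernel and the cokernel of \<open>X\<close> on \<open>M (Suc h) / N'\<close> have the same size.\<close>

lemma idx_kernel:
  assumes N': "N' \<in> Inv (Suc h)"
  shows "idx {y \<in> M (Suc h). X y \<in> N'} N' = b (Suc h) N'" "subgrp {y \<in> M (Suc h). X y \<in> N'}"
    "N' \<subseteq> {y \<in> M (Suc h). X y \<in> N'}"
proof -
  let ?K = "{y \<in> M (Suc h). X y \<in> N'}"
  note sN = submod_subgrp[OF InvD(1)[OF N']]
  \<comment> \<open>\<open>T\<close> is the sum of \<open>N'\<close> and
    \<open>M (Suc (Suc h))\<close>. The shift identifies \<open>M (Suc h)\<close> modulo
    \<open>?K\<close> with \<open>T\<close> modulo \<open>N'\<close>. The two factorisations of the
    index of \<open>N'\<close>, through \<open>T\<close> and through \<open>?K\<close>, then share a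
    factor that cancels.\<close>
  define T where "T = {f \<in> M (Suc h). pr (Suc h) f \<in> pr (Suc h) ` N'}"
  note T = idx_split_aux[OF InvD(1,2)[OF N'], folded T_def]
  have X0: "X 0 = 0" by (auto simp: shift_apply fun_eq_iff)
  show sK: "subgrp ?K" unfolding subgrp_def
    using subgrp_zero[OF subgrp_V] subgrp_diff[OF subgrp_V] subgrp_zero[OF sN] subgrp_diff[OF sN] X0
    by (auto simp: shift_diff)
  show NK: "N' \<subseteq> ?K" using InvD[OF N'] by blast
  have "idx T N' = idx (M (Suc h)) ?K"
  proof (rule idx_hom[OF sK sN])
    fix f g assume fg: "f \<in> M (Suc h)" "g \<in> M (Suc h)"
    show "X f - X g \<in> N' \<longleftrightarrow> f - g \<in> ?K" unfolding shift_diff[symmetric] using subgrp_diff[OF subgrp_V fg] by simp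
    have Xf: "X f \<in> M (Suc (Suc h))" by (rule X_M[OF fg(1)])
    then have "X f \<in> M (Suc h)" using M_Suc by blast
    moreover from this Xf have "pr (Suc h) (X f) = 0" by (simp add: pr_eq_0)
    moreover have "0 \<in> pr (Suc h) ` N'" by (rule subgrp_zero[OF submod_subgrp[OF submod_pr[OF InvD(1)[OF N']]]])
    ultimately show "X f \<in> T" by (simp add: T_def)
  next
    fix y assume "y \<in> T"
    then obtain g where y: "y \<in> M (Suc h)" and g: "g \<in> N'" "pr (Suc h) y = pr (Suc h) g" by (auto simp: T_def)
    have "y - g \<in> M (Suc h)" using y g InvD(2)[OF N'] subgrp_diff[OF subgrp_V] by blast
    moreover have "pr (Suc h) (y - g) = 0" using g by (simp add: restr_diff)
    ultimately have yg: "y - g \<in> M (Suc (Suc h))" by (simp add: pr_eq_0)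
    have "y - X (unshift (y - g)) = g" unfolding X_unshift[OF yg] by simp
    then show "\<exists>a\<in>M (Suc h). y - X a \<in> N'" using g(1) unshift_M[OF yg] by metis
  qed
  then have "idx (M (Suc h)) N' = b (Suc h) N' * idx (M (Suc h)) ?K" using T(5) by simp
  moreover have "idx (M (Suc h)) N' = idx (M (Suc h)) ?K * idx ?K N'"
    by (rule idx_mult[OF subgrp_V sK sN NK]) blast
  ultimately show "idx ?K N' = b (Suc h) N'" using InvD(4)[OF N'] by simp
qed

end

section \<open>Invariant submodules with prescribed projection and intersection\<close>

lemma restr_lin: "restr T (lin S u c) = lin S (\<lambda>q. restr T (u q)) (c :: nat \<Rightarrow> 'k::field)"
  by (auto simp: fun_eq_iff lin_def sum_fun_apply intro!: sum.neutral)

lemma shift_lin: "shift n lev (lin S u c) = lin S (\<lambda>q. shift n lev (u q)) (c :: nat \<Rightarrow> 'k::field)"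
  unfolding lin_def shift_sum shift_smul ..

lemma lin_cong: "(\<And>q. q \<in> S \<Longrightarrow> u q = v q) \<Longrightarrow> lin S u c = lin S v c"
  by (simp add: lin_def)

context chain begin

text \<open>\<open>L\<close> has a basis \<open>w\<close> with \<open>card (I h)\<close> elements,
  and \<open>N\<close> is determined by a lift \<open>w q + y\<close> of each of them, with
  \<open>y\<close> taken modulo \<open>N'\<close>. Invariance asks that \<open>X (w q + y)\<close>
  lie in \<open>N'\<close>, and the admissible cosets form a translate of the kernel in
  \<open>idx_kernel\<close>, which has \<open>b (Suc h) N'\<close> elements.\<close>

lemma fibre_card:
  assumes N': "N' \<in> Inv (Suc h)" and L: "submod R L" "L \<subseteq> allowed h N'" "0 < idx (U h) L"
  shows "card {N \<in> Inv h. N \<inter> M (Suc h) = N' \<and> pr h ` N = L} = b (Suc h) N' ^ card (I h)"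
proof -
  let ?Q = "M (Suc h)" let ?F = "{N \<in> Inv h. N \<inter> M (Suc h) = N' \<and> pr h ` N = L}"
  note mN' = InvD(1)[OF N']
  note sN' = submod_subgrp[OF mN'] and N'Q = InvD(2)[OF N'] and sL = submod_subgrp[OF L(1)]
  have LU: "L \<subseteq> U h" using L(2) allowed(2)[OF N'] by blast
  have fI: "finite (I h)" by (rule finite_level_set)
  have "smul (of_nat (idx (U h) L)) ` U h \<subseteq> L"
    by (rule image_subsetI) (rule submod_idx_mem[OF subgrp_V sL LU L(3)])
  from basis_exists[OF fI L(1) LU L(3) this] obtain w where
    w: "\<And>q. q \<in> I h \<Longrightarrow> w q \<in> L" and bij_w: "bij_betw (lin (I h) w) (U h) L" by blast
  have w_M: "w q \<in> M h" if "q \<in> I h" for q using w[OF that] LU U_M by blast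
  have pr_w: "pr h (w q) = w q" if "q \<in> I h" for q using w[OF that] LU by (intro pr_U) blast
  define Y where "Y q = (\<lambda>y. (+) y ` N') ` {y \<in> ?Q. X (w q + y) \<in> N'}" for q
  define \<Phi> where "\<Phi> N = (\<lambda>q\<in>I h. {y \<in> ?Q. w q + y \<in> N})" for N
  have cardY: "card (Y q) = b (Suc h) N'" if q: "q \<in> I h" for q
  proof -
    have "X (w q) \<in> pr (Suc h) ` N'" using w[OF q] L(2) by (auto simp: allowed_def)
    then obtain n' where n': "n' \<in> N'" "X (w q) = pr (Suc h) n'" by blast
    have n'Q: "n' \<in> ?Q" using n'(1) N'Q by blast
    have "X (w q) \<in> M (Suc h)" by (rule X_M[OF w_M[OF q]])
    then have "n' - X (w q) \<in> ?Q" by (rule subgrp_diff[OF subgrp_V n'Q])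
    moreover have "pr (Suc h) (n' - X (w q)) = 0"
      unfolding restr_diff n'(2) using pr_U[OF pr_M[OF n'Q]] by simp
    ultimately have z: "n' - X (w q) \<in> M (Suc (Suc h))" by (simp add: pr_eq_0)
    \<comment> \<open>A particular solution. Since \<open>w q\<close> lies in
      \<open>allowed h N'\<close>, the defect \<open>n' - X (w q)\<close> has zero projection at
      height \<open>h + 1\<close>, so it lives at heights from \<open>h + 2\<close> on and is itself
      a shift of an element of \<open>?Q\<close>.\<close>
    define y0 where "y0 = unshift (n' - X (w q))"
    have y0: "y0 \<in> ?Q" unfolding y0_def by (rule unshift_M[OF z])
    have Xy0: "X y0 = n' - X (w q)" unfolding y0_def by (rule X_unshift[OF z])
    let ?K = "{y \<in> ?Q. X y \<in> N'}"
    have tr: "{y \<in> ?Q. X (w q + y) \<in> N'} = (+) y0 ` ?K"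
    proof
      show "(+) y0 ` ?K \<subseteq> {y \<in> ?Q. X (w q + y) \<in> N'}"
      proof (rule image_subsetI)
        fix y assume y: "y \<in> ?K"
        have "X (w q + (y0 + y)) = n' + X y" unfolding shift_add Xy0 by simp
        then show "y0 + y \<in> {y \<in> ?Q. X (w q + y) \<in> N'}"
          using y y0 n'(1) subgrp_add[OF subgrp_V] subgrp_add[OF sN'] by simp
      qed
      show "{y \<in> ?Q. X (w q + y) \<in> N'} \<subseteq> (+) y0 ` ?K"
      proof
        fix y assume y: "y \<in> {y \<in> ?Q. X (w q + y) \<in> N'}"
        have "X (y - y0) = X (w q + y) - n'" unfolding shift_diff shift_add Xy0 by simp
        then have "y - y0 \<in> ?K" using y y0 n'(1) subgrp_diff[OF subgrp_V] subgrp_diff[OF sN'] by simp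
        then show "y \<in> (+) y0 ` ?K" by (rule image_eqI[rotated]) simp
      qed
    qed
    have "card (Y q) = card ((\<lambda>y. (+) (y0 + y) ` N') ` ?K)"
      unfolding Y_def tr image_image ..
    also have "\<dots> = idx ?K N'"
      by (rule idx_eq_card_image[OF sN', symmetric]) (simp only: coset_eq_iff[OF sN'], simp)
    finally show ?thesis using idx_kernel(1)[OF N'] by simp
  qed
  have \<Phi>_coset: "{y \<in> ?Q. w q + y \<in> N} = (+) y ` N'"
    if N: "N \<inter> ?Q = N'" "subgrp N" and y: "y \<in> ?Q" "w q + y \<in> N" for N q y
  proof
    show "{y \<in> ?Q. w q + y \<in> N} \<subseteq> (+) y ` N'"
    proof
      fix z assume z: "z \<in> {y \<in> ?Q. w q + y \<in> N}"
      have "z - y = (w q + z) - (w q + y)" by simp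
      then have "z - y \<in> N" using z y subgrp_diff[OF N(2)] by (metis (lifting) mem_Collect_eq)
      moreover have "z - y \<in> ?Q" using z y subgrp_diff[OF subgrp_V] by simp
      ultimately have "z - y \<in> N'" using N(1) by blast
      then show "z \<in> (+) y ` N'" by (rule image_eqI[rotated]) simp
    qed
    show "(+) y ` N' \<subseteq> {y \<in> ?Q. w q + y \<in> N}"
    proof (rule image_subsetI)
      fix z assume "z \<in> N'"
      then have "z \<in> N" "z \<in> ?Q" using N(1) by auto
      then have "y + z \<in> ?Q" "(w q + y) + z \<in> N" using y subgrp_add[OF subgrp_V] subgrp_add[OF N(2)] by blast+
      then show "y + z \<in> {y \<in> ?Q. w q + y \<in> N}" by (simp add: add.assoc)
    qed
  qed
  have lift: "\<exists>y. y \<in> ?Q \<and> w q + y \<in> N" if N: "N \<in> ?F" and q: "q \<in> I h" for N q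
  proof -
    have NI: "N \<in> Inv h" and NL: "pr h ` N = L" using N by auto
    have "w q \<in> pr h ` N" unfolding NL by (rule w[OF q])
    then obtain f where f: "f \<in> N" "pr h f = w q" by auto
    have "f - w q \<in> M h" by (rule subgrp_diff[OF subgrp_V subsetD[OF InvD(2)[OF NI] f(1)] w_M[OF q]])
    moreover have "pr h (f - w q) = 0" unfolding restr_diff f(2) pr_w[OF q] by simp
    ultimately have "f - w q \<in> ?Q" by (simp add: pr_eq_0)
    then show ?thesis using f(1) by (intro exI[of _ "f - w q"]) simp
  qed
  have "bij_betw \<Phi> ?F (Pi\<^sub>E (I h) Y)"
  proof (rule bij_betw_imageI)
    show "inj_on \<Phi> ?F"
    proof -
      have sub: "N1 \<subseteq> N2" if N: "N1 \<in> ?F" "N2 \<in> ?F" "\<Phi> N1 = \<Phi> N2" for N1 N2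
      proof
        fix f assume f: "f \<in> N1"
        have NI: "N1 \<in> Inv h" "N2 \<in> Inv h" and N1Q: "N1 \<inter> ?Q = N'" and N2Q: "N2 \<inter> ?Q = N'" and L1: "pr h ` N1 = L"
          using N by auto
        have "pr h f \<in> L" using f L1 by blast
        then obtain c where c: "c \<in> U h" "pr h f = lin (I h) w c" using bij_w by (auto simp: bij_betw_def)
        have "\<exists>y. y \<in> ?Q \<and> w q + y \<in> N1 \<and> w q + y \<in> N2" if q: "q \<in> I h" for q
        proof -
          obtain y where y: "y \<in> ?Q" "w q + y \<in> N1" using lift[OF N(1) q] by blast
          have "{y \<in> ?Q. w q + y \<in> N1} = {y \<in> ?Q. w q + y \<in> N2}"
            using fun_cong[OF N(3), of q] q by (simp add: \<Phi>_def)
          then show ?thesis using y by blast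
        qed
        then obtain y where y: "\<And>q. q \<in> I h \<Longrightarrow> y q \<in> ?Q \<and> w q + y q \<in> N1 \<and> w q + y q \<in> N2" by metis
        define g where "g = lin (I h) (\<lambda>q. w q + y q) c"
        have g1: "g \<in> N1"
          unfolding g_def by (rule lin_mem[OF InvD(1)[OF NI(1)]]) (use y vecsD(1)[OF c(1)] in blast)+
        have g2: "g \<in> N2"
          unfolding g_def by (rule lin_mem[OF InvD(1)[OF NI(2)]]) (use y vecsD(1)[OF c(1)] in blast)+
        have pr_y: "pr h (w q + y q) = w q" if q: "q \<in> I h" for q
        proof -
          have "y q \<in> M h" using y[OF q] M_Suc by blast
          then have "pr h (y q) = 0" using y[OF q] by (simp add: pr_eq_0)
          then show ?thesis unfolding restr_add pr_w[OF q] by simp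
        qed
        have "pr h g = lin (I h) w c" unfolding g_def restr_lin by (rule lin_cong) (rule pr_y)
        then have "pr h (f - g) = 0" unfolding restr_diff c(2) by simp
        moreover have fg: "f - g \<in> N1" by (rule subgrp_diff[OF submod_subgrp[OF InvD(1)[OF NI(1)]] f g1])
        ultimately have "f - g \<in> ?Q" using pr_eq_0[of "f - g" h] InvD(2)[OF NI(1)] by blast
        then have fgN: "f - g \<in> N2" using fg N1Q N2Q by blast
        show "f \<in> N2" using subgrp_add[OF submod_subgrp[OF InvD(1)[OF NI(2)]] fgN g2] by simp
      qed
      show ?thesis
      proof (rule inj_onI, rule equalityI)
        fix N1 N2 assume *: "N1 \<in> ?F" "N2 \<in> ?F" "\<Phi> N1 = \<Phi> N2"
        show "N1 \<subseteq> N2" by (rule sub[OF *])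
        show "N2 \<subseteq> N1" by (rule sub[OF *(2,1) *(3)[symmetric]])
      qed
    qed
    show "\<Phi> ` ?F = Pi\<^sub>E (I h) Y"
    proof
      show "\<Phi> ` ?F \<subseteq> Pi\<^sub>E (I h) Y"
      proof (rule image_subsetI)
        fix N assume N: "N \<in> ?F"
        then have NI: "N \<in> Inv h" and NQ: "N \<inter> ?Q = N'" by auto
        have "{y \<in> ?Q. w q + y \<in> N} \<in> Y q" if q: "q \<in> I h" for q
        proof -
          obtain y where y: "y \<in> ?Q" "w q + y \<in> N" using lift[OF N q] by blast
          have "w q + y \<in> M h" using y InvD(2)[OF NI] by blast
          then have "X (w q + y) \<in> N'" using X_M InvD(3)[OF NI] y(2) NQ by blast
          then have "(+) y ` N' \<in> Y q" using y(1) unfolding Y_def by blast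
          then show ?thesis using \<Phi>_coset[OF NQ submod_subgrp[OF InvD(1)[OF NI]] y] by simp
        qed
        then show "\<Phi> N \<in> Pi\<^sub>E (I h) Y" unfolding \<Phi>_def by (simp add: restrict_PiE_iff)
      qed
      show "Pi\<^sub>E (I h) Y \<subseteq> \<Phi> ` ?F"
      proof
        fix C assume C: "C \<in> Pi\<^sub>E (I h) Y"
        have "\<exists>y. y \<in> ?Q \<and> X (w q + y) \<in> N' \<and> C q = (+) y ` N'" if q: "q \<in> I h" for q
          using PiE_mem[OF C q] unfolding Y_def by blast
        then obtain y where y: "\<And>q. q \<in> I h \<Longrightarrow> y q \<in> ?Q \<and> X (w q + y q) \<in> N' \<and> C q = (+) (y q) ` N'" by metis
        define u where "u q = w q + y q" for q
        have uM: "u q \<in> M h" if q: "q \<in> I h" for q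
          unfolding u_def using w_M[OF q] y[OF q] M_Suc by (intro subgrp_add[OF subgrp_V]) auto
        have pr_u: "pr h (u q) = w q" if q: "q \<in> I h" for q
        proof -
          have "y q \<in> M h" using y[OF q] M_Suc by blast
          then have "pr h (y q) = 0" using y[OF q] by (simp add: pr_eq_0)
          then show ?thesis unfolding u_def restr_add pr_w[OF q] by simp
        qed
        have pr_lin_u: "pr h (lin (I h) u c) = lin (I h) w c" for c
          unfolding restr_lin by (rule lin_cong) (rule pr_u)
        \<comment> \<open>The module generated by the chosen lifts \<open>u q\<close> together with
          \<open>N'\<close>. It meets \<open>?Q\<close> in \<open>N'\<close> only, since a
          combination of the lifts with zero projection has zero coefficients with respect to the
          basis \<open>w\<close>.\<close>
        define N where "N = {f. \<exists>c\<in>U h. f - lin (I h) u c \<in> N'}"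
        have NM: "N \<subseteq> M h"
        proof
          fix f assume "f \<in> N"
          then obtain c where c: "c \<in> U h" "f - lin (I h) u c \<in> N'" by (auto simp: N_def)
          have "lin (I h) u c \<in> M h" by (rule lin_mem[OF submod_V]) (use uM vecsD(1)[OF c(1)] in blast)+
          moreover have "f - lin (I h) u c \<in> M h" using c(2) N'Q M_Suc by blast
          ultimately show "f \<in> M h" using subgrp_add[OF subgrp_V] by fastforce
        qed
        have mN: "submod R N" unfolding submod_def subgrp_def
        proof (intro conjI ballI)
          have "0 - lin (I h) u 0 = 0" by (simp add: lin_def smul_zero_left)
          then show "0 \<in> N" using subgrp_zero[OF sN'] subgrp_zero[OF subgrp_V] unfolding N_def by (intro CollectI bexI[of _ 0]) simp_all
          fix f g assume "f \<in> N" "g \<in> N"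
          then obtain c e where c: "c \<in> U h" "f - lin (I h) u c \<in> N'" and e: "e \<in> U h" "g - lin (I h) u e \<in> N'"
            by (auto simp: N_def)
          have eq: "(f - g) - lin (I h) u (c - e) = (f - lin (I h) u c) - (g - lin (I h) u e)" by (simp add: lin_diff)
          have "(f - g) - lin (I h) u (c - e) \<in> N'" unfolding eq by (rule subgrp_diff[OF sN' c(2) e(2)])
          then show "f - g \<in> N" using subgrp_diff[OF subgrp_V c(1) e(1)] unfolding N_def by blast
        next
          fix r f assume r: "r \<in> R" and "f \<in> N"
          then obtain c where c: "c \<in> U h" "f - lin (I h) u c \<in> N'" by (auto simp: N_def)
          have eq: "smul r f - lin (I h) u (smul r c) = smul r (f - lin (I h) u c)" by (simp add: lin_smul smul_diff)
          have "smul r f - lin (I h) u (smul r c) \<in> N'" unfolding eq by (rule submod_smul[OF mN' r c(2)])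
          then show "smul r f \<in> N" using submod_smul[OF submod_V r c(1)] unfolding N_def by blast
        qed
        note sN = submod_subgrp[OF mN]
        have N'N: "N' \<subseteq> N"
        proof
          fix f assume "f \<in> N'"
          moreover have "f - lin (I h) u 0 = f" by (simp add: lin_def smul_zero_left)
          ultimately show "f \<in> N" using subgrp_zero[OF subgrp_V] unfolding N_def by (intro CollectI bexI[of _ 0]) simp_all
        qed
        have linN: "lin (I h) u c \<in> N" if "c \<in> U h" for c
          unfolding N_def using that subgrp_zero[OF sN'] by (intro CollectI bexI[of _ c]) simp_all
        have XN: "X f \<in> N'" if f: "f \<in> N" for f
        proof -
          obtain c where c: "c \<in> U h" "f - lin (I h) u c \<in> N'" using f by (auto simp: N_def)
          have "X (lin (I h) u c) \<in> N'" unfolding shift_lin u_def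
            by (rule lin_mem[OF mN']) (use y vecsD(1)[OF c(1)] in blast)+
          moreover have "X (f - lin (I h) u c) \<in> N'" using c(2) InvD(3)[OF N'] by blast
          ultimately show ?thesis using subgrp_add[OF sN'] unfolding shift_diff by fastforce
        qed
        have prN: "pr h ` N = L"
        proof
          show "pr h ` N \<subseteq> L"
          proof (rule image_subsetI)
            fix f assume "f \<in> N"
            then obtain c where c: "c \<in> U h" "f - lin (I h) u c \<in> N'" by (auto simp: N_def)
            have "f - lin (I h) u c \<in> M h" using c(2) N'Q M_Suc by blast
            then have "pr h (f - lin (I h) u c) = 0" using c(2) N'Q by (subst pr_eq_0) auto
            then have "pr h f = lin (I h) w c" unfolding restr_diff pr_lin_u by simp
            then show "pr h f \<in> L" using bij_w c(1) by (auto simp: bij_betw_def)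
          qed
          show "L \<subseteq> pr h ` N"
          proof
            fix l assume "l \<in> L"
            then obtain c where "c \<in> U h" "l = lin (I h) w c" using bij_w by (auto simp: bij_betw_def)
            then show "l \<in> pr h ` N" using linN pr_lin_u by (metis imageI)
          qed
        qed
        have NQ: "N \<inter> ?Q = N'"
        proof
          show "N' \<subseteq> N \<inter> ?Q" using N'N N'Q by blast
          show "N \<inter> ?Q \<subseteq> N'"
          proof
            fix f assume f: "f \<in> N \<inter> ?Q"
            then obtain c where c: "c \<in> U h" "f - lin (I h) u c \<in> N'" by (auto simp: N_def)
            have "f - lin (I h) u c \<in> M h" using c(2) N'Q M_Suc by blast
            then have z1: "pr h (f - lin (I h) u c) = 0" using c(2) N'Q by (subst pr_eq_0) auto
            have "f \<in> M h" using f M_Suc by blast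
            then have z2: "pr h f = 0" using f by (subst pr_eq_0) auto
            have "lin (I h) w c = 0" using z1 unfolding restr_diff pr_lin_u z2 by simp
            also have "0 = lin (I h) w 0" by (simp add: lin_def smul_zero_left)
            finally have "c = 0" using bij_w c(1) subgrp_zero[OF subgrp_V] by (auto simp: bij_betw_def dest: inj_onD)
            then have "lin (I h) u c = 0" by (simp add: lin_def smul_zero_left)
            then show "f \<in> N'" using c(2) by simp
          qed
        qed
        have "0 < idx (M h) N" unfolding idx_split[OF mN NM] NQ b_def prN using L(3) InvD(4)[OF N'] by simp
        then have NI: "N \<in> Inv h" unfolding Inv_def using mN NM XN N'N by blast
        have "\<Phi> N = C"
        proof
          fix q
          show "\<Phi> N q = C q"
          proof (cases "q \<in> I h")
            case True
            have "u q \<in> N" using linN[OF delta_mem[OF True]] lin_delta[OF fI True, of u] by simp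
            then show ?thesis using \<Phi>_coset[OF NQ sN, of "y q" q] y[OF True] True by (simp add: \<Phi>_def u_def)
          qed (use C in \<open>auto simp: \<Phi>_def\<close>)
        qed
        then show "C \<in> \<Phi> ` ?F" using NI NQ prN by (intro image_eqI[of _ _ N]) auto
      qed
    qed
  qed
  then have "card ?F = card (Pi\<^sub>E (I h) Y)" by (rule bij_betw_same_card)
  also have "\<dots> = b (Suc h) N' ^ card (I h)" by (simp add: card_PiE fI cardY)
  finally show ?thesis .
qed

end

section \<open>Recursion for the weighted counts\<close>

context chain begin

text \<open>The coefficient at \<open>m\<close> of the Dirichlet series with terms \<open>idx (M h) N powr (- s) * b h N powr (w - e * s)\<close>.\<close>

definition G :: "nat \<Rightarrow> nat \<Rightarrow> nat \<Rightarrow> nat \<Rightarrow> nat" where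
  "G h e w m = (\<Sum>N\<in>{N \<in> Inv h. idx (M h) N * b h N ^ e = m}. b h N ^ w)"

lemma finite_Inv: "finite {N \<in> Inv h. idx (M h) N \<le> m}"
proof (rule finite_subset)
  show "{N \<in> Inv h. idx (M h) N \<le> m} \<subseteq> (\<Union>k\<in>{1..m}. {N. submod R N \<and> N \<subseteq> M h \<and> idx (M h) N = k})"
    by (auto simp: Inv_def)
  show "finite (\<Union>k\<in>{1..m}. {N. submod R N \<and> N \<subseteq> M h \<and> idx (M h) N = k})"
    by (intro finite_UN_I finite_submods finite_tail_set) auto
qed

lemma finite_weighted:
  assumes "m > 0" shows "finite {N \<in> Inv h. k * (idx (M h) N * b h N ^ e) = m}"
proof (rule finite_subset[OF _ finite_Inv[of h m]], rule subsetI)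
  fix N assume N: "N \<in> {N \<in> Inv h. k * (idx (M h) N * b h N ^ e) = m}"
  then have "m = idx (M h) N * (k * b h N ^ e)" by (simp add: mult_ac)
  then have "idx (M h) N dvd m" by simp
  then show "N \<in> {N \<in> Inv h. idx (M h) N \<le> m}" using N assms by (auto intro: dvd_imp_le)
qed

text \<open>\<open>allowed h N'\<close> is free of rank \<open>card (I h)\<close> and has index
  \<open>b (Suc h) N'\<close> in \<open>U h\<close>. So \<open>nsub (I h) r\<close> of its
  submodules have relative index \<open>r\<close>, and these have index
  \<open>b (Suc h) N' * r\<close> in \<open>U h\<close>. The powers of \<open>b (Suc h) N'\<close>
  go into \<open>t\<close> and into the weight.\<close>

lemma sum_allowed:
  fixes e w :: nat
  assumes N': "N' \<in> Inv (Suc h)" and m: "m > 0"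
  defines "t \<equiv> idx (M (Suc h)) N' * b (Suc h) N' ^ Suc e"
  defines "B \<equiv> {L. submod R L \<and> L \<subseteq> allowed h N' \<and> 0 < idx (U h) L \<and> idx (U h) L ^ Suc e * idx (M (Suc h)) N' = m}"
  shows "finite B"
    and "(\<Sum>L\<in>B. idx (U h) L ^ w) =
      (\<Sum>r\<in>{1..m}. if r ^ Suc e * t = m then nsub (I h) r * r ^ w * b (Suc h) N' ^ w else 0)"
proof -
  note al = allowed[OF N']
  have idx_L: "idx (U h) L = b (Suc h) N' * idx (allowed h N') L" if "submod R L" "L \<subseteq> allowed h N'" for L
    using idx_mult[OF subgrp_V submod_subgrp[OF al(1)] submod_subgrp[OF that(1)] that(2) al(2)] al(3) by simp
  have le: "idx (U h) L \<le> m" if "L \<in> B" for L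
  proof (rule dvd_imp_le[OF _ m])
    have "idx (U h) L ^ Suc e * idx (M (Suc h)) N' = m" using that by (simp add: B_def)
    then show "idx (U h) L dvd m" by auto
  qed
  show fin: "finite B"
  proof (rule finite_subset)
    show "B \<subseteq> (\<Union>k\<in>{1..m}. {L. submod R L \<and> L \<subseteq> U h \<and> idx (U h) L = k})"
    proof
      fix L assume L: "L \<in> B"
      then show "L \<in> (\<Union>k\<in>{1..m}. {L. submod R L \<and> L \<subseteq> U h \<and> idx (U h) L = k})"
        using le[OF L] al(2) by (intro UN_I[of "idx (U h) L"]) (auto simp: B_def)
    qed
    show "finite (\<Union>k\<in>{1..m}. {L. submod R L \<and> L \<subseteq> U h \<and> idx (U h) L = k})"
      by (intro finite_UN_I finite_submods finite_level_set) auto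
  qed
  have "(\<Sum>L\<in>B. idx (U h) L ^ w) =
      (\<Sum>r\<in>{1..m}. \<Sum>L\<in>{L \<in> B. idx (allowed h N') L = r}. idx (U h) L ^ w)"
  proof (rule sum.group[OF fin, symmetric])
    show "(\<lambda>L. idx (allowed h N') L) ` B \<subseteq> {1..m}"
    proof (rule image_subsetI)
      fix L assume L: "L \<in> B"
      then have "0 < b (Suc h) N' * idx (allowed h N') L" "b (Suc h) N' * idx (allowed h N') L \<le> m"
        using idx_L le[OF L] unfolding B_def by auto
      then show "idx (allowed h N') L \<in> {1..m}"
        by (metis One_nat_def Suc_leI atLeastAtMost_iff dvd_imp_le dvd_triv_right nat_0_less_mult_iff order_trans)
    qed
  qed simp
  also have "\<dots> = (\<Sum>r\<in>{1..m}. if r ^ Suc e * t = m then nsub (I h) r * r ^ w * b (Suc h) N' ^ w else 0)"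
  proof (rule sum.cong[OF refl])
    fix r assume r: "r \<in> {1..m}"
    have val: "idx (U h) L = b (Suc h) N' * r" if "L \<in> B" "idx (allowed h N') L = r" for L
      using idx_L that unfolding B_def by auto
    have weight: "(b (Suc h) N' * r) ^ Suc e * idx (M (Suc h)) N' = r ^ Suc e * t"
      unfolding t_def power_mult_distrib by (simp add: mult_ac)
    have "{L \<in> B. idx (allowed h N') L = r} =
        (if r ^ Suc e * t = m then {L. submod R L \<and> L \<subseteq> allowed h N' \<and> idx (allowed h N') L = r} else {})"
    proof (cases "r ^ Suc e * t = m")
      case True
      have "L \<in> B" if L: "submod R L" "L \<subseteq> allowed h N'" "idx (allowed h N') L = r" for L
        using L r b_pos[OF N'] idx_L[OF L(1,2)] weight True unfolding B_def by auto
      then show ?thesis unfolding B_def using True by auto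
    next
      case False
      have "L \<notin> B" if "idx (allowed h N') L = r" for L
      proof
        assume L: "L \<in> B"
        have "idx (U h) L ^ Suc e * idx (M (Suc h)) N' = m" using L by (simp add: B_def)
        then show False using weight False unfolding val[OF L that] by simp
      qed
      then show ?thesis using False by auto
    qed
    moreover have "(\<Sum>L\<in>{L \<in> B. idx (allowed h N') L = r}. idx (U h) L ^ w) =
        (\<Sum>L\<in>{L \<in> B. idx (allowed h N') L = r}. (b (Suc h) N' * r) ^ w)"
      by (rule sum.cong[OF refl]) (use val in auto)
    moreover have "card {L. submod R L \<and> L \<subseteq> allowed h N' \<and> idx (allowed h N') L = r} = nsub (I h) r"
      by (rule nsub_submodule[OF finite_level_set al(1,2)]) (use al(3) b_pos[OF N'] in simp)
    ultimately show "(\<Sum>L\<in>{L \<in> B. idx (allowed h N') L = r}. idx (U h) L ^ w) =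
        (if r ^ Suc e * t = m then nsub (I h) r * r ^ w * b (Suc h) N' ^ w else 0)"
      by (simp add: power_mult_distrib)
  qed
  finally show "(\<Sum>L\<in>B. idx (U h) L ^ w) =
      (\<Sum>r\<in>{1..m}. if r ^ Suc e * t = m then nsub (I h) r * r ^ w * b (Suc h) N' ^ w else 0)" .
qed

text \<open>The submodules are grouped by their intersection with \<open>M (Suc h)\<close> and their
  projection. The exponent \<open>e\<close> rises by one because the index of \<open>N\<close>
  already contains a factor \<open>b h N\<close>, which equals \<open>r * b (Suc h) N'\<close>. The
  weight \<open>w\<close> rises by \<open>card (I h)\<close> because that many factors
  \<open>b (Suc h) N'\<close> count the submodules over each pair.\<close>

lemma G_rec_aux:
  assumes m: "m > 0"
  shows "G h e w m = (\<Sum>r\<in>{1..m}. nsub (I h) r * r ^ w *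
    (\<Sum>N'\<in>{N' \<in> Inv (Suc h). r ^ Suc e * (idx (M (Suc h)) N' * b (Suc h) N' ^ Suc e) = m}.
      b (Suc h) N' ^ (w + card (I h))))"
proof -
  let ?Q = "M (Suc h)"
  define \<N> where "\<N> = {N \<in> Inv h. idx (M h) N * b h N ^ e = m}"
  define A where "A = {N' \<in> Inv (Suc h). idx ?Q N' \<le> m}"
  define B where "B N' = {L. submod R L \<and> L \<subseteq> allowed h N' \<and> 0 < idx (U h) L \<and> idx (U h) L ^ Suc e * idx ?Q N' = m}" for N'
  define t where "t N' = idx ?Q N' * b (Suc h) N' ^ Suc e" for N'
  define \<psi> where "\<psi> N = (N \<inter> ?Q, pr h ` N)" for N
  have finA: "finite A" unfolding A_def by (rule finite_Inv)
  have finB: "finite (B N')" if "N' \<in> A" for N'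
    unfolding B_def using that by (intro sum_allowed(1) m) (simp add: A_def)
  have finN: "finite \<N>" unfolding \<N>_def using finite_weighted[OF m, of h 1] by simp
  have weight: "idx (M h) N * b h N ^ e = idx (U h) (pr h ` N) ^ Suc e * idx ?Q (N \<inter> ?Q)" if "N \<in> Inv h" for N
    using idx_split[OF InvD(1,2)[OF that]] by (simp add: b_def)
  have \<psi>: "\<psi> ` \<N> \<subseteq> Sigma A B"
  proof (rule image_subsetI)
    fix N assume "N \<in> \<N>"
    then have N: "N \<in> Inv h" "idx (U h) (pr h ` N) ^ Suc e * idx ?Q (N \<inter> ?Q) = m"
      using weight by (auto simp: \<N>_def)
    have "idx ?Q (N \<inter> ?Q) dvd m" using N(2) by (metis dvd_triv_right)
    then have "N \<inter> ?Q \<in> A" using Inv_Int[OF N(1)] dvd_imp_le[OF _ m] by (simp add: A_def)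
    moreover have "pr h ` N \<in> B (N \<inter> ?Q)"
      using N submod_pr[OF InvD(1)[OF N(1)]] pr_Inv_allowed[OF N(1)] b_pos[OF N(1)] by (simp add: B_def b_def)
    ultimately show "\<psi> N \<in> Sigma A B" by (simp add: \<psi>_def)
  qed
  have "G h e w m = (\<Sum>N\<in>\<N>. b h N ^ w)" by (simp add: G_def \<N>_def)
  also have "\<dots> = (\<Sum>p\<in>Sigma A B. \<Sum>N\<in>{N \<in> \<N>. \<psi> N = p}. b h N ^ w)"
    by (rule sum.group[OF finN _ \<psi>, symmetric]) (use finA finB in auto)
  also have "\<dots> = (\<Sum>(N', L)\<in>Sigma A B. b (Suc h) N' ^ card (I h) * idx (U h) L ^ w)"
  proof (rule sum.cong[OF refl], clarify)
    fix N' L assume N': "N' \<in> A" and L: "L \<in> B N'"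
    have NI: "N' \<in> Inv (Suc h)" using N' by (simp add: A_def)
    have Lp: "submod R L" "L \<subseteq> allowed h N'" "0 < idx (U h) L" "idx (U h) L ^ Suc e * idx ?Q N' = m"
      using L by (simp_all add: B_def)
    have eq: "{N \<in> \<N>. \<psi> N = (N', L)} = {N \<in> Inv h. N \<inter> ?Q = N' \<and> pr h ` N = L}"
      unfolding \<N>_def \<psi>_def using weight Lp(4) by auto
    have "(\<Sum>N\<in>{N \<in> \<N>. \<psi> N = (N', L)}. b h N ^ w) = (\<Sum>N\<in>{N \<in> \<N>. \<psi> N = (N', L)}. idx (U h) L ^ w)"
      by (rule sum.cong[OF refl]) (auto simp: b_def \<psi>_def)
    also have "\<dots> = b (Suc h) N' ^ card (I h) * idx (U h) L ^ w"
      unfolding eq by (simp add: fibre_card[OF NI Lp(1-3)])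
    finally show "(\<Sum>N\<in>{N \<in> \<N>. \<psi> N = (N', L)}. b h N ^ w) = b (Suc h) N' ^ card (I h) * idx (U h) L ^ w" .
  qed
  also have "\<dots> = (\<Sum>N'\<in>A. \<Sum>L\<in>B N'. b (Suc h) N' ^ card (I h) * idx (U h) L ^ w)"
    by (rule sum.Sigma[symmetric]) (use finA finB in auto)
  also have "\<dots> = (\<Sum>N'\<in>A. \<Sum>r\<in>{1..m}. if r ^ Suc e * t N' = m then nsub (I h) r * r ^ w * b (Suc h) N' ^ (w + card (I h)) else 0)"
  proof (rule sum.cong[OF refl])
    fix N' assume "N' \<in> A"
    then have NI: "N' \<in> Inv (Suc h)" by (simp add: A_def)
    have "(\<Sum>L\<in>B N'. b (Suc h) N' ^ card (I h) * idx (U h) L ^ w) =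
        b (Suc h) N' ^ card (I h) * (\<Sum>L\<in>B N'. idx (U h) L ^ w)" by (simp add: sum_distrib_left)
    also have "(\<Sum>L\<in>B N'. idx (U h) L ^ w) =
        (\<Sum>r\<in>{1..m}. if r ^ Suc e * t N' = m then nsub (I h) r * r ^ w * b (Suc h) N' ^ w else 0)"
      unfolding B_def t_def by (rule sum_allowed(2)[OF NI m])
    also have "b (Suc h) N' ^ card (I h) * \<dots> =
        (\<Sum>r\<in>{1..m}. if r ^ Suc e * t N' = m then nsub (I h) r * r ^ w * b (Suc h) N' ^ (w + card (I h)) else 0)"
      unfolding sum_distrib_left by (rule sum.cong[OF refl]) (simp add: power_add)
    finally show "(\<Sum>L\<in>B N'. b (Suc h) N' ^ card (I h) * idx (U h) L ^ w) =
        (\<Sum>r\<in>{1..m}. if r ^ Suc e * t N' = m then nsub (I h) r * r ^ w * b (Suc h) N' ^ (w + card (I h)) else 0)" .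
  qed
  also have "\<dots> = (\<Sum>r\<in>{1..m}. \<Sum>N'\<in>A. if r ^ Suc e * t N' = m then nsub (I h) r * r ^ w * b (Suc h) N' ^ (w + card (I h)) else 0)"
    by (rule sum.swap)
  also have "\<dots> = (\<Sum>r\<in>{1..m}. nsub (I h) r * r ^ w * (\<Sum>N'\<in>{N' \<in> Inv (Suc h). r ^ Suc e * t N' = m}. b (Suc h) N' ^ (w + card (I h))))"
  proof (rule sum.cong[OF refl])
    fix r assume r: "r \<in> {1..m}"
    have "{N' \<in> A. r ^ Suc e * t N' = m} = {N' \<in> Inv (Suc h). r ^ Suc e * t N' = m}"
    proof -
      have "idx ?Q N' \<le> m" if "r ^ Suc e * t N' = m" for N'
      proof (rule dvd_imp_le[OF _ m])
        show "idx ?Q N' dvd m" unfolding that[symmetric] t_def by simp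
      qed
      then show ?thesis by (auto simp: A_def)
    qed
    then show "(\<Sum>N'\<in>A. if r ^ Suc e * t N' = m then nsub (I h) r * r ^ w * b (Suc h) N' ^ (w + card (I h)) else 0) =
        nsub (I h) r * r ^ w * (\<Sum>N'\<in>{N' \<in> Inv (Suc h). r ^ Suc e * t N' = m}. b (Suc h) N' ^ (w + card (I h)))"
      by (simp add: sum.inter_filter[OF finA, symmetric] sum_distrib_left del: power_Suc)
  qed
  finally show ?thesis unfolding t_def .
qed

text \<open>Coefficient form of a product of Dirichlet series: the split-off factor is the series of
  \<open>U h\<close> with \<open>r\<close> replaced by \<open>r ^ Suc e\<close> and weighted by
  \<open>r ^ w\<close>.\<close>

lemma G_rec:
  assumes m: "m > 0"
  shows "G h e w m = (\<Sum>r\<in>{1..m}. if r ^ Suc e dvd m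
    then nsub (I h) r * r ^ w * G (Suc h) (Suc e) (w + card (I h)) (m div r ^ Suc e) else 0)"
  unfolding G_rec_aux[OF m]
proof (rule sum.cong[OF refl])
  fix r assume r: "r \<in> {1..m}"
  have r0: "r ^ Suc e \<noteq> 0" using r by simp
  have "(\<Sum>N'\<in>{N' \<in> Inv (Suc h). r ^ Suc e * (idx (M (Suc h)) N' * b (Suc h) N' ^ Suc e) = m}. b (Suc h) N' ^ (w + card (I h))) =
      (if r ^ Suc e dvd m then G (Suc h) (Suc e) (w + card (I h)) (m div r ^ Suc e) else 0)"
  proof (cases "r ^ Suc e dvd m")
    case True
    then obtain k where k: "m = r ^ Suc e * k" by (elim dvdE)
    show ?thesis using r0 by (simp add: G_def k del: power_Suc)
  next
    case False
    then have emp: "{N' \<in> Inv (Suc h). r ^ Suc e * (idx (M (Suc h)) N' * b (Suc h) N' ^ Suc e) = m} = {}"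
      by (auto simp del: power_Suc)
    show ?thesis unfolding emp using False by (simp del: power_Suc)
  qed
  then show "nsub (I h) r * r ^ w *
      (\<Sum>N'\<in>{N' \<in> Inv (Suc h). r ^ Suc e * (idx (M (Suc h)) N' * b (Suc h) N' ^ Suc e) = m}. b (Suc h) N' ^ (w + card (I h))) =
    (if r ^ Suc e dvd m then nsub (I h) r * r ^ w * G (Suc h) (Suc e) (w + card (I h)) (m div r ^ Suc e) else 0)"
    by simp
qed

text \<open>Every element of \<open>M (h + j)\<close> is a \<open>j\<close>-fold shift from
  \<open>M h\<close>, so surjectivity at height \<open>h\<close> passes to all greater heights by
  invariance. Correcting height by height ends because heights are bounded.\<close>

lemma eq_M_if_pr_onto:
  assumes N: "N \<in> Inv h" and onto: "pr h ` N = U h"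
  shows "N = M h"
proof -
  note sN = submod_subgrp[OF InvD(1)[OF N]]
  have step: "\<exists>g\<in>N. f - g \<in> M (h + j)" if "f \<in> M h" for f j
    using that
  proof (induction j arbitrary: f)
    case 0
    then show ?case using subgrp_zero[OF sN] by (intro bexI[of _ 0]) simp_all
  next
    case (Suc j)
    \<comment> \<open>Undoing one shift, approximating there and shifting back raises the height by
      one and stays inside \<open>N\<close>.\<close>
    have key: "\<exists>g\<in>N. u - g \<in> M (Suc (h + j))" if "u \<in> M (h + j)" for u
      using that
    proof (induction j arbitrary: u)
      case 0
      then have u: "u \<in> M h" by simp
      then have "pr h u \<in> pr h ` N" unfolding onto by (rule pr_M)
      then obtain g where g: "g \<in> N" "pr h u = pr h g" by auto
      have "u - g \<in> M h" by (rule subgrp_diff[OF subgrp_V u]) (use g InvD(2)[OF N] in blast)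
      moreover have "pr h (u - g) = 0" using g by (simp add: restr_diff)
      ultimately have "u - g \<in> M (Suc h)" by (simp add: pr_eq_0)
      then have "u - g \<in> M (Suc (h + 0))" by simp
      then show ?case using g(1) by blast
    next
      case (Suc j)
      then have u: "u \<in> M (Suc (h + j))" by simp
      then obtain g where g: "g \<in> N" "unshift u - g \<in> M (Suc (h + j))" using Suc.IH unshift_M by blast
      have "X (unshift u - g) \<in> M (Suc (Suc (h + j)))" by (rule X_M[OF g(2)])
      then have "u - X g \<in> M (Suc (Suc (h + j)))" unfolding shift_diff X_unshift[OF u] .
      then have "u - X g \<in> M (Suc (h + Suc j))" by simp
      moreover have "X g \<in> N" using InvD(3)[OF N] g(1) by blast
      ultimately show ?case by blast
    qed
    obtain g where g: "g \<in> N" "f - g \<in> M (h + j)" using Suc by blast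
    obtain g' where g': "g' \<in> N" "f - g - g' \<in> M (Suc (h + j))" using key[OF g(2)] by blast
    have "f - (g + g') \<in> M (h + Suc j)" using g'(2) by (simp add: diff_diff_eq)
    then show ?case using subgrp_add[OF sN g(1) g'(1)] by blast
  qed
  have lev_le: "lev q \<le> q" for q
  proof (induction q)
    case 0 then show ?case using good_lev by (simp add: good_lev_def)
  next
    case (Suc q) then show ?case using levD[of "Suc q"] by (cases "lev (Suc q) = 0") auto
  qed
  have "tail_set n lev (h + Suc n) = {}"
  proof -
    have "\<not> h + Suc n \<le> lev q" if "q < n" for q using lev_le[of q] that by linarith
    then show ?thesis by (auto simp: tail_set_def)
  qed
  then have "M (h + Suc n) = {0}" using R0 by (auto simp: vecs_def fun_eq_iff)
  then have "f \<in> N" if "f \<in> M h" for f using step[OF that, of "Suc n"] by auto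
  then show ?thesis using InvD(2)[OF N] by blast
qed

lemma m0_le_b:
  assumes N: "N \<in> Inv h" "N \<noteq> M h" shows "m0 \<le> b h N"
proof -
  have "pr h ` N \<noteq> U h" using eq_M_if_pr_onto[OF N(1)] N(2) by blast
  then show ?thesis unfolding b_def
    using b_pos[OF N(1)] unfolding b_def
    by (intro m0_le finite_level_set submod_pr pr_N_U InvD[OF N(1)]) auto
qed

lemma M_Inv: "M h \<in> Inv h" "b h (M h) = 1" "idx (M h) (M h) = 1"
proof -
  show i: "idx (M h) (M h) = 1" by (rule idx_self[OF subgrp_V])
  show I: "M h \<in> Inv h" unfolding Inv_def using X_M M_Suc submod_V i by auto
  show "b h (M h) = 1" using b_le[OF I] b_pos[OF I] i by simp
qed

text \<open>A proper \<open>N\<close> has \<open>b h N\<close> at least \<open>m0\<close>, and its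
  index is at least \<open>b h N\<close>, so \<open>idx (M h) N * b h N ^ e\<close> is at least
  \<open>m0 ^ Suc e\<close>.\<close>

lemma G_vanish:
  assumes "1 < m" "m < m0 ^ Suc e" shows "G h e w m = 0"
proof -
  have emp: "{N \<in> Inv h. idx (M h) N * b h N ^ e = m} = {}"
  proof (rule ccontr)
    assume "{N \<in> Inv h. idx (M h) N * b h N ^ e = m} \<noteq> {}"
    then obtain N where N: "N \<in> Inv h" "idx (M h) N * b h N ^ e = m" by blast
    have "N \<noteq> M h" using N M_Inv assms by auto
    then have "m0 \<le> b h N" by (rule m0_le_b[OF N(1)])
    then have "m0 * m0 ^ e \<le> idx (M h) N * b h N ^ e"
      using b_le[OF N(1)] by (intro mult_le_mono power_mono) auto
    then show False using N assms by simp
  qed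
  show ?thesis unfolding G_def emp by simp
qed

lemma G_1: "G h e w 1 = 1"
proof -
  have eq: "{N \<in> Inv h. idx (M h) N * b h N ^ e = 1} = {M h}"
  proof
    show "{N \<in> Inv h. idx (M h) N * b h N ^ e = 1} \<subseteq> {M h}"
    proof
      fix N assume "N \<in> {N \<in> Inv h. idx (M h) N * b h N ^ e = 1}"
      then have N: "N \<in> Inv h" "idx (M h) N = 1" by auto
      then show "N \<in> {M h}" using idx_eq_1_iff[OF subgrp_V submod_subgrp[OF InvD(1)[OF N(1)]] InvD(2)[OF N(1)]] by simp
    qed
  qed (use M_Inv in auto)
  show ?thesis unfolding G_def eq by (simp add: M_Inv)
qed

text \<open>In the recursion at \<open>m0 ^ Suc e\<close> the term \<open>r = 1\<close> vanishes,
  because the next series has no coefficient strictly between 1 and \<open>m0 ^ Suc (Suc e)\<close>.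
  Values of \<open>r\<close> strictly between 1 and \<open>m0\<close> contribute nothing by
  minimality, and \<open>r = m0\<close> meets the coefficient 1 of the next series. So the
  coefficient sees the rank at the current height alone.\<close>

lemma G_m0: "G h e w (m0 ^ Suc e) = nsub (I h) m0 * m0 ^ w"
proof -
  have pos: "0 < m0 ^ Suc e" using m0(1) by simp
  have m0_in: "m0 \<in> {1..m0 ^ Suc e}" using m0(1) by (simp add: Suc_leI)
  have "G h e w (m0 ^ Suc e) = (\<Sum>r\<in>{1..m0 ^ Suc e}. if r = m0 then nsub (I h) m0 * m0 ^ w else 0)"
    unfolding G_rec[OF pos]
  proof (rule sum.cong[OF refl])
    fix r assume r: "r \<in> {1..m0 ^ Suc e}"
    consider "r = 1" | "1 < r" "r < m0" | "r = m0" | "m0 < r" using r by fastforce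
    then show "(if r ^ Suc e dvd m0 ^ Suc e
        then nsub (I h) r * r ^ w * G (Suc h) (Suc e) (w + card (I h)) (m0 ^ Suc e div r ^ Suc e) else 0) =
      (if r = m0 then nsub (I h) m0 * m0 ^ w else 0)"
    proof cases
      case 1
      have "1 < m0 ^ Suc e" "m0 ^ Suc e < m0 ^ Suc (Suc e)"
        using m0(1) by (intro one_less_power power_strict_increasing; simp)+
      from G_vanish[OF this, of "Suc h" "w + card (I h)"] show ?thesis using 1 m0(1) by simp
    next
      case 2
      then show ?thesis using nsub_less_m0[OF finite_level_set 2] by simp
    next
      case 3
      then show ?thesis using G_1[of "Suc h" "Suc e" "w + card (I h)"] m0(1) by simp
    next
      case 4
      then have "m0 ^ Suc e < r ^ Suc e" by (intro power_strict_mono) auto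
      then have "\<not> r ^ Suc e dvd m0 ^ Suc e" using pos dvd_imp_le by (meson linorder_not_le)
      then show ?thesis using 4 by simp
    qed
  qed
  also have "\<dots> = nsub (I h) m0 * m0 ^ w" using m0_in by (simp del: power_Suc)
  finally show ?thesis .
qed

lemma G_0: "m > 0 \<Longrightarrow> G 0 0 0 m = cnt R (vecs R {..<n}) X m"
proof -
  assume m: "m > 0"
  have "tail_set n lev 0 = {..<n}" by (auto simp: tail_set_def)
  moreover have "{N \<in> Inv 0. idx (M 0) N = m} = {N. submod R N \<and> N \<subseteq> M 0 \<and> X ` N \<subseteq> N \<and> idx (M 0) N = m}"
    using m by (auto simp: Inv_def)
  moreover have "G 0 0 0 m = card {N \<in> Inv 0. idx (M 0) N = m}" by (simp add: G_def)
  ultimately show ?thesis unfolding cnt_def by simp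
qed

end

text \<open>Both chains are peeled height by height with common parameters \<open>e\<close> and
  \<open>w\<close>. Once the ranks at height \<open>h\<close> agree, the same Dirichlet series is
  cancelled on both sides, which is possible because its coefficient at 1 is 1.\<close>

theorem (in pid_ring) level_cards_determined:
  assumes lev: "good_lev lev" "good_lev lev'"
    and eq: "\<And>m. m > 0 \<Longrightarrow> cnt R (vecs R {..<n}) (shift n lev) m = cnt R (vecs R {..<n'}) (shift n' lev') m"
  shows "card (level_set n lev h) = card (level_set n' lev' h)"
proof -
  interpret A: chain R co d n lev by unfold_locales (rule lev)
  interpret B: chain R co d n' lev' by unfold_locales (rule lev)
  have card_eq: "card (level_set n lev h) = card (level_set n' lev' h)"
    if "\<And>m. m > 0 \<Longrightarrow> A.G h e w m = B.G h e w m" for h e w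
  proof -
    have "nsub (level_set n lev h) m0 * m0 ^ w = nsub (level_set n' lev' h) m0 * m0 ^ w"
      using that[of "m0 ^ Suc e"] m0(1) by (simp only: A.G_m0 B.G_m0) simp
    then show ?thesis using m0(1) by (intro nsub_m0_inj finite_level_set) simp
  qed
  have "\<exists>e w. \<forall>m>0. A.G h e w m = B.G h e w m" for h
  proof (induction h)
    case 0
    then show ?case using eq A.G_0 B.G_0 by (intro exI[of _ 0]) simp
  next
    case (Suc h)
    then obtain e w where ew: "\<And>m. m > 0 \<Longrightarrow> A.G h e w m = B.G h e w m" by blast
    define c where "c = card (level_set n lev h)"
    have c': "card (level_set n' lev' h) = c" unfolding c_def using card_eq[OF ew] by simp
    have nsub: "nsub (level_set n' lev' h) r = nsub (level_set n lev h) r" for r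
      by (rule nsub_card_cong) (simp_all add: finite_level_set c' c_def)
    let ?e = "Suc e" and ?w = "w + c"
    have "A.G (Suc h) ?e ?w m = B.G (Suc h) ?e ?w m" if "m > 0" for m
      using that
    \<comment> \<open>In the recursion for \<open>G h e w m\<close> only the term
      \<open>r = 1\<close> involves the next series at \<open>m\<close> itself; all other terms
      concern smaller arguments.\<close>
    proof (induction m rule: less_induct)
      case (less m)
      define F where "F G r = (if r ^ Suc e dvd m then nsub (level_set n lev h) r * r ^ w * G (Suc h) ?e ?w (m div r ^ Suc e) else 0)"
        for G :: "nat \<Rightarrow> nat \<Rightarrow> nat \<Rightarrow> nat \<Rightarrow> nat" and r
      have A: "A.G h e w m = (\<Sum>r\<in>{1..m}. F A.G r)" unfolding A.G_rec[OF less.prems] F_def c_def ..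
      have B: "B.G h e w m = (\<Sum>r\<in>{1..m}. F B.G r)" unfolding B.G_rec[OF less.prems] F_def c' nsub ..
      have split: "(\<Sum>r\<in>{1..m}. F G r) = F G 1 + (\<Sum>r\<in>{2..m}. F G r)" for G
        using less.prems by (simp add: sum.atLeast_Suc_atMost numeral_2_eq_2)
      have "F A.G r = F B.G r" if "r \<in> {2..m}" for r
      proof (cases "r ^ Suc e dvd m")
        case True
        have "1 < r ^ Suc e" using that by (intro one_less_power) auto
        then have "m div r ^ Suc e < m" "0 < m div r ^ Suc e"
          using True less.prems by (auto simp: div_greater_zero_iff intro: dvd_imp_le)
        then show ?thesis unfolding F_def using less.IH by simp
      qed (simp add: F_def)
      then have "(\<Sum>r\<in>{2..m}. F A.G r) = (\<Sum>r\<in>{2..m}. F B.G r)" by (rule sum.cong[OF refl])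
      moreover have "(\<Sum>r\<in>{1..m}. F A.G r) = (\<Sum>r\<in>{1..m}. F B.G r)" using ew[OF less.prems] A B by simp
      ultimately have "F A.G 1 = F B.G 1" unfolding split by simp
      then show ?case by (simp add: F_def nsub_1[unfolded One_nat_def])
    qed
    then show ?case by blast
  qed
  then obtain e w where "\<And>m. m > 0 \<Longrightarrow> A.G h e w m = B.G h e w m" by blast
  then show ?thesis by (rule card_eq)
qed

section \<open>Chain bases of nilpotent maps\<close>

definition lin_map :: "((nat \<Rightarrow> 'k::field) \<Rightarrow> (nat \<Rightarrow> 'k)) \<Rightarrow> bool" where
  "lin_map X \<longleftrightarrow> (\<forall>f g. X (f - g) = X f - X g) \<and> (\<forall>r f. X (smul r f) = smul r (X f))"

lemma lin_map_diff: "lin_map X \<Longrightarrow> X (f - g) = X f - X g"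
  and lin_map_smul: "lin_map X \<Longrightarrow> X (smul r f) = smul r (X f)"
  by (auto simp: lin_map_def)

lemma lin_map_0: "lin_map X \<Longrightarrow> X 0 = 0"
  using lin_map_diff[of X 0 0] by simp

lemma lin_map_add: "lin_map X \<Longrightarrow> X (f + g) = X f + X g"
  using lin_map_diff[of X "f + g" g] by (simp add: algebra_simps)

lemma lin_map_sum:
  assumes X: "lin_map X" shows "X (\<Sum>i\<in>I. f i) = (\<Sum>i\<in>I. X (f i))"
  by (induction I rule: infinite_finite_induct)
    (simp_all only: sum.infinite sum.empty sum.insert lin_map_0[OF X] lin_map_add[OF X] not_False_eq_True)

lemma lin_map_funpow: "lin_map X \<Longrightarrow> lin_map (X ^^ i)"
  by (induction i) (simp_all add: lin_map_def)

lemma lin_map_lin: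
  assumes X: "lin_map X" shows "X (lin S b c) = lin S (\<lambda>q. X (b q)) c"
  by (simp add: lin_def lin_map_sum[OF X] lin_map_smul[OF X])

lemma lin_zero: "lin S b 0 = 0"
  by (simp add: lin_def smul_zero_left)

lemma vector_space_smul: "vector_space (smul :: 'k::field \<Rightarrow> _)"
  by unfold_locales (auto simp: fun_eq_iff algebra_simps)

text \<open>The basis is listed chain by chain in the order of the shifts, so that in coordinates
  \<open>X\<close> becomes \<open>shift d lev\<close>.\<close>

definition chain_basis ::
    "((nat \<Rightarrow> 'k::field) \<Rightarrow> (nat \<Rightarrow> 'k)) \<Rightarrow> (nat \<Rightarrow> 'k) set \<Rightarrow> nat \<Rightarrow> (nat \<Rightarrow> nat) \<Rightarrow> (nat \<Rightarrow> nat \<Rightarrow> 'k) \<Rightarrow> bool" where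
  "chain_basis X W d lev b \<longleftrightarrow> good_lev lev \<and> bij_betw (lin {..<d} b) (vecs UNIV {..<d}) W \<and>
     (\<forall>q<d. X (b q) = (if Suc q < d \<and> 0 < lev (Suc q) then b (Suc q) else 0))"

lemma chain_basis_intertwine:
  assumes X: "lin_map X" and b: "chain_basis X W d lev b"
  shows "X (lin {..<d} b c) = lin {..<d} b (shift d lev c)"
proof -
  have "X (lin {..<d} b c) = (\<Sum>q<d. smul (c q) (if Suc q < d \<and> 0 < lev (Suc q) then b (Suc q) else 0))"
    unfolding lin_map_lin[OF X] using b by (auto simp: lin_def chain_basis_def intro!: sum.cong)
  also have "\<dots> = (\<Sum>q<d. smul (shift d lev c q) (b q))"
  proof (cases d)
    case (Suc d')
    have "lev 0 = 0" using b by (simp add: chain_basis_def good_lev_def)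
    have "(\<Sum>q<Suc d'. smul (c q) (if Suc q < Suc d' \<and> 0 < lev (Suc q) then b (Suc q) else 0)) =
        (\<Sum>q<d'. smul (c q) (if 0 < lev (Suc q) then b (Suc q) else 0))"
      by (simp add: sum.lessThan_Suc smul_zero)
    also have "\<dots> = (\<Sum>q<d'. smul (shift (Suc d') lev c (Suc q)) (b (Suc q)))"
      by (rule sum.cong) (auto simp: shift_apply smul_zero smul_zero_left)
    also have "\<dots> = (\<Sum>q<Suc d'. smul (shift (Suc d') lev c q) (b q))"
      unfolding sum.lessThan_Suc_shift by (simp add: shift_apply[of _ _ _ 0] \<open>lev 0 = 0\<close> smul_zero_left)
    finally show ?thesis unfolding Suc .
  qed simp
  finally show ?thesis by (simp add: lin_def)
qed

text \<open>A cyclic subspace of maximal length \<open>e\<close>, spanned by \<open>v, X v, \<dots>\<close>, is complemented by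
  the vectors on which the functionals \<open>\<phi> \<circ> X ^^ i\<close> vanish, where \<open>\<phi> (X ^^ (e - 1) v) = 1\<close>.\<close>

lemma chain_basis_exists:
  fixes X :: "(nat \<Rightarrow> 'k::field) \<Rightarrow> (nat \<Rightarrow> 'k)"
  assumes X: "lin_map X"
    and "submod UNIV W" "X ` W \<subseteq> W" "\<And>f. f \<in> W \<Longrightarrow> (X ^^ k) f = 0"
    and "\<And>S. \<not> module.dependent (smul :: 'k \<Rightarrow> _) S \<Longrightarrow> S \<subseteq> W \<Longrightarrow> finite S \<and> card S \<le> N"
  shows "\<exists>d lev b. chain_basis X W d lev b"
  using assms(2-)
proof (induction N arbitrary: W rule: less_induct)
  case (less N)
  interpret fv: vector_space "smul :: 'k \<Rightarrow> (nat \<Rightarrow> 'k) \<Rightarrow> _" by (rule vector_space_smul)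
  note W = less.prems(1) and sW = submod_subgrp[OF less.prems(1)]
  note Xi = lin_map_funpow[OF X]
  show ?case
  proof (cases "W = {0}")
    case True
    have V: "vecs UNIV {} = {0 :: nat \<Rightarrow> 'k}" by (auto simp: vecs_def fun_eq_iff)
    have "chain_basis X W 0 (\<lambda>_. 0) (\<lambda>_. 0)"
      unfolding chain_basis_def True using V by (simp add: good_lev_def bij_betw_def lin_def)
    then show ?thesis by blast
  next
    case False
    \<comment> \<open>The nilpotency index on \<open>W\<close>; its minimality yields a vector
      \<open>v\<close> whose chain has full length \<open>e\<close>.\<close>
    define e where "e = (LEAST e. \<forall>f\<in>W. (X ^^ e) f = 0)"
    have e: "\<And>f. f \<in> W \<Longrightarrow> (X ^^ e) f = 0"
    proof -
      have "\<exists>e. \<forall>f\<in>W. (X ^^ e) f = 0" using less.prems(3) by blast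
      from LeastI_ex[OF this] show "\<And>f. f \<in> W \<Longrightarrow> (X ^^ e) f = 0" unfolding e_def by blast
    qed
    have e0: "e > 0"
    proof (rule ccontr)
      assume "\<not> e > 0"
      then have "f = 0" if "f \<in> W" for f using e[OF that] by simp
      then show False using False subgrp_zero[OF sW] by blast
    qed
    have Xge: "(X ^^ i) f = 0" if "f \<in> W" "i \<ge> e" for f i
    proof -
      have "(X ^^ i) f = (X ^^ (i - e)) ((X ^^ e) f)"
        using that(2) by (metis comp_apply funpow_add le_add_diff_inverse2)
      then show ?thesis using e[OF that(1)] lin_map_0[OF Xi] by simp
    qed
    have "\<not> (\<forall>f\<in>W. (X ^^ (e - 1)) f = 0)"
      using not_less_Least[of "e - 1" "\<lambda>e. \<forall>f\<in>W. (X ^^ e) f = 0"] e0 unfolding e_def by linarith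
    then obtain v where v: "v \<in> W" "(X ^^ (e - 1)) v \<noteq> 0" by blast
    then obtain j where j: "(X ^^ (e - 1)) v j \<noteq> 0" by (auto simp: fun_eq_iff)
    \<comment> \<open>Evaluation at a coordinate where \<open>(X ^^ (e - 1)) v\<close> does not
      vanish, scaled to give the value 1 there.\<close>
    define \<phi> where "\<phi> f = f j / (X ^^ (e - 1)) v j" for f :: "nat \<Rightarrow> 'k"
    have \<phi>_diff: "\<phi> (f - g) = \<phi> f - \<phi> g" for f g by (simp add: \<phi>_def diff_divide_distrib)
    have \<phi>_add: "\<phi> (f + g) = \<phi> f + \<phi> g" for f g by (simp add: \<phi>_def add_divide_distrib)
    have \<phi>_smul: "\<phi> (smul r f) = r * \<phi> f" for r f by (simp add: \<phi>_def)
    have \<phi>_0: "\<phi> 0 = 0" by (simp add: \<phi>_def)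
    have \<phi>_sum: "\<phi> (\<Sum>i\<in>I. f i) = (\<Sum>i\<in>I. \<phi> (f i))" for I and f :: "nat \<Rightarrow> nat \<Rightarrow> 'k"
      by (simp add: \<phi>_def sum_divide_distrib)
    have \<phi>_v: "\<phi> ((X ^^ (e - 1)) v) = 1" using j by (simp add: \<phi>_def)
    define W' where "W' = {w \<in> W. \<forall>i<e. \<phi> ((X ^^ i) w) = 0}"
    have W'W: "W' \<subseteq> W" by (auto simp: W'_def)
    have mW': "submod UNIV W'" unfolding submod_def subgrp_def
    proof (intro conjI ballI)
      show "0 \<in> W'" using subgrp_zero[OF sW] by (simp add: W'_def lin_map_0[OF Xi] \<phi>_0)
      fix x y assume "x \<in> W'" "y \<in> W'"
      then show "x - y \<in> W'" using subgrp_diff[OF sW] by (simp add: W'_def lin_map_diff[OF Xi] \<phi>_diff)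
    next
      fix r x assume "x \<in> W'"
      then show "smul r x \<in> W'" using submod_smul[OF W] by (simp add: W'_def lin_map_smul[OF Xi] \<phi>_smul)
    qed
    note sW' = submod_subgrp[OF mW']
    have XW: "X f \<in> W" if "f \<in> W" for f using less.prems(2) that by blast
    have XW': "X ` W' \<subseteq> W'"
    proof (rule image_subsetI)
      fix w assume w: "w \<in> W'"
      have "\<phi> ((X ^^ i) (X w)) = 0" if "i < e" for i
      proof -
        have "(X ^^ i) (X w) = (X ^^ Suc i) w" by (simp add: funpow_swap1)
        moreover have "\<phi> ((X ^^ Suc i) w) = 0"
        proof (cases "Suc i < e")
          case False
          then have "(X ^^ Suc i) w = 0" using w by (intro Xge) (auto simp: W'_def)
          then show ?thesis by (simp only: \<phi>_0)
        qed (use w in \<open>unfold W'_def, blast\<close>)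
        ultimately show ?thesis by simp
      qed
      then show "X w \<in> W'" using w XW by (simp add: W'_def)
    qed
    have XvW: "(X ^^ i) v \<in> W" for i by (induction i) (simp_all add: v XW)
    \<comment> \<open>The induction runs on a bound for independent sets in place of a dimension. As
      \<open>v\<close> lies outside the span of every subset of \<open>W'\<close>, the bound for
      \<open>W'\<close> is smaller by one.\<close>
    have bound: "finite S \<and> Suc (card S) \<le> N" if S: "\<not> fv.dependent S" "S \<subseteq> W'" for S
    proof -
      have "fv.subspace W'"
        using subgrp_zero[OF sW'] subgrp_add[OF sW'] submod_smul[OF mW'] by (auto simp: fv.subspace_def)
      then have "fv.span S \<subseteq> W'" using fv.span_minimal S(2) by blast
      moreover have "v \<notin> W'"
      proof
        assume "v \<in> W'"
        then have "\<phi> ((X ^^ (e - 1)) v) = 0" using e0 by (simp add: W'_def)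
        then show False using \<phi>_v by simp
      qed
      ultimately have "v \<notin> fv.span S" by blast
      then have ind: "\<not> fv.dependent (insert v S)" and "v \<notin> S"
        using fv.independent_insertI S(1) fv.span_base by blast+
      have "insert v S \<subseteq> W" using v(1) S(2) W'W by blast
      from less.prems(4)[OF ind this] show ?thesis using \<open>v \<notin> S\<close> by auto
    qed
    have "0 < N" using bound[OF fv.independent_empty empty_subsetI] by simp
    then have "N - 1 < N" by simp
    have Xk: "(X ^^ k) f = 0" if "f \<in> W'" for f using less.prems(3) that W'W by blast
    have bd: "finite S \<and> card S \<le> N - 1" if "\<not> fv.dependent S" "S \<subseteq> W'" for S
      using bound[OF that] by linarith
    from less.IH[OF \<open>N - 1 < N\<close> mW' XW' Xk bd] obtain d lev b where IH: "chain_basis X W' d lev b" by blast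
    \<comment> \<open>The new chain is appended at the indices from \<open>d\<close> to
      \<open>d + e - 1\<close>, with heights starting again at 0.\<close>
    define lev2 where "lev2 q = (if q < d then lev q else q - d)" for q
    define b2 where "b2 q = (if q < d then b q else (X ^^ (q - d)) v)" for q
    have bij: "bij_betw (lin {..<d} b) (vecs UNIV {..<d}) W'" using IH by (simp add: chain_basis_def)
    have good: "good_lev lev2"
      unfolding good_lev_def
    proof (intro conjI allI)
      have g: "lev 0 = 0" "\<And>q. lev (Suc q) = 0 \<or> lev (Suc q) = Suc (lev q)"
        using IH by (simp_all add: chain_basis_def good_lev_def)
      show "lev2 0 = 0" using g(1) by (simp add: lev2_def)
      fix q
      consider "Suc q < d" | "Suc q = d" | "d \<le> q" by linarith
      then show "lev2 (Suc q) = 0 \<or> lev2 (Suc q) = Suc (lev2 q)"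
      proof cases
        case 1 then show ?thesis using g(2)[of q] by (simp add: lev2_def)
      next
        case 2 then show ?thesis by (simp add: lev2_def)
      next
        case 3 then show ?thesis by (simp add: lev2_def Suc_diff_le)
      qed
    qed
    have step: "X (b2 q) = (if Suc q < d + e \<and> 0 < lev2 (Suc q) then b2 (Suc q) else 0)" if q: "q < d + e" for q
    proof -
      consider "Suc q < d" | "Suc q = d" | "d \<le> q" "Suc q < d + e" | "d \<le> q" "Suc q = d + e"
        using q by linarith
      then show ?thesis
      proof cases
        case 1 then show ?thesis using IH by (simp add: chain_basis_def b2_def lev2_def)
      next
        case 2 then show ?thesis using IH by (auto simp: chain_basis_def b2_def lev2_def)
      next
        case 3 then show ?thesis by (simp add: b2_def lev2_def Suc_diff_le)
      next
        case 4
        then have "X (b2 q) = (X ^^ e) v" by (simp add: b2_def flip: Suc_diff_le funpow.simps(2) comp_apply[of X])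
        then show ?thesis using 4 e[OF v(1)] by simp
      qed
    qed
    define cyc where "cyc a = (\<Sum>i<e. smul (a i) ((X ^^ i) v))" for a :: "nat \<Rightarrow> 'k"
    have lin2: "lin {..<d + e} b2 c = lin {..<d} b c + cyc (\<lambda>i. c (d + i))" for c
    proof -
      have "{..<d + e} = {..<d} \<union> {d..<d + e}" by auto
      then have "lin {..<d + e} b2 c = (\<Sum>q<d. smul (c q) (b2 q)) + (\<Sum>q\<in>{d..<d + e}. smul (c q) (b2 q))"
        unfolding lin_def by (simp add: sum.union_disjoint ivl_disj_int)
      also have "(\<Sum>q<d. smul (c q) (b2 q)) = lin {..<d} b c"
        unfolding lin_def by (rule sum.cong) (simp_all add: b2_def)
      also have "(\<Sum>q\<in>{d..<d + e}. smul (c q) (b2 q)) = cyc (\<lambda>i. c (d + i))"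
        unfolding cyc_def using sum.shift_bounds_nat_ivl[of "\<lambda>q. smul (c q) (b2 q)" 0 d e]
        by (simp add: b2_def add.commute atLeast0LessThan)
      finally show ?thesis .
    qed
    have cycW: "cyc a \<in> W" for a
      unfolding cyc_def by (rule subgrp_sum[OF sW]) (simp add: submod_smul[OF W] XvW)
    \<comment> \<open>The pairing of the functionals with the cyclic vectors is triangular: the
      power \<open>e - 1 - i0\<close> of \<open>X\<close> moves the first possibly nonzero term to
      the vector on which \<open>\<phi>\<close> is 1 and sends all later terms to 0.\<close>
    have lead: "\<phi> ((X ^^ (e - 1 - i0)) (cyc a)) = a i0" if "i0 < e" "\<And>i. i < i0 \<Longrightarrow> a i = 0" for a i0
    proof -
      have "\<phi> ((X ^^ (e - 1 - i0)) (cyc a)) = (\<Sum>i<e. a i * \<phi> ((X ^^ (e - 1 - i0 + i)) v))"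
        unfolding cyc_def lin_map_sum[OF Xi] \<phi>_sum lin_map_smul[OF Xi] \<phi>_smul
        by (simp add: funpow_add)
      also have "\<dots> = (\<Sum>i<e. if i = i0 then a i0 else 0)"
      proof (rule sum.cong[OF refl])
        fix i assume "i \<in> {..<e}"
        consider "i < i0" | "i = i0" | "i0 < i" by linarith
        then show "a i * \<phi> ((X ^^ (e - 1 - i0 + i)) v) = (if i = i0 then a i0 else 0)"
        proof cases
          case 1 then show ?thesis using that by simp
        next
          case 2 then show ?thesis using that \<phi>_v by simp
        next
          case 3
          then have "(X ^^ (e - 1 - i0 + i)) v = 0" using that by (intro Xge v) linarith
          then show ?thesis using 3 by (simp add: \<phi>_0)
        qed
      qed
      finally show ?thesis using that by simp
    qed
    have bij2: "bij_betw (lin {..<d + e} b2) (vecs UNIV {..<d + e}) W"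
    proof (rule bij_betw_imageI)
      show "inj_on (lin {..<d + e} b2) (vecs UNIV {..<d + e})"
      proof (rule inj_onI)
        fix f g assume fg: "f \<in> vecs UNIV {..<d + e}" "g \<in> vecs UNIV {..<d + e}"
          and eq: "lin {..<d + e} b2 f = lin {..<d + e} b2 g"
        define c where "c = f - g"
        have "lin {..<d + e} b2 c = 0" unfolding c_def lin_diff eq by simp
        then have c0: "lin {..<d} b c + cyc (\<lambda>i. c (d + i)) = 0" by (simp only: lin2)
        have lin_c: "lin {..<d} b c = lin {..<d} b (restr {..<d} c)" by (simp add: lin_def)
        moreover have rc: "restr {..<d} c \<in> vecs UNIV {..<d}" by (simp add: vecs_def)
        ultimately have linW': "lin {..<d} b c \<in> W'" using bij by (auto simp: bij_betw_def)
        have tail: "c (d + i) = 0" if "i < e" for i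
          using that
        proof (induction i rule: less_induct)
          case (less i)
          have "\<phi> ((X ^^ (e - 1 - i)) (lin {..<d} b c + cyc (\<lambda>i. c (d + i)))) = 0"
            unfolding c0 lin_map_0[OF Xi] \<phi>_0 ..
          moreover have "\<phi> ((X ^^ (e - 1 - i)) (lin {..<d} b c)) = 0"
            using linW' less.prems by (simp add: W'_def)
          moreover have "\<phi> ((X ^^ (e - 1 - i)) (cyc (\<lambda>i. c (d + i)))) = c (d + i)"
            using less by (intro lead) auto
          ultimately show ?case by (simp add: lin_map_add[OF Xi] \<phi>_add)
        qed
        have "cyc (\<lambda>i. c (d + i)) = 0" unfolding cyc_def by (rule sum.neutral) (simp add: tail smul_zero_left)
        then have "lin {..<d} b (restr {..<d} c) = lin {..<d} b 0"
          using c0 by (simp add: lin_zero lin_c)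
        moreover have "(0 :: nat \<Rightarrow> 'k) \<in> vecs UNIV {..<d}" by (simp add: vecs_def)
        ultimately have z: "restr {..<d} c = 0" using bij rc by (auto simp: bij_betw_def dest: inj_onD)
        have head: "c q = 0" if "q < d" for q using fun_cong[OF z, of q] that by simp
        have "c q = 0" for q
        proof -
          consider "q < d" | "d \<le> q" "q < d + e" | "d + e \<le> q" by linarith
          then show ?thesis
          proof cases
            case 2 then show ?thesis using tail[of "q - d"] by simp
          next
            case 3 then show ?thesis using fg by (simp add: c_def vecs_def)
          qed (rule head)
        qed
        then show "f = g" unfolding c_def by (auto simp: fun_eq_iff)
      qed
      show "lin {..<d + e} b2 ` vecs UNIV {..<d + e} = W"
      proof
        show "lin {..<d + e} b2 ` vecs UNIV {..<d + e} \<subseteq> W"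
        proof (rule image_subsetI)
          fix c :: "nat \<Rightarrow> 'k"
          have "lin {..<d} b c = lin {..<d} b (restr {..<d} c)" by (simp add: lin_def)
          moreover have "restr {..<d} c \<in> vecs UNIV {..<d}" by (simp add: vecs_def)
          ultimately have "lin {..<d} b c \<in> W" using bij W'W by (auto simp: bij_betw_def)
          then show "lin {..<d + e} b2 c \<in> W" unfolding lin2 using cycW by (rule subgrp_add[OF sW])
        qed
        show "W \<subseteq> lin {..<d + e} b2 ` vecs UNIV {..<d + e}"
        proof
          fix w assume w: "w \<in> W"
          \<comment> \<open>The triangular system is solved one unknown at a time: the first
            \<open>m\<close> coefficients are chosen so that the functionals with index at least
            \<open>e - m\<close> vanish on the difference.\<close>
          have "\<exists>a. \<forall>i. e - m \<le> i \<and> i < e \<longrightarrow> \<phi> ((X ^^ i) (w - (\<Sum>j<m. smul (a j) ((X ^^ j) v)))) = 0"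
            if "m \<le> e" for m
            using that
          proof (induction m)
            case (Suc m)
            from Suc.IH[OF Suc_leD[OF Suc.prems]] obtain a where
              a: "\<And>i. e - m \<le> i \<Longrightarrow> i < e \<Longrightarrow> \<phi> ((X ^^ i) (w - (\<Sum>j<m. smul (a j) ((X ^^ j) v)))) = 0"
              by blast
            define y where "y = w - (\<Sum>j<m. smul (a j) ((X ^^ j) v))"
            define a2 where "a2 = a(m := \<phi> ((X ^^ (e - 1 - m)) y))"
            have "(\<Sum>j<m. smul (a2 j) ((X ^^ j) v)) = (\<Sum>j<m. smul (a j) ((X ^^ j) v))"
              by (rule sum.cong) (simp_all add: a2_def)
            then have y2: "w - (\<Sum>j<Suc m. smul (a2 j) ((X ^^ j) v)) = y - smul (a2 m) ((X ^^ m) v)"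
              unfolding y_def sum.lessThan_Suc by (simp only: diff_diff_eq)
            have "\<phi> ((X ^^ i) (y - smul (a2 m) ((X ^^ m) v))) = 0" if i: "e - Suc m \<le> i" "i < e" for i
            proof -
              have *: "\<phi> ((X ^^ i) (y - smul (a2 m) ((X ^^ m) v))) = \<phi> ((X ^^ i) y) - a2 m * \<phi> ((X ^^ (i + m)) v)"
                by (simp add: lin_map_diff[OF Xi] lin_map_smul[OF Xi] \<phi>_diff \<phi>_smul funpow_add)
              show ?thesis
              proof (cases "i = e - 1 - m")
                case True
                then have "i + m = e - 1" using Suc.prems by simp
                then show ?thesis unfolding * using \<phi>_v True by (simp add: a2_def)
              next
                case False
                then have "e - m \<le> i" "e \<le> i + m" using i by linarith+
                then have "\<phi> ((X ^^ i) y) = 0" "(X ^^ (i + m)) v = 0" using a i(2) Xge[OF v(1)] unfolding y_def by blast+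
                then show ?thesis unfolding * by (simp add: \<phi>_0)
              qed
            qed
            then show ?case unfolding y2[symmetric] by blast
          qed auto
          from this[of e] obtain a where "\<forall>i. e - e \<le> i \<and> i < e \<longrightarrow> \<phi> ((X ^^ i) (w - cyc a)) = 0"
            unfolding cyc_def by blast
          then have "w - cyc a \<in> W'" unfolding W'_def using subgrp_diff[OF sW w cycW] by simp
          then obtain c where c: "c \<in> vecs UNIV {..<d}" "w - cyc a = lin {..<d} b c"
            using bij by (auto simp: bij_betw_def)
          define c2 where "c2 q = (if q < d then c q else if q < d + e then a (q - d) else 0)" for q
          have "lin {..<d} b c2 = lin {..<d} b c" by (simp add: lin_def c2_def)
          moreover have "cyc (\<lambda>i. c2 (d + i)) = cyc a" unfolding cyc_def by (simp add: c2_def)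
          ultimately have "lin {..<d + e} b2 c2 = w" unfolding lin2 c(2)[symmetric] by simp
          moreover have "c2 \<in> vecs UNIV {..<d + e}" by (simp add: vecs_def c2_def)
          ultimately show "w \<in> lin {..<d + e} b2 ` vecs UNIV {..<d + e}" by blast
        qed
      qed
    qed
    have "chain_basis X W (d + e) lev2 b2" unfolding chain_basis_def using good step bij2 by blast
    then show ?thesis by blast
  qed
qed

section \<open>Matrices acting on row vectors\<close>

definition act :: "'k::comm_ring_1 mat \<Rightarrow> nat \<Rightarrow> (nat \<Rightarrow> 'k) \<Rightarrow> (nat \<Rightarrow> 'k)" where
  "act A n f = (\<lambda>j. if j < n then \<Sum>i<n. f i * A $$ (i, j) else 0)"

lemma act_apply: "act A n f j = (if j < n then \<Sum>i<n. f i * A $$ (i, j) else 0)"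
  by (simp add: act_def)

lemma lin_map_act: "lin_map (act A n)"
  unfolding lin_map_def
  by (auto simp: fun_eq_iff act_apply sum_subtractf sum_distrib_left left_diff_distrib mult.assoc)

lemma act_mem_UNIV: "act A n f \<in> vecs UNIV {..<n}"
  by (simp add: vecs_def act_apply)

lemma act_mem:
  assumes R: "subring R" and A: "\<And>i j. i < n \<Longrightarrow> j < n \<Longrightarrow> A $$ (i, j) \<in> R" and f: "f \<in> vecs R {..<n}"
  shows "act A n f \<in> vecs R {..<n}"
  unfolding vecs_def
proof (intro CollectI allI conjI impI)
  fix j
  show "act A n f j \<in> R"
    using f A by (auto simp: act_apply vecs_def subring_zero[OF R] intro!: subgrp_sum subring_subgrp[OF R] subring_mult[OF R])
qed (simp add: act_apply)

text \<open>On row vectors the left factor of a product acts first.\<close>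

lemma act_mult:
  assumes "A \<in> carrier_mat n n" "B \<in> carrier_mat n n"
  shows "act (A * B) n f = act B n (act A n f)"
proof
  fix j
  show "act (A * B) n f j = act B n (act A n f) j"
  proof (cases "j < n")
    case True
    have "act (A * B) n f j = (\<Sum>i<n. f i * (\<Sum>k<n. A $$ (i, k) * B $$ (k, j)))"
      using assms True by (simp add: act_apply scalar_prod_def atLeast0LessThan)
    also have "\<dots> = (\<Sum>k<n. \<Sum>i<n. f i * A $$ (i, k) * B $$ (k, j))"
      by (subst sum.swap) (simp add: sum_distrib_left mult.assoc)
    also have "\<dots> = act B n (act A n f) j"
      using True by (simp add: act_apply sum_distrib_right)
    finally show ?thesis .
  qed (simp add: act_apply)
qed

lemma act_one: "f \<in> vecs UNIV {..<n} \<Longrightarrow> act (1\<^sub>m n) n f = f"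
proof
  fix j assume f: "f \<in> vecs UNIV {..<n}"
  have "(\<Sum>i<n. f i * 1\<^sub>m n $$ (i, j)) = (\<Sum>i<n. if i = j then f j else 0)" if "j < n"
    using that by (intro sum.cong) auto
  then show "act (1\<^sub>m n) n f j = f j" using f by (auto simp: act_apply vecs_def)
qed

lemma act_delta: "i < n \<Longrightarrow> j < n \<Longrightarrow> act A n (delta i) j = A $$ (i, j)"
proof -
  assume ij: "i < n" "j < n"
  have "(\<Sum>k<n. delta i k * A $$ (k, j)) = (\<Sum>k<n. if k = i then A $$ (i, j) else 0)"
    by (intro sum.cong) auto
  then show ?thesis using ij by (simp add: act_apply)
qed

lemma act_inject:
  assumes "A \<in> carrier_mat n n" "B \<in> carrier_mat n n" "\<And>f. f \<in> vecs UNIV {..<n} \<Longrightarrow> act A n f = act B n f"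
  shows "A = B"
proof (rule eq_matI)
  fix i j assume "i < dim_row B" "j < dim_col B"
  then have ij: "i < n" "j < n" using assms by auto
  then have "delta i \<in> vecs UNIV {..<n}" by (auto simp: vecs_def)
  then show "A $$ (i, j) = B $$ (i, j)" using assms(3) act_delta[OF ij] by metis
qed (use assms in auto)

lemma act_pow:
  assumes A: "A \<in> carrier_mat n n" and f: "f \<in> vecs UNIV {..<n}"
  shows "act (A ^\<^sub>m k) n f = (act A n ^^ k) f"
proof (induction k)
  case 0
  then show ?case using act_one[OF f] A by simp
next
  case (Suc k)
  then show ?case using act_mult[OF pow_carrier_mat[OF A, of k] A] by simp
qed

lemma act_mat:
  "act (mat n n (\<lambda>(i, j). b i j)) n f = restr {..<n} (lin {..<n} b f)"
  by (auto simp: fun_eq_iff act_apply lin_def)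

text \<open>The rows of the inverse are the preimages of the unit vectors; a left inverse of a
  square matrix over a field is also a right inverse.\<close>

lemma act_inverse:
  fixes P :: "'k::field mat"
  assumes P: "P \<in> carrier_mat n n" and bij: "bij_betw (act P n) (vecs UNIV {..<n}) (vecs UNIV {..<n})"
  shows "\<exists>Q \<in> carrier_mat n n. P * Q = 1\<^sub>m n \<and> Q * P = 1\<^sub>m n"
proof -
  have "\<exists>g. g \<in> vecs UNIV {..<n} \<and> act P n g = delta i" if "i < n" for i
  proof -
    have "(delta i :: nat \<Rightarrow> 'k) \<in> vecs UNIV {..<n}" using that by (auto simp: vecs_def)
    then have "delta i \<in> act P n ` vecs UNIV {..<n}" using bij by (simp add: bij_betw_def)
    then obtain g where "g \<in> vecs UNIV {..<n}" "delta i = act P n g" by (rule imageE)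
    then show ?thesis by metis
  qed
  then obtain g where g: "\<And>i. i < n \<Longrightarrow> g i \<in> vecs UNIV {..<n} \<and> act P n (g i) = delta i" by metis
  define Q where "Q = mat n n (\<lambda>(i, j). g i j)"
  have Q: "Q \<in> carrier_mat n n" by (simp add: Q_def)
  have "Q * P = 1\<^sub>m n"
  proof (rule act_inject)
    fix f :: "nat \<Rightarrow> 'k" assume f: "f \<in> vecs UNIV {..<n}"
    have "restr {..<n} (lin {..<n} g f) = lin {..<n} g f"
      unfolding restr_lin by (rule lin_cong) (use g in \<open>auto simp: fun_eq_iff vecs_def\<close>)
    then have "act (Q * P) n f = act P n (lin {..<n} g f)"
      unfolding act_mult[OF Q P] unfolding Q_def act_mat by simp
    also have "\<dots> = lin {..<n} (\<lambda>i. act P n (g i)) f" by (rule lin_map_lin[OF lin_map_act])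
    also have "\<dots> = lin {..<n} delta f" by (rule lin_cong) (use g in simp)
    also have "\<dots> = f" by (rule lin_deltas) (use f in \<open>auto simp: vecs_def\<close>)
    also have "\<dots> = act (1\<^sub>m n) n f" by (rule act_one[OF f, symmetric])
    finally show "act (Q * P) n f = act (1\<^sub>m n) n f" .
  qed (use P Q in auto)
  then show ?thesis using mat_mult_left_right_inverse[OF Q P] Q by blast
qed

text \<open>In matrix form the last assumption reads \<open>P * B = A * P\<close>, and
  \<open>P\<close> is invertible by \<open>act_inverse\<close>.\<close>

lemma similar_matI_act:
  fixes A B P :: "'k::field mat"
  assumes c: "A \<in> carrier_mat n n" "B \<in> carrier_mat n n" "P \<in> carrier_mat n n"
    and bij: "bij_betw (act P n) (vecs UNIV {..<n}) (vecs UNIV {..<n})"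
    and eq: "\<And>f. f \<in> vecs UNIV {..<n} \<Longrightarrow> act B n (act P n f) = act P n (act A n f)"
  shows "similar_mat A B"
proof -
  obtain Q where Q: "Q \<in> carrier_mat n n" "P * Q = 1\<^sub>m n" "Q * P = 1\<^sub>m n" using act_inverse[OF c(3) bij] by blast
  have "P * B = A * P"
    by (rule act_inject[of _ n]) (use c eq in \<open>auto simp: act_mult\<close>)
  then have "P * B * Q = A * (P * Q)" using c Q by (simp add: assoc_mult_mat[of _ n n _ n _ n])
  then have "A = P * B * Q" using c Q by simp
  then have "similar_mat_wit A B P Q" using c Q by (auto simp: similar_mat_wit_def Let_def)
  then show ?thesis unfolding similar_mat_def by blast
qed

text \<open>Injectivity of the coefficient map is linear independence of the vectors
  \<open>b q\<close>, and these lie in the span of \<open>n\<close> unit vectors. Applied over the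
  rationals, it also yields relations between numbers in \<open>k\<close>.\<close>

lemma dimension_le:
  fixes b :: "nat \<Rightarrow> nat \<Rightarrow> 'k::field"
  assumes inj: "inj_on (lin {..<d} b) (vecs UNIV {..<d})" and b: "\<And>q. q < d \<Longrightarrow> b q \<in> vecs UNIV {..<n}"
  shows "d \<le> n"
proof -
  interpret fv: vector_space "smul :: 'k \<Rightarrow> (nat \<Rightarrow> 'k) \<Rightarrow> _" by (rule vector_space_smul)
  have d_mem: "(delta q :: nat \<Rightarrow> 'k) \<in> vecs UNIV {..<d}" if "q < d" for q
    using that by (auto simp: vecs_def)
  have injb: "inj_on b {..<d}"
  proof (rule inj_onI)
    fix p q assume pq: "p \<in> {..<d}" "q \<in> {..<d}" "b p = b q"
    then have "lin {..<d} b (delta p) = lin {..<d} b (delta q)" by (simp add: lin_delta)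
    then have "(delta p :: nat \<Rightarrow> 'k) = delta q" using inj_onD[OF inj] d_mem pq by blast
    then have "(delta p :: nat \<Rightarrow> 'k) p = delta q p" by simp
    then show "p = q" by (simp split: if_splits)
  qed
  have "\<not> fv.dependent (b ` {..<d})"
  proof
    assume "fv.dependent (b ` {..<d})"
    then obtain u where u: "\<exists>v\<in>b ` {..<d}. u v \<noteq> 0" "(\<Sum>v\<in>b ` {..<d}. smul (u v) v) = 0"
      using fv.dependent_finite[of "b ` {..<d}"] by auto
    define c where "c q = (if q < d then u (b q) else 0)" for q
    have "lin {..<d} b c = (\<Sum>q<d. smul (u (b q)) (b q))" unfolding lin_def by (rule sum.cong) (simp_all add: c_def)
    also have "\<dots> = 0" using u(2) sum.reindex[OF injb, of "\<lambda>v. smul (u v) v"] by (simp add: comp_def)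
    also have "0 = lin {..<d} b 0" by (simp add: lin_zero)
    finally have eq: "lin {..<d} b c = lin {..<d} b 0" .
    have c0: "c = 0" by (rule inj_onD[OF inj, OF eq]) (auto simp: vecs_def c_def)
    have "u (b q) = 0" if "q < d" for q using fun_cong[OF c0, of q] that by (simp add: c_def)
    then show False using u(1) by auto
  qed
  moreover have "b ` {..<d} \<subseteq> fv.span (delta ` {..<n})"
  proof (rule image_subsetI)
    fix q assume "q \<in> {..<d}"
    then have "b q \<in> vecs UNIV {..<n}" using b by simp
    then have "b q = lin {..<n} delta (b q)" by (intro lin_deltas[symmetric]) (auto simp: vecs_def)
    also have "\<dots> \<in> fv.span (delta ` {..<n})"
      unfolding lin_def by (intro fv.span_sum fv.span_scale fv.span_base imageI)
    finally show "b q \<in> fv.span (delta ` {..<n})" .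
  qed
  moreover have "finite (delta ` {..<n} :: (nat \<Rightarrow> 'k) set)" by simp
  ultimately have "card (b ` {..<d}) \<le> card (delta ` {..<n} :: (nat \<Rightarrow> 'k) set)"
    using fv.independent_span_bound by blast
  also have "\<dots> \<le> n" using card_image_le[of "{..<n}" "delta :: nat \<Rightarrow> nat \<Rightarrow> 'k"] by simp
  finally show ?thesis using card_image[OF injb] by simp
qed

text \<open>The rows of \<open>P\<close> are a chain basis of the space of all row vectors. Its
  length \<open>d\<close> equals \<open>n\<close> by \<open>dimension_le\<close>, used once for the
  basis and once for the preimages of the unit vectors.\<close>

lemma nilpotent_chain_form:
  fixes A :: "'k::field mat"
  assumes A: "A \<in> carrier_mat n n" and nil: "nilpotent_mat A"
  shows "\<exists>lev P. good_lev lev \<and> P \<in> carrier_mat n n \<and> bij_betw (act P n) (vecs UNIV {..<n}) (vecs UNIV {..<n}) \<and>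
    (\<forall>f\<in>vecs UNIV {..<n}. act A n (act P n f) = act P n (shift n lev f))"
proof -
  interpret fv: vector_space "smul :: 'k \<Rightarrow> (nat \<Rightarrow> 'k) \<Rightarrow> _" by (rule vector_space_smul)
  let ?V = "vecs UNIV {..<n} :: (nat \<Rightarrow> 'k) set"
  obtain k where k: "A ^\<^sub>m k = 0\<^sub>m n n" using nil A by (auto simp: nilpotent_mat_def)
  have UN: "subring (UNIV :: 'k set)" by (simp add: subring_def subgrp_def)
  have nilp: "(act A n ^^ k) f = 0" if "f \<in> ?V" for f
    unfolding act_pow[OF A that, symmetric] k by (auto simp: fun_eq_iff act_apply)
  have bound: "finite S \<and> card S \<le> n" if S: "\<not> fv.dependent S" "S \<subseteq> ?V" for S
  proof -
    have "S \<subseteq> fv.span (delta ` {..<n})"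
    proof
      fix f assume "f \<in> S"
      then have "f \<in> ?V" using S(2) by blast
      then have "f = lin {..<n} delta f" by (intro lin_deltas[symmetric]) (auto simp: vecs_def)
      also have "\<dots> \<in> fv.span (delta ` {..<n})"
        unfolding lin_def by (intro fv.span_sum fv.span_scale fv.span_base imageI)
      finally show "f \<in> fv.span (delta ` {..<n})" .
    qed
    moreover have "finite (delta ` {..<n} :: (nat \<Rightarrow> 'k) set)" by simp
    ultimately have "finite S \<and> card S \<le> card (delta ` {..<n} :: (nat \<Rightarrow> 'k) set)"
      using fv.independent_span_bound S(1) by blast
    then show ?thesis using card_image_le[of "{..<n}" "delta :: nat \<Rightarrow> nat \<Rightarrow> 'k"] by simp
  qed
  have "act A n ` ?V \<subseteq> ?V" using act_mem_UNIV by blast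
  from chain_basis_exists[OF lin_map_act submod_vecs[OF UN] this nilp bound]
  obtain d lev b where cb: "chain_basis (act A n) ?V d lev b" by blast
  have bij: "bij_betw (lin {..<d} b) (vecs UNIV {..<d}) ?V" and good: "good_lev lev" using cb by (auto simp: chain_basis_def)
  have bV: "b q \<in> ?V" if "q < d" for q
  proof -
    have "(delta q :: nat \<Rightarrow> 'k) \<in> vecs UNIV {..<d}" using that by (auto simp: vecs_def)
    then have "lin {..<d} b (delta q) \<in> ?V" using bij by (auto simp: bij_betw_def)
    then show ?thesis using lin_delta[of "{..<d}" q b] that by simp
  qed
  have "d \<le> n" using dimension_le[OF _ bV] bij by (auto simp: bij_betw_def)
  moreover have "n \<le> d"
  proof -
    have "\<exists>g. g \<in> vecs UNIV {..<d} \<and> lin {..<d} b g = delta i" if "i < n" for i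
    proof -
      have "(delta i :: nat \<Rightarrow> 'k) \<in> ?V" using that by (auto simp: vecs_def)
      then have "delta i \<in> lin {..<d} b ` vecs UNIV {..<d}" using bij by (simp add: bij_betw_def)
      then obtain g where "g \<in> vecs UNIV {..<d}" "delta i = lin {..<d} b g" by (rule imageE)
      then show ?thesis by metis
    qed
    then obtain g where g: "\<And>i. i < n \<Longrightarrow> g i \<in> vecs UNIV {..<d} \<and> lin {..<d} b (g i) = delta i" by metis
    have lm: "lin_map (lin {..<d} b)" by (simp add: lin_map_def lin_diff lin_smul)
    have inv: "lin {..<d} b (lin {..<n} g f) = f" if "f \<in> ?V" for f
    proof -
      have "lin {..<d} b (lin {..<n} g f) = lin {..<n} (\<lambda>i. lin {..<d} b (g i)) f" by (rule lin_map_lin[OF lm])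
      also have "\<dots> = lin {..<n} delta f" by (rule lin_cong) (use g in simp)
      also have "\<dots> = f" by (rule lin_deltas) (use that in \<open>auto simp: vecs_def\<close>)
      finally show ?thesis .
    qed
    have "inj_on (lin {..<n} g) ?V" by (rule inj_on_inverseI) (rule inv)
    then show ?thesis using g by (intro dimension_le) auto
  qed
  ultimately have dn: "d = n" by simp
  define P where "P = mat n n (\<lambda>(i, j). b i j)"
  have actP: "act P n f = lin {..<n} b f" for f
    unfolding P_def act_mat restr_lin by (rule lin_cong) (use bV dn in \<open>auto simp: fun_eq_iff vecs_def\<close>)
  have "P \<in> carrier_mat n n" by (simp add: P_def)
  moreover have "bij_betw (act P n) ?V ?V" using bij unfolding dn by (simp add: actP[abs_def])
  moreover have "act A n (act P n f) = act P n (shift n lev f)" for f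
    unfolding actP using chain_basis_intertwine[OF lin_map_act cb] unfolding dn by blast
  ultimately show ?thesis using good by blast
qed

section \<open>Chain lengths and heights\<close>

lemma good_levD: "good_lev lev \<Longrightarrow> 0 < lev q \<Longrightarrow> 0 < q \<and> lev q = Suc (lev (q - 1))"
proof (cases q)
  case (Suc p)
  assume "good_lev lev" "0 < lev q"
  moreover from this have "lev (Suc p) = 0 \<or> lev (Suc p) = Suc (lev p)" unfolding good_lev_def by blast
  ultimately show ?thesis unfolding Suc by simp
qed (simp add: good_lev_def)

lemma good_lev_sub: "good_lev lev \<Longrightarrow> i \<le> lev q \<Longrightarrow> i \<le> q \<and> lev (q - i) = lev q - i"
proof (induction i)
  case (Suc i)
  then have i: "i \<le> q" "lev (q - i) = lev q - i" "0 < lev (q - i)" by auto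
  from good_levD[OF Suc.prems(1) i(3)] i(2) show ?case by auto
qed simp

text \<open>For \<open>good_lev lev\<close> and an index \<open>q < n\<close> of height 0 this is
  the length of the chain starting at \<open>q\<close>, the last chain being cut off at
  \<open>n\<close>. For every other \<open>q\<close> it is 0.\<close>

definition block_size :: "nat \<Rightarrow> (nat \<Rightarrow> nat) \<Rightarrow> nat \<Rightarrow> nat" where
  "block_size n lev q = card {j. q + j < n \<and> lev (q + j) = j}"

text \<open>Going back along a chain lowers the height one by one, so the heights reached from
  \<open>q\<close> form an initial segment.\<close>

lemma block_size:
  assumes lev: "good_lev lev"
  shows "q + j < n \<and> lev (q + j) = j \<longleftrightarrow> j < block_size n lev q"
proof -
  let ?J = "{j. q + j < n \<and> lev (q + j) = j}"
  have down: "i \<in> ?J" if "j \<in> ?J" "i \<le> j" for i j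
    using good_lev_sub[OF lev, of "j - i" "q + j"] that by auto
  have fin: "finite ?J" by (rule finite_subset[of _ "{..<n}"]) auto
  have "?J = {..<card ?J}"
  proof
    show "?J \<subseteq> {..<card ?J}"
    proof
      fix j assume "j \<in> ?J"
      then have "{..j} \<subseteq> ?J" using down by blast
      then have "card {..j} \<le> card ?J" by (intro card_mono fin)
      then show "j \<in> {..<card ?J}" by simp
    qed
    then show "{..<card ?J} \<subseteq> ?J" using card_subset_eq[of "{..<card ?J}" ?J] fin by simp
  qed
  then show ?thesis unfolding block_size_def by blast
qed

text \<open>Going back \<open>j\<close> places takes an index of height \<open>j\<close> to the
  start of a chain of length more than \<open>j\<close>, and every such start arises once.\<close>

lemma card_starts:
  assumes lev: "good_lev lev"
  shows "card {q \<in> level_set n lev 0. j < block_size n lev q} = card (level_set n lev j)"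
proof -
  have "bij_betw (\<lambda>q. q + j) {q \<in> level_set n lev 0. j < block_size n lev q} (level_set n lev j)"
  proof (rule bij_betw_imageI)
    show "inj_on (\<lambda>q. q + j) {q \<in> level_set n lev 0. j < block_size n lev q}" by (rule inj_onI) simp
    show "(\<lambda>q. q + j) ` {q \<in> level_set n lev 0. j < block_size n lev q} = level_set n lev j"
    proof
      show "(\<lambda>q. q + j) ` {q \<in> level_set n lev 0. j < block_size n lev q} \<subseteq> level_set n lev j"
        using block_size[OF lev, of _ j n] by (auto simp: level_set_def)
      show "level_set n lev j \<subseteq> (\<lambda>q. q + j) ` {q \<in> level_set n lev 0. j < block_size n lev q}"
      proof
        fix p assume p: "p \<in> level_set n lev j"
        then have *: "j \<le> p" "lev (p - j) = 0" using good_lev_sub[OF lev, of j p] by (auto simp: level_set_def)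
        then have "p - j \<in> level_set n lev 0" "j < block_size n lev (p - j)"
          using p block_size[OF lev, of "p - j" j n] by (auto simp: level_set_def)
        then show "p \<in> (\<lambda>q. q + j) ` {q \<in> level_set n lev 0. j < block_size n lev q}"
          using * by (intro image_eqI[of _ _ "p - j"]) auto
      qed
    qed
  qed
  then show ?thesis by (rule bij_betw_same_card)
qed

lemma bij_betw_fibres:
  fixes f g :: "nat \<Rightarrow> nat"
  assumes fin: "finite Z" "finite Z'" and card: "\<And>s. card {q \<in> Z. f q = s} = card {q \<in> Z'. g q = s}"
  shows "\<exists>\<tau>. bij_betw \<tau> Z Z' \<and> (\<forall>q\<in>Z. g (\<tau> q) = f q)"
proof -
  have "\<exists>h. bij_betw h {q \<in> Z. f q = s} {q \<in> Z'. g q = s}" for s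
    using fin card by (intro finite_same_card_bij) auto
  then obtain h where h: "\<And>s. bij_betw (h s) {q \<in> Z. f q = s} {q \<in> Z'. g q = s}" by metis
  define \<tau> where "\<tau> q = h (f q) q" for q
  have \<tau>: "\<tau> q \<in> Z'" "g (\<tau> q) = f q" if "q \<in> Z" for q
    using h[of "f q"] that unfolding \<tau>_def bij_betw_def by auto
  have "bij_betw \<tau> Z Z'"
  proof (rule bij_betw_imageI)
    show "inj_on \<tau> Z"
    proof (rule inj_onI)
      fix p q assume pq: "p \<in> Z" "q \<in> Z" "\<tau> p = \<tau> q"
      then have "f p = f q" using \<tau>(2) by metis
      then have "h (f p) p = h (f p) q" using pq(3) by (simp add: \<tau>_def)
      have inj: "inj_on (h (f p)) {q \<in> Z. f q = f p}" using h[of "f p"] by (simp add: bij_betw_def)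
      show "p = q" by (rule inj_onD[OF inj, OF \<open>h (f p) p = h (f p) q\<close>]) (use pq \<open>f p = f q\<close> in simp_all)
    qed
    show "\<tau> ` Z = Z'"
    proof
      show "\<tau> ` Z \<subseteq> Z'" using \<tau>(1) by blast
      show "Z' \<subseteq> \<tau> ` Z"
      proof
        fix y assume "y \<in> Z'"
        then have "y \<in> h (g y) ` {q \<in> Z. f q = g y}" using h[of "g y"] by (simp add: bij_betw_def)
        then obtain x where "x \<in> Z" "f x = g y" "y = h (g y) x" by auto
        then show "y \<in> \<tau> ` Z" unfolding \<tau>_def by (intro image_eqI[of _ _ x]) simp_all
      qed
    qed
  qed
  then show ?thesis using \<tau>(2) by blast
qed

lemma card_level_sets: "n = (\<Sum>h\<in>lev ` {..<n}. card (level_set n lev h))"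
proof -
  have "card {..<n} = (\<Sum>h\<in>lev ` {..<n}. card {q \<in> {..<n}. lev q = h})"
    using sum.group[of "{..<n}" "lev ` {..<n}" lev "\<lambda>_. 1::nat"] by simp
  then show ?thesis by (simp add: level_set_def)
qed

lemma level_cards_size:
  assumes "\<And>h. card (level_set n lev h) = card (level_set n' lev' h)"
  shows "n = n'"
proof -
  let ?H = "lev ` {..<n} \<union> lev' ` {..<n'}"
  have *: "n = (\<Sum>h\<in>H. card (level_set n lev h))" if "lev ` {..<n} \<subseteq> H" "finite H" for H n lev
  proof -
    have "(\<Sum>h\<in>lev ` {..<n}. card (level_set n lev h)) = (\<Sum>h\<in>H. card (level_set n lev h))"
      using that by (intro sum.mono_neutral_left) (auto simp: level_set_def)
    then show ?thesis using card_level_sets[of n lev] by simp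
  qed
  show ?thesis using *[of lev n ?H] *[of lev' n' ?H] assms by simp
qed

text \<open>The number of chains of length \<open>s > 0\<close> is the number of indices at height
  \<open>s - 1\<close> minus the number at height \<open>s\<close>. Equal level sizes thus allow
  chains of equal length to be matched, and \<open>\<sigma>\<close> moves an index to the same
  height in the matched chain.\<close>

lemma level_permutation:
  assumes lev: "good_lev lev" and lev': "good_lev lev'"
    and card: "\<And>h. card (level_set n lev h) = card (level_set n lev' h)"
  shows "\<exists>\<sigma>. bij_betw \<sigma> {..<n} {..<n} \<and> (\<forall>q<n. lev' (\<sigma> q) = lev q \<and> (0 < lev q \<longrightarrow> \<sigma> q = Suc (\<sigma> (q - 1))))"
proof -
  let ?Z = "level_set n lev 0" let ?Z' = "level_set n lev' 0"
  have split: "card {q \<in> level_set n lev 0. block_size n lev q = s} =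
      (if s = 0 then 0 else card (level_set n lev (s - 1)) - card (level_set n lev s))"
    if lev: "good_lev lev" for lev s
  proof (cases s)
    case 0
    have "0 < block_size n lev q" if "q \<in> level_set n lev 0" for q
      using block_size[OF lev, of q 0 n] that by (simp add: level_set_def)
    then have "{q \<in> level_set n lev 0. block_size n lev q = s} = {}" unfolding 0 by auto
    then show ?thesis unfolding 0 by (metis card.empty)
  next
    case (Suc t)
    have eq: "{q \<in> level_set n lev 0. block_size n lev q = s} =
        {q \<in> level_set n lev 0. t < block_size n lev q} - {q \<in> level_set n lev 0. s < block_size n lev q}"
      unfolding Suc by auto
    have "card {q \<in> level_set n lev 0. block_size n lev q = s} = card {q \<in> level_set n lev 0. t < block_size n lev q} - card {q \<in> level_set n lev 0. s < block_size n lev q}"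
      unfolding eq
    proof (rule card_Diff_subset)
      show "finite {q \<in> level_set n lev 0. s < block_size n lev q}"
        by (rule finite_subset[OF _ finite_level_set]) blast
    qed (auto simp: Suc)
    also have "\<dots> = card (level_set n lev t) - card (level_set n lev s)"
      by (simp only: card_starts[OF lev, of n t] card_starts[OF lev, of n s])
    finally show ?thesis by (simp only: Suc) simp
  qed
  have "card {q \<in> ?Z. block_size n lev q = s} = card {q \<in> ?Z'. block_size n lev' q = s}" for s
    unfolding split[OF lev] split[OF lev'] card ..
  from bij_betw_fibres[OF finite_level_set finite_level_set this]
  obtain \<tau> where \<tau>: "bij_betw \<tau> ?Z ?Z'" "\<And>q. q \<in> ?Z \<Longrightarrow> block_size n lev' (\<tau> q) = block_size n lev q" by blast
  define \<sigma> where "\<sigma> q = \<tau> (q - lev q) + lev q" for q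
  have start: "q - lev q \<in> ?Z" "lev q < block_size n lev (q - lev q)" "lev q \<le> q" if "q < n" for q
    using good_lev_sub[OF lev, of "lev q" q] block_size[OF lev, of "q - lev q" "lev q" n] that by (auto simp: level_set_def)
  have \<sigma>: "\<sigma> q < n" "lev' (\<sigma> q) = lev q" if "q < n" for q
    using block_size[OF lev', of "\<tau> (q - lev q)" "lev q" n] \<tau>(2)[OF start(1)[OF that]] start(2)[OF that]
    unfolding \<sigma>_def by auto
  have inj: "inj_on \<sigma> {..<n}"
  proof (rule inj_onI)
    fix p q assume pq: "p \<in> {..<n}" "q \<in> {..<n}" "\<sigma> p = \<sigma> q"
    then have l: "lev p = lev q" using \<sigma>(2)[of p] \<sigma>(2)[of q] by simp
    then have "\<tau> (p - lev p) = \<tau> (q - lev q)" using pq(3) by (simp add: \<sigma>_def)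
    then have "p - lev p = q - lev q" using \<tau>(1) start(1) pq by (auto simp: bij_betw_def dest: inj_onD)
    then show "p = q" using l start(3)[of p] start(3)[of q] pq by simp
  qed
  moreover have "\<sigma> ` {..<n} = {..<n}" using \<sigma>(1) inj by (intro endo_inj_surj) auto
  moreover have "\<sigma> q = Suc (\<sigma> (q - 1))" if "q < n" "0 < lev q" for q
    using good_levD[OF lev that(2)] by (auto simp: \<sigma>_def)
  ultimately show ?thesis using \<sigma>(2) by (auto simp: bij_betw_def)
qed

definition shift_mat :: "nat \<Rightarrow> (nat \<Rightarrow> nat) \<Rightarrow> 'k::comm_ring_1 mat" where
  "shift_mat n lev = mat n n (\<lambda>(i, j). if 0 < lev j \<and> j = Suc i then 1 else 0)"

lemma shift_mat_carrier: "shift_mat n lev \<in> carrier_mat n n"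
  by (simp add: shift_mat_def)

lemma act_shift_mat:
  assumes "good_lev lev" shows "act (shift_mat n lev) n f = shift n lev f"
proof
  fix j
  show "act (shift_mat n lev) n f j = shift n lev f j"
  proof (cases "j < n \<and> 0 < lev j")
    case True
    then obtain i where i: "j = Suc i" using good_levD[OF assms, of j] by (cases j) auto
    have "(\<Sum>k<n. f k * shift_mat n lev $$ (k, j)) = (\<Sum>k<n. if k = i then f i else 0)"
      using True i by (intro sum.cong) (auto simp: shift_mat_def)
    then show ?thesis using True i by (simp add: act_apply shift_apply)
  next
    case False
    have "(\<Sum>k<n. f k * shift_mat n lev $$ (k, j)) = 0" if "j < n"
      using False that by (intro sum.neutral) (auto simp: shift_mat_def)
    then show ?thesis using False by (auto simp: act_apply shift_apply)
  qed
qed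

text \<open>The permutation matrix of the \<open>\<sigma>\<close> from
  \<open>level_permutation\<close> conjugates one shift into the other.\<close>

lemma similar_shift_mat:
  assumes lev: "good_lev lev" and lev': "good_lev lev'"
    and card: "\<And>h. card (level_set n lev h) = card (level_set n lev' h)"
  shows "similar_mat (shift_mat n lev :: 'k::field mat) (shift_mat n lev')"
proof -
  let ?V = "vecs UNIV {..<n} :: (nat \<Rightarrow> 'k) set"
  obtain \<sigma> where \<sigma>: "bij_betw \<sigma> {..<n} {..<n}" "\<And>q. q < n \<Longrightarrow> lev' (\<sigma> q) = lev q"
    "\<And>q. q < n \<Longrightarrow> 0 < lev q \<Longrightarrow> \<sigma> q = Suc (\<sigma> (q - 1))"
    using level_permutation[OF lev lev' card] by blast
  have \<sigma>n: "\<sigma> q < n" if "q < n" for q using \<sigma>(1) that by (auto simp: bij_betw_def)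
  have \<sigma>inj: "\<sigma> p = \<sigma> q \<longleftrightarrow> p = q" if "p < n" "q < n" for p q
    using \<sigma>(1) that by (auto simp: bij_betw_def inj_on_def)
  have \<sigma>surj: "\<exists>q<n. p = \<sigma> q" if "p < n" for p using \<sigma>(1) that by (auto simp: bij_betw_def)
  define P where "P = (mat n n (\<lambda>(i, j). if j = \<sigma> i then 1 else 0) :: 'k mat)"
  have P: "P \<in> carrier_mat n n" by (simp add: P_def)
  have actP: "act P n f (\<sigma> q) = f q" if "q < n" for f q
  proof -
    have "(\<Sum>i<n. f i * P $$ (i, \<sigma> q)) = (\<Sum>i<n. if i = q then f q else 0)"
      using that \<sigma>n \<sigma>inj by (intro sum.cong) (auto simp: P_def)
    then show ?thesis using that \<sigma>n by (simp add: act_apply)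
  qed
  have bij: "bij_betw (act P n) ?V ?V"
  proof (rule bij_betw_imageI)
    show "inj_on (act P n) ?V"
    proof (rule inj_onI, rule ext)
      fix f g q assume fg: "f \<in> ?V" "g \<in> ?V" "act P n f = act P n g"
      show "f q = g q"
      proof (cases "q < n")
        case True
        then show ?thesis using actP[OF True, of f] actP[OF True, of g] fg(3) by simp
      qed (use fg in \<open>auto simp: vecs_def\<close>)
    qed
    show "act P n ` ?V = ?V"
    proof
      show "act P n ` ?V \<subseteq> ?V" using act_mem_UNIV by blast
      show "?V \<subseteq> act P n ` ?V"
      proof
        fix g assume g: "g \<in> ?V"
        have "act P n (restr {..<n} (\<lambda>q. g (\<sigma> q))) = g"
        proof
          fix p
          show "act P n (restr {..<n} (\<lambda>q. g (\<sigma> q))) p = g p"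
          proof (cases "p < n")
            case True
            then obtain q where "q < n" "p = \<sigma> q" using \<sigma>surj by blast
            then show ?thesis by (simp add: actP)
          qed (use g in \<open>auto simp: vecs_def act_apply\<close>)
        qed
        moreover have "restr {..<n} (\<lambda>q. g (\<sigma> q)) \<in> ?V" by (simp add: vecs_def)
        ultimately show "g \<in> act P n ` ?V" by (metis imageI)
      qed
    qed
  qed
  show ?thesis
  proof (rule similar_matI_act[OF shift_mat_carrier shift_mat_carrier P bij])
    fix f :: "nat \<Rightarrow> 'k"
    show "act (shift_mat n lev') n (act P n f) = act P n (act (shift_mat n lev) n f)"
      unfolding act_shift_mat[OF lev] act_shift_mat[OF lev']
    proof
      fix p
      show "shift n lev' (act P n f) p = act P n (shift n lev f) p"
      proof (cases "p < n")
        case True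
        then obtain q where q: "q < n" "p = \<sigma> q" using \<sigma>surj by blast
        show ?thesis
        proof (cases "0 < lev q")
          case True
          then have "\<sigma> q - 1 = \<sigma> (q - 1)" using \<sigma>(3)[OF q(1)] by simp
          moreover have "q - 1 < n" using q by simp
          ultimately show ?thesis using True q \<sigma>(2) \<sigma>n by (simp add: shift_apply actP)
        next
          case False
          then show ?thesis using q \<sigma>(2) \<sigma>n by (simp add: shift_apply actP)
        qed
      qed (simp add: shift_apply act_apply)
    qed
  qed
qed

section \<open>Places of a number field\<close>

lemma nonarch_abs:
  assumes "nonarch_abs f"
  shows nonarch_nonneg: "0 \<le> f x" and nonarch_eq_0: "f x = 0 \<longleftrightarrow> x = 0"
    and nonarch_mult: "f (x * y) = f x * f y" and nonarch_add: "f (x + y) \<le> max (f x) (f y)"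
  using assms by (auto simp: nonarch_abs_def)

lemma nonarch_1: "nonarch_abs f \<Longrightarrow> f 1 = 1"
  using nonarch_mult[of f 1 1] nonarch_eq_0[of f 1] by simp

lemma nonarch_pos: "nonarch_abs f \<Longrightarrow> x \<noteq> 0 \<Longrightarrow> 0 < f x"
  using nonarch_nonneg[of f x] nonarch_eq_0[of f x] by linarith

lemma nonarch_minus: assumes f: "nonarch_abs f" shows "f (- x) = f x"
proof -
  have "f (- 1) * f (- 1) = 1" using nonarch_mult[OF f, of "- 1" "- 1"] nonarch_1[OF f] by simp
  then have "(f (- 1))\<^sup>2 = 1" by (simp add: power2_eq_square)
  then have "f (- 1) = 1" using nonarch_nonneg[OF f, of "- 1"] by (simp add: power2_eq_1_iff)
  then show ?thesis using nonarch_mult[OF f, of "- 1" x] by simp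
qed

lemma nonarch_diff: assumes f: "nonarch_abs f" shows "f (x - y) \<le> max (f x) (f y)"
  using nonarch_add[OF f, of x "- y"] nonarch_minus[OF f, of y] by simp

lemma nonarch_power: "nonarch_abs f \<Longrightarrow> f (x ^ n) = f x ^ n"
  by (induction n) (simp_all add: nonarch_1 nonarch_mult)

lemma nonarch_inverse: assumes f: "nonarch_abs f" shows "f (inverse x) = inverse (f x)"
proof (cases "x = 0")
  case False
  then have "f x * f (inverse x) = 1" using nonarch_mult[OF f, of x "inverse x"] nonarch_1[OF f] by simp
  then show ?thesis by (metis inverse_unique)
next
  case True
  then show ?thesis using nonarch_eq_0[OF f, of 0] by simp
qed

lemma nonarch_divide: assumes f: "nonarch_abs f" shows "f (x / y) = f x / f y"
  by (simp add: divide_inverse nonarch_mult[OF f] nonarch_inverse[OF f])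

lemma nonarch_sum_le:
  assumes f: "nonarch_abs f" and "0 \<le> B" "\<And>i. i \<in> I \<Longrightarrow> f (g i) \<le> B"
  shows "f (sum g I) \<le> B"
  using assms(3)
proof (induction I rule: infinite_finite_induct)
  case (insert i I)
  then have "f (g i) \<le> B" "f (sum g I) \<le> B" by simp_all
  then have "f (g i + sum g I) \<le> B" using nonarch_add[OF f, of "g i" "sum g I"] by linarith
  then show ?case using insert.hyps by simp
qed (use assms nonarch_eq_0[OF f, of 0] in auto)

lemma nonarch_add_eq:
  assumes f: "nonarch_abs f" and "f y < f x" shows "f (x + y) = f x"
proof (rule antisym)
  show "f (x + y) \<le> f x" using nonarch_add[OF f, of x y] assms by simp
  have "f x \<le> max (f (x + y)) (f y)" using nonarch_diff[OF f, of "x + y" y] by simp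
  then show "f x \<le> f (x + y)" using assms by simp
qed

text \<open>The finitely many other summands have a maximal absolute value below that of the
  dominant one, so the ultrametric inequality leaves the dominant value.\<close>

lemma nonarch_sum_eq:
  assumes f: "nonarch_abs f" and "finite I" "j \<in> I" and less: "\<And>i. i \<in> I \<Longrightarrow> i \<noteq> j \<Longrightarrow> f (g i) < f (g j)"
    and pos: "0 < f (g j)"
  shows "f (sum g I) = f (g j)"
proof -
  have "f (sum g (I - {j})) < f (g j)"
  proof (cases "I - {j} = {}")
    case True
    show ?thesis unfolding True using pos nonarch_eq_0[OF f, of 0] by simp
  next
    case False
    define B where "B = Max ((\<lambda>i. f (g i)) ` (I - {j}))"
    have fin: "finite ((\<lambda>i. f (g i)) ` (I - {j}))" using assms by simp
    have "B \<in> (\<lambda>i. f (g i)) ` (I - {j})" unfolding B_def using False fin by (intro Max_in) auto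
    then have B: "B < f (g j)" "0 \<le> B" using less nonarch_nonneg[OF f] by auto
    have "f (sum g (I - {j})) \<le> B"
      by (rule nonarch_sum_le[OF f B(2)]) (use fin in \<open>auto simp: B_def intro: Max_ge\<close>)
    then show ?thesis using B by simp
  qed
  then have "f (g j + sum g (I - {j})) = f (g j)" by (rule nonarch_add_eq[OF f])
  then show ?thesis using assms(2,3) by (simp add: sum.remove)
qed

lemma nonarch_of_nat: assumes f: "nonarch_abs f" shows "f (of_nat m) \<le> 1"
proof (induction m)
  case 0
  then show ?case using nonarch_eq_0[OF f, of 0] by simp
next
  case (Suc m)
  then show ?case using nonarch_add[OF f, of 1 "of_nat m"] nonarch_1[OF f] by simp
qed

lemma nonarch_of_int: assumes f: "nonarch_abs f" shows "f (of_int a) \<le> 1"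
  using nonarch_of_nat[OF f, of "nat \<bar>a\<bar>"] nonarch_minus[OF f, of "of_int a"]
  by (cases "a \<ge> 0") (simp_all add: of_nat_nat)

text \<open>By Bezout 1 is an integer combination of \<open>p\<close> and \<open>a\<close>; if both
  had absolute value below 1, so would 1.\<close>

lemma nonarch_coprime:
  assumes f: "nonarch_abs f" and p: "f (of_nat p) < 1" and c: "coprime (int p) a"
  shows "f (of_int a) = 1"
proof (rule ccontr)
  assume "f (of_int a) \<noteq> 1"
  then have a: "f (of_int a) < 1" using nonarch_of_int[OF f, of a] by simp
  obtain u v where uv: "u * int p + v * a = 1" using c by (metis bezout_int coprime_iff_gcd_eq_1)
  have "of_int u * of_nat p + of_int v * of_int a = (of_int (u * int p + v * a) :: 'a)" by simp
  then have "1 = f (of_int u * of_nat p + of_int v * of_int a)" unfolding uv using nonarch_1[OF f] by simp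
  also have "\<dots> \<le> max (f (of_int u * of_nat p)) (f (of_int v * of_int a))" by (rule nonarch_add[OF f])
  also have "\<dots> < 1"
  proof -
    have "f (of_int u) * f (of_nat p) \<le> 1 * f (of_nat p)" "f (of_int v) * f (of_int a) \<le> 1 * f (of_int a)"
      using nonarch_of_int[OF f] nonarch_nonneg[OF f] by (intro mult_right_mono; simp)+
    then show ?thesis using a p by (simp add: nonarch_mult[OF f])
  qed
  finally show False by simp
qed

lemma equiv_abs: "equiv {f :: 'k::field \<Rightarrow> real. nonarch_abs f} abs_equivalence"
proof (rule equivI)
  show "abs_equivalence \<subseteq> {f :: 'k \<Rightarrow> real. nonarch_abs f} \<times> {f. nonarch_abs f}" by (auto simp: abs_equivalence_def)
  show "refl_on {f :: 'k \<Rightarrow> real. nonarch_abs f} abs_equivalence"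
    unfolding refl_on_def abs_equivalence_def
    by (auto intro!: exI[of _ 1] simp: nonarch_nonneg)
  show "sym (abs_equivalence :: (('k \<Rightarrow> real) \<times> _) set)"
  proof (rule symI)
    fix f g :: "'k \<Rightarrow> real" assume "(f, g) \<in> abs_equivalence"
    then obtain c where c: "nonarch_abs f" "nonarch_abs g" "c > 0" "\<forall>x. g x = f x powr c"
      by (auto simp: abs_equivalence_def)
    have "\<forall>x. f x = g x powr (1 / c)" using c nonarch_nonneg[OF c(1)] by (simp add: powr_powr)
    then show "(g, f) \<in> abs_equivalence" using c by (auto simp: abs_equivalence_def intro!: exI[of _ "1 / c"])
  qed
  show "trans (abs_equivalence :: (('k \<Rightarrow> real) \<times> _) set)"
  proof (rule transI)
    fix f g h :: "'k \<Rightarrow> real" assume "(f, g) \<in> abs_equivalence" "(g, h) \<in> abs_equivalence"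
    then obtain c e where "nonarch_abs f" "nonarch_abs h" "c > 0" "\<forall>x. g x = f x powr c" "e > 0" "\<forall>x. h x = g x powr e"
      by (auto simp: abs_equivalence_def)
    then show "(f, h) \<in> abs_equivalence"
      by (auto simp: abs_equivalence_def powr_powr intro!: exI[of _ "c * e"])
  qed
qed

lemma place_abs_mem: "v \<in> places \<Longrightarrow> place_abs v \<in> v"
  unfolding place_abs_def places_def using in_quotient_imp_non_empty[OF equiv_abs] by (metis some_in_eq)

lemma place_abs_nonarch: "v \<in> places \<Longrightarrow> nonarch_abs (place_abs v)"
  using place_abs_mem in_quotient_imp_subset[OF equiv_abs] unfolding places_def by blast

lemma place_eqI:
  assumes "v \<in> places" "w \<in> places" "(place_abs v, place_abs w) \<in> abs_equivalence"
  shows "v = w"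
  using quotient_eq_iff[OF equiv_abs, of v w "place_abs v" "place_abs w"] assms place_abs_mem
  unfolding places_def by blast

lemma place_of_abs:
  assumes "nonarch_abs f" shows "\<exists>v\<in>places. f \<in> v \<and> (\<exists>c>0. \<forall>x. place_abs v x = f x powr c)"
proof -
  define v where "v = abs_equivalence `` {f}"
  have v: "v \<in> places" unfolding v_def places_def using assms by (intro quotientI) simp
  have "f \<in> v" unfolding v_def using equiv_class_self[OF equiv_abs] assms by blast
  moreover have "(f, place_abs v) \<in> abs_equivalence" using place_abs_mem[OF v] unfolding v_def by simp
  ultimately show ?thesis using v by (auto simp: abs_equivalence_def)
qed

section \<open>Places over a rational prime and weak approximation\<close>

definition over :: "nat \<Rightarrow> ('k::field_char_0 \<Rightarrow> real) set set" where
  "over p = {v \<in> places. place_abs v (of_nat p) < 1}"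

text \<open>The absolute value of a place over \<open>p\<close>, normalised to take the value \<open>1 / p\<close> at \<open>p\<close>.\<close>

definition norm_abs :: "nat \<Rightarrow> ('k::field_char_0 \<Rightarrow> real) set \<Rightarrow> 'k \<Rightarrow> real" where
  "norm_abs p v x = place_abs v x powr (ln (1 / real p) / ln (place_abs v (of_nat p)))"

definition normalised :: "nat \<Rightarrow> ('k::field_char_0 \<Rightarrow> real) \<Rightarrow> bool" where
  "normalised p f \<longleftrightarrow> nonarch_abs f \<and> f (of_nat p) = 1 / real p"

lemma nonarch_powr:
  assumes f: "nonarch_abs f" and c: "c > 0" shows "nonarch_abs (\<lambda>x. f x powr c)"
  unfolding nonarch_abs_def
proof (intro conjI allI)
  fix x y
  show "0 \<le> f x powr c" by simp
  show "(f x powr c = 0) = (x = 0)" using nonarch_eq_0[OF f] by simp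
  show "f (x * y) powr c = f x powr c * f y powr c" using nonarch_nonneg[OF f] by (simp add: nonarch_mult[OF f] powr_mult)
  have "f (x + y) powr c \<le> (max (f x) (f y)) powr c"
    using c by (intro powr_mono2 nonarch_nonneg[OF f] nonarch_add[OF f]) simp
  also have "\<dots> = max (f x powr c) (f y powr c)"
    using c nonarch_nonneg[OF f] powr_mono2[of c "f x" "f y"] powr_mono2[of c "f y" "f x"] by (auto simp: max_def)
  finally show "f (x + y) powr c \<le> max (f x powr c) (f y powr c)" .
  obtain z where z: "z \<noteq> 0" "f z \<noteq> 1" using f by (auto simp: nonarch_abs_def)
  have "f z powr c \<noteq> 1"
    using z c nonarch_pos[OF f z(1)] by (simp add: powr_def)
  then show "\<exists>x. x \<noteq> 0 \<and> f x powr c \<noteq> 1" using z by blast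
qed

lemma norm_abs:
  assumes p: "prime p" and v: "v \<in> over p"
  shows "normalised p (norm_abs p v)" and "norm_abs p v x \<le> 1 \<longleftrightarrow> place_abs v x \<le> 1"
proof -
  have vp: "v \<in> places" "place_abs v (of_nat p) < 1" using v by (auto simp: over_def)
  note f = place_abs_nonarch[OF vp(1)]
  have p1: "p > 1" using p by (rule prime_gt_1_nat)
  have pos: "0 < place_abs v (of_nat p)" using nonarch_pos[OF f] p1 by simp
  then have l1: "ln (place_abs v (of_nat p)) < 0" using vp by simp
  have l2: "ln (1 / real p) < 0" using p1 by simp
  define c where "c = ln (1 / real p) / ln (place_abs v (of_nat p))"
  have c: "c > 0" unfolding c_def using l1 l2 by (simp add: divide_neg_neg)
  have n: "norm_abs p v = (\<lambda>x. place_abs v x powr c)" by (simp add: norm_abs_def c_def fun_eq_iff)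
  have "place_abs v (of_nat p) powr c = 1 / real p"
  proof -
    have "place_abs v (of_nat p) powr c = exp (c * ln (place_abs v (of_nat p)))" using pos by (simp add: powr_def)
    also have "c * ln (place_abs v (of_nat p)) = ln (1 / real p)" unfolding c_def using l1 by simp
    finally show ?thesis using p1 by (simp only: exp_ln) simp
  qed
  then show "normalised p (norm_abs p v)" unfolding normalised_def n using nonarch_powr[OF f c] by simp
  show "norm_abs p v x \<le> 1 \<longleftrightarrow> place_abs v x \<le> 1"
  proof (cases "place_abs v x \<le> 1")
    case True
    then show ?thesis unfolding n using c nonarch_nonneg[OF f, of x] powr_mono2[of c "place_abs v x" 1] by simp
  next
    case False
    then have "1 powr c < place_abs v x powr c" using c by (intro powr_less_mono2) auto
    then show ?thesis unfolding n using False by simp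
  qed
qed

text \<open>Every absolute value is equivalent to its normalisation, so places over \<open>p\<close>
  may be replaced by pairwise distinct real functions.\<close>

lemma norm_abs_inj:
  assumes p: "prime p" and v: "v \<in> over p" "w \<in> over p" and eq: "norm_abs p v = norm_abs p w"
  shows "v = w"
proof (rule place_eqI)
  show vw: "v \<in> places" "w \<in> places" using v by (auto simp: over_def)
  have rel: "(place_abs v, norm_abs p v) \<in> abs_equivalence" if "v \<in> over p" for v
  proof -
    have vp: "v \<in> places" "place_abs v (of_nat p) < 1" using that by (auto simp: over_def)
    note f = place_abs_nonarch[OF vp(1)]
    have p1: "p > 1" using p by (rule prime_gt_1_nat)
    have pos: "0 < place_abs v (of_nat p)" using nonarch_pos[OF f] p1 by simp
    then have "0 < ln (1 / real p) / ln (place_abs v (of_nat p))" using vp p1 by (intro divide_neg_neg) auto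
    then show ?thesis
      using f norm_abs(1)[OF p that] by (auto simp: abs_equivalence_def normalised_def norm_abs_def)
  qed
  show "(place_abs v, place_abs w) \<in> abs_equivalence"
    using rel[OF v(1)] rel[OF v(2)] equivE[OF equiv_abs] unfolding eq by (metis symD transD)
qed

text \<open>Without its power of \<open>p\<close> an integer is prime to \<open>p\<close> and has
  absolute value 1. The size of an integer coefficient is therefore the same at all places over
  \<open>p\<close>.\<close>

lemma normalised_eq_on_int:
  fixes f g :: "'k::field_char_0 \<Rightarrow> real"
  assumes p: "prime p" and fg: "normalised p f" "normalised p g"
  shows "f (of_int a) = g (of_int a)"
proof (cases "a = 0")
  case True
  then show ?thesis using fg nonarch_eq_0[of f 0] nonarch_eq_0[of g 0] by (simp add: normalised_def)
next
  case False
  then obtain b where b: "a = int p ^ multiplicity (int p) a * b" "\<not> int p dvd b"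
    using multiplicity_decompose'[of a "int p"] p by (metis not_prime_unit prime_nat_int_transfer)
  then have c: "coprime (int p) b" using p by (simp add: prime_imp_coprime)
  have val: "h (of_int a) = (1 / real p) ^ multiplicity (int p) a" if h: "normalised p h" for h :: "'k \<Rightarrow> real"
  proof -
    have na: "nonarch_abs h" and hp: "h (of_nat p) = 1 / real p" using h by (auto simp: normalised_def)
    have "h (of_nat p) < 1" unfolding hp using prime_gt_1_nat[OF p] by simp
    then have "h (of_int b) = 1" by (rule nonarch_coprime[OF na _ c])
    moreover have "(of_int a :: 'k) = of_nat p ^ multiplicity (int p) a * of_int b" by (subst b(1)) simp
    ultimately show ?thesis by (simp add: nonarch_mult[OF na] nonarch_power[OF na] hp)
  qed
  show ?thesis unfolding val[OF fg(1)] val[OF fg(2)] ..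
qed

text \<open>After passing to an inverse if necessary, \<open>g y < f y\<close>. A rational
  \<open>m / b\<close> between the logarithms of the two values to base \<open>p\<close> gives
  \<open>x\<close> as \<open>y ^ b\<close> times the \<open>m\<close>-th power of \<open>p\<close>:
  since \<open>f\<close> and \<open>g\<close> agree at \<open>p\<close>, this factor moves the
  threshold between them to 1.\<close>

lemma separate_two:
  assumes p: "prime p" and f: "normalised p f" and g: "normalised p g" and ne: "f \<noteq> g"
  shows "\<exists>x. f x > 1 \<and> g x < 1"
proof -
  have na: "nonarch_abs f" "nonarch_abs g" using f g by (auto simp: normalised_def)
  have p1: "real p > 1" using prime_gt_1_nat[OF p] by simp
  obtain y0 where y0: "f y0 \<noteq> g y0" using ne by auto
  have "\<exists>y. g y < f y \<and> y \<noteq> 0"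
  proof -
    have nz: "y0 \<noteq> 0" using y0 nonarch_eq_0[OF na(1), of 0] nonarch_eq_0[OF na(2), of 0] by auto
    show ?thesis
    proof (cases "g y0 < f y0")
      case False
      then have "f y0 < g y0" using y0 by simp
      then have "g (inverse y0) < f (inverse y0)"
        using nonarch_pos[OF na(1) nz] by (simp add: nonarch_inverse[OF na(1)] nonarch_inverse[OF na(2)] less_imp_inverse_less)
      then show ?thesis using nz by (metis inverse_nonzero_iff_nonzero)
    qed (use nz in blast)
  qed
  then obtain y where y: "g y < f y" "y \<noteq> 0" by blast
  have pos: "0 < g y" "0 < f y" using nonarch_pos[OF na(1) y(2)] nonarch_pos[OF na(2) y(2)] by auto
  have "ln (g y) / ln p < ln (f y) / ln p" using y pos p1 by (simp add: divide_strict_right_mono)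
  then obtain r where r: "r \<in> \<rat>" "ln (g y) / ln p < r" "r < ln (f y) / ln p" using Rats_dense_in_real by blast
  obtain m n where mn: "n > 0" "r = real_of_int m / real_of_int n" using Rats_cases'[OF r(1)] by metis
  define b where "b = nat n"
  have b: "real b = real_of_int n" "b > 0" using mn by (auto simp: b_def)
  define P where "P = (if m \<ge> 0 then of_nat p ^ nat m else inverse (of_nat p ^ nat (- m)) :: 'a)"
  have hP: "h P = exp (- (real_of_int m * ln p))" if h: "normalised p h" for h
  proof -
    have nh: "nonarch_abs h" and hp: "h (of_nat p) = 1 / real p" using h by (auto simp: normalised_def)
    have e: "exp (real k * ln p) = real p ^ k" for k using p1 by (simp add: exp_of_nat_mult)
    show ?thesis
    proof (cases "m \<ge> 0")
      case True
      have "exp (- (real_of_int m * ln p)) = inverse (exp (real (nat m) * ln p))" using True by (simp add: exp_minus)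
      then show ?thesis unfolding e using True by (simp add: P_def nonarch_power[OF nh] hp power_one_over inverse_eq_divide)
    next
      case False
      have "exp (- (real_of_int m * ln p)) = exp (real (nat (- m)) * ln p)" using False by simp
      then show ?thesis unfolding e using False
        by (simp add: P_def nonarch_inverse[OF nh] nonarch_power[OF nh] hp power_one_over)
    qed
  qed
  define x where "x = y ^ b * P"
  have hx: "h x = exp (real b * ln (h y) - real_of_int m * ln p)" if h: "normalised p h" "0 < h y" for h
  proof -
    have nh: "nonarch_abs h" using h by (auto simp: normalised_def)
    show ?thesis unfolding x_def nonarch_mult[OF nh] nonarch_power[OF nh] hP[OF h(1)]
      using h(2) by (simp add: exp_diff exp_of_nat_mult exp_minus divide_inverse)
  qed
  have lp: "ln p > 0" using p1 by simp
  have "ln (g y) < r * ln p" "r * ln p < ln (f y)" using r lp by (simp_all add: pos_divide_less_eq pos_less_divide_eq)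
  then have "real b * ln (g y) < real b * (r * ln p)" "real b * (r * ln p) < real b * ln (f y)" using b(2) by simp_all
  moreover have "real b * (r * ln p) = real_of_int m * ln p" using mn by (simp add: b)
  ultimately have "1 < exp (real b * ln (f y) - real_of_int m * ln p)" "exp (real b * ln (g y) - real_of_int m * ln p) < 1"
    by simp_all
  then have "f x > 1 \<and> g x < 1" using hx[OF f pos(2)] hx[OF g pos(1)] by simp
  then show ?thesis by blast
qed

lemma eventually_power_small:
  fixes H :: "('k \<Rightarrow> real) set"
  assumes "finite H" "\<And>h. h \<in> H \<Longrightarrow> 0 \<le> h z \<and> h z < 1"
  shows "\<exists>n>0. \<forall>h\<in>H. h z ^ n * h y < 1"
proof -
  have "eventually (\<lambda>n. h z ^ n * h y < 1) sequentially" if "h \<in> H" for h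
  proof -
    have "(\<lambda>n. h z ^ n * h y) \<longlonglongrightarrow> 0 * h y"
      using assms(2)[OF that] by (intro tendsto_mult tendsto_const LIMSEQ_power_zero) auto
    then show ?thesis by (rule order_tendstoD) simp
  qed
  then have "eventually (\<lambda>n. \<forall>h\<in>H. h z ^ n * h y < 1) sequentially"
    using assms(1) by (intro eventually_ball_finite) auto
  then have "eventually (\<lambda>n. n > 0 \<and> (\<forall>h\<in>H. h z ^ n * h y < 1)) sequentially"
    using eventually_gt_at_top[of "0::nat"] by eventually_elim auto
  then show ?thesis using eventually_happens[of _ sequentially] by fastforce
qed

text \<open>Weak approximation by induction on \<open>F\<close>. Given \<open>z\<close> for the old
  places and \<open>y\<close> separating \<open>f0\<close> from the new \<open>g\<close>, the
  product \<open>z ^ n * y\<close> works when \<open>g z\<close> is at most 1; otherwise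
  \<open>z ^ n\<close> is replaced by \<open>t\<close>.\<close>

lemma separate:
  assumes p: "prime p" and fin: "finite F" and norm: "\<And>f. f \<in> insert f0 F \<Longrightarrow> normalised p f" and "f0 \<notin> F"
  shows "\<exists>x. f0 x > 1 \<and> (\<forall>g\<in>F. g x < 1)"
  using fin norm \<open>f0 \<notin> F\<close>
proof (induction F rule: finite_induct)
  case empty
  have f0: "nonarch_abs f0" "f0 (of_nat p) = 1 / real p" using empty by (auto simp: normalised_def)
  have "f0 (inverse (of_nat p)) = real p" using f0 by (simp add: nonarch_inverse[OF f0(1)])
  then show ?case using prime_gt_1_nat[OF p] by (intro exI[of _ "inverse (of_nat p)"]) simp
next
  case (insert g F)
  obtain z where z: "f0 z > 1" "\<And>h. h \<in> F \<Longrightarrow> h z < 1" using insert by auto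
  have na: "nonarch_abs h" if "h \<in> insert f0 (insert g F)" for h using insert.prems(1)[OF that] by (simp add: normalised_def)
  note n0 = na[of f0, simplified] and ng = na[of g, simplified]
  obtain y where y: "f0 y > 1" "g y < 1" using separate_two[OF p] insert.prems by (metis insertI1 insertI2)
  obtain n where n: "n > 0" "\<And>h. h \<in> F \<Longrightarrow> h z ^ n * h y < 1"
    using eventually_power_small[of F z y] insert.hyps z(2) na nonarch_nonneg by (metis insertI2)
  show ?case
  proof (cases "g z \<le> 1")
    case True
    have "f0 (z ^ n * y) > 1"
      using z y n by (simp add: nonarch_mult[OF n0] nonarch_power[OF n0] less_1_mult one_less_power)
    moreover have "g (z ^ n * y) < 1"
    proof -
      have "g z ^ n * g y \<le> 1 * g y" using True nonarch_nonneg[OF ng] by (intro mult_right_mono power_le_one) auto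
      then show ?thesis using y by (simp add: nonarch_mult[OF ng] nonarch_power[OF ng])
    qed
    moreover have "h (z ^ n * y) < 1" if "h \<in> F" for h
      using n(2)[OF that] na[of h] that by (simp add: nonarch_mult nonarch_power)
    ultimately show ?thesis by blast
  next
    case False
    \<comment> \<open>\<open>t\<close> has absolute value 1 where \<open>z\<close> is large, and
      that of \<open>z ^ n\<close> where \<open>z\<close> is small. So \<open>y\<close> alone
      decides at \<open>f0\<close> and at \<open>g\<close>, while a large \<open>n\<close> takes
      care of \<open>F\<close>.\<close>
    define t where "t = z ^ n / (1 + z ^ n)"
    have big: "h t = 1" if "h z > 1" "nonarch_abs h" for h
    proof -
      have "h 1 < h (z ^ n)" using that n by (simp add: nonarch_1 nonarch_power one_less_power)
      then have "h (z ^ n + 1) = h (z ^ n)" by (rule nonarch_add_eq[OF that(2)])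
      moreover have "h (z ^ n) > 0" using that by (simp add: nonarch_power)
      ultimately show ?thesis unfolding t_def nonarch_divide[OF that(2)] by (simp add: add.commute)
    qed
    have small: "h t = h z ^ n" if "h z < 1" "nonarch_abs h" for h
    proof -
      have "h z ^ n < 1" using that n nonarch_nonneg[OF that(2)] by (simp add: power_less_one_iff)
      then have "h (1 + z ^ n) = h 1" using that by (intro nonarch_add_eq) (simp_all add: nonarch_1 nonarch_power)
      then show ?thesis unfolding t_def nonarch_divide[OF that(2)] using that by (simp add: nonarch_1 nonarch_power)
    qed
    have "f0 (t * y) > 1" using big[OF z(1) n0] y by (simp add: nonarch_mult[OF n0])
    moreover have "g (t * y) < 1" using big[OF _ ng] False y by (simp add: nonarch_mult[OF ng])
    moreover have "h (t * y) < 1" if "h \<in> F" for h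
      using small[of h, OF z(2)[OF that]] n(2)[OF that] na[of h] that by (simp add: nonarch_mult)
    ultimately show ?thesis by blast
  qed
qed

section \<open>Integer relations and finiteness of the set of places over a prime\<close>

locale nf =
  fixes co :: "nat \<Rightarrow> 'k::field_char_0 \<Rightarrow> rat" and d :: nat
  assumes co_add: "\<And>i x y. co i (x + y) = co i x + co i y"
    and co_rat: "\<And>i q x. co i (of_rat q * x) = q * co i x"
    and co_inj: "\<And>x. (\<forall>i<d. co i x = 0) \<Longrightarrow> x = 0"
begin

lemma co_0: "co i 0 = 0"
  using co_add[of i 0 0] by simp

lemma co_sum: "co i (\<Sum>j\<in>J. x j) = (\<Sum>j\<in>J. co i (x j))"
  by (induction J rule: infinite_finite_induct) (simp_all add: co_0 co_add)

text \<open>The coordinate vectors of \<open>d + 1\<close> numbers lie in a rational space of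
  dimension \<open>d\<close>, so by \<open>dimension_le\<close> the coefficient map is not
  injective.\<close>

lemma rat_dependence:
  fixes x :: "nat \<Rightarrow> 'k"
  shows "\<exists>c::nat \<Rightarrow> rat. (\<exists>q\<le>d. c q \<noteq> 0) \<and> (\<Sum>q\<le>d. of_rat (c q) * x q) = 0"
proof -
  define b where "b q = (\<lambda>i. if i < d then co i (x q) else 0)" for q
  have "\<not> inj_on (lin {..<Suc d} b) (vecs UNIV {..<Suc d})"
    using dimension_le[of "Suc d" b d] by (auto simp: b_def vecs_def)
  then obtain f g where fg: "f \<in> vecs UNIV {..<Suc d}" "g \<in> vecs UNIV {..<Suc d}" "f \<noteq> g"
    "lin {..<Suc d} b f = lin {..<Suc d} b g" by (auto simp: inj_on_def)
  define c where "c q = f q - g q" for q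
  obtain q where q: "f q \<noteq> g q" using fg(3) by auto
  then have "q \<le> d" using fg(1,2) by (cases "q < Suc d") (auto simp: vecs_def)
  have "co i (\<Sum>q\<le>d. of_rat (c q) * x q) = 0" if i: "i < d" for i
  proof -
    have "co i (\<Sum>q\<le>d. of_rat (c q) * x q) = (\<Sum>q<Suc d. f q * b q i) - (\<Sum>q<Suc d. g q * b q i)"
      unfolding co_sum co_rat sum_subtractf[symmetric]
      using i by (intro sum.cong) (auto simp: b_def c_def left_diff_distrib)
    also have "\<dots> = 0" using fun_cong[OF fg(4), of i] by (simp add: lin_def)
    finally show ?thesis .
  qed
  then have "(\<Sum>q\<le>d. of_rat (c q) * x q) = 0" using co_inj by blast
  moreover have "c q \<noteq> 0" using q by (simp add: c_def)
  ultimately show ?thesis using \<open>q \<le> d\<close> by blast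
qed

lemma common_denominator:
  fixes c :: "nat \<Rightarrow> rat" assumes "finite J"
  shows "\<exists>N::int. N > 0 \<and> (\<forall>q\<in>J. \<exists>a::int. of_int N * c q = of_int a)"
  using assms
proof (induction J rule: finite_induct)
  case empty
  show ?case by (intro exI[of _ 1]) simp
next
  case (insert q J)
  then obtain N where N: "N > 0" "\<And>q. q \<in> J \<Longrightarrow> \<exists>a::int. of_int N * c q = of_int a" by blast
  obtain u w where uw: "quotient_of (c q) = (u, w)" by (cases "quotient_of (c q)")
  have w: "w > 0" "c q = of_int u / of_int w" using quotient_of_denom_pos[OF uw] quotient_of_div[OF uw] by auto
  have "\<exists>a::int. of_int (N * w) * c j = of_int a" if j: "j \<in> insert q J" for j
  proof (cases "j = q")
    case True
    then have "of_int (N * w) * c j = of_int (N * u)" using w by simp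
    then show ?thesis by blast
  next
    case False
    then obtain a :: int where "of_int N * c j = of_int a" using N j by blast
    then have "of_int (N * w) * c j = of_int (w * a)" by (simp add: mult_ac)
    then show ?thesis by blast
  qed
  then show ?case using N w by (intro exI[of _ "N * w"]) simp
qed

lemma int_dependence:
  fixes x :: "nat \<Rightarrow> 'k"
  shows "\<exists>a::nat \<Rightarrow> int. (\<exists>q\<le>d. a q \<noteq> 0) \<and> (\<Sum>q\<le>d. of_int (a q) * x q) = 0"
proof -
  obtain c where c: "\<exists>q\<le>d. c q \<noteq> 0" "(\<Sum>q\<le>d. of_rat (c q) * x q) = 0" using rat_dependence by blast
  obtain N :: int where N: "N > 0" "\<forall>q\<in>{..d}. \<exists>a::int. of_int N * c q = of_int a"
    using common_denominator[of "{..d}" c] by blast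
  from bchoice[OF N(2)] obtain a :: "nat \<Rightarrow> int" where a: "\<And>q. q \<le> d \<Longrightarrow> of_int N * c q = of_int (a q)" by auto
  have "(\<Sum>q\<le>d. of_int (a q) * x q) = of_int N * (\<Sum>q\<le>d. of_rat (c q) * x q)"
    unfolding sum_distrib_left
  proof (rule sum.cong[OF refl])
    fix q assume "q \<in> {..d}"
    then have "(of_rat (of_int (a q)) :: 'k) = of_rat (of_int N * c q)" using a by simp
    then have "(of_int (a q) :: 'k) = of_int N * of_rat (c q)" by (simp add: of_rat_mult)
    then show "of_int (a q) * x q = of_int N * (of_rat (c q) * x q)" by simp
  qed
  then have "(\<Sum>q\<le>d. of_int (a q) * x q) = 0" using c by simp
  moreover obtain q where "q \<le> d" "c q \<noteq> 0" using c by blast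
  then have "a q \<noteq> 0" using a[of q] N(1) by auto
  ultimately show ?thesis using \<open>q \<le> d\<close> by blast
qed

text \<open>The equation is not monic in general. Its leading coefficient records the primes below
  the places at which \<open>x\<close> is not integral.\<close>

lemma leading_dependence:
  fixes x :: 'k
  shows "\<exists>(a::nat \<Rightarrow> int) t. a t \<noteq> 0 \<and> (\<Sum>q\<le>t. of_int (a q) * x ^ q) = 0"
proof -
  obtain a :: "nat \<Rightarrow> int" where a: "\<exists>q\<le>d. a q \<noteq> 0" "(\<Sum>q\<le>d. of_int (a q) * x ^ q) = 0"
    using int_dependence[of "\<lambda>q. x ^ q"] by blast
  define t where "t = Max {q. q \<le> d \<and> a q \<noteq> 0}"
  have fin: "finite {q. q \<le> d \<and> a q \<noteq> 0}" by simp
  have t: "t \<in> {q. q \<le> d \<and> a q \<noteq> 0}" unfolding t_def using a(1) by (intro Max_in fin) auto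
  have "(\<Sum>q\<le>t. of_int (a q) * x ^ q) = (\<Sum>q\<le>d. of_int (a q) * x ^ q)"
  proof (rule sum.mono_neutral_left)
    show "\<forall>q\<in>{..d} - {..t}. of_int (a q) * x ^ q = 0"
      using Max_ge[OF fin] unfolding t_def by fastforce
  qed (use t in auto)
  then show ?thesis using a(2) t by auto
qed

text \<open>Otherwise the leading term would strictly dominate all others and the sum could not
  vanish.\<close>

lemma leading_coeff_less_1:
  assumes f: "nonarch_abs f" and x: "f x > 1" and a: "a t \<noteq> 0" "(\<Sum>q\<le>t. of_int (a q) * x ^ q) = 0"
  shows "f (of_int (a t)) < 1"
proof (rule ccontr)
  assume "\<not> f (of_int (a t)) < 1"
  then have 1: "f (of_int (a t)) = 1" using nonarch_of_int[OF f, of "a t"] by simp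
  have ft: "f (of_int (a t) * x ^ t) = f x ^ t" by (simp add: nonarch_mult[OF f] nonarch_power[OF f] 1)
  have "f (\<Sum>q\<le>t. of_int (a q) * x ^ q) = f (of_int (a t) * x ^ t)"
  proof (rule nonarch_sum_eq[OF f])
    fix q assume "q \<in> {..t}" "q \<noteq> t"
    then have "q < t" by simp
    have "f (of_int (a q) * x ^ q) \<le> 1 * f x ^ q"
      unfolding nonarch_mult[OF f] nonarch_power[OF f]
      using nonarch_of_int[OF f] nonarch_nonneg[OF f] by (intro mult_right_mono) auto
    also have "\<dots> < f x ^ t" using x \<open>q < t\<close> by simp
    finally show "f (of_int (a q) * x ^ q) < f (of_int (a t) * x ^ t)" unfolding ft .
  qed (use x ft in auto)
  then have "f x ^ t = 0" using a ft nonarch_eq_0[OF f, of 0] by simp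
  then show False using x by simp
qed

text \<open>For \<open>x\<close> with \<open>f x > 1\<close> the leading coefficient of an integer
  equation is a nonzero integer of absolute value below 1. The least positive integer of absolute
  value below 1 is prime by multiplicativity.\<close>

lemma exists_prime_below:
  fixes f :: "'k \<Rightarrow> real"
  assumes f: "nonarch_abs f" shows "\<exists>p. prime p \<and> f (of_nat p) < 1"
proof -
  obtain x where x: "f x > 1"
  proof -
    obtain z where z: "z \<noteq> 0" "f z \<noteq> 1" using f by (auto simp: nonarch_abs_def)
    show ?thesis
    proof (cases "f z > 1")
      case False
      then have "f z < 1" using z by simp
      then have "f (inverse z) > 1" using nonarch_pos[OF f z(1)] by (simp add: nonarch_inverse[OF f] one_less_inverse_iff)
      then show ?thesis by (rule that)
    qed (rule that)
  qed
  obtain a :: "nat \<Rightarrow> int" and t where "a t \<noteq> 0" "(\<Sum>q\<le>t. of_int (a q) * x ^ q) = 0" using leading_dependence[of x] by blast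
  then have at: "f (of_int (a t)) < 1" "a t \<noteq> 0" using leading_coeff_less_1[OF f x] by auto
  define P where "P m \<longleftrightarrow> m > 0 \<and> f (of_nat m) < 1" for m
  have "P (nat \<bar>a t\<bar>)"
    using at nonarch_minus[OF f, of "of_int (a t)"] unfolding P_def by (cases "a t \<ge> 0") (simp_all add: of_nat_nat)
  then have LP: "P (LEAST m. P m)" by (rule LeastI)
  define p where "p = (LEAST m. P m)"
  have p: "p > 0" "f (of_nat p) < 1" using LP by (auto simp: p_def P_def)
  have least: "f (of_nat m) = 1" if "0 < m" "m < p" for m
    using not_less_Least[of m P] that nonarch_of_nat[OF f, of m] unfolding p_def P_def by fastforce
  have "prime p" unfolding prime_nat_iff
  proof (intro conjI allI impI)
    show "1 < p" using p nonarch_1[OF f] by (cases "p = 1") auto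
    fix m assume "m dvd p"
    then obtain k where k: "p = m * k" by (elim dvdE)
    show "m = 1 \<or> m = p"
    proof (rule ccontr)
      assume n: "\<not> (m = 1 \<or> m = p)"
      have "0 < m" "0 < k" using k p by (auto intro: Nat.gr0I)
      moreover have "m < p" using n \<open>m dvd p\<close> p dvd_imp_le by fastforce
      moreover have "k \<noteq> p" using n k p by auto
      then have "k < p" using k \<open>0 < m\<close> by (metis dvd_imp_le dvd_triv_right le_neq_implies_less p(1))
      ultimately have "f (of_nat m) = 1" "f (of_nat k) = 1" using least by auto
      then have "f (of_nat p) = 1" unfolding k by (simp add: nonarch_mult[OF f])
      then show False using p by simp
    qed
  qed
  then show ?thesis using p by blast
qed

text \<open>There are at most \<open>d\<close> such places. Given \<open>d + 1\<close> of them, let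
  \<open>x i\<close> be large at the \<open>i\<close>-th and small at the others. In an integer
  relation between the \<open>x i\<close>, the term whose coefficient has the largest absolute value
  dominates at its own place, which is impossible.\<close>

lemma finite_over: assumes p: "prime p" shows "finite (over p :: ('k \<Rightarrow> real) set set)"
proof (rule ccontr)
  assume "infinite (over p :: ('k \<Rightarrow> real) set set)"
  from infinite_arbitrarily_large[OF this, of "Suc d"]
  obtain V :: "('k \<Rightarrow> real) set set" where V: "V \<subseteq> over p" "finite V" "card V = Suc d" by blast
  define F where "F = norm_abs p ` V"
  have "inj_on (norm_abs p) V" by (rule inj_onI) (use norm_abs_inj[OF p] V(1) in blast)
  then have F: "finite F" "card F = Suc d" unfolding F_def using V by (simp_all add: card_image)
  have norm: "normalised p f" if "f \<in> F" for f using that norm_abs(1)[OF p] V(1) unfolding F_def by blast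
  obtain e where e: "bij_betw e {..d} F" using F finite_same_card_bij[of "{..d}" F] by auto
  have eF: "e i \<in> F" if "i \<le> d" for i using e that by (auto simp: bij_betw_def)
  have "\<exists>x. e i x > 1 \<and> (\<forall>g\<in>F - {e i}. g x < 1)" if "i \<le> d" for i
    using separate[OF p, of "F - {e i}" "e i"] F norm eF[OF that] by auto
  then obtain x where x: "\<And>i. i \<le> d \<Longrightarrow> e i (x i) > 1 \<and> (\<forall>g\<in>F - {e i}. g (x i) < 1)" by metis
  have x2: "e j (x i) < 1" if "i \<le> d" "j \<le> d" "i \<noteq> j" for i j
    using x[OF that(1)] eF[OF that(2)] e that unfolding bij_betw_def inj_on_def by (metis Diff_iff atMost_iff singletonD)
  obtain a :: "nat \<Rightarrow> int" where a: "\<exists>q\<le>d. a q \<noteq> 0" "(\<Sum>q\<le>d. of_int (a q) * x q) = 0"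
    using int_dependence by blast
  \<comment> \<open>The common absolute value of the integers at all these places, so that
    coefficients can be compared without fixing a place.\<close>
  define N where "N b = e 0 (of_int b)" for b :: int
  have N: "e i (of_int b) = N b" if "i \<le> d" for i b
    unfolding N_def by (rule normalised_eq_on_int[OF p]) (use norm eF that in auto)
  have na: "nonarch_abs (e i)" if "i \<le> d" for i using norm[OF eF[OF that]] by (simp add: normalised_def)
  have N0: "0 \<le> N b" "N b = 0 \<longleftrightarrow> b = 0" for b
    using nonarch_nonneg[OF na[of 0]] nonarch_eq_0[OF na[of 0]] by (auto simp: N_def)
  have "Max ((\<lambda>j. N (a j)) ` {..d}) \<in> (\<lambda>j. N (a j)) ` {..d}" by (rule Max_in) auto
  then obtain i where i0: "i \<in> {..d}" "Max ((\<lambda>j. N (a j)) ` {..d}) = N (a i)" by (rule imageE)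
  have i: "i \<le> d" "\<And>j. j \<le> d \<Longrightarrow> N (a j) \<le> N (a i)"
    using i0(1) unfolding i0(2)[symmetric] by (auto intro: Max_ge)
  obtain q where q: "q \<le> d" "a q \<noteq> 0" using a by blast
  have Ni: "N (a i) > 0" using i(2)[OF q(1)] N0[of "a q"] q(2) by linarith
  note nai = na[OF i(1)]
  have val: "e i (of_int (a j) * x j) = N (a j) * e i (x j)" for j
    by (simp add: nonarch_mult[OF nai] N[OF i(1)])
  have big: "e i (of_int (a i) * x i) > N (a i)" unfolding val using x[OF i(1)] Ni by simp
  have "e i (\<Sum>q\<le>d. of_int (a q) * x q) = e i (of_int (a i) * x i)"
  proof (rule nonarch_sum_eq[OF nai])
    fix j assume j: "j \<in> {..d}" "j \<noteq> i"
    have "N (a j) * e i (x j) \<le> N (a i) * 1"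
      using i(2)[of j] x2[of j i] j i N0 nonarch_nonneg[OF nai] by (intro mult_mono) auto
    then show "e i (of_int (a j) * x j) < e i (of_int (a i) * x i)" using big unfolding val by linarith
  qed (use i big Ni in auto)
  then show False using a(2) big Ni nonarch_eq_0[OF nai, of 0] by simp
qed

text \<open>A place where \<open>x\<close> is not integral lies over a prime divisor of the leading
  coefficient of an integer equation for \<open>x\<close>, and each prime has finitely many
  places.\<close>

lemma finite_nonintegral: "finite {v \<in> places. place_abs v (x :: 'k) > 1}"
proof -
  obtain a :: "nat \<Rightarrow> int" and t where a: "a t \<noteq> 0" "(\<Sum>q\<le>t. of_int (a q) * x ^ q) = 0" using leading_dependence[of x] by blast
  have "{v \<in> places. place_abs v x > 1} \<subseteq> (\<Union>p\<in>{p. prime p \<and> p dvd nat \<bar>a t\<bar>}. over p)"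
  proof
    fix v assume "v \<in> {v \<in> places. place_abs v x > 1}"
    then have v: "v \<in> places" "place_abs v x > 1" by auto
    note f = place_abs_nonarch[OF v(1)]
    obtain p where p: "prime p" "place_abs v (of_nat p) < 1" using exists_prime_below[OF f] by blast
    have "\<not> coprime (int p) (a t)" using nonarch_coprime[OF f p(2)] leading_coeff_less_1[OF f v(2), of a t] a by fastforce
    then have "int p dvd a t" using p by (meson prime_imp_coprime prime_nat_int_transfer)
    then have "p dvd nat \<bar>a t\<bar>" by (simp add: nat_dvd_iff int_dvd_int_iff flip: int_dvd_int_iff)
    then show "v \<in> (\<Union>p\<in>{p. prime p \<and> p dvd nat \<bar>a t\<bar>}. over p)" using p v by (auto simp: over_def)
  qed
  moreover have "finite (\<Union>p\<in>{p. prime p \<and> p dvd nat \<bar>a t\<bar>}. over p :: ('k \<Rightarrow> real) set set)"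
  proof (rule finite_UN_I)
    show "finite {p. prime p \<and> p dvd nat \<bar>a t\<bar>}" by (rule finite_subset[OF _ finite_divisors_nat[of "nat \<bar>a t\<bar>"]]) (use a in auto)
  qed (use finite_over in auto)
  ultimately show ?thesis by (rule finite_subset)
qed

end

section \<open>Existence of places over a prime\<close>

lemma subring_power: "subring R \<Longrightarrow> x \<in> R \<Longrightarrow> x ^ n \<in> R"
  by (induction n) (simp_all add: subring_one subring_mult)

lemma subring_add: "subring R \<Longrightarrow> x \<in> R \<Longrightarrow> y \<in> R \<Longrightarrow> x + y \<in> R"
  and subring_diff: "subring R \<Longrightarrow> x \<in> R \<Longrightarrow> y \<in> R \<Longrightarrow> x - y \<in> R"
  and subring_minus: "subring R \<Longrightarrow> x \<in> R \<Longrightarrow> - x \<in> R"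
  by (simp_all add: subgrp_add subgrp_diff subgrp_minus subring_subgrp)

lemma subring_sum: "subring R \<Longrightarrow> (\<And>i. i \<in> I \<Longrightarrow> f i \<in> R) \<Longrightarrow> sum f I \<in> R"
  by (simp add: subgrp_sum subring_subgrp)

lemma subringI:
  assumes "1 \<in> R" "\<And>x y. x \<in> R \<Longrightarrow> y \<in> R \<Longrightarrow> x - y \<in> R" "\<And>x y. x \<in> R \<Longrightarrow> y \<in> R \<Longrightarrow> x * y \<in> R"
  shows "subring R"
  using assms(1) assms(2)[of 1 1] assms unfolding subring_def subgrp_def by auto

text \<open>A maximal subring in which \<open>p\<close> is not invertible is a valuation ring.\<close>

locale maximal_ring =
  fixes B :: "'k::field_char_0 set" and p :: nat
  assumes p: "prime p" and B: "subring B" and pB: "inverse (of_nat p) \<notin> B"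
    and maximal: "\<And>C. subring C \<Longrightarrow> B \<subseteq> C \<Longrightarrow> inverse (of_nat p) \<notin> C \<Longrightarrow> C = B"
begin

lemma p0: "(of_nat p :: 'k) \<noteq> 0"
  using prime_gt_0_nat[OF p] by simp

lemma p_not_unit: "c \<in> B \<Longrightarrow> of_nat p * c \<noteq> 1"
  using pB by (metis inverse_unique)

text \<open>Adjoining the inverse of \<open>u = 1 - p * a\<close> cannot produce
  \<open>1 / p\<close>: if \<open>u ^ N / p\<close> lies in \<open>B\<close>, then so does
  \<open>1 / p\<close>, because \<open>u ^ N\<close> is 1 modulo \<open>p\<close>. By maximality the
  inverse already lies in \<open>B\<close>.\<close>

lemma inverse_one_minus: assumes a: "a \<in> B" shows "inverse (1 - of_nat p * a) \<in> B"
proof -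
  define u where "u = 1 - of_nat p * a"
  have u0: "u \<noteq> 0" using p_not_unit[OF a] by (simp add: u_def)
  have uB: "u \<in> B" unfolding u_def using a by (simp add: subring_diff subring_one subring_mult subring_of_nat B)
  define C where "C = {x. \<exists>N. x * u ^ N \<in> B}"
  have C: "subring C"
  proof (rule subringI)
    show "1 \<in> C" unfolding C_def using subring_one[OF B] by (intro CollectI exI[of _ 0]) simp
    fix x y assume "x \<in> C" "y \<in> C"
    then obtain M N where MN: "x * u ^ M \<in> B" "y * u ^ N \<in> B" by (auto simp: C_def)
    have "(x * u ^ M) * u ^ N \<in> B" "(y * u ^ N) * u ^ M \<in> B" "(x * u ^ M) * (y * u ^ N) \<in> B"
      using MN uB by (simp_all add: subring_mult subring_power B)
    then have "(x * u ^ M) * u ^ N - (y * u ^ N) * u ^ M \<in> B" "(x * u ^ M) * (y * u ^ N) \<in> B"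
      by (simp_all add: subring_diff B)
    then have "(x - y) * u ^ (M + N) \<in> B" "(x * y) * u ^ (M + N) \<in> B"
      by (simp_all add: power_add algebra_simps)
    then show "x - y \<in> C" "x * y \<in> C" unfolding C_def by blast+
  qed
  have BC: "B \<subseteq> C" unfolding C_def by (auto intro!: exI[of _ 0])
  have "inverse (of_nat p) \<notin> C"
  proof
    assume "inverse (of_nat p) \<in> C"
    then obtain N where N: "inverse (of_nat p) * u ^ N \<in> B" by (auto simp: C_def)
    have "\<exists>c\<in>B. u ^ N = 1 - of_nat p * c"
    proof (induction N)
      case 0
      show ?case using subring_zero[OF B] by (intro bexI[of _ 0]) simp_all
    next
      case (Suc N)
      then obtain c where c: "c \<in> B" "u ^ N = 1 - of_nat p * c" by blast
      have "u ^ Suc N = 1 - of_nat p * (c + a * u ^ N)" using c(2) by (simp add: u_def algebra_simps)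
      moreover have "c + a * u ^ N \<in> B" by (intro subring_add[OF B] subring_mult[OF B] subring_power[OF B] c(1) a uB)
      ultimately show ?case by blast
    qed
    then obtain c where c: "c \<in> B" "u ^ N = 1 - of_nat p * c" by blast
    have "inverse (of_nat p) * u ^ N + c \<in> B" using N c by (simp add: subring_add B)
    moreover have "of_nat p * (inverse (of_nat p) * u ^ N + c) = 1"
    proof -
      have "of_nat p * (inverse (of_nat p) * u ^ N + c) = (of_nat p * inverse (of_nat p)) * u ^ N + of_nat p * c"
        by (simp only: distrib_left mult.assoc)
      also have "\<dots> = 1" unfolding right_inverse[OF p0] c(2) by simp
      finally show ?thesis .
    qed
    ultimately show False using p_not_unit by blast
  qed
  then have "C = B" by (rule maximal[OF C BC])
  moreover have "inverse u \<in> C" unfolding C_def using u0 subring_one[OF B] by (intro CollectI exI[of _ 1]) simp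
  ultimately show ?thesis by (simp add: u_def)
qed

text \<open>A relation of degree at most \<open>n\<close> witnessing that \<open>1 / p\<close> lies
  in the ring generated by \<open>x\<close> over \<open>B\<close>.\<close>

definition Q :: "'k \<Rightarrow> nat \<Rightarrow> bool" where
  "Q x n \<longleftrightarrow> (\<exists>a. (\<forall>i. a i \<in> B) \<and> of_nat p * (\<Sum>i\<le>n. a i * x ^ i) = 1)"

lemma Q_mono: assumes "Q x n" "n \<le> m" shows "Q x m"
proof -
  obtain a where a: "\<forall>i. a i \<in> B" "of_nat p * (\<Sum>i\<le>n. a i * x ^ i) = 1" using assms(1) by (auto simp: Q_def)
  have "(\<Sum>i\<le>m. (if i \<le> n then a i else 0) * x ^ i) = (\<Sum>i\<le>n. a i * x ^ i)"
    using assms(2) by (intro sum.mono_neutral_cong_right) auto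
  then show ?thesis unfolding Q_def using a subring_zero[OF B]
    by (intro exI[of _ "\<lambda>i. if i \<le> n then a i else 0"]) simp
qed

lemma Q_0: "\<not> Q x 0"
  using p_not_unit by (auto simp: Q_def)

text \<open>The relation for \<open>inverse x\<close>, multiplied by \<open>x ^ Suc k\<close>,
  expresses \<open>x ^ Suc k\<close> through lower powers of \<open>x\<close>, since
  \<open>u = 1 - p * b 0\<close> is invertible in \<open>B\<close>. Substituting this into the
  relation for \<open>x\<close> lowers its degree.\<close>

lemma Q_descent: assumes x: "x \<noteq> 0" and Q: "Q x (Suc k)" "Q (inverse x) (Suc k)" shows "Q x k"
proof -
  let ?n = "Suc k"
  obtain a where a: "\<And>i. a i \<in> B" "of_nat p * (\<Sum>i\<le>?n. a i * x ^ i) = 1" using Q(1) by (auto simp: Q_def)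
  obtain b where b: "\<And>i. b i \<in> B" "of_nat p * (\<Sum>i\<le>?n. b i * inverse x ^ i) = 1" using Q(2) by (auto simp: Q_def)
  define u where "u = 1 - of_nat p * b 0"
  have u0: "u \<noteq> 0" using p_not_unit[OF b(1)[of 0]] by (simp add: u_def)
  have iu: "inverse u \<in> B" unfolding u_def by (rule inverse_one_minus[OF b(1)])
  define S where "S = (\<Sum>i\<le>k. b (Suc i) * inverse x ^ Suc i)"
  have S: "(\<Sum>i\<le>?n. b i * inverse x ^ i) = b 0 + S"
    unfolding S_def by (simp only: sum.atMost_Suc_shift) simp
  have uS: "u = of_nat p * S" using b(2) unfolding S u_def by (simp add: algebra_simps)
  have "u * x ^ ?n = of_nat p * (\<Sum>i\<le>k. x ^ ?n * (b (Suc i) * inverse x ^ Suc i))"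
  proof -
    have "(\<Sum>i\<le>k. x ^ ?n * (b (Suc i) * inverse x ^ Suc i)) = x ^ ?n * S" by (simp only: S_def sum_distrib_left)
    then show ?thesis unfolding uS by (simp only: mult_ac)
  qed
  also have "(\<Sum>i\<le>k. x ^ ?n * (b (Suc i) * inverse x ^ Suc i)) = (\<Sum>i\<le>k. b (Suc i) * x ^ (k - i))"
  proof (rule sum.cong[OF refl])
    fix i assume "i \<in> {..k}"
    then have "x ^ ?n = x ^ (k - i) * x ^ Suc i" by (simp flip: power_add)
    then show "x ^ ?n * (b (Suc i) * inverse x ^ Suc i) = b (Suc i) * x ^ (k - i)"
      using x by (simp add: field_simps power_inverse)
  qed
  also have "\<dots> = (\<Sum>i\<le>k. b (?n - i) * x ^ i)"
    using sum.nat_diff_reindex[of "\<lambda>i. b (?n - i) * x ^ i" "Suc k"]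
    by (simp add: lessThan_Suc_atMost Suc_diff_le cong: sum.cong_simp)
  finally have "x ^ ?n = inverse u * (of_nat p * (\<Sum>i\<le>k. b (?n - i) * x ^ i))" using u0 by (simp add: field_simps)
  then have xn: "a ?n * x ^ ?n = (\<Sum>i\<le>k. (of_nat p * a ?n * inverse u * b (?n - i)) * x ^ i)"
    by (simp add: sum_distrib_left mult_ac)
  have "(\<Sum>i\<le>?n. a i * x ^ i) = (\<Sum>i\<le>k. a i * x ^ i) + a ?n * x ^ ?n" by simp
  also have "\<dots> = (\<Sum>i\<le>k. (a i + of_nat p * a ?n * inverse u * b (?n - i)) * x ^ i)"
    unfolding xn by (simp only: distrib_right sum.distrib)
  finally have "of_nat p * (\<Sum>i\<le>k. (a i + of_nat p * a ?n * inverse u * b (?n - i)) * x ^ i) = 1" using a(2) by simp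
  moreover have "a i + of_nat p * a ?n * inverse u * b (?n - i) \<in> B" for i
    using a(1) b(1) iu by (simp add: subring_add subring_mult subring_of_nat B)
  ultimately show ?thesis unfolding Q_def
    by (intro exI[of _ "\<lambda>i. a i + of_nat p * a ?n * inverse u * b (?n - i)"]) simp
qed

text \<open>The values at \<open>x\<close> of polynomials over \<open>B\<close> form a strictly
  larger subring, which by maximality contains \<open>1 / p\<close>.\<close>

lemma Q_if_notin: assumes "x \<notin> B" shows "\<exists>n. Q x n"
proof (rule ccontr)
  assume nQ: "\<not> (\<exists>n. Q x n)"
  define C where "C = {y. \<exists>n a. (\<forall>i. a i \<in> B) \<and> y = poly (\<Sum>i\<le>n. Polynomial.monom (a i) i) x}"
  have C_iff: "y \<in> C \<longleftrightarrow> (\<exists>f. (\<forall>i. poly.coeff f i \<in> B) \<and> y = poly f x)" for y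
  proof
    assume "y \<in> C"
    then obtain n a where a: "\<forall>i. a i \<in> B" "y = poly (\<Sum>i\<le>n. Polynomial.monom (a i) i) x" by (auto simp: C_def)
    have "poly.coeff (\<Sum>i\<le>n. Polynomial.monom (a i) i) j = (if j \<le> n then a j else 0)" for j
      by (simp add: coeff_sum coeff_monom if_distrib cong: if_cong)
    then show "\<exists>f. (\<forall>i. poly.coeff f i \<in> B) \<and> y = poly f x"
      using a subring_zero[OF B] by (intro exI[of _ "\<Sum>i\<le>n. Polynomial.monom (a i) i"]) simp
  next
    assume "\<exists>f. (\<forall>i. poly.coeff f i \<in> B) \<and> y = poly f x"
    then obtain f where f: "\<forall>i. poly.coeff f i \<in> B" "y = poly f x" by blast
    then show "y \<in> C" unfolding C_def
      by (intro CollectI exI[of _ "degree f"] exI[of _ "poly.coeff f"]) (simp add: poly_as_sum_of_monoms)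
  qed
  have C: "subring C"
  proof (rule subringI)
    show "1 \<in> C" unfolding C_iff
      using subring_one[OF B] subring_zero[OF B] by (intro exI[of _ 1]) (simp add: coeff_1)
    fix y z assume "y \<in> C" "z \<in> C"
    then obtain f g where fg: "\<forall>i. poly.coeff f i \<in> B" "y = poly f x" "\<forall>i. poly.coeff g i \<in> B" "z = poly g x"
      unfolding C_iff by blast
    show "y - z \<in> C" unfolding C_iff using fg by (intro exI[of _ "f - g"]) (simp add: subring_diff B)
    show "y * z \<in> C" unfolding C_iff using fg
      by (intro exI[of _ "f * g"]) (auto simp: coeff_mult intro!: subring_sum[OF B] subring_mult[OF B])
  qed
  have BC: "B \<subseteq> C"
  proof
    fix y assume "y \<in> B"
    then show "y \<in> C" unfolding C_iff using subring_zero[OF B]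
      by (intro exI[of _ "[:y:]"]) (simp add: coeff_pCons split: nat.split)
  qed
  have "x \<in> C" unfolding C_iff using subring_zero[OF B] subring_one[OF B]
    by (intro exI[of _ "[:0, 1:]"]) (simp add: coeff_pCons split: nat.split)
  then have "C \<noteq> B" using assms by blast
  then have "inverse (of_nat p) \<in> C" using maximal[OF C BC] by blast
  then obtain n a where a: "\<forall>i. a i \<in> B" "inverse (of_nat p) = poly (\<Sum>i\<le>n. Polynomial.monom (a i) i) x" by (auto simp: C_def)
  then have "inverse (of_nat p) = (\<Sum>i\<le>n. a i * x ^ i)" by (simp add: poly_sum poly_monom)
  then have "of_nat p * (\<Sum>i\<le>n. a i * x ^ i) = 1" using p0 by (metis right_inverse)
  then show False using nQ a(1) by (auto simp: Q_def)
qed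

text \<open>Otherwise \<open>x\<close> and its inverse satisfy relations of a common degree, and
  \<open>Q_descent\<close>, applied to both in parallel, brings the degree down to 0 against
  \<open>Q_0\<close>.\<close>

lemma valuation: assumes x: "x \<noteq> 0" shows "x \<in> B \<or> inverse x \<in> B"
proof (rule ccontr)
  assume "\<not> (x \<in> B \<or> inverse x \<in> B)"
  then obtain n m where "Q x n" "Q (inverse x) m" using Q_if_notin by blast
  then have "Q x (max n m) \<and> Q (inverse x) (max n m)" using Q_mono by auto
  then have top: "Q x (max n m) \<and> Q (inverse x) (max n m)" .
  have "Q x k \<and> Q (inverse x) k" if k: "k \<le> max n m" for k
    using k
  proof (induction k rule: inc_induct)
    case base
    show ?case by (rule top)
  next
    case (step k)
    then show ?case using Q_descent[OF x, of k] Q_descent[of "inverse x" k] x by simp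
  qed
  then show False using Q_0 by blast
qed

definition unit :: "'k \<Rightarrow> bool" where
  "unit w \<longleftrightarrow> w \<in> B \<and> inverse w \<in> B \<and> w \<noteq> 0"

lemma unit_mult: "unit v \<Longrightarrow> unit w \<Longrightarrow> unit (v * w)"
  by (auto simp: unit_def subring_mult B)

lemma unit_inverse: "unit w \<Longrightarrow> unit (inverse w)"
  by (auto simp: unit_def)

lemma unit_power: "unit w \<Longrightarrow> unit (w ^ n)"
  by (induction n) (auto simp: unit_mult, auto simp: unit_def subring_one B)

lemma unit_of_int: assumes c: "coprime (int p) a" shows "unit (of_int a)"
proof -
  obtain u v where uv: "u * int p + v * a = 1" using c by (metis bezout_int coprime_iff_gcd_eq_1)
  have "of_int (u * int p + v * a) = (1 :: 'k)" unfolding uv by simp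
  then have e: "of_int v * of_int a = (1 - of_nat p * of_int u :: 'k)" by (simp add: algebra_simps)
  have "1 - of_nat p * of_int u \<noteq> (0 :: 'k)" using p_not_unit[OF subring_of_int[OF B, of u]] by auto
  then have nz: "(of_int a :: 'k) \<noteq> 0" "(of_int v :: 'k) \<noteq> 0" using e by auto
  have "inverse (of_int a) = (of_int v * inverse (1 - of_nat p * of_int u) :: 'k)"
    unfolding e[symmetric] using nz by simp
  also have "\<dots> \<in> B" by (rule subring_mult[OF B subring_of_int[OF B] inverse_one_minus[OF subring_of_int[OF B]]])
  finally show ?thesis using nz subring_of_int[OF B] by (simp add: unit_def)
qed

text \<open>Of two nonzero elements one divides the other in \<open>B\<close>, so a unit sum would
  make the divisor a unit.\<close>

lemma nonunit_add:
  assumes "y \<in> B" "z \<in> B" "\<not> unit y" "\<not> unit z" shows "\<not> unit (y + z)"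
proof
  assume u: "unit (y + z)"
  have *: "unit y" if "y \<in> B" "z \<in> B" "unit (y + z)" "y \<noteq> 0" "z / y \<in> B" for y z
  proof -
    have "inverse y = (1 + z / y) * inverse (y + z)" using that by (simp add: unit_def field_simps)
    also have "\<dots> \<in> B" using that by (simp add: unit_def subring_mult subring_add subring_one B)
    finally show ?thesis using that by (simp add: unit_def)
  qed
  have nz: "y \<noteq> 0" "z \<noteq> 0" using u assms by auto
  then have "z / y \<in> B \<or> y / z \<in> B" using valuation[of "z / y"] by simp
  then show False using *[of y z] *[of z y] assms u nz by (auto simp: add.commute)
qed

lemma nonunit_sum:
  assumes "finite J" "\<And>q. q \<in> J \<Longrightarrow> t q \<in> B \<and> \<not> unit (t q)" shows "sum t J \<in> B \<and> \<not> unit (sum t J)"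
  using assms
proof (induction J rule: finite_induct)
  case empty
  then show ?case by (simp add: unit_def subring_zero B)
next
  case (insert q J)
  then show ?case using nonunit_add[of "t q" "sum t J"] by (simp add: subring_add B)
qed

lemma exists_dividing_all:
  assumes "finite J" "J \<noteq> {}" "\<And>q. q \<in> J \<Longrightarrow> t q \<noteq> (0 :: 'k)"
  shows "\<exists>j\<in>J. \<forall>q\<in>J. t q / t j \<in> B"
  using assms
proof (induction J rule: finite_ne_induct)
  case (singleton q)
  then show ?case by (simp add: subring_one B)
next
  case (insert i J)
  then obtain j where j: "j \<in> J" "\<And>q. q \<in> J \<Longrightarrow> t q / t j \<in> B" by auto
  have nz: "t i \<noteq> 0" "t j \<noteq> 0" using insert.prems j by auto
  consider "t i / t j \<in> B" | "t j / t i \<in> B" using valuation[of "t i / t j"] nz by auto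
  then show ?case
  proof cases
    case 1
    then show ?thesis using j by auto
  next
    case 2
    have "t q / t i \<in> B" if "q \<in> J" for q
    proof -
      have eq: "t q / t i = (t q / t j) * (t j / t i)" using nz by simp
      show ?thesis unfolding eq by (rule subring_mult[OF B j(2)[OF that] 2])
    qed
    then show ?thesis using nz by (auto simp: subring_one B)
  qed
qed

text \<open>Up to a unit of \<open>B\<close>, \<open>x ^ b\<close> is the \<open>c\<close>-th power
  of \<open>p\<close>: the valuation of \<open>x\<close>, normalised to be 1 at \<open>p\<close>, is
  the rational number \<open>c / b\<close>.\<close>

definition E :: "'k \<Rightarrow> nat \<Rightarrow> int \<Rightarrow> bool" where
  "E x b c \<longleftrightarrow> b > 0 \<and> x \<noteq> 0 \<and> unit (x ^ b * of_nat p powi (- c))"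

lemma unit_p_powi: assumes "unit (of_nat p powi k)" shows "k = 0"
proof -
  have *: "\<not> unit (of_nat p ^ Suc n)" for n
  proof
    assume "unit (of_nat p ^ Suc n)"
    then have "of_nat p ^ n * inverse (of_nat p ^ Suc n) \<in> B" by (simp add: unit_def subring_mult subring_power subring_of_nat B del: power_Suc)
    moreover have "of_nat p * (of_nat p ^ n * inverse (of_nat p ^ Suc n)) = (1::'k)" using p0 by (simp add: field_simps)
    ultimately show False using p_not_unit by blast
  qed
  show ?thesis
  proof (rule ccontr)
    assume "k \<noteq> 0"
    then consider n where "k = int (Suc n)" | n where "k = - int (Suc n)"
      by (metis int_cases int_cases2 nat.exhaust of_nat_0 neg_equal_0_iff_equal not0_implies_Suc)
    then show False
    proof cases
      case 1
      then show ?thesis using assms *[of n] by (simp add: power_int_def nat_add_distrib)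
    next
      case 2
      then have "unit (inverse (of_nat p powi k))" using assms by (rule_tac unit_inverse)
      then have "unit (of_nat p ^ Suc n)" unfolding 2 power_int_minus power_int_of_nat by simp
      then show ?thesis using *[of n] by blast
    qed
  qed
qed

lemma power_int_power_of_nat: "(z powi m) ^ n = z powi (m * int n)" for z :: 'k
  by (simp add: power_int_mult power_int_of_nat)

lemma E_unique: assumes "E x b c" "E x b' c'" shows "real_of_int c / real b = real_of_int c' / real b'"
proof -
  have b: "b > 0" "b' > 0" "x \<noteq> 0" using assms by (auto simp: E_def)
  let ?P = "of_nat p :: 'k"
  have "unit ((x ^ b * ?P powi (- c)) ^ b' * inverse ((x ^ b' * ?P powi (- c')) ^ b))"
    using assms unfolding E_def by (intro unit_mult[OF unit_power unit_inverse[OF unit_power]]) blast+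
  also have "(x ^ b * ?P powi (- c)) ^ b' * inverse ((x ^ b' * ?P powi (- c')) ^ b) = ?P powi (c' * int b - c * int b')"
  proof -
    have "(x ^ b * ?P powi (- c)) ^ b' = x ^ (b * b') * ?P powi (- c * int b')"
      by (simp add: power_mult_distrib power_int_power_of_nat flip: power_mult)
    moreover have "(x ^ b' * ?P powi (- c')) ^ b = x ^ (b * b') * ?P powi (- c' * int b)"
      by (simp add: power_mult_distrib power_int_power_of_nat mult.commute flip: power_mult)
    moreover have "?P powi (c' * int b - c * int b') = ?P powi (- c * int b') * inverse (?P powi (- c' * int b))"
      using p0 by (simp flip: power_int_minus power_int_add)
    ultimately show ?thesis using b by simp
  qed
  finally have "c' * int b - c * int b' = 0" by (rule unit_p_powi)
  then have "c' * int b = c * int b'" by simp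
  then have "real_of_int c' * real b = real_of_int c * real b'" by (metis of_int_mult of_int_of_nat_eq)
  then show ?thesis using b by (simp add: field_simps)
qed

lemma E_mult: assumes "E x b c" "E y b' c'" shows "E (x * y) (b * b') (c * int b' + c' * int b)"
proof -
  let ?P = "of_nat p :: 'k"
  have "unit ((x ^ b * ?P powi (- c)) ^ b' * (y ^ b' * ?P powi (- c')) ^ b)"
    using assms unfolding E_def by (intro unit_mult[OF unit_power unit_power]) blast+
  also have "(x ^ b * ?P powi (- c)) ^ b' * (y ^ b' * ?P powi (- c')) ^ b = (x * y) ^ (b * b') * ?P powi (- (c * int b' + c' * int b))"
  proof -
    have "(x ^ b * ?P powi (- c)) ^ b' = x ^ (b * b') * ?P powi (- c * int b')"
      by (simp add: power_mult_distrib power_int_power_of_nat flip: power_mult)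
    moreover have "(y ^ b' * ?P powi (- c')) ^ b = y ^ (b * b') * ?P powi (- c' * int b)"
      by (simp add: power_mult_distrib power_int_power_of_nat mult.commute flip: power_mult)
    moreover have "?P powi (- (c * int b' + c' * int b)) = ?P powi (- c * int b') * ?P powi (- c' * int b)"
      using p0 by (simp flip: power_int_add)
    ultimately show ?thesis by (simp add: power_mult_distrib mult_ac)
  qed
  finally show ?thesis using assms by (auto simp: E_def)
qed

lemma E_p: "E (of_nat p) 1 1"
  using p0 by (simp add: E_def unit_def subring_one B)

text \<open>If \<open>x ^ b\<close> lies in \<open>B\<close> but \<open>x\<close> does not, then
  \<open>inverse x\<close> does, and \<open>x\<close> is \<open>x ^ b\<close> times a power of
  \<open>inverse x\<close>. For negative \<open>c\<close> an element \<open>x\<close> of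
  \<open>B\<close> would make \<open>p\<close> a divisor of a unit.\<close>

lemma E_B: assumes "E x b c" shows "x \<in> B \<longleftrightarrow> c \<ge> 0"
proof -
  have b: "b > 0" "x \<noteq> 0" and u: "unit (x ^ b * of_nat p powi (- c))" using assms by (auto simp: E_def)
  show ?thesis
  proof
    assume xB: "x \<in> B"
    show "c \<ge> 0"
    proof (rule ccontr)
      assume "\<not> c \<ge> 0"
      then obtain n where n: "- c = int (Suc n)" by (metis int_cases2 neg_0_le_iff_le nat.exhaust of_nat_0 of_nat_0_le_iff linorder_not_le add.inverse_inverse zero_less_imp_eq_int neg_0_less_iff_less gr0_conv_Suc of_nat_0_less_iff)
      define w where "w = x ^ b * of_nat p powi (- c)"
      have w: "w = of_nat p * (x ^ b * of_nat p ^ n)" unfolding w_def n power_int_of_nat by simp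
      have wu: "inverse w \<in> B" "w \<noteq> 0" using u by (auto simp: unit_def w_def)
      have "(x ^ b * of_nat p ^ n) * inverse w \<in> B"
        using xB wu by (simp add: subring_mult subring_power subring_of_nat B)
      moreover have "of_nat p * ((x ^ b * of_nat p ^ n) * inverse w) = 1"
      proof -
        have "of_nat p * ((x ^ b * of_nat p ^ n) * inverse w) = (of_nat p * (x ^ b * of_nat p ^ n)) * inverse w"
          by (simp only: mult.assoc)
        also have "\<dots> = w * inverse w" by (simp only: w[symmetric])
        finally show ?thesis using wu(2) by simp
      qed
      ultimately show False using p_not_unit by blast
    qed
  next
    assume "c \<ge> 0"
    then obtain n where n: "c = int n" using nonneg_int_cases by blast
    have "x ^ b = (x ^ b * of_nat p powi (- c)) * of_nat p ^ n"
      unfolding n power_int_minus power_int_of_nat using p0 by simp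
    also have "\<dots> \<in> B" using u by (simp add: unit_def subring_mult subring_power subring_of_nat B)
    finally have xb: "x ^ b \<in> B" .
    show "x \<in> B"
    proof (rule ccontr)
      assume "x \<notin> B"
      then have ix: "inverse x \<in> B" using valuation[OF b(2)] by blast
      obtain b' where b': "b = Suc b'" using b(1) by (cases b) auto
      have "x = x ^ b * inverse x ^ b'" using b(2) unfolding b' by (simp add: field_simps)
      then show False using \<open>x \<notin> B\<close> subring_mult[OF B xb subring_power[OF B ix, of b']] by simp
    qed
  qed
qed

end

section \<open>Rings of integral elements\<close>

text \<open>Zorn's lemma for the subrings without \<open>1 / p\<close>; the image of the integers is
  one, and the condition passes to unions of chains.\<close>

lemma exists_maximal_ring:
  assumes p: "prime p" shows "\<exists>B :: 'k::field_char_0 set. maximal_ring B p"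
proof -
  define A where "A = {B :: 'k set. subring B \<and> inverse (of_nat p) \<notin> B}"
  have "subring (range (of_int :: int \<Rightarrow> 'k))"
  proof (rule subringI)
    show "1 \<in> range (of_int :: int \<Rightarrow> 'k)" by (rule range_eqI[of _ _ 1]) simp
    fix x y assume "x \<in> range (of_int :: int \<Rightarrow> 'k)" "y \<in> range (of_int :: int \<Rightarrow> 'k)"
    then obtain a b where "x = of_int a" "y = of_int b" by blast
    then have "x - y = of_int (a - b)" "x * y = of_int (a * b)" by simp_all
    then show "x - y \<in> range (of_int :: int \<Rightarrow> 'k)" "x * y \<in> range (of_int :: int \<Rightarrow> 'k)" by (simp_all only: rangeI)
  qed
  moreover have "inverse (of_nat p) \<notin> range (of_int :: int \<Rightarrow> 'k)"
  proof
    assume "inverse (of_nat p) \<in> range (of_int :: int \<Rightarrow> 'k)"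
    then obtain a where a: "inverse (of_nat p) = (of_int a :: 'k)" by blast
    have "(of_nat p :: 'k) \<noteq> 0" using prime_gt_0_nat[OF p] by simp
    then have "of_int (int p * a) = (of_int 1 :: 'k)" using a by (simp add: flip: a)
    then have "int p * a = 1" by (simp only: of_int_eq_iff)
    then have "int p dvd 1" by (metis dvd_triv_left)
    then show False using prime_gt_1_nat[OF p] by simp
  qed
  ultimately have ne: "A \<noteq> {}" unfolding A_def by blast
  have "\<exists>M\<in>A. \<forall>X\<in>A. M \<subseteq> X \<longrightarrow> X = M"
  proof (rule subset_Zorn_nonempty[OF ne])
    fix C assume C: "C \<noteq> {}" "subset.chain A C"
    then have CA: "C \<subseteq> A" and tot: "\<And>X Y. X \<in> C \<Longrightarrow> Y \<in> C \<Longrightarrow> X \<subseteq> Y \<or> Y \<subseteq> X" by (auto simp: subset_chain_def)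
    have "subring (\<Union>C)"
    proof (rule subringI)
      obtain X where "X \<in> C" using C(1) by blast
      moreover from this have "1 \<in> X" using CA by (intro subring_one) (auto simp: A_def)
      ultimately show "1 \<in> \<Union>C" by blast
      fix x y assume "x \<in> \<Union>C" "y \<in> \<Union>C"
      then obtain X Y where XY: "X \<in> C" "Y \<in> C" "x \<in> X" "y \<in> Y" by blast
      then obtain Z where Z: "Z \<in> C" "x \<in> Z" "y \<in> Z" using tot[OF XY(1,2)] by blast
      then have "subring Z" using CA by (auto simp: A_def)
      then have "x - y \<in> Z" "x * y \<in> Z" using Z by (simp_all add: subring_diff subring_mult)
      then show "x - y \<in> \<Union>C" "x * y \<in> \<Union>C" using Z(1) by blast+
    qed
    moreover have "inverse (of_nat p) \<notin> \<Union>C" using CA by (auto simp: A_def)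
    ultimately show "\<Union>C \<in> A" by (simp add: A_def)
  qed
  then obtain B where B: "B \<in> A" "\<And>X. X \<in> A \<Longrightarrow> B \<subseteq> X \<Longrightarrow> X = B" by blast
  have "maximal_ring B p"
    by unfold_locales (use p B in \<open>auto simp: A_def\<close>)
  then show ?thesis by blast
qed

context nf begin

text \<open>Divide the nonzero terms of an integer equation for \<open>x\<close> by one that divides
  all of them in \<open>B\<close>. The remaining quotients sum to -1, so one of them is a unit, as
  sums of nonunits are nonunits. That quotient is a power of \<open>x\<close> times a power of
  \<open>p\<close>, up to units. Hence the value group is rational, and a real absolute value
  exists.\<close>

lemma exists_E:
  fixes x :: 'k
  assumes "maximal_ring B p" "x \<noteq> 0" shows "\<exists>b c. maximal_ring.E B p x b c"
proof -
  interpret maximal_ring B p by (rule assms(1))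
  obtain a :: "nat \<Rightarrow> int" where a: "\<exists>q\<le>d. a q \<noteq> 0" "(\<Sum>q\<le>d. of_int (a q) * x ^ q) = 0"
    using int_dependence[of "\<lambda>q. x ^ q"] by blast
  define J where "J = {q. q \<le> d \<and> a q \<noteq> 0}"
  define t where "t q = of_int (a q) * x ^ q" for q
  have J: "finite J" "J \<noteq> {}" using a(1) by (auto simp: J_def)
  have t0: "t q \<noteq> 0" if "q \<in> J" for q using that assms(2) by (simp add: t_def J_def)
  obtain j where j: "j \<in> J" "\<And>q. q \<in> J \<Longrightarrow> t q / t j \<in> B" using exists_dividing_all[of J t] J t0 by blast
  have "\<exists>i\<in>J. i \<noteq> j \<and> unit (t i / t j)"
  proof (rule ccontr)
    assume "\<not> ?thesis"
    then have non: "t q / t j \<in> B \<and> \<not> unit (t q / t j)" if "q \<in> J - {j}" for q using j(2) that by blast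
    have "finite (J - {j})" using J by simp
    from nonunit_sum[OF this, of "\<lambda>q. t q / t j"] non
    have nu: "\<not> unit (\<Sum>q\<in>J - {j}. t q / t j)" by blast
    have "(\<Sum>q\<in>J. t q) = 0"
      using a(2) sum.mono_neutral_left[of "{..d}" J t] unfolding t_def J_def by auto
    then have "(\<Sum>q\<in>J. t q / t j) = 0" by (simp flip: sum_divide_distrib)
    then have "t j / t j + (\<Sum>q\<in>J - {j}. t q / t j) = 0" using J j(1) by (simp add: sum.remove)
    then have "(\<Sum>q\<in>J - {j}. t q / t j) = - 1" using t0[OF j(1)] by (simp add: eq_neg_iff_add_eq_0 add.commute)
    moreover have "unit (- 1)" using subring_one[OF B] by (simp add: unit_def subring_minus B)
    ultimately show False using nu by simp
  qed
  then obtain i where i: "i \<in> J" "i \<noteq> j" "unit (t i / t j)" by blast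
  define m where "m q = int (multiplicity (int p) (a q))" for q
  have dec: "\<exists>w. unit w \<and> t q = x ^ q * of_nat p powi m q * w" if q: "q \<in> J" for q
  proof -
    have "a q \<noteq> 0" using q by (simp add: J_def)
    then obtain e where e: "a q = int p ^ multiplicity (int p) (a q) * e" "\<not> int p dvd e"
      using multiplicity_decompose'[of "a q" "int p"] p by (metis not_prime_unit prime_nat_int_transfer)
    have "coprime (int p) e" using e p by (simp add: prime_imp_coprime)
    then have "unit (of_int e)" by (rule unit_of_int)
    moreover have "of_int (a q) = (of_nat p powi m q * of_int e :: 'k)"
      unfolding m_def power_int_of_nat by (subst e(1)) simp
    ultimately show ?thesis unfolding t_def by (intro exI[of _ "of_int e"]) simp
  qed
  obtain wi wj where w: "unit wi" "t i = x ^ i * of_nat p powi m i * wi" "unit wj" "t j = x ^ j * of_nat p powi m j * wj"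
    using dec[OF i(1)] dec[OF j(1)] by blast
  define P where "P = (of_nat p :: 'k)"
  have P0: "P \<noteq> 0" using p0 by (simp add: P_def)
  have w0: "wi \<noteq> 0" "wj \<noteq> 0" using w by (auto simp: unit_def)
  have u: "unit (x ^ i / x ^ j * P powi (m i - m j))"
  proof -
    have "unit (t i / t j * (wj * inverse wi))" by (intro unit_mult i(3) w(3) unit_inverse w(1))
    also have "t i / t j * (wj * inverse wi) = x ^ i / x ^ j * P powi (m i - m j)"
      unfolding w(2,4) P_def[symmetric] using w0 P0 assms(2) by (simp add: power_int_diff field_simps)
    finally show ?thesis .
  qed
  show ?thesis
  proof (cases "j < i")
    case True
    then have "x ^ i / x ^ j = x ^ (i - j)" using assms(2) by (simp add: power_diff)
    then have "E x (i - j) (m j - m i)" using u True assms(2) by (simp add: E_def P_def)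
    then show ?thesis by blast
  next
    case False
    then have ij: "i < j" using i(2) by simp
    have "unit (inverse (x ^ i / x ^ j * P powi (m i - m j)))" using u by (rule unit_inverse)
    also have "inverse (x ^ i / x ^ j * P powi (m i - m j)) = x ^ (j - i) * P powi (m j - m i)"
      using assms(2) ij P0 by (simp add: power_diff power_int_diff field_simps)
    finally have "E x (j - i) (m i - m j)" using ij assms(2) by (simp add: E_def P_def)
    then show ?thesis by blast
  qed
qed

text \<open>The valuation attached to a maximal ring gives an absolute value with unit ball
  \<open>B\<close>. After division by the larger summand, the ultrametric inequality is closure of
  \<open>B\<close> under addition of 1.\<close>

lemma exists_over:
  assumes p: "prime p" shows "(over p :: ('k \<Rightarrow> real) set set) \<noteq> {}"
proof -
  obtain B :: "'k set" where mr: "maximal_ring B p" using exists_maximal_ring[OF p] by blast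
  interpret maximal_ring B p by (rule mr)
  define val where "val x = (SOME r. \<exists>b c. E x b c \<and> r = real_of_int c / real b)" for x :: 'k
  have val: "val x = real_of_int c / real b" if "E x b c" for x b c
    unfolding val_def by (rule some_equality) (use that E_unique in blast)+
  have ex: "\<exists>b c. E x b c" if "x \<noteq> 0" for x by (rule exists_E[OF mr that])
  have p1: "real p > 1" using prime_gt_1_nat[OF p] by simp
  define f where "f x = (if x = 0 then 0 else real p powr (- val x))" for x :: 'k
  have val_mult: "val (x * y) = val x + val y" if xy: "x \<noteq> 0" "y \<noteq> 0" for x y
  proof -
    obtain b c b' c' where E: "E x b c" "E y b' c'" using ex xy by blast
    have b: "b > 0" "b' > 0" using E by (auto simp: E_def)
    show ?thesis unfolding val[OF E_mult[OF E]] val[OF E(1)] val[OF E(2)] using b by (simp add: field_simps)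
  qed
  have f_mult: "f (x * y) = f x * f y" for x y by (simp add: f_def val_mult flip: powr_add)
  have f_le_1: "f x \<le> 1 \<longleftrightarrow> x \<in> B" for x
  proof (cases "x = 0")
    case False
    then obtain b c where E: "E x b c" using ex by blast
    then have b: "b > 0" by (simp add: E_def)
    have "f x \<le> 1 \<longleftrightarrow> 0 \<le> val x" using p1 False powr_le_cancel_iff[of "real p" "- val x" 0] by (simp add: f_def)
    also have "\<dots> \<longleftrightarrow> 0 \<le> c" unfolding val[OF E] using b by (simp add: zero_le_divide_iff)
    also have "\<dots> \<longleftrightarrow> x \<in> B" by (rule E_B[OF E, symmetric])
    finally show ?thesis .
  qed (simp add: f_def subring_zero B)
  have f0: "f x = 0 \<longleftrightarrow> x = 0" for x using p1 by (simp add: f_def)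
  have fpos: "0 \<le> f x" for x by (simp add: f_def)
  have f_add: "f (x + y) \<le> f y" if "f x \<le> f y" for x y
  proof (cases "y = 0")
    case True
    then have "f x = 0" using that fpos[of x] by (simp add: f_def)
    then show ?thesis using f0[of x] True by simp
  next
    case False
    have e: "f (x / y) * f y = f x" using f_mult[of "x / y" y] False by simp
    have fy: "f y > 0" using f0[of y] fpos[of y] False by linarith
    then have "f (x / y) = f x / f y" using e by (simp add: field_simps)
    then have "f (x / y) \<le> 1" using that fy by simp
    then have "1 + x / y \<in> B" using f_le_1 by (simp add: subring_add subring_one B)
    then have "f (1 + x / y) \<le> 1" using f_le_1 by simp
    then have "f (1 + x / y) * f y \<le> 1 * f y" using fpos by (intro mult_right_mono)
    moreover have "(1 + x / y) * y = x + y" using False by (simp add: field_simps)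
    ultimately show ?thesis using f_mult[of "1 + x / y" y] by simp
  qed
  have fp: "f (of_nat p) = 1 / real p"
    using p0 val[OF E_p] p1 by (simp add: f_def powr_minus_divide)
  have "nonarch_abs f"
    unfolding nonarch_abs_def
  proof (intro conjI allI)
    fix x y
    show "0 \<le> f x" "(f x = 0) = (x = 0)" "f (x * y) = f x * f y" by (rule fpos f0 f_mult)+
    show "f (x + y) \<le> max (f x) (f y)"
      using f_add[of x y] f_add[of y x] by (cases "f x \<le> f y") (simp_all add: add.commute max_def)
    show "\<exists>x. x \<noteq> 0 \<and> f x \<noteq> 1" using p0 fp p1 by (intro exI[of _ "of_nat p"]) simp
  qed
  from place_of_abs[OF this] obtain v c where v: "v \<in> places" "c > 0" "\<forall>x. place_abs v x = f x powr c" by blast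
  have "place_abs v (of_nat p) < 1" using v p1 fp powr_less_mono2[of c "1 / real p" 1] by simp
  then show ?thesis using v(1) by (auto simp: over_def)
qed

end

text \<open>Used for \<open>T = {v}\<close>, for \<open>T = places - S\<close>, which gives the
  \<open>S\<close>-integers, and for the parts of these sets over \<open>p\<close>.\<close>

definition intring :: "('k::field \<Rightarrow> real) set set \<Rightarrow> 'k set" where
  "intring T = {x. \<forall>v\<in>T. place_abs v x \<le> 1}"

lemma subring_intring: assumes T: "T \<subseteq> places" shows "subring (intring T)"
proof (rule subringI)
  have na: "nonarch_abs (place_abs v)" if "v \<in> T" for v using that T place_abs_nonarch by blast
  show "1 \<in> intring T" by (simp add: intring_def nonarch_1 na)
  fix x y assume xy: "x \<in> intring T" "y \<in> intring T"
  show "x - y \<in> intring T"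
    unfolding intring_def
  proof (intro CollectI ballI)
    fix v assume v: "v \<in> T"
    have "place_abs v x \<le> 1" "place_abs v y \<le> 1" using xy v by (auto simp: intring_def)
    then show "place_abs v (x - y) \<le> 1" using nonarch_diff[OF na[OF v], of x y] by simp
  qed
  show "x * y \<in> intring T"
    unfolding intring_def
  proof (intro CollectI ballI)
    fix v assume v: "v \<in> T"
    have "place_abs v x \<le> 1" "place_abs v y \<le> 1" using xy v by (auto simp: intring_def)
    then show "place_abs v (x * y) \<le> 1" using nonarch_nonneg[OF na[OF v]] by (simp add: nonarch_mult[OF na[OF v]] mult_le_one)
  qed
qed

context nf begin

lemma nf_ringI: "subring R \<Longrightarrow> nf_ring R co d"
  by unfold_locales (use co_add co_inj co_rat[of _ "of_int _"] in auto)

text \<open>Values above the \<open>N\<close>-th power of \<open>1 / p\<close> are constant on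
  residue classes modulo \<open>p ^ N\<close> of the valuation ring, and there are finitely many
  classes. So values do not accumulate away from 0.\<close>

lemma finite_values:
  fixes f :: "'k \<Rightarrow> real"
  assumes p: "prime p" and f: "normalised p f"
  shows "finite {f x |x. (1 / real p) ^ N < f x \<and> f x \<le> 1}"
proof -
  have na: "nonarch_abs f" and fp: "f (of_nat p) = 1 / real p" using f by (auto simp: normalised_def)
  define A where "A = {x. f x \<le> 1}"
  have A: "subring A"
  proof (rule subringI)
    show "1 \<in> A" by (simp add: A_def nonarch_1[OF na])
    fix x y assume xy: "x \<in> A" "y \<in> A"
    show "x - y \<in> A" using xy nonarch_diff[OF na, of x y] by (simp add: A_def)
    show "x * y \<in> A" using xy nonarch_nonneg[OF na] by (simp add: A_def nonarch_mult[OF na] mult_le_one)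
  qed
  interpret nf_ring A co d by (rule nf_ringI[OF A])
  let ?V = "vecs A {0}" let ?m = "p ^ N" let ?W = "smul (of_nat ?m) ` ?V"
  have W: "subgrp ?W" by (rule subgrp_smul_image[OF subgrp_vecs[OF A]])
  have "idx ?V ?W > 0" by (rule vecs_mult_idx_pos) (use prime_gt_0_nat[OF p] in auto)
  then have fin: "finite ((\<lambda>a. (+) a ` ?W) ` ?V)" by (rule finite_cosets)
  have "{f x |x. (1 / real p) ^ N < f x \<and> f x \<le> 1} \<subseteq> (\<lambda>C. f ((SOME g. g \<in> C) 0)) ` (\<lambda>a. (+) a ` ?W) ` ?V"
  proof
    fix y assume "y \<in> {f x |x. (1 / real p) ^ N < f x \<and> f x \<le> 1}"
    then obtain x where x: "y = f x" "(1 / real p) ^ N < f x" "f x \<le> 1" by blast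
    define g where "g = smul x (delta 0)"
    have gV: "g \<in> ?V" using x(3) nonarch_eq_0[OF na, of 0] by (simp add: g_def vecs_def A_def)
    have "g \<in> (+) g ` ?W" using subgrp_zero[OF W] by (metis add_0_right imageI)
    then have "(SOME g'. g' \<in> (+) g ` ?W) \<in> (+) g ` ?W" by (rule someI[of "\<lambda>g'. g' \<in> (+) g ` ?W"])
    then obtain w where w: "w \<in> ?W" "(SOME g'. g' \<in> (+) g ` ?W) = g + w" by blast
    then obtain h where h: "h \<in> ?V" "w = smul (of_nat ?m) h" by blast
    have "f (h 0) \<le> 1" using h(1) by (simp add: vecs_def A_def)
    then have "f (w 0) \<le> (1 / real p) ^ N"
      unfolding h(2) using nonarch_nonneg[OF na, of "h 0"]
      by (simp add: nonarch_mult[OF na] nonarch_power[OF na] fp mult_left_le)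
    then have "f (x + w 0) = f x" using x(2) by (intro nonarch_add_eq[OF na]) simp
    then have "f ((SOME g'. g' \<in> (+) g ` ?W) 0) = y" unfolding w(2) by (simp add: g_def x(1))
    then show "y \<in> (\<lambda>C. f ((SOME g. g \<in> C) 0)) ` (\<lambda>a. (+) a ` ?W) ` ?V" using gV by (intro image_eqI[OF _ imageI[OF gV]]) simp
  qed
  then show ?thesis using fin by (meson finite_imageI finite_subset)
qed

text \<open>By \<open>finite_values\<close> each place of \<open>T\<close> has an element of the
  ideal with maximal absolute value. Weak approximation supplies \<open>e f\<close> of absolute
  value 1 at \<open>f\<close> and below 1 at the other places, and the sum of the
  \<open>e f * X f\<close> attains all the maxima at once; it generates the ideal.\<close>

lemma pid_ring_intring:
  fixes T :: "('k \<Rightarrow> real) set set"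
  assumes p: "prime p" and T: "finite T" "T \<noteq> {}" "T \<subseteq> over p"
  shows "pid_ring (intring T) co d"
proof -
  define F where "F = norm_abs p ` T"
  have Tpl: "T \<subseteq> places" using T by (auto simp: over_def)
  have norm: "normalised p f" if "f \<in> F" for f using that norm_abs(1)[OF p] T by (auto simp: F_def)
  have na: "nonarch_abs f" if "f \<in> F" for f using norm[OF that] by (simp add: normalised_def)
  have R: "intring T = {x. \<forall>f\<in>F. f x \<le> 1}" unfolding intring_def F_def using norm_abs(2)[OF p] T(3) by auto
  have finF: "finite F" using T by (simp add: F_def)
  interpret nf_ring "intring T" co d by (rule nf_ringI[OF subring_intring[OF Tpl]])
  show ?thesis
  proof unfold_locales
    obtain f where f: "f \<in> F" using T by (auto simp: F_def)
    have "f (inverse (of_nat p)) = real p" using norm[OF f] by (simp add: nonarch_inverse[OF na[OF f]] normalised_def)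
    then have "inverse (of_nat p) \<notin> intring T" unfolding R using f prime_gt_1_nat[OF p] by fastforce
    then show "\<exists>c>0. inverse (of_nat c) \<notin> intring T" using prime_gt_0_nat[OF p] by blast
  next
    fix I assume I: "I \<subseteq> intring T" "subgrp I" "\<And>r a. r \<in> intring T \<Longrightarrow> a \<in> I \<Longrightarrow> r * a \<in> I"
    show "\<exists>a\<in>I. \<forall>b\<in>I. \<exists>r\<in>intring T. b = r * a"
    proof (cases "\<exists>x\<in>I. x \<noteq> 0")
      case False
      then have "\<forall>b\<in>I. \<exists>r\<in>intring T. b = r * 0" using subring_one[OF ring] by auto
      then show ?thesis using subgrp_zero[OF I(2)] by blast
    next
      case True
      then obtain x0 where x0: "x0 \<in> I" "x0 \<noteq> 0" by blast
      have "\<exists>x\<in>I. 0 < f x \<and> (\<forall>b\<in>I. f b \<le> f x)" if f: "f \<in> F" for f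
      proof -
        have pos: "0 < f x0" by (rule nonarch_pos[OF na[OF f] x0(2)])
        obtain N where N: "(1 / real p) ^ N < f x0"
          using real_arch_pow_inv[OF pos, of "1 / real p"] prime_gt_1_nat[OF p] by auto
        define V where "V = {f b |b. b \<in> I \<and> f x0 \<le> f b}"
        have "V \<subseteq> {f x |x. (1 / real p) ^ N < f x \<and> f x \<le> 1}"
          using N I(1) f unfolding V_def R by fastforce
        then have finV: "finite V" using finite_values[OF p norm[OF f]] finite_subset by blast
        have "f x0 \<in> V" using x0(1) by (auto simp: V_def)
        then have "Max V \<in> V" by (intro Max_in finV) auto
        then obtain x where x: "x \<in> I" "f x0 \<le> f x" "Max V = f x" by (auto simp: V_def)
        have "f b \<le> f x" if "b \<in> I" for b
        proof (cases "f x0 \<le> f b")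
          case True
          then have "f b \<in> V" using that by (auto simp: V_def)
          then show ?thesis using Max_ge[OF finV] x(3) by metis
        qed (use x in linarith)
        then show ?thesis using x pos by (intro bexI[of _ x]) auto
      qed
      then obtain X where X: "\<And>f. f \<in> F \<Longrightarrow> X f \<in> I" "\<And>f. f \<in> F \<Longrightarrow> 0 < f (X f)" "\<And>f b. f \<in> F \<Longrightarrow> b \<in> I \<Longrightarrow> f b \<le> f (X f)"
        by metis
      have "\<exists>e. f e = 1 \<and> (\<forall>g\<in>F - {f}. g e < 1)" if f: "f \<in> F" for f
      proof -
        have "\<exists>z. f z > 1 \<and> (\<forall>g\<in>F - {f}. g z < 1)"
          by (rule separate[OF p]) (use finF f norm in auto)
        then obtain z where z: "f z > 1" "\<And>g. g \<in> F - {f} \<Longrightarrow> g z < 1" by blast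
        \<comment> \<open>The quotient \<open>z / (z + 1)\<close> has absolute value 1 where
          \<open>z\<close> is large and keeps that of \<open>z\<close> where \<open>z\<close> is
          small.\<close>
        have "f (z + 1) = f z" using z(1) by (intro nonarch_add_eq na f) (simp add: nonarch_1[OF na[OF f]])
        then have "f (z / (z + 1)) = 1" using z(1) by (simp add: nonarch_divide[OF na[OF f]])
        moreover have "g (z / (z + 1)) < 1" if g: "g \<in> F - {f}" for g
        proof -
          have nag: "nonarch_abs g" using g na by blast
          have "g (1 + z) = g 1" using z(2)[OF g] by (intro nonarch_add_eq nag) (simp add: nonarch_1[OF nag])
          then show ?thesis using z(2)[OF g] by (simp add: nonarch_divide[OF nag] nonarch_1[OF nag] add.commute)
        qed
        ultimately show ?thesis by blast
      qed
      then obtain e where e: "\<And>f. f \<in> F \<Longrightarrow> f (e f) = 1" "\<And>f g. f \<in> F \<Longrightarrow> g \<in> F \<Longrightarrow> g \<noteq> f \<Longrightarrow> g (e f) < 1"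
        by (metis Diff_iff singletonD)
      have eR: "e f \<in> intring T" if f: "f \<in> F" for f
        unfolding R
      proof (intro CollectI ballI)
        fix g assume "g \<in> F"
        then show "g (e f) \<le> 1" using e(1)[OF f] e(2)[OF f, of g] by (cases "g = f") auto
      qed
      define a where "a = (\<Sum>f\<in>F. e f * X f)"
      have aI: "a \<in> I" unfolding a_def by (rule subgrp_sum[OF I(2)]) (simp add: I(3) eR X(1))
      have fa: "f a = f (X f)" if f: "f \<in> F" for f
      proof -
        note naf = na[OF f]
        have own: "f (e f * X f) = f (X f)" by (simp add: nonarch_mult[OF naf] e(1)[OF f])
        have "f a = f (e f * X f)" unfolding a_def
        proof (rule nonarch_sum_eq[OF naf finF f])
          fix g assume g: "g \<in> F" "g \<noteq> f"
          have "f (e g) * f (X g) \<le> f (e g) * f (X f)"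
            using X(3)[OF f X(1)[OF g(1)]] nonarch_nonneg[OF naf] by (intro mult_left_mono)
          also have "\<dots> < 1 * f (X f)" using e(2)[OF g(1) f] g X(2)[OF f] by (intro mult_strict_right_mono) auto
          finally show "f (e g * X g) < f (e f * X f)" unfolding own by (simp add: nonarch_mult[OF naf])
        qed (use own X(2)[OF f] in simp)
        then show ?thesis using own by simp
      qed
      have a0: "a \<noteq> 0"
      proof -
        obtain f where f: "f \<in> F" using T by (auto simp: F_def)
        show ?thesis using fa[OF f] X(2)[OF f] nonarch_eq_0[OF na[OF f], of a] by auto
      qed
      have "\<exists>r\<in>intring T. b = r * a" if b: "b \<in> I" for b
      proof (intro bexI[of _ "b / a"])
        show "b = b / a * a" using a0 by simp
        show "b / a \<in> intring T" unfolding R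
        proof (intro CollectI ballI)
          fix f assume f: "f \<in> F"
          show "f (b / a) \<le> 1" using X(3)[OF f b] X(2)[OF f] by (simp add: nonarch_divide[OF na[OF f]] fa[OF f])
        qed
      qed
      then show ?thesis using aI by blast
    qed
  qed
qed

text \<open>Only finitely many places of \<open>T\<close> see a denominator of \<open>y\<close>, and
  none of them lies over \<open>p\<close>. An integer \<open>D\<close> prime to \<open>p\<close>
  clears these denominators, and \<open>u * D + w * p ^ e = 1\<close> splits
  \<open>y\<close>.\<close>

lemma localisation_surj:
  fixes y :: 'k
  assumes T: "T \<subseteq> places" and p: "prime p" and y: "y \<in> intring (T \<inter> over p)"
  shows "\<exists>x\<in>intring T. \<exists>z\<in>intring (T \<inter> over p). y = x + of_nat (p ^ e) * z"
proof -
  define Bad where "Bad = {v \<in> T. place_abs v y > 1}"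
  have "Bad \<subseteq> {v \<in> places. place_abs v y > 1}" using T by (auto simp: Bad_def)
  then have fin: "finite Bad" using finite_nonintegral[of y] finite_subset by blast
  have na: "nonarch_abs (place_abs v)" if "v \<in> T" for v using that T place_abs_nonarch by blast
  have "\<exists>q. coprime q p \<and> place_abs v (of_nat q * y) \<le> 1" if v: "v \<in> Bad" for v
  proof -
    have vT: "v \<in> T" and vy: "place_abs v y > 1" using v by (auto simp: Bad_def)
    note f = na[OF vT]
    obtain q where q: "prime q" "place_abs v (of_nat q) < 1" using exists_prime_below[OF f] by blast
    have "v \<notin> over p"
    proof
      assume "v \<in> over p"
      then have "place_abs v y \<le> 1" using y vT by (simp add: intring_def)
      then show False using vy by simp
    qed
    then have "q \<noteq> p" using q vT T by (auto simp: over_def)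
    then have "coprime q p" using q p by (simp add: primes_coprime)
    obtain n where n: "place_abs v (of_nat q) ^ n < inverse (place_abs v y)"
      using real_arch_pow_inv[of "inverse (place_abs v y)" "place_abs v (of_nat q)"] q vy by auto
    have "place_abs v (of_nat (q ^ n) * y) \<le> 1"
      using n vy by (simp add: nonarch_mult[OF f] nonarch_power[OF f] field_simps)
    then show ?thesis using \<open>coprime q p\<close> by (intro exI[of _ "q ^ n"]) simp
  qed
  then obtain q where q: "\<And>v. v \<in> Bad \<Longrightarrow> coprime (q v) p" "\<And>v. v \<in> Bad \<Longrightarrow> place_abs v (of_nat (q v) * y) \<le> 1" by metis
  define D where "D = (\<Prod>v\<in>Bad. q v)"
  have "coprime D p" unfolding D_def using q(1) by (intro prod_coprime_left) auto
  then have cop: "coprime (int D) (int (p ^ e))" by (simp add: coprime_int_iff)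
  have Dy: "of_nat D * y \<in> intring T"
    unfolding intring_def
  proof (intro CollectI ballI)
    fix v assume v: "v \<in> T"
    note f = na[OF v]
    show "place_abs v (of_nat D * y) \<le> 1"
    proof (cases "v \<in> Bad")
      case True
      have "D = (\<Prod>w\<in>Bad - {v}. q w) * q v" unfolding D_def using fin True by (simp add: prod.remove mult.commute)
      then have "of_nat D * y = of_nat (\<Prod>w\<in>Bad - {v}. q w) * (of_nat (q v) * y)" by simp
      then show ?thesis
        using q(2)[OF True] nonarch_of_nat[OF f] nonarch_nonneg[OF f] by (simp only: nonarch_mult[OF f, of "of_nat (prod q (Bad - {v}))"] mult_le_one)
    next
      case False
      then have "place_abs v y \<le> 1" using v by (auto simp: Bad_def)
      then show ?thesis using nonarch_of_nat[OF f] nonarch_nonneg[OF f] by (simp only: nonarch_mult[OF f] mult_le_one)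
    qed
  qed
  obtain u w where uw: "u * int D + w * int (p ^ e) = 1" using cop by (metis bezout_int coprime_iff_gcd_eq_1)
  have T2: "T \<inter> over p \<subseteq> places" using T by blast
  have "(of_int (u * int D + w * int (p ^ e)) :: 'k) = 1" unfolding uw by simp
  then have one: "of_int u * of_nat D + of_int w * of_nat (p ^ e) = (1 :: 'k)" by simp
  have "(of_int u * of_nat D + of_int w * of_nat (p ^ e)) * y = of_int u * (of_nat D * y) + of_nat (p ^ e) * (of_int w * y)"
    by (simp only: distrib_right distrib_left mult_ac)
  then have "y = of_int u * (of_nat D * y) + of_nat (p ^ e) * (of_int w * y)" unfolding one by simp
  moreover have "of_int u * (of_nat D * y) \<in> intring T"
    using Dy subring_intring[OF T] by (simp add: subring_mult subring_of_int)
  moreover have "of_int w * y \<in> intring (T \<inter> over p)"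
    using y subring_intring[OF T2] by (simp add: subring_mult subring_of_int)
  ultimately show ?thesis by blast
qed

text \<open>At places not over \<open>p\<close>, multiplication by \<open>p ^ e\<close> preserves
  absolute values.\<close>

lemma localisation_inj:
  fixes y :: 'k
  assumes T: "T \<subseteq> places" and p: "prime p" and y: "y \<in> intring (T \<inter> over p)" "of_nat (p ^ e) * y \<in> intring T"
  shows "y \<in> intring T"
  unfolding intring_def
proof (intro CollectI ballI)
  fix v assume v: "v \<in> T"
  then have f: "nonarch_abs (place_abs v)" using T place_abs_nonarch by blast
  show "place_abs v y \<le> 1"
  proof (cases "v \<in> over p")
    case True
    then show ?thesis using y v by (auto simp: intring_def)
  next
    case False
    then have "place_abs v (of_nat p) = 1" using v T nonarch_of_nat[OF f, of p] by (fastforce simp: over_def)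
    then have "place_abs v (of_nat (p ^ e) * y) = place_abs v y" by (simp add: nonarch_mult[OF f] nonarch_power[OF f])
    then show ?thesis using y(2) v by (auto simp: intring_def)
  qed
qed

end

text \<open>A finite abelian group killed by \<open>p ^ e\<close> has order a power of
  \<open>p\<close>: an element \<open>a\<close> of order \<open>p\<close> modulo \<open>N\<close>
  enlarges \<open>N\<close> to \<open>N'\<close> with \<open>idx N' N = p\<close>, and the smaller
  index of \<open>N'\<close> is handled by induction.\<close>

lemma idx_prime_power:
  fixes M N :: "(nat \<Rightarrow> 'k::field_char_0) set"
  assumes p: "prime p" and M: "subgrp M"
  shows "subgrp N \<Longrightarrow> N \<subseteq> M \<Longrightarrow> 0 < idx M N \<Longrightarrow> (\<And>f. f \<in> M \<Longrightarrow> smul (of_nat (p ^ e)) f \<in> N) \<Longrightarrow> \<exists>k. idx M N = p ^ k"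
proof (induction "idx M N" arbitrary: N rule: less_induct)
  case less
  note N = \<open>subgrp N\<close>
  show ?case
  proof (cases "N = M")
    case True
    then show ?thesis using idx_self[OF M] by (intro exI[of _ 0]) simp
  next
    case False
    then obtain f where f: "f \<in> M" "f \<notin> N" using less.prems(2) by blast
    define i where "i = (LEAST i. smul (of_nat (p ^ i)) f \<in> N)"
    have i: "smul (of_nat (p ^ i)) f \<in> N" unfolding i_def by (rule LeastI[of "\<lambda>i. smul (of_nat (p ^ i)) f \<in> N"]) (rule less.prems(4)[OF f(1)])
    have i0: "i > 0" using i f(2) by (cases i) (simp_all add: smul_one)
    define a where "a = smul (of_nat (p ^ (i - 1))) f"
    have aM: "a \<in> M" unfolding a_def by (rule subgrp_smul_of_nat[OF M f(1)])
    have aN: "a \<notin> N" unfolding a_def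
      using not_less_Least[of "i - 1" "\<lambda>i. smul (of_nat (p ^ i)) f \<in> N"] i0 by (simp add: i_def)
    have "smul (of_nat p) a = smul (of_nat (p ^ i)) f" unfolding a_def smul_smul using i0
      by (metis Suc_pred' of_nat_mult power_Suc)
    then have pa: "smul (of_nat p) a \<in> N" using i by simp
    have mult_iff: "smul (of_int j) a \<in> N \<longleftrightarrow> int p dvd j" for j
    proof
      assume "int p dvd j"
      then obtain c where "j = int p * c" by (elim dvdE)
      then have "smul (of_int j) a = smul (of_int c) (smul (of_nat p) a)" by (simp add: smul_smul mult.commute)
      then show "smul (of_int j) a \<in> N" using subgrp_smul_of_int[OF N pa] by simp
    next
      assume ja: "smul (of_int j) a \<in> N"
      show "int p dvd j"
      proof (rule ccontr)
        assume "\<not> int p dvd j"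
        then have "coprime (int p) j" using p by (simp add: prime_imp_coprime)
        then obtain u w where uw: "u * int p + w * j = 1" by (metis bezout_int coprime_iff_gcd_eq_1)
        have "smul (of_int (u * int p + w * j)) a = smul (of_int u) (smul (of_nat p) a) + smul (of_int w) (smul (of_int j) a)"
          by (simp add: smul_smul smul_add_left)
        also have "\<dots> \<in> N" by (intro subgrp_add[OF N] subgrp_smul_of_int[OF N] pa ja)
        finally show False using aN unfolding uw by (simp add: smul_one)
      qed
    qed
    define N' where "N' = {x. \<exists>j::int. x - smul (of_int j) a \<in> N}"
    have N': "subgrp N'" unfolding subgrp_def
    proof (intro conjI ballI)
      show "0 \<in> N'" unfolding N'_def using subgrp_zero[OF N] by (intro CollectI exI[of _ 0]) (simp add: smul_zero_left)
      fix x y assume "x \<in> N'" "y \<in> N'"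
      then obtain j k where jk: "x - smul (of_int j) a \<in> N" "y - smul (of_int k) a \<in> N" by (auto simp: N'_def)
      have "(x - y) - smul (of_int (j - k)) a = (x - smul (of_int j) a) - (y - smul (of_int k) a)" by (simp add: smul_diff_left)
      then have "(x - y) - smul (of_int (j - k)) a \<in> N" using subgrp_diff[OF N jk] by metis
      then show "x - y \<in> N'" unfolding N'_def by blast
    qed
    have NN': "N \<subseteq> N'"
    proof
      fix x assume "x \<in> N"
      then show "x \<in> N'" unfolding N'_def by (intro CollectI exI[of _ 0]) (simp add: smul_zero_left)
    qed
    have N'M: "N' \<subseteq> M"
    proof
      fix x assume "x \<in> N'"
      then obtain j where "x - smul (of_int j) a \<in> N" by (auto simp: N'_def)
      then have "(x - smul (of_int j) a) + smul (of_int j) a \<in> M"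
        using less.prems(2) by (intro subgrp_add[OF M] subgrp_smul_of_int[OF M aM]) blast
      then show "x \<in> M" by simp
    qed
    have "(\<lambda>x. (+) x ` N) ` N' = (\<lambda>j. (+) (smul (of_int j) a) ` N) ` {0..<int p}"
    proof
      show "(\<lambda>x. (+) x ` N) ` N' \<subseteq> (\<lambda>j. (+) (smul (of_int j) a) ` N) ` {0..<int p}"
      proof (rule image_subsetI)
        fix x assume "x \<in> N'"
        then obtain j where j: "x - smul (of_int j) a \<in> N" by (auto simp: N'_def)
        have "smul (of_int j) a - smul (of_int (j mod int p)) a = smul (of_int (j - j mod int p)) a" by (simp add: smul_diff_left)
        also have "\<dots> \<in> N" unfolding mult_iff by (simp add: dvd_minus_mod)
        finally have "x - smul (of_int (j mod int p)) a \<in> N" by (rule subgrp_diff_trans[OF N j])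
        then have "(+) x ` N = (+) (smul (of_int (j mod int p)) a) ` N" by (simp only: coset_eq_iff[OF N])
        moreover have "j mod int p \<in> {0..<int p}" using prime_gt_0_nat[OF p] by simp
        ultimately show "(+) x ` N \<in> (\<lambda>j. (+) (smul (of_int j) a) ` N) ` {0..<int p}" by blast
      qed
      show "(\<lambda>j. (+) (smul (of_int j) a) ` N) ` {0..<int p} \<subseteq> (\<lambda>x. (+) x ` N) ` N'"
      proof (rule image_subsetI)
        fix j :: int
        have "smul (of_int j) a \<in> N'" unfolding N'_def using subgrp_zero[OF N] by (intro CollectI exI[of _ j]) simp
        then show "(+) (smul (of_int j) a) ` N \<in> (\<lambda>x. (+) x ` N) ` N'" by (rule imageI)
      qed
    qed
    moreover have "inj_on (\<lambda>j. (+) (smul (of_int j) a) ` N) {0..<int p}"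
    proof (rule inj_onI)
      fix j k assume jk: "j \<in> {0..<int p}" "k \<in> {0..<int p}" "(+) (smul (of_int j) a) ` N = (+) (smul (of_int k) a) ` N"
      then have "smul (of_int j) a - smul (of_int k) a \<in> N" by (simp only: coset_eq_iff[OF N])
      then have "smul (of_int (j - k)) a \<in> N" by (simp add: smul_diff_left)
      then have "int p dvd j - k" by (simp only: mult_iff)
      then have "j mod int p = k mod int p" by (simp add: mod_eq_dvd_iff)
      then show "j = k" using jk by simp
    qed
    ultimately have "idx N' N = p" unfolding idx_def by (simp add: card_image)
    then have split: "idx M N = idx M N' * p" using idx_mult[OF M N' N NN' N'M] by simp
    then have "0 < idx M N'" "idx M N' < idx M N" using less.prems(3) prime_gt_1_nat[OF p] by auto
    moreover have "smul (of_nat (p ^ e)) f \<in> N'" if "f \<in> M" for f using less.prems(4)[OF that] NN' by blast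
    ultimately obtain k where "idx M N' = p ^ k" using less.hyps[of N'] N' N'M by blast
    then show ?thesis using split by (intro exI[of _ "Suc k"]) simp
  qed
qed

lemma number_field_nf:
  assumes "number_field TYPE('k::field_char_0)" shows "\<exists>(co :: nat \<Rightarrow> 'k \<Rightarrow> rat) d. nf co d"
proof -
  obtain Basis where "finite_dimensional_vector_space (\<lambda>(q::rat) (x::'k). of_rat q * x) Basis"
    using assms unfolding number_field_def by blast
  then interpret fd: finite_dimensional_vector_space "\<lambda>(q::rat) (x::'k). of_rat q * x" Basis .
  define d where "d = card Basis"
  obtain e where e: "bij_betw e {0..<d} Basis" unfolding d_def using ex_bij_betw_nat_finite[OF fd.finite_Basis] by blast
  define co where "co i x = fd.representation Basis x (e i)" for i x
  have sp: "x \<in> fd.span Basis" for x using fd.span_Basis by simp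
  have "nf co d"
  proof
    fix i x y q
    show "co i (x + y) = co i x + co i y" unfolding co_def by (simp add: fd.representation_add[OF fd.independent_Basis sp sp])
    show "co i (of_rat q * x) = q * co i x" unfolding co_def by (simp add: fd.representation_scale[OF fd.independent_Basis sp])
  next
    fix x assume z: "\<forall>i<d. co i x = 0"
    have "fd.representation Basis x b = 0" if b: "b \<in> Basis" for b
    proof -
      have "b \<in> e ` {0..<d}" using e b by (simp add: bij_betw_def)
      then obtain i where "i \<in> {0..<d}" "b = e i" by blast
      then show ?thesis using z by (simp add: co_def)
    qed
    then have "(\<Sum>b\<in>Basis. of_rat (fd.representation Basis x b) * b) = 0" by simp
    then show "x = 0" using fd.sum_representation_eq[OF fd.independent_Basis sp fd.finite_Basis subset_refl, of x] by simp
  qed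
  then show ?thesis by blast
qed

section \<open>Transfer along residue isomorphisms\<close>

text \<open>If \<open>\<phi>\<close> induces an isomorphism modulo \<open>m\<close>, then \<open>R\<close> and \<open>R'\<close> have the same invariant
  submodules of index \<open>m\<close>, since these contain all multiples of \<open>m\<close>.\<close>

locale transfer = cring R' for R' :: "('r, 'b) ring_scheme" (structure) +
  fixes R :: "'k::field_char_0 set" and \<phi> :: "'k \<Rightarrow> 'r" and m n :: nat
  assumes R: "subring R" and m: "m > 0"
    and \<phi>_closed: "\<And>x. x \<in> R \<Longrightarrow> \<phi> x \<in> carrier R'"
    and \<phi>_add: "\<And>x y. x \<in> R \<Longrightarrow> y \<in> R \<Longrightarrow> \<phi> (x + y) = \<phi> x \<oplus> \<phi> y"
    and \<phi>_mult: "\<And>x y. x \<in> R \<Longrightarrow> y \<in> R \<Longrightarrow> \<phi> (x * y) = \<phi> x \<otimes> \<phi> y"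
    and \<phi>_zero: "\<phi> 0 = \<zero>" and \<phi>_one: "\<phi> 1 = \<one>"
    and \<phi>_inj: "\<And>x y. x \<in> R \<Longrightarrow> y \<in> carrier R' \<Longrightarrow> \<phi> x = \<phi> (of_nat m) \<otimes> y \<Longrightarrow> \<exists>z\<in>R. x = of_nat m * z"
    and \<phi>_surj: "\<And>y. y \<in> carrier R' \<Longrightarrow> \<exists>x\<in>R. \<exists>z\<in>carrier R'. y = \<phi> x \<oplus> \<phi> (of_nat m) \<otimes> z"
begin

abbreviation "F \<equiv> free_module R' n"
abbreviation "Gr \<equiv> add_monoid F"

definition plus :: "'r vec \<Rightarrow> 'r vec \<Rightarrow> 'r vec" where
  "plus x y = vec n (\<lambda>i. x $ i \<oplus> y $ i)"

definition scale :: "'r \<Rightarrow> 'r vec \<Rightarrow> 'r vec" where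
  "scale a x = vec n (\<lambda>i. a \<otimes> x $ i)"

definition V :: "(nat \<Rightarrow> 'k) \<Rightarrow> 'r vec" where
  "V f = vec n (\<lambda>i. \<phi> (f i))"

definition C :: "'r vec set" where
  "C = {x \<in> carrier_vec n. \<forall>i<n. x $ i \<in> carrier R'}"

abbreviation "M \<equiv> vecs R {..<n}"
abbreviation "mm \<equiv> \<phi> (of_nat m)"

lemma F_basic: "carrier F = C" "add F = plus" "\<zero>\<^bsub>F\<^esub> = vec n (\<lambda>_. \<zero>)" "a \<odot>\<^bsub>F\<^esub> x = scale a x"
  by (simp_all add: free_module_def C_def plus_def scale_def fun_eq_iff)

lemmas F_simps = F_basic monoid.simps partial_object.simps

lemma CI: "(\<And>i. i < n \<Longrightarrow> g i \<in> carrier R') \<Longrightarrow> vec n g \<in> C"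
  by (simp add: C_def)

lemma CD: "x \<in> C \<Longrightarrow> i < n \<Longrightarrow> x $ i \<in> carrier R'" "x \<in> C \<Longrightarrow> dim_vec x = n"
  by (auto simp: C_def)

lemma plus_C: "x \<in> C \<Longrightarrow> y \<in> C \<Longrightarrow> plus x y \<in> C" and scale_C: "a \<in> carrier R' \<Longrightarrow> x \<in> C \<Longrightarrow> scale a x \<in> C"
  unfolding plus_def scale_def by (auto intro!: CI simp: CD)

lemma R_of_nat: "of_nat k \<in> R"
  by (rule subring_of_nat[OF R])

lemma mm: "mm \<in> carrier R'"
  by (rule \<phi>_closed[OF R_of_nat])

lemma MD: "f \<in> M \<Longrightarrow> f i \<in> R"
  by (simp add: vecs_def)

lemma sM: "subgrp M" "submod R M"
  using subgrp_vecs submod_vecs R by blast+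

lemma V_C: "f \<in> M \<Longrightarrow> V f \<in> C"
  unfolding V_def by (auto intro!: CI \<phi>_closed MD)

lemma V_add: "f \<in> M \<Longrightarrow> g \<in> M \<Longrightarrow> V (f + g) = plus (V f) (V g)"
  unfolding V_def plus_def by (intro eq_vecI) (simp_all add: \<phi>_add MD)

lemma V_smul: "r \<in> R \<Longrightarrow> f \<in> M \<Longrightarrow> V (smul r f) = scale (\<phi> r) (V f)"
  unfolding V_def scale_def by (intro eq_vecI) (simp_all add: \<phi>_mult MD)

lemma V_zero: "V 0 = vec n (\<lambda>_. \<zero>)"
  unfolding V_def by (simp add: \<phi>_zero)

lemma comm_group_Gr: "comm_group Gr"
proof (rule comm_groupI; unfold F_simps)
  fix x y z assume x: "x \<in> C" and y: "y \<in> C" and z: "z \<in> C"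
  show "plus x y \<in> C" by (rule plus_C[OF x y])
  show "plus (plus x y) z = plus x (plus y z)"
    unfolding plus_def by (intro eq_vecI) (simp_all add: a_assoc CD x y z)
  show "plus x y = plus y x"
    unfolding plus_def by (intro eq_vecI) (simp_all add: a_comm CD x y)
next
  fix x assume x: "x \<in> C"
  show "plus (vec n (\<lambda>_. \<zero>)) x = x"
    unfolding plus_def using x by (intro eq_vecI) (simp_all add: CD)
  have "vec n (\<lambda>i. \<ominus> x $ i) \<in> C" by (rule CI) (simp add: CD x)
  moreover have "plus (vec n (\<lambda>i. \<ominus> x $ i)) x = vec n (\<lambda>_. \<zero>)"
    unfolding plus_def by (intro eq_vecI) (simp_all add: l_neg CD x)
  ultimately show "\<exists>y\<in>C. plus y x = vec n (\<lambda>_. \<zero>)" by blast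
qed (auto intro: CI)

lemma subgroupD:
  assumes N: "submodule N R' F"
  shows "subgroup N Gr" "N \<subseteq> C" "vec n (\<lambda>_. \<zero>) \<in> N" "\<And>x y. x \<in> N \<Longrightarrow> y \<in> N \<Longrightarrow> plus x y \<in> N"
    "\<And>a x. a \<in> carrier R' \<Longrightarrow> x \<in> N \<Longrightarrow> scale a x \<in> N"
proof -
  show s: "subgroup N Gr" using N by (simp add: submodule_def)
  show "N \<subseteq> C" using subgroup.subset[OF s] unfolding F_simps .
  show "vec n (\<lambda>_. \<zero>) \<in> N" using subgroup.one_closed[OF s] unfolding F_simps .
  show "\<And>x y. x \<in> N \<Longrightarrow> y \<in> N \<Longrightarrow> plus x y \<in> N" using subgroup.m_closed[OF s] unfolding F_simps .
  show "\<And>a x. a \<in> carrier R' \<Longrightarrow> x \<in> N \<Longrightarrow> scale a x \<in> N"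
    using submodule.smult_closed[OF N] unfolding F_simps .
qed

text \<open>Integer multiples are the powers in the additive group, the form in which Lagrange's
  theorem applies.\<close>

lemma nat_pow_Gr: assumes x: "x \<in> C" shows "x [^]\<^bsub>Gr\<^esub> k = scale (\<phi> (of_nat k)) x"
proof (induction k)
  case 0
  show ?case unfolding nat_pow_0 F_simps scale_def by (intro eq_vecI) (simp_all add: \<phi>_zero CD x)
next
  case (Suc k)
  have "\<phi> (of_nat (Suc k)) = \<phi> (of_nat k) \<oplus> \<one>"
    using \<phi>_add[OF R_of_nat subring_one[OF R], of k] by (simp add: \<phi>_one add.commute)
  moreover have "x [^]\<^bsub>Gr\<^esub> Suc k = plus (scale (\<phi> (of_nat k)) x) x"
  proof -
    have "x [^]\<^bsub>Gr\<^esub> Suc k = x [^]\<^bsub>Gr\<^esub> k \<otimes>\<^bsub>Gr\<^esub> x"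
      by (rule monoid.nat_pow_Suc[OF group.is_monoid[OF comm_group.axioms(2)[OF comm_group_Gr]]])
    moreover have "y \<otimes>\<^bsub>Gr\<^esub> x = plus y x" for y by (simp add: F_simps)
    ultimately show ?thesis using Suc by metis
  qed
  ultimately show ?case
    unfolding scale_def plus_def
    by (intro eq_vecI) (simp_all add: l_distr \<phi>_closed[OF R_of_nat] CD x)
qed

text \<open>The \<open>m\<close>-th power of every element of the quotient group is trivial;
  positivity of \<open>m\<close> makes this quotient finite.\<close>

lemma multiples_mem:
  assumes N: "submodule N R' F" and card: "card (rcosets\<^bsub>Gr\<^esub> N) = m" and x: "x \<in> C"
  shows "scale mm x \<in> N"
proof -
  interpret G: comm_group Gr by (rule comm_group_Gr)
  have sN: "subgroup N Gr" by (rule subgroupD(1)[OF N])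
  interpret norm: normal N Gr by (rule G.subgroup_imp_normal[OF sN])
  interpret Q: group "Gr Mod N" by (rule norm.factorgroup_is_group)
  have xG: "x \<in> carrier Gr" unfolding F_simps by (rule x)
  have c: "N #>\<^bsub>Gr\<^esub> x \<in> carrier (Gr Mod N)" unfolding FactGroup_def using G.rcosetsI[OF subgroup.subset[OF sN] xG] by simp
  have o: "order (Gr Mod N) = m" by (simp add: order_def FactGroup_def card)
  have "finite (carrier (Gr Mod N))" using o m unfolding order_def by (meson card_gt_0_iff)
  then have "(N #>\<^bsub>Gr\<^esub> x) [^]\<^bsub>Gr Mod N\<^esub> m = \<one>\<^bsub>Gr Mod N\<^esub>" using Q.pow_order_eq_1[OF c] o by simp
  then have "N #>\<^bsub>Gr\<^esub> (x [^]\<^bsub>Gr\<^esub> m) = N" unfolding norm.FactGroup_pow[OF xG] by (simp add: FactGroup_def)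
  then have "x [^]\<^bsub>Gr\<^esub> m \<in> N" using G.rcos_self[OF G.nat_pow_closed[OF xG] sN] by metis
  then show ?thesis unfolding nat_pow_Gr[OF x] .
qed

text \<open>The correspondence from submodules over \<open>R'\<close> to submodules over
  \<open>R\<close>; \<open>submodule_of_submod\<close> provides its inverse at index
  \<open>m\<close>.\<close>

definition \<Phi> :: "'r vec set \<Rightarrow> (nat \<Rightarrow> 'k) set" where
  "\<Phi> N = {f \<in> M. V f \<in> N}"

lemma decompose: assumes y: "y \<in> C" shows "\<exists>f\<in>M. \<exists>z\<in>C. y = plus (V f) (scale mm z)"
proof -
  have "\<exists>x z. x \<in> R \<and> z \<in> carrier R' \<and> y $ i = \<phi> x \<oplus> mm \<otimes> z" if "i < n" for i
    using \<phi>_surj[OF CD(1)[OF y that]] by blast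
  then obtain g h where gh: "\<And>i. i < n \<Longrightarrow> g i \<in> R \<and> h i \<in> carrier R' \<and> y $ i = \<phi> (g i) \<oplus> mm \<otimes> h i" by metis
  define f where "f i = (if i < n then g i else 0)" for i
  have "f \<in> M" using gh subring_zero[OF R] by (simp add: f_def vecs_def)
  moreover have "vec n h \<in> C" using gh by (intro CI) blast
  moreover have "y = plus (V f) (scale mm (vec n h))"
    unfolding plus_def V_def scale_def using gh by (intro eq_vecI) (simp_all add: f_def CD[OF y])
  ultimately show ?thesis by blast
qed

lemma submod_\<Phi>: assumes N: "submodule N R' F" shows "submod R (\<Phi> N)"
proof -
  note sD = subgroupD[OF N]
  have add: "f + g \<in> \<Phi> N" if "f \<in> \<Phi> N" "g \<in> \<Phi> N" for f g
    using that sD(4) subgrp_add[OF sM(1)] by (simp add: \<Phi>_def V_add)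
  have smul: "smul r f \<in> \<Phi> N" if "r \<in> R" "f \<in> \<Phi> N" for r f
    using that sD(5)[OF \<phi>_closed] submod_smul[OF sM(2)] by (simp add: \<Phi>_def V_smul)
  have m1: "- 1 \<in> R" using subring_minus[OF R subring_one[OF R]] .
  have "f - g \<in> \<Phi> N" if "f \<in> \<Phi> N" "g \<in> \<Phi> N" for f g
  proof -
    have "f - g = f + smul (- 1) g" by (simp add: fun_eq_iff)
    then show ?thesis using add[OF that(1) smul[OF m1 that(2)]] by metis
  qed
  moreover have "0 \<in> \<Phi> N" using sD(3) subgrp_zero[OF sM(1)] by (simp add: \<Phi>_def V_zero)
  ultimately show ?thesis using smul by (simp add: submod_def subgrp_def)
qed

text \<open>The vectors \<open>V f\<close> meet every coset of \<open>N\<close>, because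
  \<open>\<phi>\<close> is onto modulo \<open>m\<close> and \<open>N\<close> contains the multiples
  of \<open>m\<close>.\<close>

lemma card_rcosets:
  assumes N: "submodule N R' F" and mult: "\<And>z. z \<in> C \<Longrightarrow> scale mm z \<in> N"
  shows "card (rcosets\<^bsub>Gr\<^esub> N) = idx M (\<Phi> N)"
proof -
  interpret G: comm_group Gr by (rule comm_group_Gr)
  note sD = subgroupD[OF N]
  let ?h = "\<lambda>f. N #>\<^bsub>Gr\<^esub> V f"
  have coset: "y \<in> N #>\<^bsub>Gr\<^esub> x \<longleftrightarrow> (\<exists>h\<in>N. y = plus h x)" for x y
    by (simp add: r_coset_def F_simps)
  have "idx M (\<Phi> N) = card (?h ` M)"
  proof (rule idx_eq_card_image[OF submod_subgrp[OF submod_\<Phi>[OF N]]])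
    fix f g assume f: "f \<in> M" and g: "g \<in> M"
    have fg: "f - g \<in> M" by (rule subgrp_diff[OF sM(1) f g])
    have dec: "V f = plus (V (f - g)) (V g)" using V_add[OF fg g] by simp
    show "?h f = ?h g \<longleftrightarrow> f - g \<in> \<Phi> N"
    proof
      assume "?h f = ?h g"
      then have "V f \<in> N #>\<^bsub>Gr\<^esub> V g"
        using G.rcos_self[of "V f" N] sD(1) V_C[OF f] by (simp add: F_simps)
      then obtain h where h: "h \<in> N" "V f = plus h (V g)" unfolding coset by blast
      have "plus h (V g) = plus (V (f - g)) (V g)" using h dec by simp
      then have "h = V (f - g)"
        using G.right_cancel[of "V g" h "V (f - g)"] h(1) sD(2) V_C[OF g] V_C[OF fg] by (auto simp: F_simps)
      then show "f - g \<in> \<Phi> N" using h(1) fg by (simp add: \<Phi>_def)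
    next
      assume "f - g \<in> \<Phi> N"
      then have "V f \<in> N #>\<^bsub>Gr\<^esub> V g" unfolding coset using dec by (auto simp: \<Phi>_def)
      then show "?h f = ?h g" using G.repr_independence[of "V f" N "V g"] sD(1) V_C[OF g] by (simp add: F_simps)
    qed
  qed
  also have "?h ` M = rcosets\<^bsub>Gr\<^esub> N"
  proof
    show "?h ` M \<subseteq> rcosets\<^bsub>Gr\<^esub> N"
      using G.rcosetsI[OF subgroup.subset[OF sD(1)]] V_C by (auto simp: F_simps)
    show "rcosets\<^bsub>Gr\<^esub> N \<subseteq> ?h ` M"
    proof
      fix K assume "K \<in> rcosets\<^bsub>Gr\<^esub> N"
      then obtain y where y: "y \<in> C" "K = N #>\<^bsub>Gr\<^esub> y" by (auto simp: RCOSETS_def F_simps)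
      obtain f z where fz: "f \<in> M" "z \<in> C" "y = plus (V f) (scale mm z)" using decompose[OF y(1)] by blast
      have "y = plus (scale mm z) (V f)"
        unfolding fz(3) using G.m_comm[of "V f" "scale mm z"] V_C[OF fz(1)] scale_C[OF mm fz(2)] by (simp add: F_simps)
      then have "y \<in> N #>\<^bsub>Gr\<^esub> V f" unfolding coset using mult[OF fz(2)] by blast
      then have "N #>\<^bsub>Gr\<^esub> V f = K" unfolding y(2)
        using G.repr_independence[of y N "V f"] sD(1) V_C[OF fz(1)] by (simp add: F_simps)
      then show "K \<in> ?h ` M" using fz(1) by blast
    qed
  qed
  finally show ?thesis by simp
qed

lemma \<phi>_sum: "(\<And>i. i \<in> I \<Longrightarrow> h i \<in> R) \<Longrightarrow> finite I \<Longrightarrow> \<phi> (\<Sum>i\<in>I. h i) = (\<Oplus>i\<in>I. \<phi> (h i))"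
proof (induction I rule: infinite_finite_induct)
  case (insert i I)
  have "(\<Sum>i\<in>I. h i) \<in> R" using insert.prems by (intro subring_sum[OF R]) auto
  moreover have "(\<Oplus>i\<in>insert i I. \<phi> (h i)) = \<phi> (h i) \<oplus> (\<Oplus>i\<in>I. \<phi> (h i))"
    using insert.hyps insert.prems \<phi>_closed by (intro finsum_insert) auto
  ultimately show ?case using insert by (simp add: \<phi>_add)
qed (simp_all add: \<phi>_zero)

context
  fixes A :: "'k mat"
  assumes A: "A \<in> carrier_mat n n" and AR: "\<And>i j. i < n \<Longrightarrow> j < n \<Longrightarrow> A $$ (i, j) \<in> R"
begin

abbreviation "rmul x \<equiv> row_mult R' x (map_mat \<phi> A)"

lemma rmul_C: assumes x: "x \<in> C" shows "rmul x = vec n (\<lambda>j. \<Oplus>i\<in>{..<n}. x $ i \<otimes> \<phi> (A $$ (i, j)))"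
proof (rule eq_vecI)
  fix j assume "j < dim_vec (vec n (\<lambda>j. \<Oplus>i\<in>{..<n}. x $ i \<otimes> \<phi> (A $$ (i, j))))"
  then have j: "j < n" by simp
  have "(\<Oplus>i\<in>{..<n}. x $ i \<otimes> map_mat \<phi> A $$ (i, j)) = (\<Oplus>i\<in>{..<n}. x $ i \<otimes> \<phi> (A $$ (i, j)))"
    by (rule finsum_cong') (use A j x AR in \<open>auto simp: CD \<phi>_closed\<close>)
  then show "rmul x $ j = vec n (\<lambda>j. \<Oplus>i\<in>{..<n}. x $ i \<otimes> \<phi> (A $$ (i, j))) $ j"
    using A j by (simp add: row_mult_def)
qed (use A in \<open>simp add: row_mult_def\<close>)

lemma term_closed: "x \<in> C \<Longrightarrow> j < n \<Longrightarrow> (\<lambda>i. x $ i \<otimes> \<phi> (A $$ (i, j))) \<in> {..<n} \<rightarrow> carrier R'"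
  by (auto simp: CD \<phi>_closed AR)

lemma rmul_closed: "x \<in> C \<Longrightarrow> rmul x \<in> C"
  unfolding rmul_C by (intro CI finsum_closed term_closed)

lemma rmul_V: assumes f: "f \<in> M" shows "rmul (V f) = V (act A n f)"
proof (rule eq_vecI)
  fix j assume "j < dim_vec (V (act A n f))"
  then have j: "j < n" by (simp add: V_def)
  have "rmul (V f) $ j = (\<Oplus>i\<in>{..<n}. V f $ i \<otimes> \<phi> (A $$ (i, j)))" using j by (simp add: rmul_C[OF V_C[OF f]])
  also have "\<dots> = (\<Oplus>i\<in>{..<n}. \<phi> (f i * A $$ (i, j)))"
    by (rule finsum_cong') (use j f in \<open>auto simp: V_def \<phi>_mult MD AR intro!: \<phi>_closed subring_mult[OF R]\<close>)
  also have "\<dots> = \<phi> (\<Sum>i<n. f i * A $$ (i, j))"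
    by (rule \<phi>_sum[symmetric]) (use j f in \<open>auto simp: MD AR intro!: subring_mult[OF R]\<close>)
  finally show "rmul (V f) $ j = V (act A n f) $ j" using j by (simp add: V_def act_apply)
qed (use A in \<open>simp add: row_mult_def V_def\<close>)

lemma rmul_plus: assumes x: "x \<in> C" and y: "y \<in> C" shows "rmul (plus x y) = plus (rmul x) (rmul y)"
  unfolding rmul_C[OF plus_C[OF x y]] rmul_C[OF x] rmul_C[OF y]
proof (rule eq_vecI)
  fix j assume "j < dim_vec (plus (vec n (\<lambda>j. \<Oplus>i\<in>{..<n}. x $ i \<otimes> \<phi> (A $$ (i, j)))) (vec n (\<lambda>j. \<Oplus>i\<in>{..<n}. y $ i \<otimes> \<phi> (A $$ (i, j)))))"
  then have j: "j < n" by (simp add: plus_def)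
  have "(\<Oplus>i\<in>{..<n}. plus x y $ i \<otimes> \<phi> (A $$ (i, j))) = (\<Oplus>i\<in>{..<n}. x $ i \<otimes> \<phi> (A $$ (i, j)) \<oplus> y $ i \<otimes> \<phi> (A $$ (i, j)))"
    by (rule finsum_cong') (use j x y in \<open>auto simp: plus_def l_distr CD \<phi>_closed AR\<close>)
  also have "\<dots> = (\<Oplus>i\<in>{..<n}. x $ i \<otimes> \<phi> (A $$ (i, j))) \<oplus> (\<Oplus>i\<in>{..<n}. y $ i \<otimes> \<phi> (A $$ (i, j)))"
    by (rule finsum_addf[OF term_closed[OF x j] term_closed[OF y j]])
  finally show "vec n (\<lambda>j. \<Oplus>i\<in>{..<n}. plus x y $ i \<otimes> \<phi> (A $$ (i, j))) $ j =
      plus (vec n (\<lambda>j. \<Oplus>i\<in>{..<n}. x $ i \<otimes> \<phi> (A $$ (i, j)))) (vec n (\<lambda>j. \<Oplus>i\<in>{..<n}. y $ i \<otimes> \<phi> (A $$ (i, j)))) $ j"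
    using j by (simp add: plus_def)
qed (simp add: plus_def)

lemma rmul_scale: assumes a: "a \<in> carrier R'" and x: "x \<in> C" shows "rmul (scale a x) = scale a (rmul x)"
  unfolding rmul_C[OF scale_C[OF a x]] rmul_C[OF x]
proof (rule eq_vecI)
  fix j assume "j < dim_vec (scale a (vec n (\<lambda>j. \<Oplus>i\<in>{..<n}. x $ i \<otimes> \<phi> (A $$ (i, j)))))"
  then have j: "j < n" by (simp add: scale_def)
  have "(\<Oplus>i\<in>{..<n}. scale a x $ i \<otimes> \<phi> (A $$ (i, j))) = (\<Oplus>i\<in>{..<n}. a \<otimes> (x $ i \<otimes> \<phi> (A $$ (i, j))))"
    by (rule finsum_cong') (use j x a in \<open>auto simp: scale_def m_assoc CD \<phi>_closed AR\<close>)
  also have "\<dots> = a \<otimes> (\<Oplus>i\<in>{..<n}. x $ i \<otimes> \<phi> (A $$ (i, j)))"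
    by (rule finsum_rdistr[OF _ a term_closed[OF x j], symmetric]) simp
  finally show "vec n (\<lambda>j. \<Oplus>i\<in>{..<n}. scale a x $ i \<otimes> \<phi> (A $$ (i, j))) $ j =
      scale a (vec n (\<lambda>j. \<Oplus>i\<in>{..<n}. x $ i \<otimes> \<phi> (A $$ (i, j)))) $ j"
    using j by (simp add: scale_def)
qed (simp add: scale_def)

lemma plus_interchange:
  assumes "x \<in> C" "y \<in> C" "x' \<in> C" "y' \<in> C" and a: "a \<in> carrier R'"
  shows "plus (plus x (scale a y)) (plus x' (scale a y')) = plus (plus x x') (scale a (plus y y'))"
  unfolding plus_def scale_def using assms
  by (intro eq_vecI) (simp_all add: CD r_distr a_ac)

lemma scale_decomposed:
  assumes r: "r \<in> carrier R'" "s \<in> carrier R'" and x: "x \<in> C" "z \<in> C"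
  shows "scale (r \<oplus> mm \<otimes> s) (plus x (scale mm z)) =
    plus (scale r x) (scale mm (plus (scale s x) (scale (r \<oplus> mm \<otimes> s) z)))"
  unfolding plus_def scale_def
  by (intro eq_vecI) (simp_all add: CD[OF x(1)] CD[OF x(2)] r mm l_distr r_distr m_ac a_ac)

text \<open>\<open>N\<close> is generated by the image of \<open>K\<close> and the multiples of
  \<open>m\<close>. Recovering \<open>K\<close> uses injectivity modulo \<open>m\<close>: a vector
  over \<open>R\<close> whose image is a multiple of \<open>m\<close> is a multiple of
  \<open>m\<close> over \<open>R\<close>, and such vectors lie in \<open>K\<close> since its index
  is \<open>m\<close>.\<close>

lemma submodule_of_submod:
  assumes K: "submod R K" "K \<subseteq> M" "idx M K = m"
  defines "N \<equiv> {y. \<exists>f\<in>K. \<exists>z\<in>C. y = plus (V f) (scale mm z)}"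
  shows "submodule N R' F" "\<And>z. z \<in> C \<Longrightarrow> scale mm z \<in> N" "\<Phi> N = K"
proof -
  note sK = submod_subgrp[OF K(1)]
  have VK: "V f \<in> C" if "f \<in> K" for f using V_C K(2) that by blast
  have NC: "N \<subseteq> C" unfolding N_def using VK plus_C scale_C[OF mm] by blast
  have addN: "plus x y \<in> N" if xy: "x \<in> N" "y \<in> N" for x y
  proof -
    obtain f z g w where fz: "f \<in> K" "z \<in> C" "x = plus (V f) (scale mm z)" and gw: "g \<in> K" "w \<in> C" "y = plus (V g) (scale mm w)"
      using xy by (auto simp: N_def)
    have "f \<in> M" "g \<in> M" using fz gw K(2) by auto
    then have "plus x y = plus (V (f + g)) (scale mm (plus z w))"
      unfolding fz(3) gw(3) using plus_interchange[OF VK[OF fz(1)] fz(2) VK[OF gw(1)] gw(2) mm] by (simp add: V_add)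
    then show ?thesis unfolding N_def using subgrp_add[OF sK fz(1) gw(1)] plus_C[OF fz(2) gw(2)] by blast
  qed
  have scaleN: "scale a y \<in> N" if a: "a \<in> carrier R'" and y: "y \<in> N" for a y
  proof -
    obtain f z where fz: "f \<in> K" "z \<in> C" "y = plus (V f) (scale mm z)" using y by (auto simp: N_def)
    obtain r s where rs: "r \<in> R" "s \<in> carrier R'" "a = \<phi> r \<oplus> mm \<otimes> s" using \<phi>_surj[OF a] by blast
    have "scale a y = plus (scale (\<phi> r) (V f)) (scale mm (plus (scale s (V f)) (scale a z)))"
      unfolding fz(3) rs(3) by (rule scale_decomposed[OF \<phi>_closed[OF rs(1)] rs(2) VK[OF fz(1)] fz(2)])
    also have "scale (\<phi> r) (V f) = V (smul r f)" using V_smul[OF rs(1)] fz(1) K(2) by (metis subsetD)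
    finally show ?thesis
      unfolding N_def using submod_smul[OF K(1) rs(1) fz(1)] plus_C[OF scale_C[OF rs(2) VK[OF fz(1)]] scale_C[OF a fz(2)]] by blast
  qed
  have mult: "scale mm z \<in> N" if z: "z \<in> C" for z
  proof -
    have "scale mm z = plus (V 0) (scale mm z)"
      unfolding V_zero plus_def scale_def using z mm by (intro eq_vecI) (simp_all add: CD)
    then show ?thesis unfolding N_def using subgrp_zero[OF sK] z by blast
  qed
  then show "\<And>z. z \<in> C \<Longrightarrow> scale mm z \<in> N" .
  interpret G: comm_group Gr by (rule comm_group_Gr)
  have zeroC: "vec n (\<lambda>_. \<zero>) \<in> C" by (rule CI) simp
  have zero: "vec n (\<lambda>_. \<zero>) \<in> N"
  proof -
    have "scale mm (vec n (\<lambda>_. \<zero>)) = vec n (\<lambda>_. \<zero>)" unfolding scale_def using mm by (intro eq_vecI) simp_all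
    then show ?thesis using mult[OF zeroC] by simp
  qed
  show sub: "submodule N R' F"
  proof (intro submodule.intro subgroup.intro submodule_axioms.intro)
    show "N \<subseteq> carrier Gr" unfolding F_simps by (rule NC)
    show "\<one>\<^bsub>Gr\<^esub> \<in> N" unfolding F_simps by (rule zero)
    fix x assume x: "x \<in> N"
    then have xC: "x \<in> C" using NC by blast
    show "inv\<^bsub>Gr\<^esub> x \<in> N"
    proof -
      have "plus (scale (\<ominus> \<one>) x) x = vec n (\<lambda>_. \<zero>)"
        unfolding plus_def scale_def by (intro eq_vecI) (simp_all add: CD[OF xC] l_minus l_neg)
      then have "inv\<^bsub>Gr\<^esub> x = scale (\<ominus> \<one>) x"
        using G.inv_equality[of "scale (\<ominus> \<one>) x" x] xC scale_C[OF _ xC, of "\<ominus> \<one>"] by (simp add: F_simps)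
      then show ?thesis using scaleN[OF _ x, of "\<ominus> \<one>"] by simp
    qed
    show "a \<odot>\<^bsub>F\<^esub> x \<in> N" if "a \<in> carrier R'" for a unfolding F_simps by (rule scaleN[OF that x])
    fix y assume "y \<in> N"
    then show "x \<otimes>\<^bsub>Gr\<^esub> y \<in> N" unfolding F_simps by (rule addN[OF x])
  qed
  show "\<Phi> N = K"
  proof
    show "K \<subseteq> \<Phi> N"
    proof
      fix f assume f: "f \<in> K"
      have "V f = plus (V f) (scale mm (vec n (\<lambda>_. \<zero>)))"
        unfolding plus_def scale_def using mm by (intro eq_vecI) (simp_all add: CD[OF VK[OF f]])
      then have "V f \<in> N" unfolding N_def using f zeroC by blast
      then show "f \<in> \<Phi> N" using f K(2) by (auto simp: \<Phi>_def)
    qed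
    show "\<Phi> N \<subseteq> K"
    proof
      fix g assume "g \<in> \<Phi> N"
      then have g: "g \<in> M" and "V g \<in> N" by (auto simp: \<Phi>_def)
      then obtain f z where fz: "f \<in> K" "z \<in> C" "V g = plus (V f) (scale mm z)" by (auto simp: N_def)
      have f: "f \<in> M" using fz(1) K(2) by blast
      have gf: "g - f \<in> M" by (rule subgrp_diff[OF sM(1) g f])
      have "\<exists>h\<in>R. (g - f) i = of_nat m * h" if i: "i < n" for i
      proof (rule \<phi>_inj[of _ "z $ i"])
        show "(g - f) i \<in> R" by (rule MD[OF gf])
        show "z $ i \<in> carrier R'" using CD(1)[OF fz(2) i] .
        have "\<phi> (g i) = \<phi> (f i) \<oplus> mm \<otimes> z $ i"
          using arg_cong[OF fz(3), of "\<lambda>v. v $ i"] i by (simp add: V_def plus_def scale_def)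
        moreover have "\<phi> (g i) = \<phi> (f i) \<oplus> \<phi> ((g - f) i)"
          using \<phi>_add[OF MD[OF f, of i] MD[OF gf, of i]] by simp
        ultimately have "\<phi> (f i) \<oplus> \<phi> ((g - f) i) = \<phi> (f i) \<oplus> mm \<otimes> z $ i" by simp
        then show "\<phi> ((g - f) i) = mm \<otimes> z $ i"
          using CD(1)[OF fz(2) i] mm add.right_cancel[of "\<phi> (f i)" "\<phi> ((g - f) i)" "mm \<otimes> z $ i"]
            \<phi>_closed[OF MD[OF f, of i]] \<phi>_closed[OF MD[OF gf, of i]]
          by (simp add: a_comm)
      qed
      then obtain h where h: "\<And>i. i < n \<Longrightarrow> h i \<in> R \<and> (g - f) i = of_nat m * h i" by metis
      define h' where "h' i = (if i < n then h i else 0)" for i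
      have h'M: "h' \<in> M" using h subring_zero[OF R] by (simp add: h'_def vecs_def)
      have "g - f = smul (of_nat m) h'"
      proof
        fix i show "(g - f) i = smul (of_nat m) h' i"
          using h[of i] gf by (cases "i < n") (auto simp: h'_def vecs_def)
      qed
      then have "g - f \<in> K"
        using submod_idx_mem[OF sM(1) sK K(2) _ h'M] K(3) m by simp
      then show "g \<in> K" using subgrp_add[OF sK _ fz(1), of "g - f"] by simp
    qed
  qed
qed

theorem num_invariant_submodules_eq_cnt:
  "num_invariant_submodules R' (map_mat \<phi> A) m = cnt R M (act A n) m"
proof -
  let ?S = "{N. submodule N R' F \<and> (\<forall>x\<in>N. rmul x \<in> N) \<and> card (rcosets\<^bsub>Gr\<^esub> N) = m}"
  let ?D = "{K. submod R K \<and> K \<subseteq> M \<and> act A n ` K \<subseteq> K \<and> idx M K = m}"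
  have actM: "act A n f \<in> M" if "f \<in> M" for f using act_mem[OF R AR that] .
  have mult: "scale mm z \<in> N" if "N \<in> ?S" "z \<in> C" for N z using multiples_mem[of N z] that by simp
  have "inj_on \<Phi> ?S"
  proof -
    have sub: "N1 \<subseteq> N2" if N: "N1 \<in> ?S" "N2 \<in> ?S" "\<Phi> N1 = \<Phi> N2" for N1 N2
    proof
      have s1: "submodule N1 R' F" and s2: "submodule N2 R' F" using N by auto
      note D1 = subgroupD[OF s1] and D2 = subgroupD[OF s2]
      fix y assume y: "y \<in> N1"
      then have yC: "y \<in> C" using D1(2) by blast
      obtain f z where fz: "f \<in> M" "z \<in> C" "y = plus (V f) (scale mm z)" using decompose[OF yC] by blast
      have "V f = plus y (scale (\<ominus> \<one>) (scale mm z))"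
        unfolding fz(3) plus_def scale_def using mm
        by (intro eq_vecI) (simp_all add: CD[OF V_C[OF fz(1)]] CD[OF fz(2)] l_minus a_assoc r_neg)
      then have "V f \<in> N1" using D1(4)[OF y D1(5)[OF _ mult[OF N(1) fz(2)], of "\<ominus> \<one>"]] by simp
      then have "f \<in> \<Phi> N2" using fz(1) N(3) by (auto simp: \<Phi>_def)
      then show "y \<in> N2" unfolding fz(3) using D2(4)[OF _ mult[OF N(2) fz(2)]] by (simp add: \<Phi>_def)
    qed
    show ?thesis
    proof (rule inj_onI, rule equalityI)
      fix N1 N2 assume *: "N1 \<in> ?S" "N2 \<in> ?S" "\<Phi> N1 = \<Phi> N2"
      show "N1 \<subseteq> N2" by (rule sub[OF *])
      show "N2 \<subseteq> N1" by (rule sub[OF *(2,1) *(3)[symmetric]])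
    qed
  qed
  moreover have "\<Phi> ` ?S = ?D"
  proof
    show "\<Phi> ` ?S \<subseteq> ?D"
    proof (rule image_subsetI)
      fix N assume N: "N \<in> ?S"
      then have s: "submodule N R' F" and inv: "\<And>x. x \<in> N \<Longrightarrow> rmul x \<in> N" and c: "card (rcosets\<^bsub>Gr\<^esub> N) = m" by auto
      have "act A n ` \<Phi> N \<subseteq> \<Phi> N"
      proof (rule image_subsetI)
        fix f assume "f \<in> \<Phi> N"
        then have f: "f \<in> M" "V f \<in> N" by (auto simp: \<Phi>_def)
        then show "act A n f \<in> \<Phi> N" using inv[OF f(2)] actM by (simp add: \<Phi>_def rmul_V)
      qed
      moreover have "idx M (\<Phi> N) = m" using card_rcosets[OF s mult[OF N]] c by simp
      ultimately show "\<Phi> N \<in> ?D" using submod_\<Phi>[OF s] by (auto simp: \<Phi>_def)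
    qed
    show "?D \<subseteq> \<Phi> ` ?S"
    proof
      fix K assume "K \<in> ?D"
      then have K: "submod R K" "K \<subseteq> M" "idx M K = m" "act A n ` K \<subseteq> K" by auto
      define N where "N = {y. \<exists>f\<in>K. \<exists>z\<in>C. y = plus (V f) (scale mm z)}"
      note N = submodule_of_submod[OF K(1-3), folded N_def]
      have "rmul y \<in> N" if y: "y \<in> N" for y
      proof -
        obtain f z where fz: "f \<in> K" "z \<in> C" "y = plus (V f) (scale mm z)" using y by (auto simp: N_def)
        have f: "f \<in> M" using fz(1) K(2) by blast
        have "rmul y = plus (V (act A n f)) (scale mm (rmul z))"
          unfolding fz(3) rmul_plus[OF V_C[OF f] scale_C[OF mm fz(2)]] rmul_V[OF f] rmul_scale[OF mm fz(2)] ..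
        moreover have "act A n f \<in> K" using K(4) fz(1) by blast
        ultimately show ?thesis unfolding N_def using rmul_closed[OF fz(2)] by blast
      qed
      then have "N \<in> ?S" using N(1) card_rcosets[OF N(1,2)] N(3) K(3) by simp
      then show "K \<in> \<Phi> ` ?S" using N(3) by blast
    qed
  qed
  ultimately have "card ?S = card ?D" using card_image[of \<Phi> ?S] by simp
  moreover have "dim_row (map_mat \<phi> A) = n" using A by simp
  ultimately show ?thesis unfolding num_invariant_submodules_def cnt_def A_RCOSETS_def by simp
qed

end

end

section \<open>Completions\<close>

locale place =
  fixes v :: "('k::field_char_0 \<Rightarrow> real) set"
  assumes v: "v \<in> places"
begin

abbreviation "f \<equiv> place_abs v"

lemmas na = place_abs_nonarch[OF v]

definition cauchy :: "(nat \<Rightarrow> 'k) \<Rightarrow> bool" where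
  "cauchy X \<longleftrightarrow> (\<forall>e>0. \<exists>M. \<forall>i\<ge>M. \<forall>j\<ge>M. f (X i - X j) < e)"

definition null :: "(nat \<Rightarrow> 'k) \<Rightarrow> bool" where
  "null X \<longleftrightarrow> (\<lambda>i. f (X i)) \<longlonglongrightarrow> 0"

text \<open>Elements of the completion are sets of sequences; \<open>cls_ops\<close> reduces the
  ring operations on them to operations on representatives.\<close>

definition cls :: "(nat \<Rightarrow> 'k) \<Rightarrow> (nat \<Rightarrow> 'k) set" where
  "cls X = null_seqs v +>\<^bsub>cauchy_ring v\<^esub> X"

definition L :: "(nat \<Rightarrow> 'k) \<Rightarrow> real" where
  "L X = lim (\<lambda>i. f (X i))"

lemma to_completion: "to_completion v x = cls (\<lambda>_. x)"
  by (simp add: to_completion_def cls_def)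

lemma mem_cls: "Z \<in> cls X \<longleftrightarrow> null (\<lambda>i. Z i - X i)"
proof -
  have "Z \<in> cls X \<longleftrightarrow> (\<exists>h. null h \<and> Z = (\<lambda>i. h i + X i))"
    unfolding cls_def a_r_coset_def' by (auto simp: cauchy_ring_def null_seqs_def null_def)
  also have "\<dots> \<longleftrightarrow> null (\<lambda>i. Z i - X i)"
  proof
    assume "null (\<lambda>i. Z i - X i)"
    then show "\<exists>h. null h \<and> Z = (\<lambda>i. h i + X i)" by (intro exI[of _ "\<lambda>i. Z i - X i"]) simp
  qed auto
  finally show ?thesis .
qed

lemma null_add: assumes "null X" "null Y" shows "null (\<lambda>i. X i + Y i)"
proof -
  have "(\<lambda>i. f (X i) + f (Y i)) \<longlonglongrightarrow> 0" using tendsto_add[OF assms[unfolded null_def]] by simp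
  moreover have "norm (f (X i + Y i)) \<le> f (X i) + f (Y i)" for i
    using nonarch_add[OF na, of "X i" "Y i"] nonarch_nonneg[OF na, of "X i"] nonarch_nonneg[OF na, of "Y i"]
      nonarch_nonneg[OF na, of "X i + Y i"] by simp
  ultimately show ?thesis unfolding null_def by (rule Lim_null_comparison[OF always_eventually[OF allI], rotated])
qed

lemma null_minus: "null X \<Longrightarrow> null (\<lambda>i. - X i)"
  by (simp add: null_def nonarch_minus[OF na])

lemma null_mult: assumes "\<And>i. f (X i) \<le> B" "null Y" shows "null (\<lambda>i. X i * Y i)"
proof -
  have "(\<lambda>i. B * f (Y i)) \<longlonglongrightarrow> 0" using tendsto_mult_left[OF assms(2)[unfolded null_def], of B] by simp
  moreover have "norm (f (X i * Y i)) \<le> B * f (Y i)" for i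
    using assms(1)[of i] nonarch_nonneg[OF na] by (simp add: nonarch_mult[OF na] mult_right_mono)
  ultimately show ?thesis unfolding null_def by (rule Lim_null_comparison[OF always_eventually[OF allI], rotated])
qed

lemma null_0: "null (\<lambda>_. 0)"
  using nonarch_eq_0[OF na, of 0] by (simp add: null_def)

lemma cls_self: "X \<in> cls X"
  by (simp add: mem_cls null_0)

lemma cls_eqI: assumes "null (\<lambda>i. X i - Y i)" shows "cls X = cls Y"
proof (rule Set.set_eqI)
  fix Z
  show "Z \<in> cls X \<longleftrightarrow> Z \<in> cls Y"
    using null_add[OF _ assms, of "\<lambda>i. Z i - X i"] null_add[OF _ null_minus[OF assms], of "\<lambda>i. Z i - Y i"]
    by (auto simp: mem_cls)
qed

lemma cauchyD: "cauchy X \<Longrightarrow> e > 0 \<Longrightarrow> \<exists>M. \<forall>i\<ge>M. \<forall>j\<ge>M. f (X i - X j) < e"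
  by (simp add: cauchy_def)

lemma cauchy_bounded: assumes "cauchy X" shows "\<exists>B>0. \<forall>i. f (X i) \<le> B"
proof -
  obtain M where M: "\<And>i. i \<ge> M \<Longrightarrow> f (X i - X M) < 1"
    using cauchyD[OF assms, of 1] by auto
  define B where "B = Max (insert 1 ((\<lambda>i. f (X i)) ` {..M}))"
  have B1: "1 \<le> B" unfolding B_def by (rule Max_ge) auto
  have BM: "f (X i) \<le> B" if "i \<le> M" for i unfolding B_def by (rule Max_ge) (use that in auto)
  have "f (X i) \<le> B" for i
  proof (cases "i \<le> M")
    case False
    then have "f (X i - X M) < 1" using M by simp
    moreover have "f (X i) \<le> max (f (X i - X M)) (f (X M))" using nonarch_add[OF na, of "X i - X M" "X M"] by simp
    ultimately show ?thesis using B1 BM[of M] by auto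
  qed (rule BM)
  then show ?thesis using B1 by (intro exI[of _ B]) auto
qed

lemma cauchy_const: "cauchy (\<lambda>_. x)"
  using nonarch_eq_0[OF na, of 0] by (simp add: cauchy_def)

lemma cauchy_minus: "cauchy X \<Longrightarrow> cauchy (\<lambda>i. - X i)"
proof -
  have "f (- x - - y) = f (x - y)" for x y using nonarch_minus[OF na, of "x - y"] by simp
  then show "cauchy X \<Longrightarrow> cauchy (\<lambda>i. - X i)" unfolding cauchy_def by simp
qed

lemma cauchy_add: assumes "cauchy X" "cauchy Y" shows "cauchy (\<lambda>i. X i + Y i)"
  unfolding cauchy_def
proof (intro allI impI)
  fix e :: real assume e: "e > 0"
  obtain M N where M: "\<forall>i\<ge>M. \<forall>j\<ge>M. f (X i - X j) < e" and N: "\<forall>i\<ge>N. \<forall>j\<ge>N. f (Y i - Y j) < e"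
    using cauchyD[OF assms(1) e] cauchyD[OF assms(2) e] by blast
  have "f (X i + Y i - (X j + Y j)) < e" if ij: "i \<ge> max M N" "j \<ge> max M N" for i j
  proof -
    have "f ((X i - X j) + (Y i - Y j)) \<le> max (f (X i - X j)) (f (Y i - Y j))" by (rule nonarch_add[OF na])
    moreover have "f (X i - X j) < e" "f (Y i - Y j) < e" using M N ij by auto
    moreover have "(X i - X j) + (Y i - Y j) = X i + Y i - (X j + Y j)" by simp
    ultimately show ?thesis by (metis max_less_iff_conj le_less_trans)
  qed
  then show "\<exists>M. \<forall>i\<ge>M. \<forall>j\<ge>M. f (X i + Y i - (X j + Y j)) < e" by blast
qed

lemma cauchy_mult: assumes "cauchy X" "cauchy Y" shows "cauchy (\<lambda>i. X i * Y i)"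
  unfolding cauchy_def
proof (intro allI impI)
  fix e :: real assume e: "e > 0"
  obtain B C where B: "B > 0" "\<And>i. f (X i) \<le> B" and C: "C > 0" "\<And>i. f (Y i) \<le> C"
    using cauchy_bounded[OF assms(1)] cauchy_bounded[OF assms(2)] by blast
  obtain M N where M: "\<forall>i\<ge>M. \<forall>j\<ge>M. f (X i - X j) < e / C" and N: "\<forall>i\<ge>N. \<forall>j\<ge>N. f (Y i - Y j) < e / B"
    using cauchyD[OF assms(1), of "e / C"] cauchyD[OF assms(2), of "e / B"] e B C by auto
  have "f (X i * Y i - X j * Y j) < e" if ij: "i \<ge> max M N" "j \<ge> max M N" for i j
  proof -
    have "f (X i * (Y i - Y j) + (X i - X j) * Y j) \<le> max (f (X i * (Y i - Y j))) (f ((X i - X j) * Y j))"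
      by (rule nonarch_add[OF na])
    moreover have "f (X i * (Y i - Y j)) < e"
    proof -
      have "f (X i * (Y i - Y j)) \<le> B * f (Y i - Y j)"
        unfolding nonarch_mult[OF na] by (rule mult_right_mono[OF B(2) nonarch_nonneg[OF na]])
      also have "\<dots> < B * (e / B)" by (rule mult_strict_left_mono) (use N ij B in auto)
      finally show ?thesis using B by simp
    qed
    moreover have "f ((X i - X j) * Y j) < e"
    proof -
      have "f ((X i - X j) * Y j) \<le> f (X i - X j) * C"
        unfolding nonarch_mult[OF na] by (rule mult_left_mono[OF C(2) nonarch_nonneg[OF na]])
      also have "\<dots> < e / C * C" by (rule mult_strict_right_mono) (use M ij C in auto)
      finally show ?thesis using C by simp
    qed
    moreover have "X i * (Y i - Y j) + (X i - X j) * Y j = X i * Y i - X j * Y j" by (simp add: algebra_simps)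
    ultimately show ?thesis by (metis max_less_iff_conj le_less_trans)
  qed
  then show "\<exists>M. \<forall>i\<ge>M. \<forall>j\<ge>M. f (X i * Y i - X j * Y j) < e" by blast
qed

lemma abs_diff_le: "\<bar>f x - f y\<bar> \<le> f (x - y)"
proof -
  have *: "f x \<le> f (x - y) + f y" for x y
    using nonarch_add[OF na, of "x - y" y] nonarch_nonneg[OF na, of "x - y"] nonarch_nonneg[OF na, of y] by simp
  show ?thesis using *[of x y] *[of y x] nonarch_minus[OF na, of "x - y"] by (simp add: abs_le_iff)
qed

lemma L: assumes "cauchy X" shows "(\<lambda>i. f (X i)) \<longlonglongrightarrow> L X"
proof -
  have "Cauchy (\<lambda>i. f (X i))"
  proof (rule CauchyI)
    fix e :: real assume "e > 0"
    then obtain M where M: "\<forall>i\<ge>M. \<forall>j\<ge>M. f (X i - X j) < e" using cauchyD[OF assms] by blast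
    then show "\<exists>M. \<forall>i\<ge>M. \<forall>j\<ge>M. norm (f (X i) - f (X j)) < e"
      using abs_diff_le by (metis le_less_trans real_norm_def)
  qed
  then show ?thesis unfolding L_def using Cauchy_convergent_iff convergent_LIMSEQ_iff by blast
qed

lemma L_eqI: "(\<lambda>i. f (X i)) \<longlonglongrightarrow> l \<Longrightarrow> L X = l"
  unfolding L_def by (rule limI)

text \<open>The representative chosen by \<open>completion_abs\<close> differs from \<open>X\<close>
  by a null sequence, and so do the absolute values.\<close>

lemma completion_abs_cls: assumes X: "cauchy X" shows "completion_abs v (cls X) = L X"
proof -
  define Y where "Y = (SOME Y. Y \<in> cls X)"
  have "Y \<in> cls X" unfolding Y_def by (rule someI[of _ X]) (rule cls_self)
  then have "(\<lambda>i. f (Y i - X i)) \<longlonglongrightarrow> 0" by (simp add: mem_cls null_def)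
  then have "(\<lambda>i. f (Y i) - f (X i)) \<longlonglongrightarrow> 0"
    by (rule Lim_null_comparison[rotated]) (simp add: abs_diff_le)
  from tendsto_add[OF this L[OF X]] have "(\<lambda>i. f (Y i)) \<longlonglongrightarrow> L X" by simp
  then show ?thesis unfolding completion_abs_def Y_def[symmetric] by (rule limI)
qed

definition integral_seq :: "(nat \<Rightarrow> 'k) \<Rightarrow> bool" where
  "integral_seq X \<longleftrightarrow> cauchy X \<and> L X \<le> 1"

lemma L_const: "L (\<lambda>_. x) = f x"
  by (rule L_eqI) simp

lemma carrier_valuation_ring: "carrier (valuation_ring v) = cls ` {X. integral_seq X}"
proof -
  have "carrier (completion v) = cls ` {X. cauchy X}"
    unfolding completion_def FactRing_simps by (auto simp: cls_def cauchy_def cauchy_ring_def)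
  then show ?thesis unfolding valuation_ring_def integral_seq_def by (auto simp: completion_abs_cls)
qed

lemma cls_mem: "integral_seq X \<Longrightarrow> cls X \<in> carrier (valuation_ring v)"
  by (simp add: carrier_valuation_ring)

lemma cls_memD: "y \<in> carrier (valuation_ring v) \<Longrightarrow> \<exists>X. integral_seq X \<and> y = cls X"
  by (auto simp: carrier_valuation_ring)

lemma integral_add: assumes "integral_seq X" "integral_seq Y" shows "integral_seq (\<lambda>i. X i + Y i)"
proof -
  have c: "cauchy X" "cauchy Y" "L X \<le> 1" "L Y \<le> 1" using assms by (auto simp: integral_seq_def)
  have "L (\<lambda>i. X i + Y i) \<le> max (L X) (L Y)"
    by (rule LIMSEQ_le[OF L[OF cauchy_add[OF c(1,2)]] tendsto_max[OF L[OF c(1)] L[OF c(2)]]]) (use nonarch_add[OF na] in blast)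
  then show ?thesis using c cauchy_add by (simp add: integral_seq_def)
qed

lemma L_mult: assumes "cauchy X" "cauchy Y" shows "L (\<lambda>i. X i * Y i) = L X * L Y"
  by (rule L_eqI) (use tendsto_mult[OF L[OF assms(1)] L[OF assms(2)]] in \<open>simp add: nonarch_mult[OF na]\<close>)

lemma L_nonneg: assumes "cauchy X" shows "0 \<le> L X"
  by (rule LIMSEQ_le_const[OF L[OF assms]]) (use nonarch_nonneg[OF na] in blast)

lemma integral_mult: "integral_seq X \<Longrightarrow> integral_seq Y \<Longrightarrow> integral_seq (\<lambda>i. X i * Y i)"
  unfolding integral_seq_def using cauchy_mult L_mult L_nonneg mult_le_one[of "L X" "L Y"] by simp

lemma integral_minus: "integral_seq X \<Longrightarrow> integral_seq (\<lambda>i. - X i)"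
  unfolding integral_seq_def using cauchy_minus by (simp add: L_def nonarch_minus[OF na])

lemma integral_const: "f x \<le> 1 \<Longrightarrow> integral_seq (\<lambda>_. x)"
  by (simp add: integral_seq_def L_const cauchy_const)

lemma cls_add: "cls X \<oplus>\<^bsub>valuation_ring v\<^esub> cls Y = cls (\<lambda>i. X i + Y i)"
proof -
  have "cls X \<oplus>\<^bsub>valuation_ring v\<^esub> cls Y = {Z. \<exists>A\<in>cls X. \<exists>B\<in>cls Y. Z = (\<lambda>i. A i + B i)}"
    by (auto simp: valuation_ring_def completion_def FactRing_def set_add_def' cauchy_ring_def)
  also have "\<dots> = cls (\<lambda>i. X i + Y i)"
  proof (rule Set.set_eqI)
    fix Z
    show "Z \<in> {Z. \<exists>A\<in>cls X. \<exists>B\<in>cls Y. Z = (\<lambda>i. A i + B i)} \<longleftrightarrow> Z \<in> cls (\<lambda>i. X i + Y i)"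
    proof
      assume "Z \<in> {Z. \<exists>A\<in>cls X. \<exists>B\<in>cls Y. Z = (\<lambda>i. A i + B i)}"
      then obtain A B where AB: "A \<in> cls X" "B \<in> cls Y" "Z = (\<lambda>i. A i + B i)" by blast
      then have "null (\<lambda>i. (A i - X i) + (B i - Y i))" by (intro null_add) (simp_all add: mem_cls)
      then show "Z \<in> cls (\<lambda>i. X i + Y i)" unfolding mem_cls AB(3) by (simp add: algebra_simps)
    next
      assume "Z \<in> cls (\<lambda>i. X i + Y i)"
      then have "(\<lambda>i. Z i - Y i) \<in> cls X" by (simp add: mem_cls algebra_simps)
      moreover have "Z = (\<lambda>i. (Z i - Y i) + Y i)" by simp
      ultimately show "Z \<in> {Z. \<exists>A\<in>cls X. \<exists>B\<in>cls Y. Z = (\<lambda>i. A i + B i)}" using cls_self[of Y]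
        by (intro CollectI bexI)
    qed
  qed
  finally show ?thesis .
qed

text \<open>The product of two cosets in the factor ring is a union over all pairs of
  representatives. All members of this union coincide, since Cauchy sequences are bounded and a
  bounded sequence times a null sequence is null.\<close>

lemma cls_mult:
  assumes X: "cauchy X" and Y: "cauchy Y"
  shows "cls X \<otimes>\<^bsub>valuation_ring v\<^esub> cls Y = cls (\<lambda>i. X i * Y i)"
proof -
  have eq: "cls (\<lambda>i. A i * B i) = cls (\<lambda>i. X i * Y i)" if A: "A \<in> cls X" and B: "B \<in> cls Y" for A B
  proof (rule cls_eqI)
    obtain b c where b: "\<And>i. f (X i) \<le> b" and c: "\<And>i. f (Y i) \<le> c"
      using cauchy_bounded[OF X] cauchy_bounded[OF Y] by blast
    define h k where hk: "h i = A i - X i" "k i = B i - Y i" for i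
    have null: "null h" "null k" using A B by (simp_all add: mem_cls hk[abs_def])
    have "null (\<lambda>i. h i * k i)"
      unfolding null_def nonarch_mult[OF na] using tendsto_mult[OF null[unfolded null_def]] by simp
    from null_add[OF null_add[OF null_mult[OF b null(2)] null_mult[OF c null(1)]] this]
    have "null (\<lambda>i. X i * k i + Y i * h i + h i * k i)" .
    also have "(\<lambda>i. X i * k i + Y i * h i + h i * k i) = (\<lambda>i. A i * B i - X i * Y i)"
      by (simp add: hk algebra_simps)
    finally show "null (\<lambda>i. A i * B i - X i * Y i)" .
  qed
  have "cls X \<otimes>\<^bsub>valuation_ring v\<^esub> cls Y = (\<Union>A\<in>cls X. \<Union>B\<in>cls Y. cls (\<lambda>i. A i * B i))"
    by (simp add: valuation_ring_def completion_def FactRing_def rcoset_mult_def cls_def[symmetric] cauchy_ring_def)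
      (simp add: cls_def cauchy_ring_def)
  also have "\<dots> = (\<Union>A\<in>cls X. \<Union>B\<in>cls Y. cls (\<lambda>i. X i * Y i))"
    by (intro SUP_cong refl eq)
  also have "\<dots> = cls (\<lambda>i. X i * Y i)" using cls_self[of X] cls_self[of Y] by auto
  finally show ?thesis .
qed

lemma cls_zero: "\<zero>\<^bsub>valuation_ring v\<^esub> = cls (\<lambda>_. 0)"
proof -
  have "\<zero>\<^bsub>valuation_ring v\<^esub> = null_seqs v" by (simp add: valuation_ring_def completion_def FactRing_def)
  also have "null_seqs v = cls (\<lambda>_. 0)"
    by (rule Set.set_eqI) (simp only: mem_cls null_def null_seqs_def mem_Collect_eq diff_0_right)
  finally show ?thesis .
qed

lemma cls_one: "\<one>\<^bsub>valuation_ring v\<^esub> = cls (\<lambda>_. 1)"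
  by (simp add: valuation_ring_def completion_def FactRing_def cls_def) (simp add: cauchy_ring_def)

lemma f_le_1: "f 0 \<le> 1" "f 1 \<le> 1" "f (of_nat j) \<le> 1"
  using nonarch_eq_0[OF na, of 0] nonarch_1[OF na] nonarch_of_nat[OF na] by auto

lemma integral_cauchy: "integral_seq X \<Longrightarrow> cauchy X"
  by (simp add: integral_seq_def)

lemmas cls_ops = cls_add cls_mult cls_zero cls_one
lemmas integral_ops = integral_add integral_mult integral_minus integral_const f_le_1 integral_cauchy

lemma cring_valuation_ring: "cring (valuation_ring v)"
proof (rule cringI)
  show "abelian_group (valuation_ring v)"
  proof (rule abelian_groupI)
    fix x assume "x \<in> carrier (valuation_ring v)"
    then obtain X where X: "integral_seq X" "x = cls X" using cls_memD by blast
    show "\<zero>\<^bsub>valuation_ring v\<^esub> \<oplus>\<^bsub>valuation_ring v\<^esub> x = x" by (simp add: X cls_ops)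
    have "cls (\<lambda>i. - X i) \<oplus>\<^bsub>valuation_ring v\<^esub> x = \<zero>\<^bsub>valuation_ring v\<^esub>" by (simp add: X cls_ops)
    then show "\<exists>y\<in>carrier (valuation_ring v). y \<oplus>\<^bsub>valuation_ring v\<^esub> x = \<zero>\<^bsub>valuation_ring v\<^esub>"
      using cls_mem[OF integral_minus[OF X(1)]] by blast
    fix y assume "y \<in> carrier (valuation_ring v)"
    then obtain Y where Y: "integral_seq Y" "y = cls Y" using cls_memD by blast
    show "x \<oplus>\<^bsub>valuation_ring v\<^esub> y \<in> carrier (valuation_ring v)" by (simp add: X Y cls_ops cls_mem integral_ops)
    show "x \<oplus>\<^bsub>valuation_ring v\<^esub> y = y \<oplus>\<^bsub>valuation_ring v\<^esub> x" by (simp add: X Y cls_ops add.commute)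
    fix z assume "z \<in> carrier (valuation_ring v)"
    then obtain Z where Z: "integral_seq Z" "z = cls Z" using cls_memD by blast
    show "x \<oplus>\<^bsub>valuation_ring v\<^esub> y \<oplus>\<^bsub>valuation_ring v\<^esub> z = x \<oplus>\<^bsub>valuation_ring v\<^esub> (y \<oplus>\<^bsub>valuation_ring v\<^esub> z)"
      by (simp add: X Y Z cls_ops add.assoc)
  qed (simp add: cls_zero cls_mem integral_ops)
  show "comm_monoid (valuation_ring v)"
  proof (rule comm_monoidI)
    fix x assume "x \<in> carrier (valuation_ring v)"
    then obtain X where X: "integral_seq X" "x = cls X" using cls_memD by blast
    show "\<one>\<^bsub>valuation_ring v\<^esub> \<otimes>\<^bsub>valuation_ring v\<^esub> x = x" by (simp add: X cls_ops integral_cauchy cauchy_const)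
    fix y assume "y \<in> carrier (valuation_ring v)"
    then obtain Y where Y: "integral_seq Y" "y = cls Y" using cls_memD by blast
    show "x \<otimes>\<^bsub>valuation_ring v\<^esub> y \<in> carrier (valuation_ring v)" by (simp add: X Y cls_ops cls_mem integral_ops)
    show "x \<otimes>\<^bsub>valuation_ring v\<^esub> y = y \<otimes>\<^bsub>valuation_ring v\<^esub> x" by (simp add: X Y cls_ops integral_cauchy mult.commute)
    fix z assume "z \<in> carrier (valuation_ring v)"
    then obtain Z where Z: "integral_seq Z" "z = cls Z" using cls_memD by blast
    show "x \<otimes>\<^bsub>valuation_ring v\<^esub> y \<otimes>\<^bsub>valuation_ring v\<^esub> z = x \<otimes>\<^bsub>valuation_ring v\<^esub> (y \<otimes>\<^bsub>valuation_ring v\<^esub> z)"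
      by (simp add: X Y Z cls_ops integral_cauchy cauchy_mult mult.assoc)
  qed (simp add: cls_one cls_mem integral_ops)
  fix x y z assume "x \<in> carrier (valuation_ring v)" "y \<in> carrier (valuation_ring v)" "z \<in> carrier (valuation_ring v)"
  then obtain X Y Z where "integral_seq X" "x = cls X" "integral_seq Y" "y = cls Y" "integral_seq Z" "z = cls Z"
    using cls_memD by metis
  then show "(x \<oplus>\<^bsub>valuation_ring v\<^esub> y) \<otimes>\<^bsub>valuation_ring v\<^esub> z =
      x \<otimes>\<^bsub>valuation_ring v\<^esub> z \<oplus>\<^bsub>valuation_ring v\<^esub> y \<otimes>\<^bsub>valuation_ring v\<^esub> z"
    by (simp add: cls_ops integral_cauchy cauchy_add distrib_right)
qed

lemma to_completion_mem_iff: "to_completion v x \<in> carrier (valuation_ring v) \<longleftrightarrow> f x \<le> 1"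
proof
  assume "to_completion v x \<in> carrier (valuation_ring v)"
  then have "completion_abs v (to_completion v x) \<le> 1" by (simp add: valuation_ring_def)
  then show "f x \<le> 1" by (simp add: to_completion completion_abs_cls cauchy_const L_const)
qed (simp add: to_completion cls_mem integral_const)

text \<open>A late term \<open>Y M\<close> of a representing sequence approximates an integral
  element up to less than the absolute value of \<open>m\<close>, so the error is \<open>m\<close>
  times an integral sequence. Injectivity modulo \<open>m\<close> is a comparison of absolute
  values.\<close>

lemma transfer_valuation_ring:
  assumes m: "m > 0" shows "transfer (valuation_ring v) (intring {v}) (to_completion v) m"
proof -
  have R: "subring (intring {v})" using subring_intring[of "{v}"] v by simp
  have memI: "x \<in> intring {v} \<longleftrightarrow> f x \<le> 1" for x by (simp add: intring_def)
  have m0: "(of_nat m :: 'k) \<noteq> 0" using m by simp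
  have fm: "0 < f (of_nat m)" by (rule nonarch_pos[OF na m0])
  have "\<exists>z\<in>intring {v}. x = of_nat m * z"
    if y: "y \<in> carrier (valuation_ring v)" and eq: "to_completion v x = to_completion v (of_nat m) \<otimes>\<^bsub>valuation_ring v\<^esub> y" for x y
  proof -
    obtain Y where Y: "integral_seq Y" "y = cls Y" using cls_memD[OF y] by blast
    have c: "cauchy Y" "L Y \<le> 1" using Y by (auto simp: integral_seq_def)
    have "f x = completion_abs v (to_completion v x)" by (simp add: to_completion completion_abs_cls cauchy_const L_const)
    also have "\<dots> = L (\<lambda>i. of_nat m * Y i)"
      unfolding eq by (simp add: to_completion Y(2) cls_mult cauchy_const c completion_abs_cls cauchy_mult)
    also have "\<dots> = f (of_nat m) * L Y" by (simp add: L_mult cauchy_const c L_const)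
    also have "\<dots> \<le> f (of_nat m) * 1" by (rule mult_left_mono[OF c(2)]) (use fm in simp)
    finally have "f (x / of_nat m) \<le> 1" using fm by (simp add: nonarch_divide[OF na])
    then show ?thesis using m0 by (intro bexI[of _ "x / of_nat m"]) (auto simp: memI)
  qed
  moreover have "\<exists>x\<in>intring {v}. \<exists>z\<in>carrier (valuation_ring v).
      y = to_completion v x \<oplus>\<^bsub>valuation_ring v\<^esub> to_completion v (of_nat m) \<otimes>\<^bsub>valuation_ring v\<^esub> z"
    if y: "y \<in> carrier (valuation_ring v)" for y
  proof -
    obtain Y where Y: "integral_seq Y" "y = cls Y" using cls_memD[OF y] by blast
    have c: "cauchy Y" "L Y \<le> 1" using Y by (auto simp: integral_seq_def)
    obtain M where M: "\<forall>i\<ge>M. \<forall>j\<ge>M. f (Y i - Y j) < f (of_nat m)" using cauchyD[OF c(1) fm] by blast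
    define Z where "Z i = inverse (of_nat m) * (Y i + - Y M)" for i
    have Zc: "cauchy Z" unfolding Z_def by (intro cauchy_mult cauchy_add cauchy_const c)
    have "L Z \<le> 1"
    proof (rule LIMSEQ_le_const2[OF L[OF Zc]], intro exI allI impI)
      fix i assume "M \<le> i"
      then have "f (Y i - Y M) \<le> f (of_nat m)" using M by (meson less_imp_le order_refl)
      then have "f (Y i - Y M) / f (of_nat m) \<le> 1" using fm by simp
      then show "f (Z i) \<le> 1" unfolding Z_def nonarch_mult[OF na] nonarch_inverse[OF na] by (simp add: field_simps)
    qed
    then have Z: "cls Z \<in> carrier (valuation_ring v)" using Zc by (intro cls_mem) (simp add: integral_seq_def)
    have "f (Y M) \<le> max (L Y) 1"
    proof (rule LIMSEQ_le_const[OF tendsto_max[OF L[OF c(1)] tendsto_const]], intro exI allI impI)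
      fix i assume "M \<le> i"
      then have "f (Y M - Y i) < f (of_nat m)" using M by simp
      moreover have "f (Y M) \<le> max (f (Y M - Y i)) (f (Y i))" using nonarch_add[OF na, of "Y M - Y i" "Y i"] by simp
      ultimately show "f (Y M) \<le> max (f (Y i)) 1" using f_le_1(3)[of m] by linarith
    qed
    then have "Y M \<in> intring {v}" using c by (simp add: memI)
    moreover have "y = to_completion v (Y M) \<oplus>\<^bsub>valuation_ring v\<^esub> to_completion v (of_nat m) \<otimes>\<^bsub>valuation_ring v\<^esub> cls Z"
      unfolding Y(2) to_completion using m0
      by (simp add: cls_mult[OF cauchy_const Zc] cls_add) (simp add: Z_def field_simps)
    ultimately show ?thesis using Z by blast
  qed
  moreover have "to_completion v x \<in> carrier (valuation_ring v)" if "x \<in> intring {v}" for x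
    using that by (simp add: to_completion_mem_iff memI)
  ultimately show ?thesis
    by (intro transfer.intro transfer_axioms.intro cring_valuation_ring R m)
      (simp_all add: to_completion cls_ops cauchy_const)
qed

lemma matrix_over_valuation_ring:
  "matrix_over (valuation_ring v) (map_mat (to_completion v) A) \<longleftrightarrow>
    (\<forall>i<dim_row A. \<forall>j<dim_col A. f (A $$ (i, j)) \<le> 1)"
  unfolding matrix_over_def elements_mat_def by (fastforce simp: to_completion_mem_iff)

end

section \<open>Subrings of \<open>k\<close> as ring records, and localisation of counts\<close>

definition ring_of :: "'k::field set \<Rightarrow> 'k ring" where
  "ring_of R = \<lparr>carrier = R, mult = (*), one = 1, zero = 0, add = (+)\<rparr>"

lemma ring_of_simps [simp]:
  "carrier (ring_of R) = R" "x \<otimes>\<^bsub>ring_of R\<^esub> y = x * y" "x \<oplus>\<^bsub>ring_of R\<^esub> y = x + y"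
  "\<one>\<^bsub>ring_of R\<^esub> = 1" "\<zero>\<^bsub>ring_of R\<^esub> = 0"
  by (simp_all add: ring_of_def)

lemma cring_ring_of: assumes R: "subring R" shows "cring (ring_of R)"
proof (rule cringI)
  have "\<exists>y\<in>R. y + x = 0" if "x \<in> R" for x
    using subring_minus[OF R that] by (intro bexI[of _ "- x"]) auto
  then show "abelian_group (ring_of R)"
    by (intro abelian_groupI) (auto simp: add_ac subring_add[OF R] subring_zero[OF R])
  show "comm_monoid (ring_of R)"
    by (intro comm_monoidI) (auto simp: mult_ac subring_mult[OF R] subring_one[OF R])
qed (simp add: distrib_right)

lemma S_integers_eq:
  fixes S :: "('k::field_char_0 \<Rightarrow> real) set set"
  shows "S_integers S = ring_of (intring (places - S))"
proof -
  have "{x. \<forall>v\<in>places - S. to_completion v x \<in> carrier (valuation_ring v)} = intring (places - S)"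
    unfolding intring_def by (intro Collect_cong ball_cong refl) (simp add: place.to_completion_mem_iff[OF place.intro])
  then show ?thesis by (simp add: S_integers_def ring_of_def)
qed

lemma matrix_over_ring_of:
  "matrix_over (ring_of R) A \<longleftrightarrow> (\<forall>i<dim_row A. \<forall>j<dim_col A. A $$ (i, j) \<in> R)"
  unfolding matrix_over_def elements_mat_def by fastforce

lemma transfer_ring_of:
  fixes R R' :: "'k::field_char_0 set"
  assumes R: "subring R" "subring R'" and m: "m > 0" and sub: "R \<subseteq> R'"
    and surj: "\<And>y. y \<in> R' \<Longrightarrow> \<exists>x\<in>R. \<exists>z\<in>R'. y = x + of_nat m * z"
    and inj: "\<And>y. y \<in> R' \<Longrightarrow> of_nat m * y \<in> R \<Longrightarrow> y \<in> R"
  shows "transfer (ring_of R') R (\<lambda>x. x) m"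
proof (intro transfer.intro transfer_axioms.intro cring_ring_of R m)
  show "\<exists>z\<in>R. x = of_nat m * z"
    if "x \<in> R" "y \<in> carrier (ring_of R')" "x = of_nat m \<otimes>\<^bsub>ring_of R'\<^esub> y" for x y
    using that inj by auto
qed (use sub surj in auto)

text \<open>The transfer along the identity of \<open>R\<close>, which passes from ring records to
  subsets of \<open>k\<close>.\<close>

lemma num_invariant_submodules_ring_of:
  fixes R :: "'k::field_char_0 set"
  assumes R: "subring R" and m: "m > 0" and A: "A \<in> carrier_mat n n" "\<And>i j. i < n \<Longrightarrow> j < n \<Longrightarrow> A $$ (i, j) \<in> R"
  shows "num_invariant_submodules (ring_of R) A m = cnt R (vecs R {..<n}) (act A n) m"
proof -
  interpret tr: transfer "ring_of R" R "\<lambda>x. x" m n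
    by (rule transfer_ring_of[OF R R m]) (use subring_zero[OF R] in force)+
  have "map_mat (\<lambda>x. x) A = A" by (intro eq_matI) auto
  then show ?thesis using tr.num_invariant_submodules_eq_cnt[OF A] by simp
qed

text \<open>Passing to the places over \<open>p\<close> leaves the residues modulo
  \<open>p ^ e\<close> unchanged, by \<open>localisation_surj\<close> and
  \<open>localisation_inj\<close>. Both sides are compared with the count for the record of the
  larger ring.\<close>

lemma (in nf) cnt_localise:
  fixes T :: "('k \<Rightarrow> real) set set"
  assumes T: "T \<subseteq> places" and p: "prime p" and A: "A \<in> carrier_mat n n" "\<And>i j. i < n \<Longrightarrow> j < n \<Longrightarrow> A $$ (i, j) \<in> intring T"
  shows "cnt (intring T) (vecs (intring T) {..<n}) (act A n) (p ^ e) =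
    cnt (intring (T \<inter> over p)) (vecs (intring (T \<inter> over p)) {..<n}) (act A n) (p ^ e)"
proof -
  let ?R = "intring T" and ?R' = "intring (T \<inter> over p)"
  have R: "subring ?R" "subring ?R'" using T by (auto intro!: subring_intring)
  have sub: "?R \<subseteq> ?R'" by (auto simp: intring_def)
  have m: "p ^ e > 0" using prime_gt_0_nat[OF p] by simp
  interpret tr: transfer "ring_of ?R'" ?R "\<lambda>x. x" "p ^ e" n
    by (rule transfer_ring_of[OF R m sub localisation_surj[OF T p] localisation_inj[OF T p]])
  have "map_mat (\<lambda>x. x) A = A" by (intro eq_matI) auto
  then have "num_invariant_submodules (ring_of ?R') A (p ^ e) = cnt ?R (vecs ?R {..<n}) (act A n) (p ^ e)"
    using tr.num_invariant_submodules_eq_cnt[OF A] by simp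
  moreover have "A $$ (i, j) \<in> ?R'" if "i < n" "j < n" for i j using A(2)[OF that] sub by blast
  ultimately show ?thesis using num_invariant_submodules_ring_of[OF R(2) m A(1)] by simp
qed

text \<open>The part \<open>u\<close> of \<open>m\<close> prime to \<open>p\<close> is invertible in
  the ring, so a submodule of index \<open>m\<close> already contains the multiples of the
  \<open>p\<close>-part of \<open>m\<close>, and its index would be a power of
  \<open>p\<close>.\<close>

lemma cnt_local_eq_0:
  fixes T :: "('k::field_char_0 \<Rightarrow> real) set set"
  assumes p: "prime p" and T: "T \<subseteq> over p" and m: "m > 0" "\<And>e. m \<noteq> p ^ e"
  shows "cnt (intring T) (vecs (intring T) {..<n}) X m = 0"
proof -
  let ?R = "intring T"
  let ?M = "vecs ?R {..<n}"
  have Tp: "T \<subseteq> places" using T by (auto simp: over_def)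
  have R: "subring ?R" by (rule subring_intring[OF Tp])
  have M: "subgrp ?M" "submod ?R ?M" using subgrp_vecs submod_vecs R by blast+
  obtain u where u: "m = p ^ multiplicity p m * u" "\<not> p dvd u"
    using multiplicity_decompose'[of m p] m p by (metis not_prime_unit neq0_conv)
  have cop: "coprime (int p) (int u)" using u(2) p by (simp add: prime_imp_coprime)
  have "place_abs v (inverse (of_nat u)) \<le> 1" if v: "v \<in> T" for v
  proof -
    have vp: "v \<in> places" "place_abs v (of_nat p) < 1" using v T by (auto simp: over_def)
    show ?thesis using nonarch_coprime[OF place_abs_nonarch[OF vp(1)] vp(2) cop] nonarch_inverse[OF place_abs_nonarch[OF vp(1)], of "of_nat u"]
      by simp
  qed
  then have uR: "inverse (of_nat u) \<in> ?R" by (simp add: intring_def)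
  have u0: "(of_nat u :: 'k) \<noteq> 0" using u m by (metis mult_0_right neq0_conv of_nat_eq_0_iff)
  have "{N. submod ?R N \<and> N \<subseteq> ?M \<and> X ` N \<subseteq> N \<and> idx ?M N = m} = {}"
  proof (rule equals0I)
    fix N assume "N \<in> {N. submod ?R N \<and> N \<subseteq> ?M \<and> X ` N \<subseteq> N \<and> idx ?M N = m}"
    then have N: "submod ?R N" "N \<subseteq> ?M" "idx ?M N = m" by auto
    have "smul (of_nat (p ^ multiplicity p m)) g \<in> N" if g: "g \<in> ?M" for g
    proof -
      have "smul (of_nat m) g \<in> N"
        using submod_idx_mem[OF M(1) submod_subgrp[OF N(1)] N(2) _ g] N(3) m by simp
      then have "smul (inverse (of_nat u)) (smul (of_nat m) g) \<in> N" by (rule submod_smul[OF N(1) uR])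
      moreover have "smul (inverse (of_nat u)) (smul (of_nat m) g) = smul (of_nat (p ^ multiplicity p m)) g"
        using u0 arg_cong[OF u(1), of "of_nat :: nat \<Rightarrow> 'k"] by (auto simp: fun_eq_iff)
      ultimately show ?thesis by simp
    qed
    from idx_prime_power[OF p M(1) submod_subgrp[OF N(1)] N(2) _ this] m N(3) show False by auto
  qed
  then show ?thesis unfolding cnt_def by (simp only: card.empty)
qed

section \<open>Uniqueness of Dirichlet series\<close>

text \<open>At the first disagreement \<open>m0\<close> the series are multiplied by
  \<open>M powr s\<close> with \<open>M = m0 + 1\<close>, and \<open>s\<close> runs through the real
  values \<open>s0 + j\<close>. The terms after \<open>m0\<close> decay at least like
  \<open>\<rho> ^ j\<close> against a fixed convergent majorant, so the difference at
  \<open>m0\<close> must vanish.\<close>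

lemma dirichlet_series_unique:
  fixes a b :: "nat \<Rightarrow> nat"
  assumes a: "\<And>m. a m \<le> Suc m ^ K" and b: "\<And>m. b m \<le> Suc m ^ K"
    and eq: "\<And>s::complex. Re s > \<sigma> \<Longrightarrow>
      (\<Sum>m. of_nat (a m) * of_nat (Suc m) powr (- s)) = (\<Sum>m. of_nat (b m) * of_nat (Suc m) powr (- s))"
  shows "a = b"
proof (rule ccontr)
  assume "a \<noteq> b"
  define m0 where "m0 = (LEAST m. a m \<noteq> b m)"
  have "\<exists>m. a m \<noteq> b m" using \<open>a \<noteq> b\<close> by auto
  then have m0: "a m0 \<noteq> b m0" unfolding m0_def by (rule LeastI_ex[of "\<lambda>m. a m \<noteq> b m"])
  have less: "a m = b m" if "m < m0" for m using not_less_Least that unfolding m0_def by blast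
  \<comment> \<open>Beyond \<open>s0\<close> the two series are known to agree, and the growth bound
    makes the general term at most \<open>real (Suc m) powr (- 2)\<close>.\<close>
  define s0 where "s0 = max (\<sigma> + 1) (real K + 2)"
  define M where "M = real (Suc m0)"
  define d where "d m = real (a m) - real (b m)" for m
  have sm: "summable (\<lambda>m. real (c m) * real (Suc m) powr (- s))"
    if c: "\<And>m. c m \<le> Suc m ^ K" and s: "s \<ge> s0" for c s
  proof (rule summable_comparison_test_ev)
    show "summable (\<lambda>m. real (Suc m) powr (- 2))"
      using summable_Suc_iff[of "\<lambda>m. real m powr (- 2)"] summable_real_powr_iff[of "- 2"] by simp
    show "\<forall>\<^sub>F m in sequentially. norm (real (c m) * real (Suc m) powr (- s)) \<le> real (Suc m) powr (- 2)"
    proof (intro always_eventually allI)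
      fix m
      have "real (c m) \<le> real (Suc m) powr real K"
        using of_nat_mono[OF c[of m], where 'a = real] by (simp add: powr_realpow del: of_nat_Suc)
      then have "real (c m) * real (Suc m) powr (- s) \<le> real (Suc m) powr real K * real (Suc m) powr (- s)"
        by (rule mult_right_mono) simp
      also have "\<dots> = real (Suc m) powr (real K - s)" by (simp flip: powr_add)
      also have "\<dots> \<le> real (Suc m) powr (- 2)" using s unfolding s0_def by (intro powr_mono) auto
      finally show "norm (real (c m) * real (Suc m) powr (- s)) \<le> real (Suc m) powr (- 2)" by simp
    qed
  qed
  have eq_real: "(\<Sum>m. real (a m) * real (Suc m) powr (- s)) = (\<Sum>m. real (b m) * real (Suc m) powr (- s))"
    if s: "s \<ge> s0" for s
  proof -
    have conv: "(\<Sum>m. of_nat (c m) * of_nat (Suc m) powr (- complex_of_real s)) =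
        complex_of_real (\<Sum>m. real (c m) * real (Suc m) powr (- s))" if "\<And>m. c m \<le> Suc m ^ K" for c
    proof -
      have "of_nat (c m) * of_nat (Suc m) powr (- complex_of_real s) =
          complex_of_real (real (c m) * real (Suc m) powr (- s))" for m
        using powr_of_real[of "real (Suc m)" "- s"] by simp
      then show ?thesis using suminf_of_real[OF sm[OF that s], where 'a = complex] by (simp only:)
    qed
    have "Re (complex_of_real s) > \<sigma>" using s unfolding s0_def by simp
    from eq[OF this] show ?thesis unfolding conv[OF a] conv[OF b] by simp
  qed
  have zero: "(\<lambda>m. d m * (M / real (Suc m)) powr s) sums 0" if s: "s \<ge> s0" for s
  proof -
    have "(\<lambda>m. real (a m) * real (Suc m) powr (- s) - real (b m) * real (Suc m) powr (- s)) sums 0"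
      using sums_diff[OF summable_sums[OF sm[OF a s]] summable_sums[OF sm[OF b s]]] eq_real[OF s] by simp
    then have "(\<lambda>m. M powr s * (real (a m) * real (Suc m) powr (- s) - real (b m) * real (Suc m) powr (- s))) sums (M powr s * 0)"
      by (rule sums_mult)
    moreover have "M powr s * (real (a m) * real (Suc m) powr (- s) - real (b m) * real (Suc m) powr (- s)) =
        d m * (M / real (Suc m)) powr s" for m
      unfolding d_def M_def by (simp add: powr_divide powr_minus_divide field_simps)
    ultimately show ?thesis by simp
  qed
  define g where "g m = (if m \<le> m0 then 0 else \<bar>d m\<bar> * (M / real (Suc m)) powr s0)" for m
  have "summable (\<lambda>m. M powr s0 * (real (a m) * real (Suc m) powr (- s0) + real (b m) * real (Suc m) powr (- s0)))"
    using sm[OF a order_refl] sm[OF b order_refl] by (intro summable_mult summable_add)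
  then have sg: "summable g"
  proof (rule summable_comparison_test_ev[rotated], intro always_eventually allI)
    fix m
    have "\<bar>d m\<bar> \<le> real (a m) + real (b m)" unfolding d_def by linarith
    then have "\<bar>d m\<bar> * (M / real (Suc m)) powr s0 \<le> (real (a m) + real (b m)) * (M / real (Suc m)) powr s0"
      by (rule mult_right_mono) simp
    also have "\<dots> = M powr s0 * (real (a m) * real (Suc m) powr (- s0) + real (b m) * real (Suc m) powr (- s0))"
      unfolding M_def by (simp add: powr_divide powr_minus_divide field_simps)
    finally show "norm (g m) \<le> M powr s0 * (real (a m) * real (Suc m) powr (- s0) + real (b m) * real (Suc m) powr (- s0))"
      unfolding g_def by (auto simp: M_def)
  qed
  \<comment> \<open>The largest of the ratios \<open>M / real (Suc m)\<close> with
    \<open>m > m0\<close>, attained at \<open>m = m0 + 1\<close>.\<close>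
  define \<rho> where "\<rho> = M / (M + 1)"
  have \<rho>: "0 < \<rho>" "\<rho> < 1" unfolding \<rho>_def M_def by auto
  have bound: "\<bar>d m0\<bar> \<le> \<rho> ^ j * suminf g" for j :: nat
  proof -
    define t where "t m = d m * (M / real (Suc m)) powr (s0 + real j)" for m
    have t: "t sums 0" unfolding t_def by (rule zero) simp
    have "d m = 0" if "m < m0" for m using less[OF that] by (simp add: d_def)
    then have tm: "(\<Sum>m<Suc m0. t m) = d m0" unfolding t_def by (simp add: M_def)
    have "(\<lambda>m. t (m + Suc m0)) sums (0 - d m0)"
      using sums_iff_shift[of t "Suc m0" "0 - d m0"] t tm by simp
    moreover have "norm (t (m + Suc m0)) \<le> \<rho> ^ j * g (m + Suc m0)" for m
    proof -
      have "M / real (Suc (m + Suc m0)) \<le> \<rho>" unfolding \<rho>_def M_def by (intro divide_left_mono) auto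
      then have "(M / real (Suc (m + Suc m0))) powr real j \<le> \<rho> powr real j"
        by (intro powr_mono2) (auto simp: M_def)
      also have "\<dots> = \<rho> ^ j" using \<rho> by (simp add: powr_realpow)
      finally have le: "(M / real (Suc (m + Suc m0))) powr real j \<le> \<rho> ^ j" .
      have "norm (t (m + Suc m0)) = (\<bar>d (m + Suc m0)\<bar> * (M / real (Suc (m + Suc m0))) powr s0) * (M / real (Suc (m + Suc m0))) powr real j"
        unfolding t_def by (simp add: powr_add abs_mult)
      also have "\<dots> \<le> (\<bar>d (m + Suc m0)\<bar> * (M / real (Suc (m + Suc m0))) powr s0) * \<rho> ^ j"
        using le by (intro mult_left_mono) auto
      finally show ?thesis unfolding g_def by (simp add: mult.commute)
    qed
    moreover have sg': "summable (\<lambda>m. g (m + Suc m0))" using summable_iff_shift[of g "Suc m0"] sg by simp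
    ultimately have "norm (0 - d m0) \<le> (\<Sum>m. \<rho> ^ j * g (m + Suc m0))"
      using norm_suminf_le[of "\<lambda>m. t (m + Suc m0)" "\<lambda>m. \<rho> ^ j * g (m + Suc m0)"]
      by (metis sums_unique summable_mult)
    also have "\<dots> = \<rho> ^ j * (\<Sum>m. g (m + Suc m0))" by (rule suminf_mult[OF sg'])
    also have "(\<Sum>m. g (m + Suc m0)) = suminf g"
    proof -
      have "(\<Sum>m<Suc m0. g m) = 0" by (rule sum.neutral) (simp add: g_def)
      then show ?thesis using suminf_minus_initial_segment[OF sg, of "Suc m0"] by (simp only: diff_0_right)
    qed
    finally show ?thesis by simp
  qed
  have "(\<lambda>j. \<rho> ^ j * suminf g) \<longlonglongrightarrow> 0 * suminf g"
    using \<rho> by (intro tendsto_mult LIMSEQ_power_zero tendsto_const) auto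
  then have "\<bar>d m0\<bar> \<le> 0 * suminf g"
    using bound by (intro LIMSEQ_le_const) auto
  then show False using m0 by (simp add: d_def)
qed

section \<open>Similarity and zeta functions\<close>

definition bad_places :: "'k::field_char_0 mat \<Rightarrow> ('k \<Rightarrow> real) set set" where
  "bad_places A = (\<Union>i<dim_row A. \<Union>j<dim_col A. {v \<in> places. place_abs v (A $$ (i, j)) > 1})"

lemma (in nf) finite_bad_places: "finite (bad_places (A :: 'k mat))"
  unfolding bad_places_def by (intro finite_UN_I finite_lessThan finite_nonintegral)

lemma bad_places_subset: "bad_places A \<subseteq> places"
  unfolding bad_places_def by (intro UN_least) simp

lemma mem_intring_if_not_bad:
  assumes "A \<in> carrier_mat n n" "T \<subseteq> places" "T \<inter> bad_places A = {}" "i < n" "j < n"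
  shows "A $$ (i, j) \<in> intring T"
  unfolding intring_def
proof (intro CollectI ballI)
  fix v assume v: "v \<in> T"
  then have "v \<notin> bad_places A" using assms(3) by blast
  moreover have "v \<in> bad_places A" if "place_abs v (A $$ (i, j)) > 1"
    unfolding bad_places_def using assms v that by (intro UN_I[of i] UN_I[of j]) auto
  ultimately show "place_abs v (A $$ (i, j)) \<le> 1" by (meson not_le)
qed

text \<open>\<open>P\<close> is invertible over \<open>R\<close>, so right multiplication by it is
  an automorphism of the free module that carries \<open>X\<close> to the action of
  \<open>A\<close>.\<close>

lemma cnt_conjugate:
  fixes P Q A :: "'k::field_char_0 mat"
  assumes R: "subring R" and c: "P \<in> carrier_mat n n" "Q \<in> carrier_mat n n"
    and inv: "P * Q = 1\<^sub>m n" "Q * P = 1\<^sub>m n"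
    and PR: "\<And>i j. i < n \<Longrightarrow> j < n \<Longrightarrow> P $$ (i, j) \<in> R" and QR: "\<And>i j. i < n \<Longrightarrow> j < n \<Longrightarrow> Q $$ (i, j) \<in> R"
    and X: "\<And>f. f \<in> vecs R {..<n} \<Longrightarrow> X f \<in> vecs R {..<n}"
    and eq: "\<And>f. f \<in> vecs UNIV {..<n} \<Longrightarrow> act A n (act P n f) = act P n (X f)"
  shows "cnt R (vecs R {..<n}) X m = cnt R (vecs R {..<n}) (act A n) m"
proof -
  have U: "f \<in> vecs UNIV {..<n}" if "f \<in> vecs R {..<n}" for f using that by (simp add: vecs_def)
  show ?thesis
  proof (rule cnt_iso[of "act P n"])
    show "bij_betw (act P n) (vecs R {..<n}) (vecs R {..<n})"
    proof (rule bij_betw_byWitness[of _ "act Q n"])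
      show "\<forall>f\<in>vecs R {..<n}. act Q n (act P n f) = f"
        using act_mult[OF c] inv act_one U by metis
      show "\<forall>f\<in>vecs R {..<n}. act P n (act Q n f) = f"
        using act_mult[OF c(2,1)] inv act_one U by metis
      show "act P n ` vecs R {..<n} \<subseteq> vecs R {..<n}" by (intro image_subsetI act_mem[OF R PR])
      show "act Q n ` vecs R {..<n} \<subseteq> vecs R {..<n}" by (intro image_subsetI act_mem[OF R QR])
    qed
    show "submod R (vecs R {..<n})" by (rule submod_vecs[OF R])
  qed (simp_all add: lin_map_diff[OF lin_map_act] lin_map_smul[OF lin_map_act] X eq U)
qed

lemma shift_mem: assumes R: "subring R" and f: "f \<in> vecs R {..<n}" shows "shift n lev f \<in> vecs R {..<n}"
  using f subring_zero[OF R] by (simp add: vecs_def shift_apply)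

text \<open>Both implications back to similarity pass through here, with \<open>T = {v}\<close> and
  with \<open>T = places - S\<close>. The counts are localised at \<open>p\<close> before
  conjugating, so the conjugating matrices have to be integral only at the places of
  \<open>T\<close> over \<open>p\<close>. Hence \<open>E\<close> is fixed by \<open>A\<close> and
  \<open>B\<close> before \<open>T\<close> and \<open>p\<close> are chosen.\<close>

lemma (in nf) similar_if_cnt_eq:
  fixes A B :: "'k mat"
  assumes A: "A \<in> carrier_mat n n" "nilpotent_mat A" and B: "B \<in> carrier_mat m m" "nilpotent_mat B"
  shows "\<exists>E. finite E \<and> (\<forall>T p. T \<subseteq> places \<longrightarrow> prime p \<longrightarrow> T \<inter> over p \<noteq> {} \<longrightarrow> T \<inter> over p \<inter> E = {} \<longrightarrow>
    (\<forall>i<n. \<forall>j<n. A $$ (i, j) \<in> intring T) \<longrightarrow> (\<forall>i<m. \<forall>j<m. B $$ (i, j) \<in> intring T) \<longrightarrow>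
    (\<forall>j>0. cnt (intring T) (vecs (intring T) {..<n}) (act A n) j = cnt (intring T) (vecs (intring T) {..<m}) (act B m) j) \<longrightarrow>
    n = m \<and> similar_mat A B)"
proof -
  obtain lev P where P: "good_lev lev" "P \<in> carrier_mat n n" "bij_betw (act P n) (vecs UNIV {..<n}) (vecs UNIV {..<n})"
    "\<forall>f\<in>vecs UNIV {..<n}. act A n (act P n f) = act P n (shift n lev f)"
    using nilpotent_chain_form[OF A] by blast
  obtain lev' P' where P': "good_lev lev'" "P' \<in> carrier_mat m m" "bij_betw (act P' m) (vecs UNIV {..<m}) (vecs UNIV {..<m})"
    "\<forall>f\<in>vecs UNIV {..<m}. act B m (act P' m f) = act P' m (shift m lev' f)"
    using nilpotent_chain_form[OF B] by blast
  obtain Q where Q: "Q \<in> carrier_mat n n" "P * Q = 1\<^sub>m n" "Q * P = 1\<^sub>m n" using act_inverse[OF P(2,3)] by blast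
  obtain Q' where Q': "Q' \<in> carrier_mat m m" "P' * Q' = 1\<^sub>m m" "Q' * P' = 1\<^sub>m m" using act_inverse[OF P'(2,3)] by blast
  define E where "E = bad_places P \<union> bad_places Q \<union> bad_places P' \<union> bad_places Q'"
  have "n = m \<and> similar_mat A B"
    if T: "T \<subseteq> places" and p: "prime p" and ne: "T \<inter> over p \<noteq> {}" and TE: "T \<inter> over p \<inter> E = {}"
      and AT: "\<forall>i<n. \<forall>j<n. A $$ (i, j) \<in> intring T" and BT: "\<forall>i<m. \<forall>j<m. B $$ (i, j) \<in> intring T"
      and eq: "\<forall>j>0. cnt (intring T) (vecs (intring T) {..<n}) (act A n) j = cnt (intring T) (vecs (intring T) {..<m}) (act B m) j"
    for T p
  proof -
    let ?T = "T \<inter> over p"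
    let ?R = "intring ?T"
    have Tp: "?T \<subseteq> places" using T by blast
    have R: "subring ?R" by (rule subring_intring[OF Tp])
    have dis: "?T \<inter> bad_places P = {}" "?T \<inter> bad_places Q = {}" "?T \<inter> bad_places P' = {}" "?T \<inter> bad_places Q' = {}"
      using TE unfolding E_def by blast+
    interpret pid: pid_ring ?R co d
      by (rule pid_ring_intring[OF p finite_subset[OF Int_lower2 finite_over[OF p]] ne Int_lower2])
    have shiftA: "cnt ?R (vecs ?R {..<n}) (shift n lev) j = cnt ?R (vecs ?R {..<n}) (act A n) j" for j
      by (rule cnt_conjugate[OF R P(2) Q mem_intring_if_not_bad[OF P(2) Tp dis(1)] mem_intring_if_not_bad[OF Q(1) Tp dis(2)]
            shift_mem[OF R]]) (use P(4) in auto)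
    have shiftB: "cnt ?R (vecs ?R {..<m}) (shift m lev') j = cnt ?R (vecs ?R {..<m}) (act B m) j" for j
      by (rule cnt_conjugate[OF R P'(2) Q' mem_intring_if_not_bad[OF P'(2) Tp dis(3)] mem_intring_if_not_bad[OF Q'(1) Tp dis(4)]
            shift_mem[OF R]]) (use P'(4) in auto)
    \<comment> \<open>At powers of \<open>p\<close> the equality comes from the hypothesis on
      \<open>T\<close>; at every other index both local counts are 0.\<close>
    have "cnt ?R (vecs ?R {..<n}) (shift n lev) j = cnt ?R (vecs ?R {..<m}) (shift m lev') j" if j: "j > 0" for j
    proof (cases "\<exists>e. j = p ^ e")
      case True
      then obtain e where e: "j = p ^ e" by blast
      show ?thesis
        unfolding shiftA shiftB e
        using cnt_localise[OF T p A(1), of e] cnt_localise[OF T p B(1), of e] AT BT eq j e by simp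
    next
      case False
      then show ?thesis using cnt_local_eq_0[OF p Int_lower2 j] by metis
    qed
    then have card: "card (level_set n lev h) = card (level_set m lev' h)" for h
      by (rule pid.level_cards_determined[OF P(1) P'(1)])
    then have nm: "n = m" by (rule level_cards_size)
    have "similar_mat (shift_mat n lev) A"
      by (rule similar_matI_act[OF shift_mat_carrier A(1) P(2,3)]) (use P(1,4) in \<open>simp add: act_shift_mat\<close>)
    moreover have "similar_mat (shift_mat m lev') B"
      by (rule similar_matI_act[OF shift_mat_carrier B(1) P'(2,3)]) (use P'(1,4) in \<open>simp add: act_shift_mat\<close>)
    moreover have "similar_mat (shift_mat n lev :: 'k mat) (shift_mat n lev')"
      by (rule similar_shift_mat[OF P(1) P'(1)]) (use card nm in simp)
    ultimately show ?thesis using nm similar_mat_sym similar_mat_trans by metis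
  qed
  moreover have "finite E" unfolding E_def by (intro finite_UnI finite_bad_places)
  ultimately show ?thesis by (intro exI[of _ E]) simp
qed

lemma (in nf) cnt_eq_if_zeta_eq:
  fixes R :: "'k set"
  assumes R: "subring R"
    and A: "\<And>j. num_invariant_submodules R' A' (Suc j) = cnt R (vecs R {..<n}) X (Suc j)"
    and B: "\<And>j. num_invariant_submodules R' B' (Suc j) = cnt R (vecs R {..<m}) Y (Suc j)"
    and eq: "zeta_eq R' A' B'" and j: "j > 0"
  shows "cnt R (vecs R {..<n}) X j = cnt R (vecs R {..<m}) Y j"
proof -
  interpret r: nf_ring R co d by (rule nf_ringI[OF R])
  let ?a = "\<lambda>j. cnt R (vecs R {..<n}) X (Suc j)" and ?b = "\<lambda>j. cnt R (vecs R {..<m}) Y (Suc j)"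
  let ?N = "(n * d) * (n * d)" and ?M = "(m * d) * (m * d)"
  obtain \<sigma> :: real where \<sigma>: "\<And>s. Re s > \<sigma> \<Longrightarrow> submodule_zeta R' A' s = submodule_zeta R' B' s"
    using eq unfolding zeta_eq_def by blast
  have "?a = ?b"
  \<comment> \<open>The sum of the two growth exponents bounds both coefficient sequences, whose
    matrices may have different sizes.\<close>
  proof (rule dirichlet_series_unique[of ?a "?N + ?M" ?b \<sigma>])
    show "?a j \<le> Suc j ^ (?N + ?M)" for j
      by (rule order_trans[OF r.cnt_bound power_increasing]) auto
    show "?b j \<le> Suc j ^ (?N + ?M)" for j
      by (rule order_trans[OF r.cnt_bound power_increasing]) auto
    show "(\<Sum>j. of_nat (?a j) * of_nat (Suc j) powr (- s)) = (\<Sum>j. of_nat (?b j) * of_nat (Suc j) powr (- s))"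
      if "Re s > \<sigma>" for s :: complex
      using \<sigma>[OF that] unfolding submodule_zeta_def A B .
  qed
  then show ?thesis using j fun_cong[of ?a ?b "j - 1"] by simp
qed

lemma zeta_eqI:
  assumes "\<And>j. num_invariant_submodules R' A' (Suc j) = num_invariant_submodules R' B' (Suc j)"
  shows "zeta_eq R' A' B'"
  unfolding zeta_eq_def submodule_zeta_def assms by blast

lemma num_invariant_submodules_valuation_ring:
  fixes v :: "('k::field_char_0 \<Rightarrow> real) set"
  assumes v: "v \<in> places" and A: "A \<in> carrier_mat n n"
    and int: "matrix_over (valuation_ring v) (map_mat (to_completion v) A)"
  shows "num_invariant_submodules (valuation_ring v) (map_mat (to_completion v) A) (Suc j) =
    cnt (intring {v}) (vecs (intring {v}) {..<n}) (act A n) (Suc j)"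
proof -
  interpret pl: place v by (rule place.intro[OF v])
  show ?thesis
    by (rule transfer.num_invariant_submodules_eq_cnt[OF pl.transfer_valuation_ring[OF zero_less_Suc] A])
      (use int A in \<open>auto simp: pl.matrix_over_valuation_ring intring_def\<close>)
qed

text \<open>A place lies over at most one prime, so finitely many places exclude finitely many
  primes.\<close>

lemma (in nf) exists_prime_avoiding:
  fixes F :: "('k \<Rightarrow> real) set set"
  assumes "finite F" shows "\<exists>p. prime p \<and> over p \<inter> F = {}"
proof -
  have "finite {p. prime p \<and> v \<in> over p}" for v :: "('k \<Rightarrow> real) set"
  proof (cases "\<exists>p. prime p \<and> v \<in> over p")
    case True
    then obtain p where p: "prime p" "v \<in> over p" by blast
    then have vp: "v \<in> places" "place_abs v (of_nat p) < 1" by (auto simp: over_def)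
    have "q = p" if q: "prime q" "v \<in> over q" for q
    proof (rule ccontr)
      assume "q \<noteq> p"
      then have "coprime p q" using primes_coprime[OF p(1) q(1)] by simp
      then have "coprime (int p) (int q)" by simp
      from nonarch_coprime[OF place_abs_nonarch[OF vp(1)] vp(2) this] q(2) show False by (simp add: over_def)
    qed
    then have "{p. prime p \<and> v \<in> over p} \<subseteq> {p}" by (intro subsetI) simp
    then show ?thesis by (rule finite_subset) simp
  next
    case False
    then have "{p. prime p \<and> v \<in> over p} = {}" by simp
    then show ?thesis by (simp only: finite.emptyI)
  qed
  then have fin: "finite (\<Union>v\<in>F. {p. prime p \<and> v \<in> over p})" using assms by (intro finite_UN_I)
  show ?thesis
  proof (rule ccontr)
    assume no: "\<not> (\<exists>p. prime p \<and> over p \<inter> F = {})"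
    have "p \<in> (\<Union>v\<in>F. {p. prime p \<and> v \<in> over p})" if p: "prime p" for p
    proof -
      obtain v where "v \<in> over p" "v \<in> F" using no p by auto
      then show ?thesis using p by (intro UN_I[of v]) simp_all
    qed
    then have "{p::nat. prime p} \<subseteq> (\<Union>v\<in>F. {p. prime p \<and> v \<in> over p})" by (intro subsetI) simp
    then show False using finite_subset[OF _ fin] primes_infinite by simp
  qed
qed

text \<open>Where \<open>A\<close>, \<open>B\<close>, the conjugating matrix and its inverse are all
  integral, the conjugation takes place over the ring itself. One finite \<open>E\<close> serves for
  the single places outside it and for the elements integral outside it.\<close>

lemma (in nf) cnt_eq_if_similar:
  fixes A B :: "'k mat"
  assumes A: "A \<in> carrier_mat n n" and B: "B \<in> carrier_mat n n" and sim: "similar_mat A B"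
  shows "\<exists>E\<subseteq>places. finite E \<and> (\<forall>T\<subseteq>places - E. \<forall>i<n. \<forall>j<n. A $$ (i, j) \<in> intring T \<and> B $$ (i, j) \<in> intring T) \<and>
    (\<forall>T\<subseteq>places - E. \<forall>m. cnt (intring T) (vecs (intring T) {..<n}) (act A n) m = cnt (intring T) (vecs (intring T) {..<n}) (act B n) m)"
proof -
  obtain P Q where w: "similar_mat_wit A B P Q" using sim unfolding similar_mat_def by blast
  note PQ = similar_mat_witD2[OF A w]
  define E where "E = bad_places A \<union> bad_places B \<union> bad_places P \<union> bad_places Q"
  have "finite E" unfolding E_def by (intro finite_UnI finite_bad_places)
  moreover have "E \<subseteq> places" unfolding E_def using bad_places_subset by (intro Un_least)
  moreover have ent: "C $$ (i, j) \<in> intring T"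
    if T: "T \<subseteq> places - E" and C: "C \<in> {A, B, P, Q}" and ij: "i < n" "j < n" for T C i j
  proof (rule mem_intring_if_not_bad[OF _ _ _ ij])
    show "C \<in> carrier_mat n n" using C PQ by blast
    show "T \<subseteq> places" using T by blast
    show "T \<inter> bad_places C = {}" using T C unfolding E_def by blast
  qed
  moreover have "cnt (intring T) (vecs (intring T) {..<n}) (act A n) m = cnt (intring T) (vecs (intring T) {..<n}) (act B n) m"
    if T: "T \<subseteq> places - E" for T m
  proof -
    have R: "subring (intring T)" by (rule subring_intring) (use T in blast)
    have "A * P = P * B * (Q * P)" unfolding PQ(3) using PQ(4-7) by (simp add: assoc_mult_mat[of _ n n _ n _ n])
    then have AP: "A * P = P * B" using PQ(2,5,6) by simp
    show ?thesis
    proof (rule cnt_conjugate[OF R PQ(6,7,1,2)])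
      show "P $$ (i, j) \<in> intring T" "Q $$ (i, j) \<in> intring T" if "i < n" "j < n" for i j
        using ent[OF T _ that] by auto
      show "act A n f \<in> vecs (intring T) {..<n}" if "f \<in> vecs (intring T) {..<n}" for f
        by (rule act_mem[OF R _ that]) (rule ent[OF T], simp_all)
      show "act B n (act P n f) = act P n (act A n f)" for f
        using act_mult[OF PQ(6) B, of f] act_mult[OF A PQ(6), of f] AP by simp
    qed
  qed
  ultimately show ?thesis by (intro exI[of _ E] conjI allI impI) simp_all
qed

theorem theoremC:
  fixes A B :: "'k::field_char_0 mat" and n m :: nat
  assumes "number_field TYPE('k)"
    and "0 < n" and "0 < m"
    and "A \<in> carrier_mat n n" and "B \<in> carrier_mat m m"
    and "nilpotent_mat A" and "nilpotent_mat B"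
  shows
    "(n = m \<and> similar_mat A B \<longleftrightarrow>
       finite {v \<in> places. \<not>
         (matrix_over (valuation_ring v) (map_mat (to_completion v) A) \<and>
          matrix_over (valuation_ring v) (map_mat (to_completion v) B) \<and>
          zeta_eq (valuation_ring v) (map_mat (to_completion v) A) (map_mat (to_completion v) B))})
     \<and>
     (n = m \<and> similar_mat A B \<longleftrightarrow>
       (\<exists>S \<subseteq> places. finite S \<and>
          matrix_over (S_integers S) A \<and> matrix_over (S_integers S) B \<and>
          zeta_eq (S_integers S) A B))"
    (is "(?i \<longleftrightarrow> finite ?X) \<and> (?i \<longleftrightarrow> ?iii)")
proof -
  note A = assms(4) and B = assms(5)
  obtain co :: "nat \<Rightarrow> 'k \<Rightarrow> rat" and d where "nf co d" using number_field_nf[OF assms(1)] by blast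
  then interpret nf co d .
  have sub1: "subring (intring {v})" if "v \<in> places" for v :: "('k \<Rightarrow> real) set"
    using subring_intring[of "{v}"] that by simp
  have subS: "subring (intring (places - S))" for S :: "('k \<Rightarrow> real) set set" by (rule subring_intring) blast
  have fwd: "finite ?X \<and> ?iii" if i: ?i
  proof -
    have Bn: "B \<in> carrier_mat n n" and sim: "similar_mat A B" using i B by auto
    obtain E where E: "E \<subseteq> places" "finite E"
      "\<forall>T\<subseteq>places - E. \<forall>i<n. \<forall>j<n. A $$ (i, j) \<in> intring T \<and> B $$ (i, j) \<in> intring T"
      "\<forall>T\<subseteq>places - E. \<forall>m. cnt (intring T) (vecs (intring T) {..<n}) (act A n) m = cnt (intring T) (vecs (intring T) {..<n}) (act B n) m"
      using cnt_eq_if_similar[OF A Bn sim] by blast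
    have good: "matrix_over (valuation_ring v) (map_mat (to_completion v) A) \<and>
          matrix_over (valuation_ring v) (map_mat (to_completion v) B) \<and>
          zeta_eq (valuation_ring v) (map_mat (to_completion v) A) (map_mat (to_completion v) B)"
      if v: "v \<in> places" "v \<notin> E" for v
    proof -
      have T: "{v} \<subseteq> places - E" using v by simp
      interpret pl: place v by (rule place.intro[OF v(1)])
      have mA: "matrix_over (valuation_ring v) (map_mat (to_completion v) A)"
        and mB: "matrix_over (valuation_ring v) (map_mat (to_completion v) B)"
        using E(3)[rule_format, OF T] A Bn by (auto simp: pl.matrix_over_valuation_ring intring_def)
      have "zeta_eq (valuation_ring v) (map_mat (to_completion v) A) (map_mat (to_completion v) B)"
        by (rule zeta_eqI) (simp only: num_invariant_submodules_valuation_ring[OF v(1) A mA]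
            num_invariant_submodules_valuation_ring[OF v(1) Bn mB] E(4)[rule_format, OF T])
      then show ?thesis using mA mB by blast
    qed
    have "?X \<subseteq> E" using good by blast
    then have fin: "finite ?X" using E(2) by (rule finite_subset)
    have ent: "A $$ (i, j) \<in> intring (places - E)" "B $$ (i, j) \<in> intring (places - E)" if "i < n" "j < n" for i j
      using E(3) that by blast+
    \<comment> \<open>The exceptional set itself is taken for \<open>S\<close>.\<close>
    have "zeta_eq (S_integers E) A B"
      unfolding S_integers_eq
      by (rule zeta_eqI) (simp only: num_invariant_submodules_ring_of[OF subS zero_less_Suc A ent(1)]
          num_invariant_submodules_ring_of[OF subS zero_less_Suc Bn ent(2)] E(4)[rule_format, OF order_refl])
    moreover have "matrix_over (S_integers E) A" "matrix_over (S_integers E) B"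
      unfolding S_integers_eq matrix_over_ring_of using ent A Bn by auto
    ultimately show ?thesis using fin E(1,2) by blast
  qed
  obtain E where E: "finite E" and main: "\<And>T p. T \<subseteq> places \<Longrightarrow> prime p \<Longrightarrow> T \<inter> over p \<noteq> {} \<Longrightarrow> T \<inter> over p \<inter> E = {} \<Longrightarrow>
    \<forall>i<n. \<forall>j<n. A $$ (i, j) \<in> intring T \<Longrightarrow> \<forall>i<m. \<forall>j<m. B $$ (i, j) \<in> intring T \<Longrightarrow>
    \<forall>j>0. cnt (intring T) (vecs (intring T) {..<n}) (act A n) j = cnt (intring T) (vecs (intring T) {..<m}) (act B m) j \<Longrightarrow>
    n = m \<and> similar_mat A B"
    using similar_if_cnt_eq[OF A assms(6) B assms(7)] by blast
  have bwd2: ?i if fin: "finite ?X"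
  proof -
    \<comment> \<open>Every place over this \<open>p\<close> satisfies the local condition and
      avoids \<open>E\<close>, and at least one exists; a single place decides similarity.\<close>
    obtain p where p: "prime p" "over p \<inter> (E \<union> ?X) = {}" using exists_prime_avoiding[of "E \<union> ?X"] E fin by blast
    obtain v :: "('k \<Rightarrow> real) set" where v: "v \<in> over p" using exists_over[OF p(1)] by blast
    have vpl: "v \<in> places" using v by (simp add: over_def)
    have "v \<notin> ?X" using p(2) v by blast
    then have mA: "matrix_over (valuation_ring v) (map_mat (to_completion v) A)"
      and mB: "matrix_over (valuation_ring v) (map_mat (to_completion v) B)"
      and z: "zeta_eq (valuation_ring v) (map_mat (to_completion v) A) (map_mat (to_completion v) B)"
      using vpl by blast+
    interpret pl: place v by (rule place.intro[OF vpl])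
    show ?i
    proof (rule main[OF _ p(1), of "{v}"])
      show "{v} \<subseteq> places" using vpl by simp
      show "{v} \<inter> over p \<noteq> {}" using v by simp
      show "{v} \<inter> over p \<inter> E = {}" using p(2) by blast
      show "\<forall>i<n. \<forall>j<n. A $$ (i, j) \<in> intring {v}" "\<forall>i<m. \<forall>j<m. B $$ (i, j) \<in> intring {v}"
        using mA mB A B by (auto simp: pl.matrix_over_valuation_ring intring_def)
      show "\<forall>j>0. cnt (intring {v}) (vecs (intring {v}) {..<n}) (act A n) j = cnt (intring {v}) (vecs (intring {v}) {..<m}) (act B m) j"
        by (intro allI impI, rule cnt_eq_if_zeta_eq[OF sub1[OF vpl] num_invariant_submodules_valuation_ring[OF vpl A mA]
            num_invariant_submodules_valuation_ring[OF vpl B mB] z])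
    qed
  qed
  have bwd3: ?i if iii: ?iii
  proof -
    obtain S where S: "finite S" "matrix_over (S_integers S) A" "matrix_over (S_integers S) B" "zeta_eq (S_integers S) A B"
      using iii by blast
    let ?T = "places - S"
    have ent: "\<forall>i<n. \<forall>j<n. A $$ (i, j) \<in> intring ?T" "\<forall>i<m. \<forall>j<m. B $$ (i, j) \<in> intring ?T"
      using S(2,3) A B unfolding S_integers_eq matrix_over_ring_of by auto
    \<comment> \<open>Avoiding \<open>S\<close> keeps all places over \<open>p\<close> inside
      \<open>?T\<close>, so the part of \<open>?T\<close> over \<open>p\<close> is not
      empty.\<close>
    obtain p where p: "prime p" "over p \<inter> (E \<union> S) = {}" using exists_prime_avoiding[of "E \<union> S"] E S(1) by blast
    have "over p \<subseteq> ?T" using p(2) by (auto simp: over_def)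
    show ?i
    proof (rule main[OF _ p(1) _ _ ent])
      show "?T \<inter> over p \<noteq> {}" using exists_over[OF p(1)] \<open>over p \<subseteq> ?T\<close> by blast
      show "?T \<inter> over p \<inter> E = {}" using p(2) by blast
      show "\<forall>j>0. cnt (intring ?T) (vecs (intring ?T) {..<n}) (act A n) j = cnt (intring ?T) (vecs (intring ?T) {..<m}) (act B m) j"
        by (intro allI impI, rule cnt_eq_if_zeta_eq[OF subS num_invariant_submodules_ring_of[OF subS zero_less_Suc A]
            num_invariant_submodules_ring_of[OF subS zero_less_Suc B] S(4)[unfolded S_integers_eq]]) (use ent in auto)
    qed blast
  qed
  show ?thesis using fwd bwd2 bwd3 by blast
qed

end
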